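(* Let $p$ be an odd prime, $n\ge p$, with $n_2>1$. Let $\mathfrak t\in[\mathfrak t_n]$ and $\mathfrak s\in\mathrm{Std}(\mathrm{Par}_{n_2}^{\le2})$, and let $\iota_{KLR}^{\mathbb Q}:\mathsf{TL}_{n_2}^{\mathbb Q}\to\mathsf{TL}_n^{\mathbb Q}$ be the inclusion induced by $\iota_{KLR}$. Then $$\iota_{KLR}^{\mathbb Q}(\mathbb E_{\mathfrak s})\cdot\mathbb E_{\mathfrak t}=\mathbb E_{\mathfrak t}\cdot\iota_{KLR}^{\mathbb Q}(\mathbb E_{\mathfrak s})=\begin{cases}\mathbb E_{\mathfrak t}&\text{if } f(\mathfrak t)=\mathfrak s,\\0&\text{if } f(\mathfrak t)\ne\mathfrak s.\end{cases}$$ In particular $$\iota_{KLR}^{\mathbb Q}(\mathbb E_{\mathfrak s})=\sum_{\substack{\mathfrak t\in[\mathfrak t_n]\\ f(\mathfrak t)=\mathfrak s}}\mathbb E_{\mathfrak t}.$$ (Here $\mathbb E_{\mathfrak s}\in\mathsf{TL}_{n_2}^{\mathbb Q}$ and $\mathbb E_{\mathfrak t}\in\mathsf{TL}_n^{\mathbb Q}$.)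
   Context: **Algebra and tableaux.** $\mathsf{TL}_n^{\Bbbk}$ is the unital $\Bbbk$-algebra on $u_1,\dots,u_{n-1}$ with $u_i^2=2u_i$, $u_iu_ju_i=u_i$ for $|i-j|=1$, $u_iu_j=u_ju_i$ for $|i-j|>1$; equivalently, the algebra with basis non-crossing matchings of $n$ top and $n$ bottom points, $D_1D_2$ being $D_1$ on top of $D_2$ with loops replaced by $2$. $\mathrm{Par}_n^{\le2}$: partitions of $n$ with at most two columns; $\mathrm{Std}(\lambda)$: standard $\lambda$-tableaux; $\mathrm{Std}(\mathrm{Par}_n^{\le2})=\bigcup_\lambda\mathrm{Std}(\lambda)$. Content: $c_{\mathfrak t}(i)=c-r$ if $i$ is in row $r$, column $c$ of $\mathfrak t$. $\mathfrak s\trianglelefteq\mathfrak t$ means that for each $m$ the shape of $\mathfrak s$ restricted to entries $\le m$ is dominated by that of $\mathfrak t$ restricted to entries $\le m$. $\mathfrak S_n$ acts on tableaux by permuting entries; $s_k=(k,k+1)$. **Idempotents (for every $N$ in place of $n$, in particular $N=n$ and $N=n_2$).** $\Phi:\mathbb Q\mathfrak S_N\to\mathsf{TL}_N^{\mathbb Q}$ is the homomorphism $s_i\mapsto u_i-1$; $L_1=0$, $L_i=\sum_{j<i}(j,i)$, $\mathbf L_i=\Phi(L_i)$. With $\mathcal C$ the set of all contents $c_{\mathfrak s}(i)$ ($\mathfrak s\in\mathrm{Std}(\mathrm{Par}_N^{\le2})$, $1\le i\le N$), $\mathbb E_{\mathfrak t}=\prod_{c\in\mathcal C}\prod_{i:\,c\ne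 c_{\mathfrak t}(i)}\frac{\mathbf L_i-c}{c_{\mathfrak t}(i)-c}\in\mathsf{TL}_N^{\mathbb Q}$ for $\mathfrak t\in\mathrm{Std}(\mathrm{Par}_N^{\le2})$; these form a complete set of orthogonal primitive idempotents of $\mathsf{TL}_N^{\mathbb Q}$. **Basis $f_{\mathfrak s\mathfrak t}$.** For $\mathfrak t\in\mathrm{Std}(\lambda)$, $\lambda\in\mathrm{Par}_n^{\le2}$, the half-diagram $C_{\mathfrak t}$ has $n$ bottom points: going through $1,\dots,n$ in increasing order, raise a vertical line from $i$ if $i$ is in the first column of $\mathfrak t$, and join $i$ to the nearest still vacant line to its left if $i$ is in the second column. For $\mathfrak s,\mathfrak t\in\mathrm{Std}(\lambda)$, $C_{\mathfrak s\mathfrak t}$ is the diagram obtained by placing the horizontal reflection of $C_{\mathfrak s}$ on top of $C_{\mathfrak t}$. Put $f_{\mathfrak s\mathfrak t}:=\mathbb E_{\mathfrak s}C_{\mathfrak s\mathfrak t}\mathbb E_{\mathfrak t}$; these form a $\mathbb Q$-basis of $\mathsf{TL}_n^{\mathbb Q}$. **Classes.** $p$ is an odd prime, $n\ge p$, and $n=(p-1)+n_1$, $n_1=pn_2+r_0$ with $0\le r_0<p$. $\mathfrak t_n$ is the one-column standard tableau with $n$ boxes; $[\mathfrak t_n]=\{\mathfrak s\in\mathrm{Std}(\mathrm{Par}_n^{\le2})\mid c_{\mathfrak s}(i)\equiv c_{\mathfrak t_n}(i)\bmod p\ \forall i\}$; $\mathbf e:=\sum_{\mathfrak s\in[\mathfrak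 t_n]}\mathbb E_{\mathfrak s}$, which lies in $\mathsf{TL}_n^{\mathbb Z_{(p)}}$ ($\mathbb Z_{(p)}$ is the localization of $\mathbb Z$ at $p$). **Blocks and $f$.** For $1\le j\le n_2$, $B_j=\{jp,jp+1,\dots,(j+1)p-1\}$. For $\mathfrak s\in[\mathfrak t_n]$ the numbers of each $B_j$ all lie in one column of $\mathfrak s$, and $f(\mathfrak s)\in\mathrm{Std}(\mathrm{Par}_{n_2}^{\le2})$ is the tableau having $j$ in the first column iff $B_j$ lies in the first column of $\mathfrak s$. **KLR elements.** For $1\le k<n$, $\psi_k\in\mathsf{TL}_n^{\mathbb Z_{(p)}}$ is the image under $\Phi$ of the KLR generator $\psi_k$ of $\mathbb Z_{(p)}\mathfrak S_n$ given by the Hu–Mathas isomorphism; it is the unique element of $\mathsf{TL}_n^{\mathbb Q}$ whose left multiplication is as follows. For $\mathfrak s,\mathfrak a\in\mathrm{Std}(\lambda)$, $\lambda\in\mathrm{Par}_n^{\le2}$, put $\mathfrak t=\mathfrak ss_k$, $r=c_{\mathfrak s}(k)-c_{\mathfrak s}(k+1)$, and let $\alpha=1$ if $\mathfrak t$ is standard with $\mathfrak t\lhd\mathfrak s$, $\alpha=(r^2-1)/r^2$ if $\mathfrak t$ is standard with $\mathfrak t\rhd\mathfrak s$. Let $\beta=0$ if $\mathfrak t$ is not standard; otherwise $\beta=\frac{\alpha}{1-r}$ if $r\equiv0$, $\beta=\alpha r$ if $r\equiv1$, $\beta=\frac{\alpha r}{1-r}$ otherwise (congruences mod $p$). Then $\psi_kf_{\mathfrak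 s\mathfrak a}=\beta f_{\mathfrak t\mathfrak a}-\delta\frac1rf_{\mathfrak s\mathfrak a}$, where $\delta=1$ if $r\equiv0\bmod p$ and $\delta=0$ otherwise (the term $\beta f_{\mathfrak t\mathfrak a}$ is $0$ if $\mathfrak t$ is not standard). **$\mathbb U_i$ and $\iota_{KLR}$.** For $1\le i<n_2$ let $I=(i+1)p-1$, $\Psi_j=\psi_{I-j+1}\psi_{I-j+3}\cdots\psi_{I+j-3}\psi_{I+j-1}$ ($j$ factors) for $1\le j\le p$, and $\mathbb U_i=\mathbf e\,\Psi_1\cdots\Psi_{p-1}\Psi_p\Psi_{p-1}\cdots\Psi_1\,\mathbf e$. For $n_2>1$ there is an injective (non-unital) algebra homomorphism $\iota_{KLR}:\mathsf{TL}_{n_2}^{\mathbb Z_{(p)}}\to\mathsf{TL}_n^{\mathbb Z_{(p)}}$ with $1\mapsto\mathbf e$, $u_i\mapsto\mathbb U_i$. *)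

theory Defs
  imports
    Complex_Main
    "HOL-Algebra.Module"
    "HOL-Combinatorics.Permutations"
    "HOL-Library.Disjoint_Sets"
    "HOL-Library.FuncSet"
    "HOL-Number_Theory.Cong"
    "HOL-Computational_Algebra.Primes"
begin

section \<open>Temperley-Lieb algebras\<close>

datatype point = Top nat | Bot nat

type_synonym diagram = "point set set"

definition points :: "nat \<Rightarrow> point set" where
  "points n = Top ` {1..n} \<union> Bot ` {1..n}"

text \<open>Position of a point when walking clockwise along the boundary of the rectangle, from the
  top left corner to the bottom left corner.\<close>

fun boundary_pos :: "nat \<Rightarrow> point \<Rightarrow> nat" where
  "boundary_pos n (Top i) = i"
| "boundary_pos n (Bot i) = 2 * n + 1 - i"

definition noncrossing :: "nat \<Rightarrow> diagram \<Rightarrow> bool" where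
  "noncrossing n D \<longleftrightarrow>
     \<not> (\<exists>a b c d. {a, c} \<in> D \<and> {b, d} \<in> D \<and>
          boundary_pos n a < boundary_pos n b \<and> boundary_pos n b < boundary_pos n c \<and>
          boundary_pos n c < boundary_pos n d)"

definition diagrams :: "nat \<Rightarrow> diagram set" where
  "diagrams n = {D. partition_on (points n) D \<and> (\<forall>a\<in>D. card a = 2) \<and> noncrossing n D}"

text \<open>To multiply, \<open>D1\<close> is put on top of \<open>D2\<close>. The points of the stacked picture are pairs
  (level, index); level 0 is the top of \<open>D1\<close>, level 1 is the bottom of \<open>D1\<close> glued to the top of
  \<open>D2\<close>, and level 2 is the bottom of \<open>D2\<close>.\<close>

fun at_level :: "nat \<Rightarrow> point \<Rightarrow> nat \<times> nat" where
  "at_level l (Top i) = (l, i)"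
| "at_level l (Bot i) = (Suc l, i)"

definition stack_connected :: "diagram \<Rightarrow> diagram \<Rightarrow> ((nat \<times> nat) \<times> (nat \<times> nat)) set" where
  "stack_connected D1 D2 =
     {(x, y). {x, y} \<in> image (at_level 0) ` D1 \<union> image (at_level 1) ` D2}\<^sup>*"

fun outer :: "point \<Rightarrow> nat \<times> nat" where
  "outer (Top i) = (0, i)"
| "outer (Bot i) = (2, i)"

definition concat_diagram :: "nat \<Rightarrow> diagram \<Rightarrow> diagram \<Rightarrow> diagram" where
  "concat_diagram n D1 D2 =
     {{a, b} | a b. a \<in> points n \<and> b \<in> points n \<and> a \<noteq> b \<and>
                    (outer a, outer b) \<in> stack_connected D1 D2}"

text \<open>The loops are the connected components that stay at level 1.\<close>

definition loops :: "nat \<Rightarrow> diagram \<Rightarrow> diagram \<Rightarrow> nat" where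
  "loops n D1 D2 =
     card {C. (\<exists>i\<in>{1..n}. C = stack_connected D1 D2 `` {(1, i)}) \<and> C \<subseteq> {1} \<times> UNIV}"

definition delta :: "'a \<Rightarrow> 'a \<Rightarrow> rat" where
  "delta a = (\<lambda>b. if b = a then 1 else 0)"

definition identity_diagram :: "nat \<Rightarrow> diagram" where
  "identity_diagram n = {{Top j, Bot j} | j. j \<in> {1..n}}"

definition u_diagram :: "nat \<Rightarrow> nat \<Rightarrow> diagram" where
  "u_diagram n i = {{Top i, Top (i + 1)}, {Bot i, Bot (i + 1)}} \<union>
                   {{Top j, Bot j} | j. j \<in> {1..n} - {i, i + 1}}"

text \<open>The Temperley-Lieb algebra on \<open>n\<close> strands with loop parameter 2 over a subring \<open>S\<close> of the
  rationals: coefficient functions on the diagrams, with values in \<open>S\<close>. In this way the algebra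
  over \<open>S\<close> is a subset of the algebra over the rationals.\<close>

definition TL :: "rat set \<Rightarrow> nat \<Rightarrow> (rat, diagram \<Rightarrow> rat) module" where
  "TL S n =
     \<lparr>carrier = {x. (\<forall>D\<in>diagrams n. x D \<in> S) \<and> (\<forall>D. D \<notin> diagrams n \<longrightarrow> x D = 0)},
      monoid.mult = (\<lambda>x y D. \<Sum>D1\<in>diagrams n. \<Sum>D2\<in>diagrams n.
                if concat_diagram n D1 D2 = D then x D1 * y D2 * 2 ^ loops n D1 D2 else 0),
      one = delta (identity_diagram n),
      zero = (\<lambda>D. 0),
      add = (\<lambda>x y D. x D + y D),
      smult = (\<lambda>c x D. c * x D)\<rparr>"

abbreviation TLQ :: "nat \<Rightarrow> (rat, diagram \<Rightarrow> rat) module" where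
  "TLQ \<equiv> TL UNIV"

text \<open>The localization of the integers at the prime \<open>p\<close>.\<close>

definition Z_loc :: "nat \<Rightarrow> rat set" where
  "Z_loc p = {x. \<not> int p dvd snd (quotient_of x)}"

definition u_gen :: "nat \<Rightarrow> nat \<Rightarrow> diagram \<Rightarrow> rat" where
  "u_gen n i = delta (u_diagram n i)"

definition list_mult :: "('a, 'b) monoid_scheme \<Rightarrow> 'a list \<Rightarrow> 'a" where
  "list_mult A xs = foldr (\<otimes>\<^bsub>A\<^esub>) xs \<one>\<^bsub>A\<^esub>"

text \<open>Not necessarily unital homomorphisms of algebras over a subring \<open>S\<close> of the rationals.\<close>

definition alg_hom ::
  "rat set \<Rightarrow> (rat, 'a) module \<Rightarrow> (rat, 'b) module \<Rightarrow> ('a \<Rightarrow> 'b) \<Rightarrow> bool" where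
  "alg_hom S A B h \<longleftrightarrow>
     h \<in> carrier A \<rightarrow> carrier B \<and>
     (\<forall>x\<in>carrier A. \<forall>y\<in>carrier A. h (x \<oplus>\<^bsub>A\<^esub> y) = h x \<oplus>\<^bsub>B\<^esub> h y) \<and>
     (\<forall>x\<in>carrier A. \<forall>y\<in>carrier A. h (x \<otimes>\<^bsub>A\<^esub> y) = h x \<otimes>\<^bsub>B\<^esub> h y) \<and>
     (\<forall>c\<in>S. \<forall>x\<in>carrier A. h (c \<odot>\<^bsub>A\<^esub> x) = c \<odot>\<^bsub>B\<^esub> h x)"


section \<open>Two-column tableaux\<close>

definition Par2 :: "nat \<Rightarrow> nat list set" where
  "Par2 n = {l. sorted_wrt (\<ge>) l \<and> 0 \<notin> set l \<and> sum_list l = n \<and> (\<forall>x\<in>set l. x \<le> 2)}"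

definition cells :: "nat list \<Rightarrow> (nat \<times> nat) set" where
  "cells l = {(r, c). 1 \<le> r \<and> r \<le> length l \<and> 1 \<le> c \<and> c \<le> l ! (r - 1)}"

text \<open>A tableau is the function that sends every entry to the cell (row, column) containing it.\<close>

type_synonym tableau = "nat \<Rightarrow> nat \<times> nat"

definition Std :: "nat list \<Rightarrow> tableau set" where
  "Std l =
     {t. t \<in> extensional {1..sum_list l} \<and> bij_betw t {1..sum_list l} (cells l) \<and>
         (\<forall>i\<in>{1..sum_list l}. \<forall>j\<in>{1..sum_list l}.
            (fst (t i) = fst (t j) \<and> snd (t i) < snd (t j) \<longrightarrow> i < j) \<and>
            (snd (t i) = snd (t j) \<and> fst (t i) < fst (t j) \<longrightarrow> i < j))}"

definition Std2 :: "nat \<Rightarrow> tableau set" where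
  "Std2 n = (\<Union>l\<in>Par2 n. Std l)"

definition content :: "tableau \<Rightarrow> nat \<Rightarrow> int" where
  "content t i = int (snd (t i)) - int (fst (t i))"

text \<open>Length of row \<open>r\<close> of the subtableau consisting of the entries up to \<open>m\<close>.\<close>

definition row_length :: "tableau \<Rightarrow> nat \<Rightarrow> nat \<Rightarrow> nat" where
  "row_length t m r = card {i\<in>{1..m}. fst (t i) = r}"

definition dominated :: "nat \<Rightarrow> tableau \<Rightarrow> tableau \<Rightarrow> bool" where
  "dominated n s t \<longleftrightarrow>
     (\<forall>m\<in>{1..n}. \<forall>k. (\<Sum>r = 1..k. row_length s m r) \<le> (\<Sum>r = 1..k. row_length t m r))"

definition strictly_dominated :: "nat \<Rightarrow> tableau \<Rightarrow> tableau \<Rightarrow> bool" where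
  "strictly_dominated n s t \<longleftrightarrow> dominated n s t \<and> s \<noteq> t"

text \<open>Exchanging the entries \<open>k\<close> and \<open>k + 1\<close>.\<close>

definition swap_entries :: "tableau \<Rightarrow> nat \<Rightarrow> tableau" where
  "swap_entries t k = t \<circ> transpose k (k + 1)"


section \<open>Jucys-Murphy elements and idempotents\<close>

definition QSym :: "nat \<Rightarrow> (rat, (nat \<Rightarrow> nat) \<Rightarrow> rat) module" where
  "QSym N =
     \<lparr>carrier = {x. \<forall>\<pi>. \<not> \<pi> permutes {1..N} \<longrightarrow> x \<pi> = 0},
      monoid.mult = (\<lambda>x y \<pi>. \<Sum>\<sigma> | \<sigma> permutes {1..N}. \<Sum>\<tau> | \<tau> permutes {1..N}.
                if \<sigma> \<circ> \<tau> = \<pi> then x \<sigma> * y \<tau> else 0),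
      one = delta id,
      zero = (\<lambda>\<pi>. 0),
      add = (\<lambda>x y \<pi>. x \<pi> + y \<pi>),
      smult = (\<lambda>c x \<pi>. c * x \<pi>)\<rparr>"

text \<open>Only the values on the carrier matter, and there the homomorphism is unique.\<close>

definition Phi :: "nat \<Rightarrow> ((nat \<Rightarrow> nat) \<Rightarrow> rat) \<Rightarrow> diagram \<Rightarrow> rat" where
  "Phi N = (SOME h. alg_hom UNIV (QSym N) (TLQ N) h \<and> h \<one>\<^bsub>QSym N\<^esub> = \<one>\<^bsub>TLQ N\<^esub> \<and>
              (\<forall>i\<in>{1..<N}. h (delta (transpose i (i + 1))) = u_gen N i \<ominus>\<^bsub>TLQ N\<^esub> \<one>\<^bsub>TLQ N\<^esub>))"

definition JM :: "nat \<Rightarrow> nat \<Rightarrow> (nat \<Rightarrow> nat) \<Rightarrow> rat" where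
  "JM N i = (\<Oplus>\<^bsub>QSym N\<^esub>j\<in>{1..<i}. delta (transpose j i))"

definition JM_TL :: "nat \<Rightarrow> nat \<Rightarrow> diagram \<Rightarrow> rat" where
  "JM_TL N i = Phi N (JM N i)"

definition contents :: "nat \<Rightarrow> int set" where
  "contents N = {content s i | s i. s \<in> Std2 N \<and> i \<in> {1..N}}"

text \<open>The factors commute, so the order in which the product is taken is irrelevant.\<close>

definition EE :: "nat \<Rightarrow> tableau \<Rightarrow> diagram \<Rightarrow> rat" where
  "EE N t = list_mult (TLQ N)
     [(1 / of_int (content t i - c)) \<odot>\<^bsub>TLQ N\<^esub>
        (JM_TL N i \<ominus>\<^bsub>TLQ N\<^esub> of_int c \<odot>\<^bsub>TLQ N\<^esub> \<one>\<^bsub>TLQ N\<^esub>).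
      c \<leftarrow> sorted_list_of_set (contents N), i \<leftarrow> [1..<N + 1], c \<noteq> content t i]"


section \<open>The seminormal basis\<close>

text \<open>The half-diagram of \<open>t\<close>, after treating the entries up to \<open>m\<close>: the set of the vacant vertical
  lines, and the set of the arcs (left end, right end).\<close>

fun half_diagram :: "tableau \<Rightarrow> nat \<Rightarrow> nat set \<times> (nat \<times> nat) set" where
  "half_diagram t 0 = ({}, {})"
| "half_diagram t (Suc m) =
     (let (V, A) = half_diagram t m in
      if snd (t (Suc m)) = 1 then (insert (Suc m) V, A)
      else (V - {Max V}, insert (Max V, Suc m) A))"

text \<open>The vertical lines of the two halves are joined in order, from left to right.\<close>

definition C_diagram :: "nat \<Rightarrow> tableau \<Rightarrow> tableau \<Rightarrow> diagram" where
  "C_diagram n s t =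
     {{Top a, Top b} | a b. (a, b) \<in> snd (half_diagram s n)} \<union>
     {{Bot a, Bot b} | a b. (a, b) \<in> snd (half_diagram t n)} \<union>
     {{Top a, Bot b} | a b. (a, b) \<in> set (zip (sorted_list_of_set (fst (half_diagram s n)))
                                              (sorted_list_of_set (fst (half_diagram t n))))}"

definition f_basis :: "nat \<Rightarrow> tableau \<Rightarrow> tableau \<Rightarrow> diagram \<Rightarrow> rat" where
  "f_basis n s t = EE n s \<otimes>\<^bsub>TLQ n\<^esub> delta (C_diagram n s t) \<otimes>\<^bsub>TLQ n\<^esub> EE n t"


section \<open>The class of the one-column tableau\<close>

definition one_column :: "nat \<Rightarrow> tableau" where
  "one_column n = (\<lambda>i\<in>{1..n}. (i, 1))"

definition one_column_class :: "nat \<Rightarrow> nat \<Rightarrow> tableau set" where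
  "one_column_class p n =
     {s\<in>Std2 n. \<forall>i\<in>{1..n}. [content s i = content (one_column n) i] (mod int p)}"

definition e_class :: "nat \<Rightarrow> nat \<Rightarrow> diagram \<Rightarrow> rat" where
  "e_class p n = (\<Oplus>\<^bsub>TLQ n\<^esub>s\<in>one_column_class p n. EE n s)"

definition block :: "nat \<Rightarrow> nat \<Rightarrow> nat set" where
  "block p j = {j * p..<(j + 1) * p}"

definition f_tableau :: "nat \<Rightarrow> nat \<Rightarrow> tableau \<Rightarrow> tableau" where
  "f_tableau p n2 s =
     (THE v. v \<in> Std2 n2 \<and>
        (\<forall>j\<in>{1..n2}. snd (v j) = 1 \<longleftrightarrow> (\<forall>b\<in>block p j. snd (s b) = 1)))"


section \<open>KLR elements\<close>

definition axial :: "tableau \<Rightarrow> nat \<Rightarrow> int" where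
  "axial s k = content s k - content s (k + 1)"

text \<open>Only used if the tableau \<open>t\<close> obtained from \<open>s\<close> is standard; then either \<open>t\<close> is strictly
  dominated by \<open>s\<close> or conversely.\<close>

definition psi_alpha :: "nat \<Rightarrow> nat \<Rightarrow> tableau \<Rightarrow> rat" where
  "psi_alpha n k s =
     (let t = swap_entries s k; r = of_int (axial s k)
      in if strictly_dominated n t s then 1 else (r ^ 2 - 1) / r ^ 2)"

definition psi_beta :: "nat \<Rightarrow> nat \<Rightarrow> nat \<Rightarrow> tableau \<Rightarrow> rat" where
  "psi_beta p n k s =
     (let r = of_int (axial s k); \<alpha> = psi_alpha n k s
      in if swap_entries s k \<notin> Std2 n then 0
         else if [axial s k = 0] (mod int p) then \<alpha> / (1 - r)
         else if [axial s k = 1] (mod int p) then \<alpha> * r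
         else \<alpha> * r / (1 - r))"

definition psi :: "nat \<Rightarrow> nat \<Rightarrow> nat \<Rightarrow> diagram \<Rightarrow> rat" where
  "psi p n k =
     (THE x. x \<in> carrier (TLQ n) \<and>
        (\<forall>l\<in>Par2 n. \<forall>s\<in>Std l. \<forall>a\<in>Std l.
           x \<otimes>\<^bsub>TLQ n\<^esub> f_basis n s a =
             (if swap_entries s k \<in> Std l
              then psi_beta p n k s \<odot>\<^bsub>TLQ n\<^esub> f_basis n (swap_entries s k) a
              else \<zero>\<^bsub>TLQ n\<^esub>)
             \<ominus>\<^bsub>TLQ n\<^esub>
             (if [axial s k = 0] (mod int p)
              then (1 / of_int (axial s k)) \<odot>\<^bsub>TLQ n\<^esub> f_basis n s a
              else \<zero>\<^bsub>TLQ n\<^esub>)))"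

text \<open>The indices \<open>I - j + 1, I - j + 3, \<dots>, I + j - 1\<close> with \<open>I = (i + 1) p - 1\<close>.\<close>

definition Psi :: "nat \<Rightarrow> nat \<Rightarrow> nat \<Rightarrow> nat \<Rightarrow> diagram \<Rightarrow> rat" where
  "Psi p n i j =
     (let I = (i + 1) * p - 1
      in list_mult (TLQ n) (map (\<lambda>m. psi p n (I + 1 + 2 * m - j)) [0..<j]))"

definition UU :: "nat \<Rightarrow> nat \<Rightarrow> nat \<Rightarrow> diagram \<Rightarrow> rat" where
  "UU p n i =
     list_mult (TLQ n)
       ([e_class p n] @ map (Psi p n i) [1..<p + 1] @ map (Psi p n i) (rev [1..<p]) @
        [e_class p n])"

definition iota_KLR ::
  "nat \<Rightarrow> nat \<Rightarrow> nat \<Rightarrow> ((diagram \<Rightarrow> rat) \<Rightarrow> (diagram \<Rightarrow> rat)) \<Rightarrow> bool" where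
  "iota_KLR p n n2 \<iota> \<longleftrightarrow>
     alg_hom (Z_loc p) (TL (Z_loc p) n2) (TL (Z_loc p) n) \<iota> \<and>
     inj_on \<iota> (carrier (TL (Z_loc p) n2)) \<and>
     \<iota> \<one>\<^bsub>TL (Z_loc p) n2\<^esub> = e_class p n \<and>
     (\<forall>i\<in>{1..<n2}. \<iota> (u_gen n2 i) = UU p n i)"

text \<open>The map induced on the algebras over the rationals, that is, the rational algebra
  homomorphism that extends \<open>\<iota>\<close>.\<close>

definition induced_over_Q ::
  "nat \<Rightarrow> nat \<Rightarrow> nat \<Rightarrow> ((diagram \<Rightarrow> rat) \<Rightarrow> (diagram \<Rightarrow> rat)) \<Rightarrow>
   ((diagram \<Rightarrow> rat) \<Rightarrow> (diagram \<Rightarrow> rat)) \<Rightarrow> bool" where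
  "induced_over_Q p n n2 \<iota> \<iota>Q \<longleftrightarrow>
     alg_hom UNIV (TLQ n2) (TLQ n) \<iota>Q \<and>
     (\<forall>x\<in>carrier (TL (Z_loc p) n2). \<iota>Q x = \<iota> x)"

end

theory Submission
 imports Defs
begin

text \<open>Let the diagrams act on functions on the subsets of \<open>{1..n}\<close> so that \<open>u_i - 1\<close> becomes the signed
 exchange of two neighbouring strands. On the highest weight vectors, which are indexed by the
 standard tableaux with two columns, this gives a faithful matrix representation in which the
 Jucys-Murphy elements are diagonal with the contents as eigenvalues; hence \<open>EE\<close> is a diagonal
 matrix unit, and \<open>psi\<close> mixes a tableau only with the one obtained by exchanging two entries.
 The tableaux in the class of the one-column tableau are constant on the blocks, and there \<open>UU\<close>
 only mixes a tableau with the one obtained by exchanging two blocks. The images of the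
 Jucys-Murphy elements \<open>L_i\<close> satisfy \<open>L_(i+1) = s_i L_i s_i + s_i\<close> with \<open>s_i = u_i - 1\<close>, and they
 commute. By induction on \<open>i\<close> they are diagonal with the contents of \<open>f_tableau\<close> as eigenvalues: since
 \<open>s_i\<close> squares to 1, it is enough to know that one off-diagonal entry of \<open>UU\<close> does not vanish (or a
 diagonal entry, if exchanging the blocks does not give a standard tableau), so the exact
 coefficients of the long products of KLR elements never enter.\<close>

section \<open>Concatenation of non-crossing diagrams\<close>

text \<open>Two obstacles shape the proof. Multiplication is concatenation of diagrams, so even
  closure and associativity have to be earned: planarity of a product comes from contracting glued
  points one by one, and the ring axioms are pulled back from matrices. The loop value 2 is the
  number of labels of a loop, so diagrams can act on subsets by counting labellings; arcs on one
  side join places of opposite parity, which lets \<open>theta\<close> and the twist in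
  \<open>label\<close> encode the antisymmetric sign. Second, \<open>psi\<close> is given by a
  description over all products with \<open>f_basis\<close>, so the representation must also be
  shown to reach every matrix that respects shapes; for this the half-diagrams must pair
  nontrivially with the highest weight vectors. In a window the height just before it is -1 modulo
  \<open>p\<close>; hence, on the path starting at the given set, equal residues occur only in the
  factor \<open>Psi\<close> of length \<open>p\<close>, which isolates one path for the diagonal
  entry. The off-diagonal entry is isolated because the word has p^2 letters, exactly the amount by
  which the exchange lowers the sum of the second column.\<close>

definition nc_involution :: "'a set \<Rightarrow> ('a \<Rightarrow> nat) \<Rightarrow> ('a \<Rightarrow> 'a) \<Rightarrow> bool" where
 "nc_involution P pos m \<longleftrightarrow>
   inj_on pos P \<and> (\<forall>x\<in>P. m x \<in> P \<and> m x \<noteq> x \<and> m (m x) = x) \<and>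
   (\<forall>a\<in>P. \<forall>b\<in>P. \<not> (pos a < pos b \<and> pos b < pos (m a) \<and> pos (m a) < pos (m b)))"

text \<open>Boolean functions constant on the pairs detect connectivity: two points lie in one
  component iff no such function separates them. Gluing pictures then becomes restricting functions,
  and no paths have to be followed.\<close>

definition invariant_on :: "'a set \<Rightarrow> ('a \<Rightarrow> 'a) \<Rightarrow> ('a \<Rightarrow> bool) \<Rightarrow> bool" where
 "invariant_on P m g \<longleftrightarrow> (\<forall>x\<in>P. g (m x) = g x)"

text \<open>Joining the neighbours \<open>a\<close> and \<open>b\<close> closes a loop when they are
  partners and otherwise makes their partners a new pair. An arc crossing the new one separates the
  two partners; as \<open>a\<close> and \<open>b\<close> lie on the same side of it, it already
  crossed one of the two old arcs.\<close>

lemma nc_involution_contract: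
 assumes nc: "nc_involution P pos m" and ab: "a \<in> P" "b \<in> P" "pos a < pos b"
  and adj: "\<And>x. x \<in> P \<Longrightarrow> \<not> (pos a < pos x \<and> pos x < pos b)"
 obtains m' where "nc_involution (P - {a, b}) pos m'"
  and "\<And>g. invariant_on (P - {a, b}) m' g \<longleftrightarrow>
      (\<exists>h. (\<forall>x\<in>P - {a, b}. h x = g x) \<and> h a = h b \<and> invariant_on P m h)"
proof -
 have inj: "inj_on pos P"
  and inv: "\<And>x. x \<in> P \<Longrightarrow> m x \<in> P \<and> m x \<noteq> x \<and> m (m x) = x"
  and ncr: "\<And>u v. u \<in> P \<Longrightarrow> v \<in> P \<Longrightarrow> \<not> (pos u < pos v \<and> pos v < pos (m u) \<and> pos (m u) < pos (m v))"
  using nc unfolding nc_involution_def by auto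
 have inj': "inj_on pos (P - {a, b})" using inj by (rule inj_on_subset) auto
 have ne: "a \<noteq> b" using ab by auto
 have poseq: "pos u = pos v \<longleftrightarrow> u = v" if "u \<in> P" "v \<in> P" for u v
  using inj that by (auto dest: inj_onD)
 show thesis
 proof (cases "m a = b")
  case True
  hence mb: "m b = a" using inv[OF ab(1)] by auto
  have stay: "m x \<in> P - {a, b}" if "x \<in> P - {a, b}" for x
   using that inv[of x] True mb by auto
  have "nc_involution (P - {a, b}) pos m"
   unfolding nc_involution_def
   by (intro conjI ballI) (use inj' stay inv ncr in auto)
  moreover have "invariant_on (P - {a, b}) m g \<longleftrightarrow>
      (\<exists>h. (\<forall>x\<in>P - {a, b}. h x = g x) \<and> h a = h b \<and> invariant_on P m h)" for g
  proof
   assume g: "invariant_on (P - {a, b}) m g"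
   \<comment> \<open>The removed loop may carry any value; \<open>True\<close> is an arbitrary
     choice.\<close>
   have "invariant_on P m (g(a := True, b := True))"
    unfolding invariant_on_def
   proof
    fix x assume "x \<in> P"
    thus "(g(a := True, b := True)) (m x) = (g(a := True, b := True)) x"
     using g stay[of x] True mb ne by (cases "x = a \<or> x = b") (auto simp: invariant_on_def)
   qed
   thus "\<exists>h. (\<forall>x\<in>P - {a, b}. h x = g x) \<and> h a = h b \<and> invariant_on P m h"
    by (intro exI[of _ "g(a := True, b := True)"]) auto
  next
   assume "\<exists>h. (\<forall>x\<in>P - {a, b}. h x = g x) \<and> h a = h b \<and> invariant_on P m h"
   thus "invariant_on (P - {a, b}) m g" using stay unfolding invariant_on_def by (metis Diff_iff)
  qed
  ultimately show thesis using that by blast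
 next
  case False
  define a' where "a' = m a"
  define b' where "b' = m b"
  have na: "m a = a'" "m b = b'" by (auto simp: a'_def b'_def)
  have a': "a' \<in> P" "a' \<noteq> a" "a' \<noteq> b" "m a' = a" using inv[OF ab(1)] False by (auto simp: a'_def)
  have b': "b' \<in> P" "b' \<noteq> b" "b' \<noteq> a" "m b' = b"
   using inv[OF ab(2)] False inv[OF ab(1)] by (auto simp: b'_def)
  have ab': "a' \<noteq> b'" using a' b' ne by auto
  define m' where "m' = (\<lambda>x. if x = a' then b' else if x = b' then a' else m x)"
  have stay: "m x \<in> P - {a, b, a', b'}" if "x \<in> P - {a, b, a', b'}" for x
   using that inv[of x] a' b' a'_def b'_def by auto
  have inv': "m' x \<in> P - {a, b} \<and> m' x \<noteq> x \<and> m' (m' x) = x" if "x \<in> P - {a, b}" for x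
   using that a' b' ab' stay[of x] inv[of x] by (auto simp: m'_def)
  have ncr': "\<not> (pos u < pos v \<and> pos v < pos (m' u) \<and> pos (m' u) < pos (m' v))"
   if u: "u \<in> P - {a, b}" and v: "v \<in> P - {a, b}" for u v
  proof
   assume cr: "pos u < pos v \<and> pos v < pos (m' u) \<and> pos (m' u) < pos (m' v)"
   \<comment> \<open>With nothing strictly between \<open>a\<close> and \<open>b\<close>, every
     other point lies to one side of both; this turns a crossing of the new arc into a crossing of
     \<open>m\<close>.\<close>
   have side: "pos x < pos a \<or> pos b < pos x" if "x \<in> P - {a, b}" for x
    using adj[of x] that poseq[of x a] poseq[of x b] ab ne by (metis Diff_iff insertCI linorder_neqE_nat)
   have sides: "pos u < pos a \<or> pos b < pos u" "pos v < pos a \<or> pos b < pos v"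
    "pos (m' u) < pos a \<or> pos b < pos (m' u)" "pos (m' v) < pos a \<or> pos b < pos (m' v)"
    "pos a' < pos a \<or> pos b < pos a'" "pos b' < pos a \<or> pos b < pos b'"
    using side u v inv'[OF u] inv'[OF v] a' b' by auto
   consider (1) "u \<noteq> a'" "u \<noteq> b'" "v \<noteq> a'" "v \<noteq> b'"
    | (2) "u = a' \<or> u = b'" "v = a' \<or> v = b'"
    | (3) "u = a' \<or> u = b'" "v \<noteq> a'" "v \<noteq> b'"
    | (4) "u \<noteq> a'" "u \<noteq> b'" "v = a' \<or> v = b'" by blast
   thus False
   proof cases
    case 1
    thus False using cr ncr[of u v] u v by (auto simp: m'_def)
   next
    case 2
    thus False using cr ab' by (auto simp: m'_def split: if_splits)
   next
    case 3
    have mv: "m' v = m v" "m v \<in> P" "m (m v) = v" "v \<in> P" using 3 v inv[of v] by (auto simp: m'_def)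
    have sv: "pos v < pos a \<or> pos b < pos v" "pos (m v) < pos a \<or> pos b < pos (m v)"
     using sides mv by auto
    \<comment> \<open>Whether \<open>a\<close> and \<open>b\<close> lie before, inside or after the
      arc at \<open>v\<close> decides which old arc it crosses.\<close>
    then consider "pos b < pos v" | "pos v < pos a" "pos b < pos (m v)" | "pos (m v) < pos a"
     by linarith
    note cs = this
    from 3(1) show False
    proof
     assume u: "u = a'"
     hence c: "pos a' < pos v" "pos v < pos b'" "pos b' < pos (m v)"
      using cr mv by (auto simp: m'_def)
     from cs show False
      using c ab(3) ncr[OF ab(2) mv(4)] ncr[OF a'(1) mv(4)] ncr[OF mv(4) b'(1)]
      unfolding na a' b' by cases auto
    next
     assume u: "u = b'"
     hence c: "pos b' < pos v" "pos v < pos a'" "pos a' < pos (m v)"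
      using cr mv ab' by (auto simp: m'_def)
     from cs show False
      using c ab(3) ncr[OF ab(1) mv(4)] ncr[OF b'(1) mv(4)] ncr[OF mv(4) a'(1)]
      unfolding na a' b' by cases auto
    qed
   next
    case 4
    have mv: "m' u = m u" "m u \<in> P" "m (m u) = u" "u \<in> P" using 4 u inv[of u] by (auto simp: m'_def)
    have sv: "pos u < pos a \<or> pos b < pos u" "pos (m u) < pos a \<or> pos b < pos (m u)"
     using sides mv by auto
    then consider "pos b < pos u" | "pos u < pos a" "pos b < pos (m u)" | "pos (m u) < pos a"
     by linarith
    note cs = this
    from 4(3) show False
    proof
     assume v: "v = a'"
     hence c: "pos u < pos a'" "pos a' < pos (m u)" "pos (m u) < pos b'"
      using cr mv by (auto simp: m'_def)
     from cs show False
      using c ab(3) ncr[OF mv(4) ab(2)] ncr[OF ab(1) mv(4)] ncr[OF mv(4) a'(1)]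
      unfolding na a' b' by cases auto
    next
     assume v: "v = b'"
     hence c: "pos u < pos b'" "pos b' < pos (m u)" "pos (m u) < pos a'"
      using cr mv ab' by (auto simp: m'_def)
     from cs show False
      using c ab(3) ncr[OF mv(4) ab(1)] ncr[OF ab(2) mv(4)] ncr[OF mv(4) b'(1)]
      unfolding na a' b' by cases auto
    qed
   qed
  qed
  have "nc_involution (P - {a, b}) pos m'"
   unfolding nc_involution_def
   by (intro conjI ballI) (use inj' inv' ncr' in auto)
  moreover have "invariant_on (P - {a, b}) m' g \<longleftrightarrow>
      (\<exists>h. (\<forall>x\<in>P - {a, b}. h x = g x) \<and> h a = h b \<and> invariant_on P m h)" for g
  proof
   assume g: "invariant_on (P - {a, b}) m' g"
   have gab: "g b' = g a'" using bspec[OF g[unfolded invariant_on_def], of a'] a' by (simp add: m'_def)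
   \<comment> \<open>Before the contraction \<open>a\<close> and \<open>b\<close> hang on the two
     ends of the new pair, so both must take its common value.\<close>
   let ?h = "g(a := g a', b := g a')"
   have "invariant_on P m ?h"
    unfolding invariant_on_def
   proof
    fix x assume x: "x \<in> P"
    show "?h (m x) = ?h x"
    proof (cases "x \<in> {a, b, a', b'}")
     case True
     thus ?thesis using a' b' ab' ne gab by (auto simp: na)
    next
     case False
     hence "m' x = m x" by (simp add: m'_def)
     hence "g (m x) = g x" using bspec[OF g[unfolded invariant_on_def], of x] False x by simp
     moreover have "m x \<noteq> a" "m x \<noteq> b" using False stay[of x] x by auto
     ultimately show ?thesis using False by simp
    qed
   qed
   thus "\<exists>h. (\<forall>x\<in>P - {a, b}. h x = g x) \<and> h a = h b \<and> invariant_on P m h"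
    by (intro exI[of _ ?h]) auto
  next
   assume "\<exists>h. (\<forall>x\<in>P - {a, b}. h x = g x) \<and> h a = h b \<and> invariant_on P m h"
   then obtain h where h: "\<And>x. x \<in> P - {a, b} \<Longrightarrow> h x = g x" "h a = h b" "\<And>x. x \<in> P \<Longrightarrow> h (m x) = h x"
    by (auto simp: invariant_on_def)
   have "h a' = h b'" using h(2) h(3)[OF ab(1)] h(3)[OF ab(2)] by (simp add: a'_def b'_def)
   moreover have "h a' = g a'" "h b' = g b'" using h(1) a' b' by auto
   moreover have "g (m x) = g x" if "x \<in> P - {a, b, a', b'}" for x
    using h(1)[of x] h(1)[of "m x"] h(3)[of x] stay[of x] that by auto
   ultimately show "invariant_on (P - {a, b}) m' g"
    unfolding invariant_on_def m'_def by (intro ballI) simp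
  qed
  ultimately show thesis using that by blast
 qed
qed

section \<open>Diagrams as non-crossing involutions of the boundary points\<close>

definition mate :: "diagram \<Rightarrow> point \<Rightarrow> point" where
 "mate D x = (THE y. y \<noteq> x \<and> {x, y} \<in> D)"

lemma points_iff [simp]: "Top i \<in> points n \<longleftrightarrow> i \<in> {1..n}" "Bot i \<in> points n \<longleftrightarrow> i \<in> {1..n}"
 by (auto simp: points_def)

lemma finite_points [simp]: "finite (points n)"
 by (simp add: points_def)

lemma inj_on_boundary_pos: "inj_on (boundary_pos n) (points n)"
 by (auto simp: inj_on_def points_def)

lemma finite_diagrams [simp]: "finite (diagrams n)"
proof (rule finite_subset)
 show "diagrams n \<subseteq> Pow (Pow (points n))" by (auto simp: diagrams_def partition_on_def)
qed simp

lemma diagram_edge: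
 assumes D: "D \<in> diagrams n" and e: "{a, b} \<in> D"
 shows "a \<noteq> b" "a \<in> points n" "b \<in> points n" "mate D a = b" "mate D b = a"
proof -
 have "card {a, b} = 2" using D e by (auto simp: diagrams_def)
 thus ab: "a \<noteq> b" by auto
 have p: "partition_on (points n) D" using D by (simp add: diagrams_def)
 show "a \<in> points n" "b \<in> points n" using p e by (auto simp: partition_on_def)
 have uniq: "B = {a, b}" if "B \<in> D" "a \<in> B \<or> b \<in> B" for B
  using disjointD[OF partition_onD2[OF p] that(1) e] that(2) by auto
 have yb: "y = b" if "{a, y} \<in> D" for y
  using uniq[OF that] ab by (auto simp: doubleton_eq_iff)
 show "mate D a = b" unfolding mate_def
  by (rule the_equality, use ab e in blast, use yb in blast)
 have ya: "y = a" if "{b, y} \<in> D" for y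
  using uniq[OF that] ab by (auto simp: doubleton_eq_iff)
 have "{b, a} \<in> D" using e by (simp add: insert_commute)
 thus "mate D b = a" unfolding mate_def
  by (intro the_equality, use ab in blast, use ya in blast)
qed

lemma diagram_block:
 assumes D: "D \<in> diagrams n" and B: "B \<in> D"
 obtains a b where "B = {a, b}" "a \<noteq> b"
 using assms by (auto simp: diagrams_def card_2_iff)

lemma mate_edge:
 assumes D: "D \<in> diagrams n" and x: "x \<in> points n"
 shows "{x, mate D x} \<in> D"
proof -
 obtain B where B: "B \<in> D" "x \<in> B" using D x by (auto simp: diagrams_def partition_on_def)
 obtain a b where ab: "B = {a, b}" "a \<noteq> b" by (rule diagram_block[OF D B(1)])
 show ?thesis using B ab diagram_edge[OF D, of a b] by (auto simp: insert_commute)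
qed

lemma mate_props:
 assumes D: "D \<in> diagrams n" and x: "x \<in> points n"
 shows "mate D x \<in> points n" "mate D x \<noteq> x" "mate D (mate D x) = x"
 using diagram_edge[OF D mate_edge[OF D x]] by auto

lemma edge_iff_mate:
 assumes D: "D \<in> diagrams n"
 shows "{a, b} \<in> D \<longleftrightarrow> a \<in> points n \<and> b = mate D a"
 using diagram_edge[OF D] mate_edge[OF D] by auto

lemma diagram_eq_mates:
 assumes D: "D \<in> diagrams n"
 shows "D = (\<lambda>x. {x, mate D x}) ` points n"
proof (intro equalityI subsetI)
 fix B assume B: "B \<in> D"
 obtain a b where ab: "B = {a, b}" "a \<noteq> b" by (rule diagram_block[OF D B])
 thus "B \<in> (\<lambda>x. {x, mate D x}) ` points n" using diagram_edge[OF D, of a b] B by auto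
qed (use mate_edge[OF D] in auto)

lemma nc_involution_mate:
 assumes D: "D \<in> diagrams n"
 shows "nc_involution (points n) (boundary_pos n) (mate D)"
proof -
 have "\<not> (boundary_pos n a < boundary_pos n b \<and> boundary_pos n b < boundary_pos n (mate D a) \<and>
   boundary_pos n (mate D a) < boundary_pos n (mate D b))"
  if "a \<in> points n" "b \<in> points n" for a b
 proof -
  have "noncrossing n D" using D by (simp add: diagrams_def)
  thus ?thesis unfolding noncrossing_def using mate_edge[OF D] that by blast
 qed
 thus ?thesis
  unfolding nc_involution_def using inj_on_boundary_pos mate_props[OF D] by simp
qed

text \<open>The way back from involutions to diagrams; the identity, the generators and all products
  are recognised as diagrams through it.\<close>

lemma diagram_of_involution:
 assumes nc: "nc_involution (points n) (boundary_pos n) m"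
 shows "(\<lambda>x. {x, m x}) ` points n \<in> diagrams n"
proof -
 let ?D = "(\<lambda>x. {x, m x}) ` points n"
 have inv: "\<And>x. x \<in> points n \<Longrightarrow> m x \<in> points n \<and> m x \<noteq> x \<and> m (m x) = x"
  and ncr: "\<And>u v. u \<in> points n \<Longrightarrow> v \<in> points n \<Longrightarrow>
   \<not> (boundary_pos n u < boundary_pos n v \<and> boundary_pos n v < boundary_pos n (m u) \<and>
     boundary_pos n (m u) < boundary_pos n (m v))"
  using nc unfolding nc_involution_def by auto
 have e: "a \<in> points n \<and> b = m a" if "{a, b} \<in> ?D" for a b
  using that inv by (auto simp: doubleton_eq_iff)
 have "partition_on (points n) ?D"
 proof (rule partition_onI)
  show "\<Union> ?D = points n" using inv by auto
  fix p q assume "p \<in> ?D" "q \<in> ?D" "p \<noteq> q"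
  then obtain x y where xy: "p = {x, m x}" "q = {y, m y}" "x \<in> points n" "y \<in> points n" by blast
  have x: "m (m x) = x" and y: "m (m y) = y" using inv xy(3,4) by blast+
  have "x \<noteq> y" using \<open>p \<noteq> q\<close> xy by blast
  moreover have "y \<noteq> m x" using \<open>p \<noteq> q\<close> xy x by fastforce
  moreover have "x \<noteq> m y" using \<open>p \<noteq> q\<close> xy y by fastforce
  moreover have "m x \<noteq> m y" using \<open>x \<noteq> y\<close> x y by metis
  ultimately show "disjnt p q" using xy by (simp add: disjnt_def)
 qed auto
 moreover have "\<forall>B\<in>?D. card B = 2"
 proof
  fix B assume "B \<in> ?D"
  then obtain x where "x \<in> points n" "B = {x, m x}" by auto
  moreover from this have "x \<noteq> m x" using inv[of x] by metis
  ultimately show "card B = 2" by (simp add: card_insert_if)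
 qed
 moreover have "noncrossing n ?D" unfolding noncrossing_def
 proof (rule notI, elim exE conjE)
  fix a b c d
  assume "{a, c} \<in> ?D" "{b, d} \<in> ?D" "boundary_pos n a < boundary_pos n b"
   "boundary_pos n b < boundary_pos n c" "boundary_pos n c < boundary_pos n d"
  thus False using e[of a c] e[of b d] ncr[of a b] by simp
 qed
 ultimately show ?thesis by (simp add: diagrams_def)
qed

section \<open>Connectivity in a stacked picture\<close>

definition edge_constant :: "diagram \<Rightarrow> diagram \<Rightarrow> (nat \<times> nat \<Rightarrow> bool) \<Rightarrow> bool" where
 "edge_constant D1 D2 L \<longleftrightarrow>
   (\<forall>a b. {a, b} \<in> D1 \<longrightarrow> L (at_level 0 a) = L (at_level 0 b)) \<and>
   (\<forall>a b. {a, b} \<in> D2 \<longrightarrow> L (at_level 1 a) = L (at_level 1 b))"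

lemma stack_edge_iff:
 assumes D: "D1 \<in> diagrams n" "D2 \<in> diagrams n"
 shows "{x, y} \<in> image (at_level 0) ` D1 \<union> image (at_level 1) ` D2 \<longleftrightarrow>
   (\<exists>a b. {a, b} \<in> D1 \<and> x = at_level 0 a \<and> y = at_level 0 b) \<or>
   (\<exists>a b. {a, b} \<in> D2 \<and> x = at_level 1 a \<and> y = at_level 1 b)"
proof -
 have *: "{x, y} \<in> image f ` D \<longleftrightarrow> (\<exists>a b. {a, b} \<in> D \<and> x = f a \<and> y = f b)"
  if DD: "D \<in> diagrams n" for D and f :: "point \<Rightarrow> nat \<times> nat"
 proof
  assume "{x, y} \<in> image f ` D"
  then obtain B where B: "B \<in> D" "{x, y} = f ` B" by auto
  obtain a b where ab: "B = {a, b}" "a \<noteq> b" by (rule diagram_block[OF DD B(1)])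
  hence "{x, y} = {f a, f b}" using B by simp
  hence "x = f a \<and> y = f b \<or> x = f b \<and> y = f a" by (simp add: doubleton_eq_iff)
  moreover have "{a, b} \<in> D" "{b, a} \<in> D" using B ab by (simp_all add: insert_commute)
  ultimately show "\<exists>a b. {a, b} \<in> D \<and> x = f a \<and> y = f b" by blast
 next
  assume "\<exists>a b. {a, b} \<in> D \<and> x = f a \<and> y = f b"
  then obtain a b where "{a, b} \<in> D" "{x, y} = f ` {a, b}" by auto
  thus "{x, y} \<in> image f ` D" by blast
 qed
 show ?thesis unfolding Un_iff *[OF D(1)] *[OF D(2)] ..
qed

text \<open>Edges are undirected, so being reachable from \<open>x\<close> is itself an
  edge-constant labelling; testing with it yields the path. The converse is induction along the
  path.\<close>

lemma stack_connected_iff: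
 assumes D: "D1 \<in> diagrams n" "D2 \<in> diagrams n"
 shows "(x, y) \<in> stack_connected D1 D2 \<longleftrightarrow> (\<forall>L. edge_constant D1 D2 L \<longrightarrow> L x = L y)"
proof -
 define r where "r = {(x, y). {x, y} \<in> image (at_level 0) ` D1 \<union> image (at_level 1) ` D2}"
 have sc: "stack_connected D1 D2 = r\<^sup>*" by (simp add: stack_connected_def r_def)
 have r: "(u, v) \<in> r \<longleftrightarrow> (\<exists>a b. {a, b} \<in> D1 \<and> u = at_level 0 a \<and> v = at_level 0 b) \<or>
   (\<exists>a b. {a, b} \<in> D2 \<and> u = at_level 1 a \<and> v = at_level 1 b)" for u v
  unfolding r_def using stack_edge_iff[OF D] by simp
 have 1: "L x = L y" if L: "edge_constant D1 D2 L" and "(x, y) \<in> r\<^sup>*" for L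
  using that(2)
 proof (induction rule: rtrancl_induct)
  case (step u v)
  thus ?case using L r[of u v] unfolding edge_constant_def by metis
 qed simp
 have 2: "(x, y) \<in> r\<^sup>*" if all: "\<forall>L. edge_constant D1 D2 L \<longrightarrow> L x = L y"
 proof -
  have edge: "(x, u) \<in> r\<^sup>* \<longleftrightarrow> (x, v) \<in> r\<^sup>*" if "(u, v) \<in> r" "(v, u) \<in> r" for u v
   using that by (meson rtrancl.rtrancl_into_rtrancl)
  have "(x, at_level 0 a) \<in> r\<^sup>* \<longleftrightarrow> (x, at_level 0 b) \<in> r\<^sup>*" if "{a, b} \<in> D1" for a b
  proof (rule edge)
   show "(at_level 0 a, at_level 0 b) \<in> r" using that r by blast
   have "{b, a} \<in> D1" using that by (simp add: insert_commute)
   thus "(at_level 0 b, at_level 0 a) \<in> r" using r by blast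
  qed
  moreover have "(x, at_level 1 a) \<in> r\<^sup>* \<longleftrightarrow> (x, at_level 1 b) \<in> r\<^sup>*" if "{a, b} \<in> D2" for a b
  proof (rule edge)
   show "(at_level 1 a, at_level 1 b) \<in> r" using that r by blast
   have "{b, a} \<in> D2" using that by (simp add: insert_commute)
   thus "(at_level 1 b, at_level 1 a) \<in> r" using r by blast
  qed
  ultimately have "edge_constant D1 D2 (\<lambda>z. (x, z) \<in> r\<^sup>*)" by (simp add: edge_constant_def)
  thus ?thesis using all by blast
 qed
 show ?thesis unfolding sc
 proof (rule iffI)
  assume "(x, y) \<in> r\<^sup>*"
  thus "\<forall>L. edge_constant D1 D2 L \<longrightarrow> L x = L y" using 1 by simp
 qed (rule 2)
qed

lemma stack_connected_refl [simp]: "(x, x) \<in> stack_connected D1 D2"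
 unfolding stack_connected_def by (rule rtrancl.rtrancl_refl)

text \<open>The bottom of the first diagram occupies the positions n + 1 to 2n from right to left,
  and the top of the second starts at 2n + 1 from left to right. So the two copies of glued point 1
  are adjacent, and after their removal those of point 2.\<close>

fun stack_pos :: "nat \<Rightarrow> point + point \<Rightarrow> nat" where
 "stack_pos n (Inl p) = boundary_pos n p"
| "stack_pos n (Inr p) = 2 * n + boundary_pos n p"

definition stack_points :: "nat \<Rightarrow> nat \<Rightarrow> (point + point) set" where
 "stack_points n k = Inl ` Top ` {1..n} \<union> Inr ` Bot ` {1..n} \<union>
   Inl ` Bot ` {k<..n} \<union> Inr ` Top ` {k<..n}"

text \<open>The bottom of \<open>D1\<close> is glued to the top of \<open>D2\<close> one strand at a time, starting on the left;
 in the order of \<open>stack_pos\<close> every strand joins two neighbouring points.\<close>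

lemma stack_contract:
 assumes D: "D1 \<in> diagrams n" "D2 \<in> diagrams n" and "k \<le> n"
 shows "\<exists>m. nc_involution (stack_points n k) (stack_pos n) m \<and>
  (\<forall>g. invariant_on (stack_points n k) m g \<longleftrightarrow>
   (\<exists>h. (\<forall>x\<in>stack_points n k. h x = g x) \<and> (\<forall>i\<in>{1..k}. h (Inl (Bot i)) = h (Inr (Top i))) \<and>
      invariant_on (stack_points n 0) (map_sum (mate D1) (mate D2)) h))"
 using \<open>k \<le> n\<close>
proof (induction k)
 case 0
 let ?m = "map_sum (mate D1) (mate D2)"
 have sp: "stack_points n 0 = Inl ` points n \<union> Inr ` points n"
  by (auto simp: stack_points_def points_def)
 have bound: "boundary_pos n p \<in> {1..2 * n}" if "p \<in> points n" for p
  using that by (cases p) auto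
 have "nc_involution (stack_points n 0) (stack_pos n) ?m"
  unfolding nc_involution_def
 proof (intro conjI ballI)
  show "inj_on (stack_pos n) (stack_points n 0)"
  proof (rule inj_onI)
   fix x y assume xy: "x \<in> stack_points n 0" "y \<in> stack_points n 0" "stack_pos n x = stack_pos n y"
   have eq: "u = v" if "u \<in> points n" "v \<in> points n" "boundary_pos n u = boundary_pos n v" for u v
    using inj_on_boundary_pos[of n] that by (auto dest: inj_onD)
   show "x = y"
   proof (cases x)
    case x: (Inl u)
    hence u: "u \<in> points n" using xy sp by auto
    show ?thesis
    proof (cases y)
     case y: (Inl v)
     hence "v \<in> points n" using xy sp by auto
     thus ?thesis using eq[OF u] xy(3) x y by simp
    next
     case y: (Inr v)
     hence "v \<in> points n" using xy sp by auto
     thus ?thesis using bound[OF u] bound[of v] xy(3) x y by simp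
    qed
   next
    case x: (Inr u)
    hence u: "u \<in> points n" using xy sp by auto
    show ?thesis
    proof (cases y)
     case y: (Inl v)
     hence "v \<in> points n" using xy sp by auto
     thus ?thesis using bound[OF u] bound[of v] xy(3) x y by simp
    next
     case y: (Inr v)
     hence "v \<in> points n" using xy sp by auto
     thus ?thesis using eq[OF u] xy(3) x y by simp
    qed
   qed
  qed
 next
  fix x assume "x \<in> stack_points n 0"
  thus "?m x \<in> stack_points n 0" "?m x \<noteq> x" "?m (?m x) = x"
   unfolding sp using mate_props[OF D(1)] mate_props[OF D(2)] by auto
 next
  fix a b assume ab: "a \<in> stack_points n 0" "b \<in> stack_points n 0"
  have n1: "\<not> (boundary_pos n u < boundary_pos n v \<and> boundary_pos n v < boundary_pos n (mate D u) \<and>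
   boundary_pos n (mate D u) < boundary_pos n (mate D v))"
   if "D \<in> diagrams n" "u \<in> points n" "v \<in> points n" for D u v
   using nc_involution_mate[OF that(1)] that unfolding nc_involution_def by blast
  show "\<not> (stack_pos n a < stack_pos n b \<and> stack_pos n b < stack_pos n (?m a) \<and>
    stack_pos n (?m a) < stack_pos n (?m b))"
  proof (cases a)
   case [simp]: (Inl u)
   hence u: "u \<in> points n" using ab sp by auto
   show ?thesis
   proof (cases b)
    case [simp]: (Inl v)
    hence v: "v \<in> points n" using ab sp by auto
    show ?thesis using n1[OF D(1) u v] by simp
   next
    case [simp]: (Inr v)
    show ?thesis using bound[OF mate_props(1)[OF D(1) u]] by auto
   qed
  next
   case [simp]: (Inr u)
   hence u: "u \<in> points n" using ab sp by auto
   show ?thesis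
   proof (cases b)
    case [simp]: (Inl v)
    hence v: "v \<in> points n" using ab sp by auto
    show ?thesis using bound[OF v] bound[OF u] by auto
   next
    case [simp]: (Inr v)
    hence v: "v \<in> points n" using ab sp by auto
    show ?thesis using n1[OF D(2) u v] by simp
   qed
  qed
 qed
 moreover have "invariant_on (stack_points n 0) ?m g \<longleftrightarrow>
   (\<exists>h. (\<forall>x\<in>stack_points n 0. h x = g x) \<and> (\<forall>i\<in>{1..0}. h (Inl (Bot i)) = h (Inr (Top i))) \<and>
    invariant_on (stack_points n 0) ?m h)" for g
 proof
  assume "invariant_on (stack_points n 0) ?m g"
  thus "\<exists>h. (\<forall>x\<in>stack_points n 0. h x = g x) \<and>
    (\<forall>i\<in>{1..0}. h (Inl (Bot i)) = h (Inr (Top i))) \<and> invariant_on (stack_points n 0) ?m h"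
   by (intro exI[of _ g]) simp
 next
  assume "\<exists>h. (\<forall>x\<in>stack_points n 0. h x = g x) \<and>
    (\<forall>i\<in>{1..0}. h (Inl (Bot i)) = h (Inr (Top i))) \<and> invariant_on (stack_points n 0) ?m h"
  then obtain h where h: "\<forall>x\<in>stack_points n 0. h x = g x" "invariant_on (stack_points n 0) ?m h" by blast
  have "?m x \<in> stack_points n 0" if "x \<in> stack_points n 0" for x
   using that unfolding sp using mate_props[OF D(1)] mate_props[OF D(2)] by auto
  thus "invariant_on (stack_points n 0) ?m g" using h unfolding invariant_on_def by simp
 qed
 ultimately show ?case by blast
next
 case (Suc k)
 let ?m0 = "map_sum (mate D1) (mate D2)"
 obtain m where m: "nc_involution (stack_points n k) (stack_pos n) m"
  and inv: "\<And>g. invariant_on (stack_points n k) m g \<longleftrightarrow>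
   (\<exists>h. (\<forall>x\<in>stack_points n k. h x = g x) \<and> (\<forall>i\<in>{1..k}. h (Inl (Bot i)) = h (Inr (Top i))) \<and>
      invariant_on (stack_points n 0) ?m0 h)"
  using Suc by auto
 let ?a = "Inl (Bot (Suc k)) :: point + point" and ?b = "Inr (Top (Suc k)) :: point + point"
 have ab: "?a \<in> stack_points n k" "?b \<in> stack_points n k" "stack_pos n ?a < stack_pos n ?b"
  using Suc.prems by (auto simp: stack_points_def)
 have adj: "\<not> (stack_pos n ?a < stack_pos n x \<and> stack_pos n x < stack_pos n ?b)"
  if "x \<in> stack_points n k" for x
  using that Suc.prems by (auto simp: stack_points_def)
 have sp: "stack_points n k - {?a, ?b} = stack_points n (Suc k)"
  using Suc.prems by (auto simp: stack_points_def)
 obtain m' where m': "nc_involution (stack_points n (Suc k)) (stack_pos n) m'"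
  and inv': "\<And>g. invariant_on (stack_points n (Suc k)) m' g \<longleftrightarrow>
      (\<exists>h. (\<forall>x\<in>stack_points n (Suc k). h x = g x) \<and> h ?a = h ?b \<and> invariant_on (stack_points n k) m h)"
  using nc_involution_contract[OF m ab adj, unfolded sp] by blast
 have "invariant_on (stack_points n (Suc k)) m' g \<longleftrightarrow>
   (\<exists>h. (\<forall>x\<in>stack_points n (Suc k). h x = g x) \<and>
      (\<forall>i\<in>{1..Suc k}. h (Inl (Bot i)) = h (Inr (Top i))) \<and>
      invariant_on (stack_points n 0) ?m0 h)" for g
 proof
  assume "invariant_on (stack_points n (Suc k)) m' g"
  then obtain h where h: "\<forall>x\<in>stack_points n (Suc k). h x = g x" "h ?a = h ?b"
   "invariant_on (stack_points n k) m h" using inv'[of g] by blast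
  then obtain h' where h': "\<forall>x\<in>stack_points n k. h' x = h x"
   "\<forall>i\<in>{1..k}. h' (Inl (Bot i)) = h' (Inr (Top i))" "invariant_on (stack_points n 0) ?m0 h'"
   using inv[of h] by blast
  have "\<forall>i\<in>{1..Suc k}. h' (Inl (Bot i)) = h' (Inr (Top i))"
   using h' h(2) ab by (auto simp: le_Suc_eq)
  moreover have "\<forall>x\<in>stack_points n (Suc k). h' x = g x" using h h' sp by auto
  ultimately show "\<exists>h. (\<forall>x\<in>stack_points n (Suc k). h x = g x) \<and>
      (\<forall>i\<in>{1..Suc k}. h (Inl (Bot i)) = h (Inr (Top i))) \<and>
      invariant_on (stack_points n 0) ?m0 h" using h'(3) by blast
 next
  assume "\<exists>h. (\<forall>x\<in>stack_points n (Suc k). h x = g x) \<and>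
      (\<forall>i\<in>{1..Suc k}. h (Inl (Bot i)) = h (Inr (Top i))) \<and>
      invariant_on (stack_points n 0) ?m0 h"
  then obtain h where h: "\<forall>x\<in>stack_points n (Suc k). h x = g x"
   "\<forall>i\<in>{1..Suc k}. h (Inl (Bot i)) = h (Inr (Top i))" "invariant_on (stack_points n 0) ?m0 h" by blast
  have "\<forall>i\<in>{1..k}. h (Inl (Bot i)) = h (Inr (Top i))" using h(2) by simp
  hence "invariant_on (stack_points n k) m h" using inv[of h] h(3) by blast
  moreover have "h ?a = h ?b" using h(2) by auto
  ultimately show "invariant_on (stack_points n (Suc k)) m' g" using inv'[of g] h(1) by blast
 qed
 thus ?case by (intro exI[of _ m'] conjI allI m')
qed

text \<open>Once all \<open>n\<close> glued points are contracted, only the outer points remain,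
  matched without crossings by \<open>\<mu>\<close>. The invariant functions on them are the
  restrictions of edge-constant labellings of the stacked picture, so \<open>\<mu>\<close> pairs
  exactly the connected outer points.\<close>

lemma concat_diagram_in_diagrams:
 assumes D: "D1 \<in> diagrams n" "D2 \<in> diagrams n"
 shows "concat_diagram n D1 D2 \<in> diagrams n"
proof -
 define emb where "emb = (\<lambda>p. case p of Top i \<Rightarrow> Inl (Top i) | Bot i \<Rightarrow> (Inr (Bot i) :: point + point))"
 define proj where "proj = case_sum id (id :: point \<Rightarrow> point)"
 let ?P = "stack_points n n" and ?m0 = "map_sum (mate D1) (mate D2)"
 have emb_P: "emb x \<in> ?P" if "x \<in> points n" for x
  using that by (cases x) (auto simp: emb_def stack_points_def)
 have proj_emb [simp]: "proj (emb x) = x" for x by (cases x) (auto simp: emb_def proj_def)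
 have P_cases: "proj y \<in> points n" "emb (proj y) = y" if "y \<in> ?P" for y
  using that by (auto simp: emb_def proj_def stack_points_def)
 have mono: "boundary_pos n a < boundary_pos n b \<longleftrightarrow> stack_pos n (emb a) < stack_pos n (emb b)"
  if "a \<in> points n" "b \<in> points n" for a b
  using that by (cases a; cases b) (auto simp: emb_def)
 obtain m where m: "nc_involution ?P (stack_pos n) m"
  and inv: "\<And>g. invariant_on ?P m g \<longleftrightarrow>
   (\<exists>h. (\<forall>x\<in>?P. h x = g x) \<and> (\<forall>i\<in>{1..n}. h (Inl (Bot i)) = h (Inr (Top i))) \<and>
      invariant_on (stack_points n 0) ?m0 h)"
  using stack_contract[OF D order_refl] by blast
 have mP: "m y \<in> ?P" "m y \<noteq> y" "m (m y) = y" if "y \<in> ?P" for y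
  using m that unfolding nc_involution_def by auto
 define \<mu> where "\<mu> = (\<lambda>x. proj (m (emb x)))"
 have emb_\<mu>: "emb (\<mu> x) = m (emb x)" if "x \<in> points n" for x
  unfolding \<mu>_def using P_cases mP emb_P that by blast
 have \<mu>P: "\<mu> x \<in> points n" if "x \<in> points n" for x
  using P_cases(1)[OF mP(1)[OF emb_P[OF that]]] by (simp only: \<mu>_def)
 have mnc: "\<not> (stack_pos n a < stack_pos n b \<and> stack_pos n b < stack_pos n (m a) \<and>
    stack_pos n (m a) < stack_pos n (m b))" if "a \<in> ?P" "b \<in> ?P" for a b
  using m that unfolding nc_involution_def by simp
 have sp0: "stack_points n 0 = Inl ` points n \<union> Inr ` points n"
  by (auto simp: stack_points_def points_def)
 have "nc_involution (points n) (boundary_pos n) \<mu>"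
  unfolding nc_involution_def
 proof (intro conjI ballI inj_on_boundary_pos)
  fix x assume x: "x \<in> points n"
  show "\<mu> x \<in> points n" using x by (rule \<mu>P)
  show "\<mu> x \<noteq> x" using emb_\<mu>[OF x] mP(2)[OF emb_P[OF x]] by auto
  have "\<mu> (\<mu> x) = proj (m (emb (\<mu> x)))" by (simp only: \<mu>_def)
  thus "\<mu> (\<mu> x) = x" by (simp only: emb_\<mu>[OF x] mP(3)[OF emb_P[OF x]] proj_emb)
 next
  fix a b assume ab: "a \<in> points n" "b \<in> points n"
  have \<mu>ab: "\<mu> a \<in> points n" "\<mu> b \<in> points n" using ab \<mu>P by blast+
  show "\<not> (boundary_pos n a < boundary_pos n b \<and> boundary_pos n b < boundary_pos n (\<mu> a) \<and>
    boundary_pos n (\<mu> a) < boundary_pos n (\<mu> b))"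
   unfolding mono[OF ab] mono[OF ab(2) \<mu>ab(1)] mono[OF \<mu>ab] emb_\<mu>[OF ab(1)] emb_\<mu>[OF ab(2)]
   by (rule mnc[OF emb_P[OF ab(1)] emb_P[OF ab(2)]])
 qed
 hence "(\<lambda>x. {x, \<mu> x}) ` points n \<in> diagrams n" by (rule diagram_of_involution)
 moreover have conn: "(outer a, outer b) \<in> stack_connected D1 D2 \<longleftrightarrow> b = a \<or> b = \<mu> a"
  if ab: "a \<in> points n" "b \<in> points n" for a b
 proof -
  have "(\<forall>L. edge_constant D1 D2 L \<longrightarrow> L (outer a) = L (outer b)) \<longleftrightarrow>
    (\<forall>g. invariant_on ?P m g \<longrightarrow> g (emb a) = g (emb b))"
  proof (rule iffI; intro allI impI)
   fix g assume L: "\<forall>L. edge_constant D1 D2 L \<longrightarrow> L (outer a) = L (outer b)" and "invariant_on ?P m g"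
   then obtain h where h: "\<forall>x\<in>?P. h x = g x" "\<forall>i\<in>{1..n}. h (Inl (Bot i)) = h (Inr (Top i))"
      "invariant_on (stack_points n 0) ?m0 h" using inv[of g] by blast
   \<comment> \<open>\<open>h\<close> becomes a labelling of the three levels; the two copies of a
     glued point carry the same value, so at level 1 either may be read.\<close>
   define L where "L = (\<lambda>(l, i). if l = (0::nat) then h (Inl (Top i)) else if l = 1 then h (Inl (Bot i))
     else h (Inr (Bot i)))"
   have L0: "L (at_level 0 p) = h (Inl p)" for p by (cases p) (auto simp: L_def)
   have L1: "L (at_level 1 p) = h (Inr p)" if "p \<in> points n" for p
    using that h(2) by (cases p) (auto simp: L_def)
   have "edge_constant D1 D2 L" unfolding edge_constant_def
   proof (intro conjI allI impI)
    fix u v assume e: "{u, v} \<in> D1"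
    note de = diagram_edge[OF D(1) e]
    show "L (at_level 0 u) = L (at_level 0 v)" unfolding L0
     using h(3) de unfolding invariant_on_def sp0 by auto
   next
    fix u v assume e: "{u, v} \<in> D2"
    note de = diagram_edge[OF D(2) e]
    show "L (at_level 1 u) = L (at_level 1 v)" unfolding L1[OF de(2)] L1[OF de(3)]
     using h(3) de unfolding invariant_on_def sp0 by auto
   qed
   moreover have "L (outer p) = g (emb p)" if "p \<in> points n" for p
    using h(1) emb_P[OF that] by (cases p) (auto simp: L_def emb_def)
   ultimately show "g (emb a) = g (emb b)" using L ab by auto
  next
   fix L assume g: "\<forall>g. invariant_on ?P m g \<longrightarrow> g (emb a) = g (emb b)" and L: "edge_constant D1 D2 L"
   define g where "g = case_sum (\<lambda>p. L (at_level 0 p)) (\<lambda>p. L (at_level 1 p))"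
   have "L (at_level 0 (mate D1 x)) = L (at_level 0 x)" "L (at_level 1 (mate D2 x)) = L (at_level 1 x)"
    if "x \<in> points n" for x
    using L mate_edge[OF D(1) that] mate_edge[OF D(2) that] unfolding edge_constant_def by blast+
   hence "invariant_on (stack_points n 0) ?m0 g"
    unfolding invariant_on_def sp0 by (auto simp: g_def)
   moreover have "\<forall>i\<in>{1..n}. g (Inl (Bot i)) = g (Inr (Top i))" by (simp add: g_def)
   ultimately have "invariant_on ?P m g" using inv[of g] by blast
   hence "g (emb a) = g (emb b)" using g by blast
   moreover have "g (emb p) = L (outer p)" for p
    by (cases p) (auto simp: g_def emb_def numeral_2_eq_2)
   ultimately show "L (outer a) = L (outer b)" by simp
  qed
  also have "\<dots> \<longleftrightarrow> emb b = emb a \<or> emb b = m (emb a)"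
  proof
   assume all: "\<forall>g. invariant_on ?P m g \<longrightarrow> g (emb a) = g (emb b)"
   \<comment> \<open>The indicator of the pair of \<open>emb a\<close> separates this pair from all
     other points.\<close>
   have "invariant_on ?P m (\<lambda>y. y = emb a \<or> y = m (emb a))"
    unfolding invariant_on_def using mP emb_P[OF ab(1)] by metis
   from all[rule_format, OF this] show "emb b = emb a \<or> emb b = m (emb a)" by simp
  next
   assume eq: "emb b = emb a \<or> emb b = m (emb a)"
   show "\<forall>g. invariant_on ?P m g \<longrightarrow> g (emb a) = g (emb b)"
   proof (intro allI impI)
    fix g assume "invariant_on ?P m g"
    hence "g (m (emb a)) = g (emb a)" using emb_P[OF ab(1)] unfolding invariant_on_def by blast
    with eq show "g (emb a) = g (emb b)" by (elim disjE) simp_all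
   qed
  qed
  also have "\<dots> \<longleftrightarrow> b = a \<or> b = \<mu> a"
   unfolding emb_\<mu>[OF ab(1), symmetric] by (metis proj_emb)
  finally show ?thesis unfolding stack_connected_iff[OF D] .
 qed
 have "concat_diagram n D1 D2 = (\<lambda>x. {x, \<mu> x}) ` points n"
 proof (intro equalityI subsetI)
  fix B assume "B \<in> concat_diagram n D1 D2"
  thus "B \<in> (\<lambda>x. {x, \<mu> x}) ` points n"
   unfolding concat_diagram_def using conn by auto
 next
  fix B assume "B \<in> (\<lambda>x. {x, \<mu> x}) ` points n"
  then obtain x where x: "x \<in> points n" "B = {x, \<mu> x}" by auto
  have "\<mu> x \<in> points n" using x(1) by (rule \<mu>P)
  moreover have "\<mu> x \<noteq> x" using emb_\<mu>[OF x(1)] mP(2)[OF emb_P[OF x(1)]] by auto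
  moreover have "(outer x, outer (\<mu> x)) \<in> stack_connected D1 D2"
   using conn[OF x(1) \<mu>P[OF x(1)]] by simp
  ultimately show "B \<in> concat_diagram n D1 D2"
   unfolding concat_diagram_def x(2) using x(1) by (intro CollectI exI[of _ x] exI[of _ "\<mu> x"]) simp
 qed
 ultimately show ?thesis by simp
qed

section \<open>A faithful representation on tensor space\<close>

declare sum_mult_of_bool_eq [simp del] sum_of_bool_mult_eq [simp del]

text \<open>A sign for every even place. The ends of an arc on one side have opposite parity, so
  moving an element from one end to the other changes the sign: an arc becomes an antisymmetric
  vector.\<close>

definition theta :: "nat set \<Rightarrow> rat" where
 "theta X = (-1) ^ card {i \<in> X. even i}"

lemma theta_square [simp]: "theta X * theta X = 1"
 by (simp add: theta_def flip: power_add mult_2)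

text \<open>Twisting membership by parity turns the condition on every edge into equality: an arc on
  one side joins opposite parities and must contain exactly one element of the set, while a through
  line joins equal parities and transports membership.\<close>

fun label :: "nat set \<Rightarrow> nat set \<Rightarrow> point \<Rightarrow> bool" where
 "label X Y (Top i) \<longleftrightarrow> (i \<in> X) \<noteq> even i"
| "label X Y (Bot i) \<longleftrightarrow> (i \<in> Y) \<noteq> even i"

definition fits :: "diagram \<Rightarrow> nat set \<Rightarrow> nat set \<Rightarrow> bool" where
 "fits D X Y \<longleftrightarrow> (\<forall>a b. {a, b} \<in> D \<longrightarrow> label X Y a = label X Y b)"

fun stack_label :: "nat set \<Rightarrow> nat set \<Rightarrow> nat set \<Rightarrow> nat \<times> nat \<Rightarrow> bool" where
 "stack_label X Z Y (l, i) \<longleftrightarrow> (i \<in> (if l = 0 then X else if l = 1 then Z else Y)) \<noteq> even i"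

lemma stack_label_simps [simp]:
 "stack_label X Z Y (at_level 0 p) = label X Z p"
 "stack_label X Z Y (at_level (Suc 0) p) = label Z Y p"
 "stack_label X Z Y (outer p) = label X Y p"
 by (cases p; simp)+

lemma outer_image_iff: "(l, i) \<in> outer ` points n \<longleftrightarrow> i \<in> {1..n} \<and> (l = 0 \<or> l = 2)"
 by (auto simp: points_def image_Un image_image)

lemma fits_stack: "fits D1 X Z \<and> fits D2 Z Y \<longleftrightarrow> edge_constant D1 D2 (stack_label X Z Y)"
 by (simp add: fits_def edge_constant_def)

text \<open>A labelling of the middle level is forced on the components that reach an outer point
  and free on every closed loop, hence a power of 2; if connected outer points disagree, there is
  none.\<close>

lemma card_fits_stack:
 assumes D: "D1 \<in> diagrams n" "D2 \<in> diagrams n"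
 shows "card {Z \<in> Pow {1..n}. fits D1 X Z \<and> fits D2 Z Y} =
  (if fits (concat_diagram n D1 D2) X Y then 2 ^ loops n D1 D2 else 0)"
proof -
 let ?c = "stack_connected D1 D2"
 note conn = stack_connected_iff[OF D]
 have c_sym: "(y, x) \<in> ?c" if "(x, y) \<in> ?c" for x y using that unfolding conn by metis
 have c_trans: "(x, z) \<in> ?c" if "(x, y) \<in> ?c" "(y, z) \<in> ?c" for x y z using that unfolding conn by metis
 show ?thesis
 proof (cases "fits (concat_diagram n D1 D2) X Y")
  case False
  then obtain a b where ab: "{a, b} \<in> concat_diagram n D1 D2" "label X Y a \<noteq> label X Y b"
   by (auto simp: fits_def)
  then obtain a' b' where "{a, b} = {a', b'}" and c': "(outer a', outer b') \<in> ?c"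
   unfolding concat_diagram_def by blast
  hence "label X Y a' \<noteq> label X Y b'" using ab(2) by (auto simp: doubleton_eq_iff)
  hence "\<not> edge_constant D1 D2 (stack_label X Z Y)" for Z
   using c' unfolding conn using stack_label_simps(3) by blast
  hence "{Z \<in> Pow {1..n}. fits D1 X Z \<and> fits D2 Z Y} = {}" unfolding fits_stack by simp
  thus ?thesis using False by simp
 next
  case True
  define Cl where "Cl = (\<lambda>z. ?c `` {z})"
  define Loops where "Loops = {C. (\<exists>i\<in>{1..n}. C = Cl (1, i)) \<and> C \<subseteq> {1} \<times> UNIV}"
  \<comment> \<open>\<open>ext\<close> marks the components reaching an outer point;
    \<open>Lab U\<close> copies the outer labels there and labels a loop by membership in
    \<open>U\<close>. \<open>ZZ\<close> and \<open>UU\<close> translate between sets of loops and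
    labellings of the middle level.\<close>
  define ext where "ext = (\<lambda>z. \<exists>a\<in>points n. (outer a, z) \<in> ?c)"
  define Lab where "Lab = (\<lambda>U z. if ext z then \<exists>a\<in>points n. (outer a, z) \<in> ?c \<and> label X Y a else Cl z \<in> U)"
  define ZZ where "ZZ = (\<lambda>U. {i \<in> {1..n}. Lab U (1, i) \<noteq> even i})"
  define UU where "UU = (\<lambda>Z. {C \<in> Loops. \<exists>i\<in>{1..n}. C = Cl (1, i) \<and> stack_label X Z Y (1, i)})"
  have Cl_eq: "Cl x = Cl y \<longleftrightarrow> (x, y) \<in> ?c" for x y
  proof
   assume "Cl x = Cl y"
   thus "(x, y) \<in> ?c" unfolding Cl_def using stack_connected_refl[of y D1 D2] by blast
  next
   assume "(x, y) \<in> ?c"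
   thus "Cl x = Cl y" unfolding Cl_def using c_sym c_trans by blast
  qed
  have loops: "loops n D1 D2 = card Loops" by (simp add: loops_def Loops_def Cl_def)
  have fin: "finite Loops"
   by (rule finite_subset[of _ "(\<lambda>i. Cl (1, i)) ` {1..n}"]) (auto simp: Loops_def)
  have outer_label: "label X Y a = label X Y b" if "a \<in> points n" "b \<in> points n" "(outer a, outer b) \<in> ?c" for a b
  proof (cases "a = b")
   case False
   hence "{a, b} \<in> concat_diagram n D1 D2" unfolding concat_diagram_def using that by blast
   thus ?thesis using True unfolding fits_def by blast
  qed simp
  have ext_or_loop: "ext (1, i) \<or> Cl (1, i) \<in> Loops" if i: "i \<in> {1..n}" for i
  proof -
   \<comment> \<open>Every end of an edge is an outer point or at level 1, so a component without
     outer points stays at level 1 and is a loop.\<close>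
   have lev: "z \<in> outer ` points n \<or> fst z = 1" if "((1, i), z) \<in> ?c" for z
   proof -
    let ?L = "\<lambda>z. z \<in> outer ` points n \<or> fst z = 1"
    have "?L (at_level 0 p)" if "p \<in> points n" for p
     using that by (cases p) (simp_all add: outer_image_iff)
    moreover have "?L (at_level 1 p)" if "p \<in> points n" for p
     using that by (cases p) (simp_all add: outer_image_iff)
    ultimately have "edge_constant D1 D2 ?L"
     unfolding edge_constant_def using diagram_edge(2,3)[OF D(1)] diagram_edge(2,3)[OF D(2)] by blast
    hence "?L (1, i) = ?L z" using that conn by blast
    thus ?thesis by simp
   qed
   show ?thesis
   proof (rule disjCI)
    assume "Cl (1, i) \<notin> Loops"
    hence "\<not> Cl (1, i) \<subseteq> {1} \<times> UNIV" using i unfolding Loops_def by blast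
    then obtain z where z: "((1, i), z) \<in> ?c" "fst z \<noteq> 1" unfolding Cl_def by force
    then obtain a where "a \<in> points n" "z = outer a" using lev by blast
    thus "ext (1, i)" unfolding ext_def using c_sym z by blast
   qed
  qed
  have loop_ext: "\<not> ext (1, i)" if "Cl (1, i) \<in> Loops" for i
  proof
   assume "ext (1, i)"
   then obtain a where "(outer a, (1, i)) \<in> ?c" unfolding ext_def by blast
   hence "outer a \<in> Cl (1, i)" unfolding Cl_def using c_sym by blast
   hence "outer a \<in> {1} \<times> UNIV" using that unfolding Loops_def by blast
   thus False by (cases a) auto
  qed
  have Lab_const: "Lab U x = Lab U y" if "(x, y) \<in> ?c" for U x y
  proof -
   have "(outer a, x) \<in> ?c \<longleftrightarrow> (outer a, y) \<in> ?c" for a using that c_sym c_trans by blast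
   moreover have "Cl x = Cl y" using Cl_eq that by simp
   ultimately show ?thesis unfolding Lab_def ext_def by simp
  qed
  have Lab_outer: "Lab U (outer a) = label X Y a" if "a \<in> points n" for U a
  proof -
   have "ext (outer a)" unfolding ext_def using that by (intro bexI[of _ a]) simp_all
   hence "Lab U (outer a) \<longleftrightarrow> (\<exists>b\<in>points n. (outer b, outer a) \<in> ?c \<and> label X Y b)"
    unfolding Lab_def by simp
   also have "\<dots> \<longleftrightarrow> label X Y a"
   proof
    assume "\<exists>b\<in>points n. (outer b, outer a) \<in> ?c \<and> label X Y b"
    then obtain b where "b \<in> points n" "(outer b, outer a) \<in> ?c" "label X Y b" by blast
    thus "label X Y a" using outer_label[of b a] that by blast
   next
    assume "label X Y a"
    thus "\<exists>b\<in>points n. (outer b, outer a) \<in> ?c \<and> label X Y b"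
     using that by (intro bexI[of _ a]) simp_all
   qed
   finally show ?thesis .
  qed
  have Lab_level: "stack_label X (ZZ U) Y z = Lab U z"
   if "z \<in> outer ` points n \<or> z \<in> {1} \<times> {1..n}" for U z
   using that
  proof
   assume "z \<in> outer ` points n"
   thus ?thesis using Lab_outer by auto
  next
   assume "z \<in> {1} \<times> {1..n}"
   thus ?thesis by (auto simp: ZZ_def)
  qed
  have edges: "edge_constant D1 D2 (stack_label X (ZZ U) Y)" for U
  proof -
   have lv0: "at_level 0 p \<in> outer ` points n \<or> at_level 0 p \<in> {1} \<times> {1..n}" if "p \<in> points n" for p
    using that by (cases p) (simp_all add: outer_image_iff)
   have lv1: "at_level 1 p \<in> outer ` points n \<or> at_level 1 p \<in> {1} \<times> {1..n}" if "p \<in> points n" for p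
    using that by (cases p) (simp_all add: outer_image_iff)
   have c0: "(at_level 0 a, at_level 0 b) \<in> ?c" if "{a, b} \<in> D1" for a b
    using that unfolding conn edge_constant_def by simp
   have c1: "(at_level 1 a, at_level 1 b) \<in> ?c" if "{a, b} \<in> D2" for a b
    using that unfolding conn edge_constant_def by simp
   show ?thesis unfolding edge_constant_def
   proof (intro conjI allI impI)
    fix a b assume e: "{a, b} \<in> D1"
    show "stack_label X (ZZ U) Y (at_level 0 a) = stack_label X (ZZ U) Y (at_level 0 b)"
     unfolding Lab_level[OF lv0[OF diagram_edge(2)[OF D(1) e]]] Lab_level[OF lv0[OF diagram_edge(3)[OF D(1) e]]]
     by (rule Lab_const[OF c0[OF e]])
   next
    fix a b assume e: "{a, b} \<in> D2"
    show "stack_label X (ZZ U) Y (at_level 1 a) = stack_label X (ZZ U) Y (at_level 1 b)"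
     unfolding Lab_level[OF lv1[OF diagram_edge(2)[OF D(2) e]]] Lab_level[OF lv1[OF diagram_edge(3)[OF D(2) e]]]
     by (rule Lab_const[OF c1[OF e]])
   qed
  qed
  have "bij_betw ZZ (Pow Loops) {Z \<in> Pow {1..n}. fits D1 X Z \<and> fits D2 Z Y}"
  proof (rule bij_betw_byWitness[where f' = UU])
   show "\<forall>U\<in>Pow Loops. UU (ZZ U) = U"
   proof
    fix U assume U: "U \<in> Pow Loops"
    have k: "stack_label X (ZZ U) Y (1, i) \<longleftrightarrow> Cl (1, i) \<in> U" if "i \<in> {1..n}" "Cl (1, i) \<in> Loops" for i
     using Lab_level[of "(1, i)" U] that loop_ext[OF that(2)] by (simp add: Lab_def)
    show "UU (ZZ U) = U"
    proof (intro equalityI subsetI)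
     fix C assume "C \<in> UU (ZZ U)"
     then obtain i where "C \<in> Loops" "i \<in> {1..n}" "C = Cl (1, i)" "stack_label X (ZZ U) Y (1, i)"
      unfolding UU_def by blast
     thus "C \<in> U" using k[of i] by simp
    next
     fix C assume C: "C \<in> U"
     hence L: "C \<in> Loops" using U by blast
     then obtain i where i: "i \<in> {1..n}" "C = Cl (1, i)" unfolding Loops_def by blast
     hence "stack_label X (ZZ U) Y (1, i)" using k[of i] C L by simp
     thus "C \<in> UU (ZZ U)" unfolding UU_def using L i by (intro CollectI conjI bexI[of _ i]) simp_all
    qed
   qed
   show "\<forall>Z\<in>{Z \<in> Pow {1..n}. fits D1 X Z \<and> fits D2 Z Y}. ZZ (UU Z) = Z"
   proof
    fix Z assume "Z \<in> {Z \<in> Pow {1..n}. fits D1 X Z \<and> fits D2 Z Y}"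
    hence Z: "Z \<subseteq> {1..n}" "edge_constant D1 D2 (stack_label X Z Y)" using fits_stack by auto
    have same: "stack_label X Z Y x = stack_label X Z Y y" if "(x, y) \<in> ?c" for x y
     using that Z(2) conn by blast
    have "Lab (UU Z) (1, i) = stack_label X Z Y (1, i)" if i: "i \<in> {1..n}" for i
    proof (cases "ext (1, i)")
     case True
     then obtain a where a: "a \<in> points n" "(outer a, (1, i)) \<in> ?c" unfolding ext_def by blast
     have "Lab (UU Z) (1, i) = label X Y a" using Lab_const[OF a(2)] Lab_outer[OF a(1)] by simp
     also have "\<dots> = stack_label X Z Y (1, i)" using same[OF a(2)] by (simp only: stack_label_simps)
     finally show ?thesis .
    next
     case False
     hence "Cl (1, i) \<in> Loops" using ext_or_loop[OF i] by simp
     note L = this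
     have "Cl (1, i) \<in> UU Z \<longleftrightarrow> stack_label X Z Y (1, i)"
     proof
      assume "Cl (1, i) \<in> UU Z"
      then obtain j where j: "Cl (1, i) = Cl (1, j)" "stack_label X Z Y (1, j)" unfolding UU_def by blast
      hence "((1, i), (1, j)) \<in> ?c" using Cl_eq by blast
      from same[OF this] j(2) show "stack_label X Z Y (1, i)" by (simp only:)
     next
      assume "stack_label X Z Y (1, i)"
      thus "Cl (1, i) \<in> UU Z"
       unfolding UU_def using L i by (intro CollectI conjI bexI[of _ i]) simp_all
     qed
     thus ?thesis using False by (simp add: Lab_def)
    qed
    thus "ZZ (UU Z) = Z" unfolding ZZ_def using Z(1) by auto
   qed
   show "ZZ ` Pow Loops \<subseteq> {Z \<in> Pow {1..n}. fits D1 X Z \<and> fits D2 Z Y}"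
    unfolding fits_stack using edges by (auto simp: ZZ_def)
   show "UU ` {Z \<in> Pow {1..n}. fits D1 X Z \<and> fits D2 Z Y} \<subseteq> Pow Loops" by (auto simp: UU_def)
  qed
  hence "card {Z \<in> Pow {1..n}. fits D1 X Z \<and> fits D2 Z Y} = card (Pow Loops)"
   by (simp add: bij_betw_same_card)
  thus ?thesis using True fin loops by (simp add: card_Pow)
 qed
qed

definition rep :: "nat \<Rightarrow> (diagram \<Rightarrow> rat) \<Rightarrow> nat set \<Rightarrow> nat set \<Rightarrow> rat" where
 "rep n x X Y = (if X \<subseteq> {1..n} \<and> Y \<subseteq> {1..n}
   then theta X * theta Y * (\<Sum>D\<in>diagrams n. x D * of_bool (fits D X Y)) else 0)"

lemma rep_outside: "\<not> X \<subseteq> {1..n} \<Longrightarrow> rep n x X Y = 0" "\<not> Y \<subseteq> {1..n} \<Longrightarrow> rep n x X Y = 0"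
 by (auto simp: rep_def)

lemma TL_carrier: "x \<in> carrier (TL S n) \<longleftrightarrow> (\<forall>D\<in>diagrams n. x D \<in> S) \<and> (\<forall>D. D \<notin> diagrams n \<longrightarrow> x D = 0)"
 by (simp add: TL_def)

lemma TL_simps:
 "x \<otimes>\<^bsub>TL S n\<^esub> y = (\<lambda>D. \<Sum>D1\<in>diagrams n. \<Sum>D2\<in>diagrams n.
        if concat_diagram n D1 D2 = D then x D1 * y D2 * 2 ^ loops n D1 D2 else 0)"
 "\<one>\<^bsub>TL S n\<^esub> = delta (identity_diagram n)"
 "\<zero>\<^bsub>TL S n\<^esub> = (\<lambda>D. 0)"
 "x \<oplus>\<^bsub>TL S n\<^esub> y = (\<lambda>D. x D + y D)"
 "c \<odot>\<^bsub>TL S n\<^esub> x = (\<lambda>D. c * x D)"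
 by (simp_all add: TL_def)

lemma rep_add: "rep n (x \<oplus>\<^bsub>TLQ n\<^esub> y) X Y = rep n x X Y + rep n y X Y"
 by (simp add: rep_def TL_simps algebra_simps sum.distrib)

lemma rep_smult: "rep n (c \<odot>\<^bsub>TLQ n\<^esub> x) X Y = c * rep n x X Y"
 by (simp add: rep_def TL_simps algebra_simps sum_distrib_left)

lemma rep_zero: "rep n \<zero>\<^bsub>TLQ n\<^esub> X Y = 0"
 by (simp add: rep_def TL_simps)

text \<open>The two signs \<open>theta Z\<close> of the middle level cancel. What remains counts the
  labellings of the middle level, which is where the loop value 2 enters.\<close>

lemma rep_mult:
 "rep n (x \<otimes>\<^bsub>TLQ n\<^esub> y) X Y = (\<Sum>Z\<in>Pow {1..n}. rep n x X Z * rep n y Z Y)"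
proof (cases "X \<subseteq> {1..n} \<and> Y \<subseteq> {1..n}")
 case True
 let ?d = "diagrams n"
 have "(\<Sum>D\<in>?d. (x \<otimes>\<^bsub>TLQ n\<^esub> y) D * of_bool (fits D X Y)) =
  (\<Sum>D\<in>?d. \<Sum>D1\<in>?d. \<Sum>D2\<in>?d. if concat_diagram n D1 D2 = D
    then x D1 * y D2 * 2 ^ loops n D1 D2 * of_bool (fits D X Y) else 0)"
  unfolding TL_simps sum_distrib_right by (intro sum.cong refl) simp
 also have "\<dots> = (\<Sum>D1\<in>?d. \<Sum>D2\<in>?d. \<Sum>D\<in>?d. if concat_diagram n D1 D2 = D
    then x D1 * y D2 * 2 ^ loops n D1 D2 * of_bool (fits D X Y) else 0)"
  by (subst sum.swap, rule sum.cong[OF refl], rule sum.swap)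
 also have "\<dots> = (\<Sum>D1\<in>?d. \<Sum>D2\<in>?d. x D1 * y D2 * 2 ^ loops n D1 D2 * of_bool (fits (concat_diagram n D1 D2) X Y))"
  by (intro sum.cong refl) (simp add: sum.delta' concat_diagram_in_diagrams)
 also have "\<dots> = (\<Sum>D1\<in>?d. \<Sum>D2\<in>?d. \<Sum>Z\<in>Pow {1..n}. x D1 * y D2 * (of_bool (fits D1 X Z) * of_bool (fits D2 Z Y)))"
 proof (intro sum.cong refl)
  fix D1 D2 assume D: "D1 \<in> ?d" "D2 \<in> ?d"
  have "(2::rat) ^ loops n D1 D2 * of_bool (fits (concat_diagram n D1 D2) X Y) =
    of_nat (card {Z \<in> Pow {1..n}. fits D1 X Z \<and> fits D2 Z Y})"
   unfolding card_fits_stack[OF D] by simp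
  also have "\<dots> = (\<Sum>Z\<in>{Z \<in> Pow {1..n}. fits D1 X Z \<and> fits D2 Z Y}. 1)" by simp
  also have "\<dots> = (\<Sum>Z\<in>Pow {1..n}. of_bool (fits D1 X Z) * of_bool (fits D2 Z Y))"
   by (rule sum.mono_neutral_cong_left) auto
  finally have eq: "2 ^ loops n D1 D2 * of_bool (fits (concat_diagram n D1 D2) X Y) =
   (\<Sum>Z\<in>Pow {1..n}. of_bool (fits D1 X Z) * of_bool (fits D2 Z Y) :: rat)" .
  show "x D1 * y D2 * 2 ^ loops n D1 D2 * of_bool (fits (concat_diagram n D1 D2) X Y) =
   (\<Sum>Z\<in>Pow {1..n}. x D1 * y D2 * (of_bool (fits D1 X Z) * of_bool (fits D2 Z Y)))"
   unfolding mult.assoc[of "x D1 * y D2"] eq by (simp only: sum_distrib_left)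
 qed
 also have "\<dots> = (\<Sum>Z\<in>Pow {1..n}. \<Sum>D1\<in>?d. \<Sum>D2\<in>?d. x D1 * y D2 * (of_bool (fits D1 X Z) * of_bool (fits D2 Z Y)))"
  by (rule trans[OF sum.cong[OF refl sum.swap] sum.swap])
 also have "\<dots> = (\<Sum>Z\<in>Pow {1..n}. (\<Sum>D1\<in>?d. x D1 * of_bool (fits D1 X Z)) * (\<Sum>D2\<in>?d. y D2 * of_bool (fits D2 Z Y)))"
  by (intro sum.cong refl) (simp add: sum_product algebra_simps)
 finally have eq: "(\<Sum>D\<in>?d. (x \<otimes>\<^bsub>TLQ n\<^esub> y) D * of_bool (fits D X Y)) =
  (\<Sum>Z\<in>Pow {1..n}. (\<Sum>D1\<in>?d. x D1 * of_bool (fits D1 X Z)) * (\<Sum>D2\<in>?d. y D2 * of_bool (fits D2 Z Y)))" .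
 have "rep n (x \<otimes>\<^bsub>TLQ n\<^esub> y) X Y = theta X * theta Y * (\<Sum>D\<in>?d. (x \<otimes>\<^bsub>TLQ n\<^esub> y) D * of_bool (fits D X Y))"
  using True by (simp add: rep_def)
 also have "\<dots> = (\<Sum>Z\<in>Pow {1..n}. rep n x X Z * rep n y Z Y)"
  unfolding eq
 proof (subst sum_distrib_left, rule sum.cong[OF refl])
  fix Z assume "Z \<in> Pow {1..n}"
  hence "rep n x X Z * rep n y Z Y = (theta Z * theta Z) * (theta X * theta Y *
   ((\<Sum>D1\<in>?d. x D1 * of_bool (fits D1 X Z)) * (\<Sum>D2\<in>?d. y D2 * of_bool (fits D2 Z Y))))"
   using True by (simp only: rep_def if_True Pow_iff simp_thms mult_ac)
  thus "theta X * theta Y * ((\<Sum>D1\<in>?d. x D1 * of_bool (fits D1 X Z)) * (\<Sum>D2\<in>?d. y D2 * of_bool (fits D2 Z Y))) =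
   rep n x X Z * rep n y Z Y"
   by simp
 qed
 finally show ?thesis .
next
 case False
 thus ?thesis by (cases "X \<subseteq> {1..n}") (simp_all add: rep_outside)
qed

section \<open>Faithfulness: recovering a diagram from the opening ends of its arcs\<close>

lemma nc_involution_unique_aux:
 assumes nc: "nc_involution P pos m" and nc': "nc_involution P pos m'"
  and op: "\<And>p. p \<in> P \<Longrightarrow> pos p < pos (m p) \<longleftrightarrow> pos p < pos (m' p)"
  and c: "c \<in> P" "\<not> pos c < pos (m c)"
  and IH: "\<And>d. d \<in> P \<Longrightarrow> \<not> pos d < pos (m d) \<Longrightarrow> pos d < pos c \<Longrightarrow> m d = m' d"
  and lt: "pos (m c) < pos (m' c)"
 shows False
proof -
 have inj: "inj_on pos P" using nc by (simp add: nc_involution_def)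
 have inv: "m x \<in> P" "m x \<noteq> x" "m (m x) = x" if "x \<in> P" for x
  using nc that unfolding nc_involution_def by blast+
 have inv': "m' x \<in> P" "m' x \<noteq> x" "m' (m' x) = x" if "x \<in> P" for x
  using nc' that unfolding nc_involution_def by blast+
 have ncr: "\<not> (pos a < pos b \<and> pos b < pos (m a) \<and> pos (m a) < pos (m b))" if "a \<in> P" "b \<in> P" for a b
  using nc that unfolding nc_involution_def by blast
 have neq: "pos x \<noteq> pos y" if "x \<in> P" "y \<in> P" "x \<noteq> y" for x y
  using inj that by (auto dest: inj_onD)
 define a' where "a' = m' c"
 have a': "a' \<in> P" "m' a' = c" "a' \<noteq> c" using inv'[OF c(1)] by (simp_all add: a'_def)
 have "\<not> pos c < pos a'" using op[OF c(1)] c(2) by (simp add: a'_def)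
 hence a'c: "pos a' < pos c" using neq[OF a'(1) c(1) a'(3)] by simp
 hence opn: "pos a' < pos (m a')" using op[OF a'(1)] a'(2) by simp
 have ne: "m a' \<noteq> c" using lt inv(3)[OF a'(1)] by (auto simp: a'_def)
 have mma: "m (m a') = a'" "m (m c) = c" using inv a' c by auto
 have "\<not> pos c < pos (m a')" using ncr[OF inv(1)[OF c(1)] a'(1)] lt a'c mma by (simp add: a'_def)
 hence less: "pos (m a') < pos c" using neq[OF inv(1)[OF a'(1)] c(1) ne] by simp
 have "m (m a') = m' (m a')"
  by (rule IH[OF inv(1)[OF a'(1)] _ less]) (use mma opn in simp)
 hence "m' a' = m a'" using mma inv'(3)[OF inv(1)[OF a'(1)]] by simp
 thus False using a'(2) ne by simp
qed

text \<open>A bracket word determines its matching. Proceed through the closing points from left to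
  right and suppose \<open>m c\<close> lies before \<open>m' c\<close>. The point
  \<open>m' c\<close> opens an arc of \<open>m\<close> which, by non-crossing, ends before
  \<open>c\<close>; there both matchings agree by induction, contradicting that \<open>m'\<close>
  joins this point to \<open>c\<close>.\<close>

lemma nc_involution_unique:
 assumes nc: "nc_involution P pos m" and nc': "nc_involution P pos m'"
  and op: "\<And>p. p \<in> P \<Longrightarrow> pos p < pos (m p) \<longleftrightarrow> pos p < pos (m' p)"
  and x: "x \<in> P"
 shows "m x = m' x"
proof -
 have inj: "inj_on pos P" using nc by (simp add: nc_involution_def)
 have inv: "m x \<in> P" "m x \<noteq> x" "m (m x) = x" if "x \<in> P" for x
  using nc that unfolding nc_involution_def by blast+
 have inv': "m' x \<in> P" "m' x \<noteq> x" "m' (m' x) = x" if "x \<in> P" for x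
  using nc' that unfolding nc_involution_def by blast+
 have closer: "c \<in> P \<Longrightarrow> \<not> pos c < pos (m c) \<Longrightarrow> m c = m' c" for c
 proof (induction "pos c" arbitrary: c rule: less_induct)
  case less
  have IH: "m d = m' d" if "d \<in> P" "\<not> pos d < pos (m d)" "pos d < pos c" for d
   using less.hyps[OF that(3,1,2)] .
  have IH': "m' d = m d" if "d \<in> P" "\<not> pos d < pos (m' d)" "pos d < pos c" for d
   using IH[OF that(1) _ that(3)] op[OF that(1)] that(2) by simp
  have "\<not> pos (m c) < pos (m' c)"
   using nc_involution_unique_aux[OF nc nc' op less.prems IH] by blast
  moreover have "\<not> pos (m' c) < pos (m c)"
   using nc_involution_unique_aux[OF nc' nc op[symmetric] less.prems(1) _ IH'] less.prems op[OF less.prems(1)] by blast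
  ultimately have "pos (m c) = pos (m' c)" by simp
  thus ?case using inj inv(1) inv'(1) less.prems(1) by (auto dest: inj_onD)
 qed
 show ?thesis
 proof (cases "pos x < pos (m x)")
  case True
  hence "m (m x) = m' (m x)" using inv[OF x] by (intro closer) auto
  hence "m' (m' (m x)) = m' x" using inv[OF x] by simp
  thus ?thesis using inv'(3)[OF inv(1)[OF x]] by simp
 qed (use closer x in blast)
qed

lemma boundary_pos_image: "boundary_pos n ` points n = {1..2 * n}"
proof (intro equalityI subsetI)
 fix k assume k: "k \<in> {1..2 * n}"
 show "k \<in> boundary_pos n ` points n"
 proof (cases "k \<le> n")
  case True
  thus ?thesis using k by (intro image_eqI[of _ _ "Top k"]) auto
 next
  case False
  thus ?thesis using k by (intro image_eqI[of _ _ "Bot (2 * n + 1 - k)"]) auto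
 qed
qed (auto simp: points_def)

text \<open>The points strictly below an arc are matched among themselves, so their number is even.\<close>

lemma mate_parity:
 assumes D: "D \<in> diagrams n" and p: "p \<in> points n"
 shows "even (boundary_pos n (mate D p)) \<longleftrightarrow> odd (boundary_pos n p)"
proof -
 let ?b = "boundary_pos n" and ?m = "mate D"
 note mp = mate_props[OF D]
 have main: "even (?b (?m p)) \<longleftrightarrow> odd (?b p)" if p: "p \<in> points n" and lt: "?b p < ?b (?m p)" for p
 proof -
  define I where "I = {q \<in> points n. ?b p < ?b q \<and> ?b q < ?b (?m p)}"
  define I1 where "I1 = {q \<in> I. ?b q < ?b (?m q)}"
  have nc: "\<not> (?b a < ?b b \<and> ?b b < ?b (?m a) \<and> ?b (?m a) < ?b (?m b))" if "a \<in> points n" "b \<in> points n" for a b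
   using nc_involution_mate[OF D] that unfolding nc_involution_def by blast
  have neq: "?b u \<noteq> ?b v" if "u \<in> points n" "v \<in> points n" "u \<noteq> v" for u v
   using inj_on_boundary_pos that by (auto dest: inj_onD)
  have mI: "?m q \<in> I" if "q \<in> I" for q
  proof -
   have q: "q \<in> points n" "?b p < ?b q" "?b q < ?b (?m p)" using that by (auto simp: I_def)
   have "q \<noteq> p" "q \<noteq> ?m p" using q by auto
   hence "?m q \<noteq> p" "?m q \<noteq> ?m p" using mp q(1) p by metis+
   hence "?b (?m q) \<noteq> ?b p" "?b (?m q) \<noteq> ?b (?m p)" using neq mp(1) q(1) p by blast+
   moreover have "\<not> ?b (?m p) < ?b (?m q)" using nc[OF p q(1)] q by simp
   moreover have "\<not> ?b (?m q) < ?b p"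
    using nc[OF mp(1)[OF q(1)] p] q mp(3)[OF q(1)] by auto
   ultimately show ?thesis using mp(1)[OF q(1)] by (auto simp: I_def)
  qed
  have Ip: "I \<subseteq> points n" by (auto simp: I_def)
  have finI: "finite I" using Ip finite_points finite_subset by blast
  have un: "I = I1 \<union> ?m ` I1"
  proof (intro equalityI subsetI)
   fix q assume q: "q \<in> I"
   hence qp: "q \<in> points n" using Ip by blast
   show "q \<in> I1 \<union> ?m ` I1"
   proof (cases "?b q < ?b (?m q)")
    case True
    thus ?thesis using q by (simp add: I1_def)
   next
    case False
    hence "?b (?m q) < ?b q" using neq[OF mp(1)[OF qp] qp mp(2)[OF qp]] by simp
    hence "?m q \<in> I1" using mI[OF q] mp(3)[OF qp] by (simp add: I1_def)
    thus ?thesis using mp(3)[OF qp] by (metis UnCI image_eqI)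
   qed
  next
   fix q assume "q \<in> I1 \<union> ?m ` I1"
   thus "q \<in> I" using mI by (auto simp: I1_def)
  qed
  have disj: "I1 \<inter> ?m ` I1 = {}"
  proof (rule ccontr)
   assume "I1 \<inter> ?m ` I1 \<noteq> {}"
   then obtain q where q: "q \<in> I1" "?m q \<in> I1" by auto
   hence "q \<in> points n" using Ip by (auto simp: I1_def)
   thus False using q mp(3)[of q] by (simp add: I1_def)
  qed
  have inj1: "inj_on ?m I1"
   by (rule inj_on_inverseI[of _ ?m]) (use mp(3) Ip in \<open>auto simp: I1_def\<close>)
  have "card I = card I1 + card (?m ` I1)"
   using un disj finI by (metis card_Un_disjoint finite_Un)
  hence evI: "even (card I)" using card_image[OF inj1] by simp
  have "?b ` I = {?b p<..<?b (?m p)}"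
  proof (intro equalityI subsetI)
   fix k assume k: "k \<in> {?b p<..<?b (?m p)}"
   moreover have "?b p \<in> {1..2 * n}" "?b (?m p) \<in> {1..2 * n}"
    using boundary_pos_image p mp(1)[OF p] by blast+
   ultimately have "k \<in> ?b ` points n" unfolding boundary_pos_image by auto
   thus "k \<in> ?b ` I" using k by (auto simp: I_def)
  qed (auto simp: I_def)
  moreover have "inj_on ?b I" using inj_on_boundary_pos Ip inj_on_subset by blast
  ultimately have "card I = ?b (?m p) - ?b p - 1" using card_image[of ?b I] by simp
  hence "?b (?m p) = card I + 1 + ?b p" using lt by simp
  thus ?thesis using evI by simp
 qed
 show ?thesis
 proof (cases "?b p < ?b (?m p)")
  case True
  thus ?thesis using main p by blast
 next
  case False
  hence "?b (?m p) < ?b p"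
   using inj_on_boundary_pos[of n] mp(1,2)[OF p] p by (metis inj_onD linorder_neqE_nat)
  thus ?thesis using main[OF mp(1)[OF p]] mp(3)[OF p] by auto
 qed
qed

text \<open>The labelling by the points of \<open>X\<close> on top and of \<open>Y\<close> at the bottom fits a diagram iff
 \<open>selection n X Y\<close> contains exactly one end of every arc.\<close>

definition selection :: "nat \<Rightarrow> nat set \<Rightarrow> nat set \<Rightarrow> point set" where
 "selection n X Y = Top ` X \<union> Bot ` ({1..n} - Y)"

lemma label_selection:
 assumes "p \<in> points n"
 shows "label X Y p \<longleftrightarrow> (p \<in> selection n X Y) \<noteq> even (boundary_pos n p)"
 using assms by (cases p) (auto simp: selection_def)

lemma fits_selection:
 assumes D: "D \<in> diagrams n"
 shows "fits D X Y \<longleftrightarrow> (\<forall>p\<in>points n. p \<in> selection n X Y \<longleftrightarrow> mate D p \<notin> selection n X Y)"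
proof -
 have "fits D X Y \<longleftrightarrow> (\<forall>p\<in>points n. label X Y p = label X Y (mate D p))"
  unfolding fits_def edge_iff_mate[OF D] by auto
 also have "\<dots> \<longleftrightarrow> (\<forall>p\<in>points n. p \<in> selection n X Y \<longleftrightarrow> mate D p \<notin> selection n X Y)"
 proof (intro ball_cong refl)
  fix p assume p: "p \<in> points n"
  show "(label X Y p = label X Y (mate D p)) \<longleftrightarrow> (p \<in> selection n X Y \<longleftrightarrow> mate D p \<notin> selection n X Y)"
   unfolding label_selection[OF p] label_selection[OF mate_props(1)[OF D p]] mate_parity[OF D p] by blast
 qed
 finally show ?thesis .
qed

definition openers :: "nat \<Rightarrow> diagram \<Rightarrow> point set" where
 "openers n D = {p \<in> points n. boundary_pos n p < boundary_pos n (mate D p)}"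

lemma openers_unique:
 assumes D: "D \<in> diagrams n" "D' \<in> diagrams n" and op: "openers n D = openers n D'"
 shows "D = D'"
proof -
 have "mate D x = mate D' x" if "x \<in> points n" for x
  by (rule nc_involution_unique[OF nc_involution_mate[OF D(1)] nc_involution_mate[OF D(2)] _ that])
    (use op in \<open>auto simp: openers_def set_eq_iff\<close>)
 thus ?thesis using diagram_eq_mates[OF D(1)] diagram_eq_mates[OF D(2)] by simp
qed

text \<open>Among all choices of one end from every arc, the earlier ends minimise the sum of the
  positions, and they are the only minimiser.\<close>

lemma transversal_openers:
 assumes D: "D \<in> diagrams n" and S: "S \<subseteq> points n"
  and tr: "\<And>p. p \<in> points n \<Longrightarrow> p \<in> S \<longleftrightarrow> mate D p \<notin> S"
  and le: "(\<Sum>p\<in>S. boundary_pos n p) \<le> (\<Sum>p\<in>openers n D. boundary_pos n p)"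
 shows "S = openers n D"
proof -
 let ?b = "boundary_pos n" and ?m = "mate D" and ?O = "openers n D"
 note mp = mate_props[OF D]
 have O: "?O \<subseteq> points n" by (auto simp: openers_def)
 have fin: "finite S" "finite ?O" using S O finite_points finite_subset by blast+
 have neg: "q \<notin> ?O \<longleftrightarrow> ?m q \<in> ?O" if q: "q \<in> points n" for q
 proof -
  have "?b q \<noteq> ?b (?m q)" using inj_on_boundary_pos mp(1,2)[OF q] q by (metis inj_onD)
  thus ?thesis using mp[OF q] q by (auto simp: openers_def)
 qed
 have bij: "bij_betw ?m (?O - S) (S - ?O)"
 proof (rule bij_betw_byWitness[where f' = ?m])
  show "?m ` (?O - S) \<subseteq> S - ?O"
  proof
   fix y assume "y \<in> ?m ` (?O - S)"
   then obtain x where x: "x \<in> ?O" "x \<notin> S" "y = ?m x" by blast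
   hence xp: "x \<in> points n" using O by blast
   have "y \<in> S" using tr[OF xp] x by simp
   moreover have "y \<notin> ?O" using neg[OF mp(1)[OF xp]] mp(3)[OF xp] x by simp
   ultimately show "y \<in> S - ?O" by simp
  qed
  show "?m ` (S - ?O) \<subseteq> ?O - S"
  proof
   fix y assume "y \<in> ?m ` (S - ?O)"
   then obtain x where x: "x \<in> S" "x \<notin> ?O" "y = ?m x" by blast
   hence xp: "x \<in> points n" using S by blast
   show "y \<in> ?O - S" using tr[OF xp] neg[OF xp] x by simp
  qed
 qed (use mp(3) O S in blast)+
 have "(\<Sum>p\<in>S. ?b p) = (\<Sum>p\<in>S \<inter> ?O. ?b p) + (\<Sum>p\<in>S - ?O. ?b p)"
  using fin by (simp add: sum.Int_Diff)
 also have "(\<Sum>p\<in>S - ?O. ?b p) = (\<Sum>q\<in>?O - S. ?b (?m q))"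
  using sum.reindex_bij_betw[OF bij, of ?b] by simp
 finally have 1: "(\<Sum>p\<in>S. ?b p) = (\<Sum>p\<in>S \<inter> ?O. ?b p) + (\<Sum>q\<in>?O - S. ?b (?m q))" .
 have 2: "(\<Sum>p\<in>?O. ?b p) = (\<Sum>p\<in>S \<inter> ?O. ?b p) + (\<Sum>q\<in>?O - S. ?b q)"
  using fin by (simp add: sum.Int_Diff[of ?O _ S] Int_commute)
 have "?O - S = {}"
 proof (rule ccontr)
  assume ne: "?O - S \<noteq> {}"
  have "(\<Sum>q\<in>?O - S. ?b q) < (\<Sum>q\<in>?O - S. ?b (?m q))"
   using ne fin by (intro sum_strict_mono) (auto simp: openers_def)
  thus False using 1 2 le by simp
 qed
 moreover have "S - ?O = ?m ` (?O - S)" using bij by (simp add: bij_betw_def)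
 ultimately show ?thesis by blast
qed

text \<open>Triangularity. Take a diagram of nonzero coefficient whose openers have the least total
  position and look at the entry selected by these openers. A diagram fitting this entry has them as
  a transversal, so its own openers are at most as heavy; if its coefficient is nonzero, minimality
  makes the openers equal, and then the diagrams coincide.\<close>

lemma rep_injective_zero:
 assumes z: "\<And>X Y. rep n x X Y = 0" and D: "D \<in> diagrams n"
 shows "x D = 0"
proof (rule ccontr)
 let ?w = "\<lambda>D. \<Sum>p\<in>openers n D. boundary_pos n p"
 assume "x D \<noteq> 0"
 hence "\<exists>D. D \<in> diagrams n \<and> x D \<noteq> 0" using D by blast
 then obtain D0 where D0: "D0 \<in> diagrams n" "x D0 \<noteq> 0"
  and least: "\<And>D. D \<in> diagrams n \<Longrightarrow> x D \<noteq> 0 \<Longrightarrow> ?w D0 \<le> ?w D"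
  using ex_has_least_nat[of "\<lambda>D. D \<in> diagrams n \<and> x D \<noteq> 0" _ ?w] by blast
 define X where "X = {i. Top i \<in> openers n D0}"
 define Y where "Y = {j \<in> {1..n}. Bot j \<notin> openers n D0}"
 have XY: "X \<subseteq> {1..n}" "Y \<subseteq> {1..n}" by (auto simp: X_def Y_def openers_def)
 have sub: "openers n D0 \<subseteq> points n" by (auto simp: openers_def)
 have sel: "selection n X Y = openers n D0"
 proof (rule Set.set_eqI)
  fix p show "p \<in> selection n X Y \<longleftrightarrow> p \<in> openers n D0"
   using sub by (cases p) (auto simp: selection_def X_def Y_def)
 qed
 have "fits D0 X Y"
  unfolding fits_selection[OF D0(1)] sel
 proof
  fix p assume p: "p \<in> points n"
  have "boundary_pos n p \<noteq> boundary_pos n (mate D0 p)"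
   using inj_on_boundary_pos mate_props(1,2)[OF D0(1) p] p by (metis inj_onD)
  thus "p \<in> openers n D0 \<longleftrightarrow> mate D0 p \<notin> openers n D0"
   using mate_props[OF D0(1) p] p by (auto simp: openers_def)
 qed
 moreover have "x D' * of_bool (fits D' X Y) = 0" if "D' \<in> diagrams n - {D0}" for D'
 proof (rule ccontr)
  assume "x D' * of_bool (fits D' X Y) \<noteq> 0"
  hence f: "fits D' X Y" "x D' \<noteq> 0" by auto
  have D': "D' \<in> diagrams n" "D' \<noteq> D0" using that by auto
  have "openers n D0 = openers n D'"
   by (rule transversal_openers[OF D'(1) sub])
     (use f(1)[unfolded fits_selection[OF D'(1)] sel] least[OF D'(1) f(2)] in auto)
  thus False using openers_unique[OF D0(1) D'(1)] D'(2) by simp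
 qed
 hence "(\<Sum>D\<in>diagrams n - {D0}. x D * of_bool (fits D X Y)) = 0" by (rule sum.neutral[rule_format])
 ultimately have "(\<Sum>D\<in>diagrams n. x D * of_bool (fits D X Y)) = x D0"
  using sum.remove[OF finite_diagrams D0(1), of "\<lambda>D. x D * of_bool (fits D X Y)"] by simp
 moreover have "theta X * theta Y \<noteq> 0" by (simp add: theta_def)
 ultimately show False using z[of X Y] XY D0(2) by (simp add: rep_def)
qed

lemma rep_faithful:
 assumes x: "x \<in> carrier (TLQ n)" and y: "y \<in> carrier (TLQ n)"
  and eq: "\<And>X Y. X \<subseteq> {1..n} \<Longrightarrow> Y \<subseteq> {1..n} \<Longrightarrow> rep n x X Y = rep n y X Y"
 shows "x = y"
proof
 fix D
 show "x D = y D"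
 proof (cases "D \<in> diagrams n")
  case True
  have "rep n (\<lambda>D. x D - y D) X Y = rep n x X Y - rep n y X Y" for X Y
   by (simp add: rep_def algebra_simps sum_subtractf)
  moreover have "rep n x X Y = rep n y X Y" for X Y
   using eq[of X Y] by (cases "X \<subseteq> {1..n}"; cases "Y \<subseteq> {1..n}") (simp_all add: rep_outside)
  ultimately have "rep n (\<lambda>D. x D - y D) X Y = 0" for X Y by (metis diff_self)
  from rep_injective_zero[OF this True] show ?thesis by simp
 next
  case False
  hence "x D = 0" "y D = 0" using x y unfolding TL_carrier by blast+
  thus ?thesis by simp
 qed
qed

section \<open>The ring structure\<close>

lemma TL_mult_closed:
 assumes "x \<in> carrier (TLQ n)" "y \<in> carrier (TLQ n)"
 shows "x \<otimes>\<^bsub>TLQ n\<^esub> y \<in> carrier (TLQ n)"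
 unfolding TL_carrier
proof (intro conjI ballI allI impI UNIV_I)
 fix D assume D: "D \<notin> diagrams n"
 show "(x \<otimes>\<^bsub>TLQ n\<^esub> y) D = 0" unfolding TL_simps
 proof (intro sum.neutral ballI)
  fix D1 D2 assume "D1 \<in> diagrams n" "D2 \<in> diagrams n"
  hence "concat_diagram n D1 D2 \<noteq> D" using D concat_diagram_in_diagrams by blast
  thus "(if concat_diagram n D1 D2 = D then x D1 * y D2 * 2 ^ loops n D1 D2 else 0) = 0" by simp
 qed
qed

lemma fits_involution:
 assumes "\<And>x. x \<in> points n \<Longrightarrow> m x \<in> points n \<and> m (m x) = x"
 shows "fits ((\<lambda>x. {x, m x}) ` points n) X Y \<longleftrightarrow> (\<forall>x\<in>points n. label X Y (m x) = label X Y x)"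
proof
 assume f: "fits ((\<lambda>x. {x, m x}) ` points n) X Y"
 show "\<forall>x\<in>points n. label X Y (m x) = label X Y x"
 proof
  fix x assume "x \<in> points n"
  hence "{x, m x} \<in> (\<lambda>x. {x, m x}) ` points n" by (rule imageI)
  thus "label X Y (m x) = label X Y x" using f unfolding fits_def by blast
 qed
next
 assume f: "\<forall>x\<in>points n. label X Y (m x) = label X Y x"
 show "fits ((\<lambda>x. {x, m x}) ` points n) X Y" unfolding fits_def
 proof (intro allI impI)
  fix a b assume "{a, b} \<in> (\<lambda>x. {x, m x}) ` points n"
  then obtain x where x: "x \<in> points n" "{a, b} = {x, m x}" by blast
  hence "a = x \<and> b = m x \<or> a = m x \<and> b = x" by (simp add: doubleton_eq_iff)
  moreover have "label X Y (m x) = label X Y x" using f x(1) by blast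
  ultimately show "label X Y a = label X Y b" by (elim disjE conjE) simp_all
 qed
qed

fun flip :: "point \<Rightarrow> point" where
 "flip (Top i) = Bot i"
| "flip (Bot i) = Top i"

lemma identity_diagram_image: "identity_diagram n = (\<lambda>x. {x, flip x}) ` points n"
 by (auto simp: identity_diagram_def points_def image_iff Bex_def insert_commute)

lemma identity_diagram_in_diagrams: "identity_diagram n \<in> diagrams n"
 unfolding identity_diagram_image
proof (rule diagram_of_involution, unfold nc_involution_def, intro conjI ballI inj_on_boundary_pos)
 fix x assume "x \<in> points n"
 thus "flip x \<in> points n" "flip x \<noteq> x" "flip (flip x) = x" by (cases x; simp)+
next
 fix a b assume "a \<in> points n" "b \<in> points n"
 thus "\<not> (boundary_pos n a < boundary_pos n b \<and> boundary_pos n b < boundary_pos n (flip a) \<and>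
   boundary_pos n (flip a) < boundary_pos n (flip b))"
  by (cases a; cases b) auto
qed

lemma fits_identity:
 assumes "X \<subseteq> {1..n}" "Y \<subseteq> {1..n}"
 shows "fits (identity_diagram n) X Y \<longleftrightarrow> X = Y"
proof -
 have "fits (identity_diagram n) X Y \<longleftrightarrow> (\<forall>x\<in>points n. label X Y (flip x) = label X Y x)"
  unfolding identity_diagram_image
 proof (rule fits_involution)
  fix x assume "x \<in> points n"
  thus "flip x \<in> points n \<and> flip (flip x) = x" by (cases x) simp_all
 qed
 also have "\<dots> \<longleftrightarrow> (\<forall>j\<in>{1..n}. j \<in> X \<longleftrightarrow> j \<in> Y)"
  unfolding points_def ball_Un ball_simps by auto
 also have "\<dots> \<longleftrightarrow> X = Y" using assms by blast
 finally show ?thesis .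
qed

lemma delta_in_carrier: "D \<in> diagrams n \<Longrightarrow> delta D \<in> carrier (TLQ n)"
 by (auto simp: TL_carrier delta_def)

lemma rep_delta:
 assumes "D \<in> diagrams n" "X \<subseteq> {1..n}" "Y \<subseteq> {1..n}"
 shows "rep n (delta D) X Y = theta X * theta Y * of_bool (fits D X Y)"
proof -
 have "(\<Sum>D'\<in>diagrams n. delta D D' * of_bool (fits D' X Y)) =
   (\<Sum>D'\<in>diagrams n. if D' = D then of_bool (fits D X Y) else 0)"
  by (intro sum.cong) (simp_all add: delta_def)
 thus ?thesis using assms by (simp add: rep_def)
qed

lemma rep_one: "rep n \<one>\<^bsub>TLQ n\<^esub> X Y = of_bool (X = Y \<and> X \<subseteq> {1..n})"
proof (cases "X \<subseteq> {1..n} \<and> Y \<subseteq> {1..n}")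
 case True
 thus ?thesis
  by (simp only: TL_simps rep_delta[OF identity_diagram_in_diagrams] fits_identity) auto
next
 case False
 thus ?thesis by (cases "X \<subseteq> {1..n}") (auto simp: rep_outside)
qed

lemma rep_one_mult:
 "(\<Sum>Z\<in>Pow {1..n}. rep n \<one>\<^bsub>TLQ n\<^esub> X Z * rep n x Z Y) = rep n x X Y"
proof -
 have "(\<Sum>Z\<in>Pow {1..n}. rep n \<one>\<^bsub>TLQ n\<^esub> X Z * rep n x Z Y) = (\<Sum>Z\<in>Pow {1..n}. if Z = X then rep n x X Y else 0)"
  by (intro sum.cong) (auto simp: rep_one)
 thus ?thesis by (auto simp: rep_outside)
qed

lemma rep_mult_one:
 "(\<Sum>Z\<in>Pow {1..n}. rep n x X Z * rep n \<one>\<^bsub>TLQ n\<^esub> Z Y) = rep n x X Y"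
proof -
 have "(\<Sum>Z\<in>Pow {1..n}. rep n x X Z * rep n \<one>\<^bsub>TLQ n\<^esub> Z Y) = (\<Sum>Z\<in>Pow {1..n}. if Z = Y then rep n x X Y else 0)"
  by (intro sum.cong) (auto simp: rep_one)
 thus ?thesis by (auto simp: rep_outside)
qed

lemma abelian_group_TLQ: "abelian_group (TLQ n)"
proof (rule abelian_groupI)
 fix x assume x: "x \<in> carrier (TLQ n)"
 show "\<exists>y\<in>carrier (TLQ n). y \<oplus>\<^bsub>TLQ n\<^esub> x = \<zero>\<^bsub>TLQ n\<^esub>"
  by (rule bexI[of _ "\<lambda>D. - x D"]) (use x in \<open>simp_all add: TL_simps TL_carrier\<close>)
qed (simp_all add: TL_simps TL_carrier add_ac)

lemma one_in_carrier: "\<one>\<^bsub>TLQ n\<^esub> \<in> carrier (TLQ n)"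
 unfolding TL_simps by (rule delta_in_carrier[OF identity_diagram_in_diagrams])

text \<open>Associativity, unit laws and distributivity hold for the matrices \<open>rep\<close> and
  come back through faithfulness; stacks of three diagrams are never analysed.\<close>

lemma ring_TLQ: "ring (TLQ n)"
proof (rule ringI[OF abelian_group_TLQ])
 interpret abelian_group "TLQ n" by (rule abelian_group_TLQ)
 show "monoid (TLQ n)"
 proof (rule monoidI)
  fix x y z assume xyz: "x \<in> carrier (TLQ n)" "y \<in> carrier (TLQ n)" "z \<in> carrier (TLQ n)"
  show "x \<otimes>\<^bsub>TLQ n\<^esub> y \<otimes>\<^bsub>TLQ n\<^esub> z = x \<otimes>\<^bsub>TLQ n\<^esub> (y \<otimes>\<^bsub>TLQ n\<^esub> z)"
  proof (rule rep_faithful)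
   fix X Y
   have "rep n (x \<otimes>\<^bsub>TLQ n\<^esub> y \<otimes>\<^bsub>TLQ n\<^esub> z) X Y =
    (\<Sum>Z\<in>Pow {1..n}. \<Sum>W\<in>Pow {1..n}. rep n x X W * rep n y W Z * rep n z Z Y)"
    unfolding rep_mult sum_distrib_right ..
   also have "\<dots> = (\<Sum>W\<in>Pow {1..n}. \<Sum>Z\<in>Pow {1..n}. rep n x X W * rep n y W Z * rep n z Z Y)"
    by (rule sum.swap)
   also have "\<dots> = rep n (x \<otimes>\<^bsub>TLQ n\<^esub> (y \<otimes>\<^bsub>TLQ n\<^esub> z)) X Y"
    unfolding rep_mult sum_distrib_left mult.assoc ..
   finally show "rep n (x \<otimes>\<^bsub>TLQ n\<^esub> y \<otimes>\<^bsub>TLQ n\<^esub> z) X Y = rep n (x \<otimes>\<^bsub>TLQ n\<^esub> (y \<otimes>\<^bsub>TLQ n\<^esub> z)) X Y" .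
  qed (intro TL_mult_closed xyz)+
 next
  fix x assume x: "x \<in> carrier (TLQ n)"
  show "\<one>\<^bsub>TLQ n\<^esub> \<otimes>\<^bsub>TLQ n\<^esub> x = x"
   by (rule rep_faithful[OF TL_mult_closed[OF one_in_carrier x] x]) (simp only: rep_mult rep_one_mult)
  show "x \<otimes>\<^bsub>TLQ n\<^esub> \<one>\<^bsub>TLQ n\<^esub> = x"
   by (rule rep_faithful[OF TL_mult_closed[OF x one_in_carrier] x]) (simp only: rep_mult rep_mult_one)
 qed (intro one_in_carrier TL_mult_closed; assumption)+
 fix x y z assume xyz: "x \<in> carrier (TLQ n)" "y \<in> carrier (TLQ n)" "z \<in> carrier (TLQ n)"
 show "(x \<oplus>\<^bsub>TLQ n\<^esub> y) \<otimes>\<^bsub>TLQ n\<^esub> z = x \<otimes>\<^bsub>TLQ n\<^esub> z \<oplus>\<^bsub>TLQ n\<^esub> y \<otimes>\<^bsub>TLQ n\<^esub> z"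
  by (rule rep_faithful[OF TL_mult_closed[OF a_closed[OF xyz(1,2)] xyz(3)]
     a_closed[OF TL_mult_closed[OF xyz(1,3)] TL_mult_closed[OF xyz(2,3)]]])
    (simp only: rep_mult rep_add distrib_right sum.distrib)
 show "z \<otimes>\<^bsub>TLQ n\<^esub> (x \<oplus>\<^bsub>TLQ n\<^esub> y) = z \<otimes>\<^bsub>TLQ n\<^esub> x \<oplus>\<^bsub>TLQ n\<^esub> z \<otimes>\<^bsub>TLQ n\<^esub> y"
  by (rule rep_faithful[OF TL_mult_closed[OF xyz(3) a_closed[OF xyz(1,2)]]
     a_closed[OF TL_mult_closed[OF xyz(3,1)] TL_mult_closed[OF xyz(3,2)]]])
    (simp only: rep_mult rep_add distrib_left sum.distrib)
qed

interpretation TL: ring "TLQ n" for n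
 by (rule ring_TLQ)

lemma TL_minus:
 assumes "x \<in> carrier (TLQ n)" "y \<in> carrier (TLQ n)"
 shows "x \<ominus>\<^bsub>TLQ n\<^esub> y = (\<lambda>D. x D - y D)"
proof -
 have c: "(\<lambda>D. - y D) \<in> carrier (TLQ n)" using assms by (simp add: TL_carrier)
 have "\<ominus>\<^bsub>TLQ n\<^esub> y = (\<lambda>D. - y D)"
  by (rule TL.minus_equality[OF _ assms(2) c]) (simp add: TL_simps)
 thus ?thesis by (simp add: a_minus_def TL_simps)
qed

lemma rep_minus:
 assumes "x \<in> carrier (TLQ n)" "y \<in> carrier (TLQ n)"
 shows "rep n (x \<ominus>\<^bsub>TLQ n\<^esub> y) X Y = rep n x X Y - rep n y X Y"
 unfolding TL_minus[OF assms] by (simp add: rep_def algebra_simps sum_subtractf)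

lemma smult_closed: "x \<in> carrier (TLQ n) \<Longrightarrow> c \<odot>\<^bsub>TLQ n\<^esub> x \<in> carrier (TLQ n)"
 by (simp add: TL_carrier TL_simps)

section \<open>The action of the symmetric group\<close>

fun u_mate :: "nat \<Rightarrow> point \<Rightarrow> point" where
 "u_mate i (Top j) = (if j = i then Top (i + 1) else if j = i + 1 then Top i else Bot j)"
| "u_mate i (Bot j) = (if j = i then Bot (i + 1) else if j = i + 1 then Bot i else Top j)"

lemma u_diagram_image:
 assumes i: "i \<in> {1..<n}"
 shows "u_diagram n i = (\<lambda>x. {x, u_mate i x}) ` points n"
proof (intro equalityI subsetI)
 fix B assume "B \<in> u_diagram n i"
 then consider "B = {Top i, Top (i + 1)}" | "B = {Bot i, Bot (i + 1)}"
  | j where "B = {Top j, Bot j}" "j \<in> {1..n} - {i, i + 1}"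
  unfolding u_diagram_def by blast
 thus "B \<in> (\<lambda>x. {x, u_mate i x}) ` points n"
 proof cases
  case 1
  thus ?thesis using i by (intro image_eqI[of _ _ "Top i"]) simp_all
 next
  case 2
  thus ?thesis using i by (intro image_eqI[of _ _ "Bot i"]) simp_all
 next
  case 3
  thus ?thesis using i by (intro image_eqI[of _ _ "Top j"]) simp_all
 qed
next
 fix B assume "B \<in> (\<lambda>x. {x, u_mate i x}) ` points n"
 then obtain x where x: "x \<in> points n" "B = {x, u_mate i x}" by blast
 thus "B \<in> u_diagram n i"
  by (cases x) (auto simp: u_diagram_def insert_commute)
qed

lemma u_mate_props:
 assumes i: "i \<in> {1..<n}" and x: "x \<in> points n"
 shows "u_mate i x \<in> points n \<and> u_mate i (u_mate i x) = x"
 using assms by (cases x) auto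

lemma u_diagram_in_diagrams:
 assumes i: "i \<in> {1..<n}"
 shows "u_diagram n i \<in> diagrams n"
 unfolding u_diagram_image[OF i]
proof (rule diagram_of_involution, unfold nc_involution_def, intro conjI ballI inj_on_boundary_pos)
 fix x assume x: "x \<in> points n"
 show "u_mate i x \<in> points n" "u_mate i (u_mate i x) = x"
  using u_mate_props[OF i x] by blast+
 show "u_mate i x \<noteq> x" by (cases x) auto
next
 fix a b assume "a \<in> points n" "b \<in> points n"
 thus "\<not> (boundary_pos n a < boundary_pos n b \<and> boundary_pos n b < boundary_pos n (u_mate i a) \<and>
   boundary_pos n (u_mate i a) < boundary_pos n (u_mate i b))"
  using i by (cases a; cases b) (simp_all, (linarith | (intro conjI impI, linarith+))+)
qed

lemma fits_u_diagram:
 assumes i: "i \<in> {1..<n}"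
 shows "fits (u_diagram n i) X Y \<longleftrightarrow> (i \<in> X \<longleftrightarrow> i + 1 \<notin> X) \<and> (i \<in> Y \<longleftrightarrow> i + 1 \<notin> Y) \<and>
   (\<forall>j\<in>{1..n} - {i, i + 1}. j \<in> X \<longleftrightarrow> j \<in> Y)"
proof -
 have "fits (u_diagram n i) X Y \<longleftrightarrow> (\<forall>x\<in>points n. label X Y (u_mate i x) = label X Y x)"
  unfolding u_diagram_image[OF i] by (rule fits_involution[OF u_mate_props[OF i]])
 also have "\<dots> \<longleftrightarrow> (i \<in> X \<longleftrightarrow> i + 1 \<notin> X) \<and> (i \<in> Y \<longleftrightarrow> i + 1 \<notin> Y) \<and>
   (\<forall>j\<in>{1..n} - {i, i + 1}. j \<in> X \<longleftrightarrow> j \<in> Y)" (is "?l \<longleftrightarrow> ?r")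
 proof
  assume l: ?l
  have "label X Y (u_mate i (Top i)) = label X Y (Top i)" "label X Y (u_mate i (Bot i)) = label X Y (Bot i)"
   using l i by (simp_all del: u_mate.simps)
  moreover have "j \<in> X \<longleftrightarrow> j \<in> Y" if "j \<in> {1..n} - {i, i + 1}" for j
   using bspec[OF l, of "Top j"] that by auto
  ultimately show ?r by auto
 next
  assume r: ?r
  show ?l
  proof
   fix x assume "x \<in> points n"
   thus "label X Y (u_mate i x) = label X Y x"
    using r by (cases x) auto
  qed
 qed
 finally show ?thesis .
qed

lemma theta_insert:
 assumes "finite X" "a \<notin> X"
 shows "theta (insert a X) = (if even a then - theta X else theta X)"
proof -
 have "{i \<in> insert a X. even i} = (if even a then insert a {i \<in> X. even i} else {i \<in> X. even i})" by auto
 thus ?thesis using assms by (simp add: theta_def)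
qed

lemma transpose_image_cases:
 "transpose a b ` Y = (if a \<in> Y \<longleftrightarrow> b \<in> Y then Y else if a \<in> Y then insert b (Y - {a}) else insert a (Y - {b}))"
 by (auto simp: transpose_def image_iff split: if_splits)

text \<open>In matrix form the generator is 1 minus the exchange of the states at \<open>i\<close>
  and \<open>i + 1\<close>. With equal states the two terms coincide and cancel; with different
  states \<open>theta\<close> supplies the minus sign of the exchanged term.\<close>

lemma rep_u_gen:
 assumes i: "i \<in> {1..<n}" and XY: "X \<subseteq> {1..n}" "Y \<subseteq> {1..n}"
 shows "rep n (u_gen n i) X Y = of_bool (X = Y) - of_bool (X = transpose i (i + 1) ` Y)"
proof -
 have fin: "finite X" "finite Y" using XY finite_subset by blast+
 have r: "rep n (u_gen n i) X Y = theta X * theta Y * of_bool (fits (u_diagram n i) X Y)"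
  unfolding u_gen_def by (rule rep_delta[OF u_diagram_in_diagrams[OF i] XY])
 show ?thesis
 proof (cases "i \<in> Y \<longleftrightarrow> i + 1 \<in> Y")
  case True
  thus ?thesis unfolding r fits_u_diagram[OF i] transpose_image_cases by auto
 next
  case False
  define Z where "Z = Y - {i, i + 1}"
  \<comment> \<open>\<open>a\<close> is the occupied and \<open>b\<close> the empty one of the two
    places; their parities differ, so moving the element flips \<open>theta\<close>.\<close>
  define a where "a = (if i \<in> Y then i else i + 1)"
  define b where "b = (if i \<in> Y then i + 1 else i)"
  have Y: "Y = insert a Z" using False by (auto simp: a_def b_def Z_def)
  have sY: "transpose i (i + 1) ` Y = insert b Z"
   using False unfolding transpose_image_cases by (auto simp: a_def b_def Z_def)
  have ab: "a \<notin> Z" "b \<notin> Z" "a \<noteq> b" "even a \<longleftrightarrow> odd b" "{a, b} = {i, i + 1}"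
   by (auto simp: a_def b_def Z_def)
  have Zn: "Z \<subseteq> {1..n} - {i, i + 1}" using XY by (auto simp: Z_def)
  have th: "theta (insert b Z) = - theta (insert a Z)"
   using ab fin by (simp add: theta_insert Z_def)
  have "fits (u_diagram n i) X Y \<longleftrightarrow> X = insert a Z \<or> X = insert b Z"
  proof
   assume "fits (u_diagram n i) X Y"
   hence f: "i \<in> X \<longleftrightarrow> i + 1 \<notin> X" "\<forall>j\<in>{1..n} - {i, i + 1}. j \<in> X \<longleftrightarrow> j \<in> Y"
    unfolding fits_u_diagram[OF i] by blast+
   have "X - {i, i + 1} = Z" using f(2) XY by (auto simp: Z_def)
   thus "X = insert a Z \<or> X = insert b Z" using f(1) by (auto simp: a_def b_def)
  next
   assume "X = insert a Z \<or> X = insert b Z"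
   thus "fits (u_diagram n i) X Y"
    unfolding fits_u_diagram[OF i] using False by (auto simp: a_def b_def Z_def split: if_splits)
  qed
  moreover have "insert a Z \<noteq> insert b Z" using ab by blast
  ultimately show ?thesis unfolding r sY using th Y by auto
 qed
qed

section \<open>The image of the symmetric group\<close>

definition perm_rep :: "nat \<Rightarrow> (nat \<Rightarrow> nat) \<Rightarrow> nat set \<Rightarrow> nat set \<Rightarrow> rat" where
 "perm_rep n \<pi> X Y = (if Y \<subseteq> {1..n} \<and> X = \<pi> ` Y then of_int (sign \<pi>) else 0)"

lemma perm_rep_comp:
 assumes "\<sigma> permutes {1..n}" "\<tau> permutes {1..n}"
 shows "(\<Sum>Z\<in>Pow {1..n}. perm_rep n \<sigma> X Z * perm_rep n \<tau> Z Y) = perm_rep n (\<sigma> \<circ> \<tau>) X Y"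
proof (cases "Y \<subseteq> {1..n}")
 case True
 have sub: "\<tau> ` Y \<subseteq> {1..n}" using True permutes_image[OF assms(2)] by blast
 have "(\<Sum>Z\<in>Pow {1..n}. perm_rep n \<sigma> X Z * perm_rep n \<tau> Z Y) =
  (\<Sum>Z\<in>Pow {1..n}. if Z = \<tau> ` Y then perm_rep n \<sigma> X (\<tau> ` Y) * of_int (sign \<tau>) else 0)"
  by (intro sum.cong) (use True in \<open>auto simp: perm_rep_def\<close>)
 also have "\<dots> = perm_rep n \<sigma> X (\<tau> ` Y) * of_int (sign \<tau>)" using sub by simp
 also have "\<dots> = perm_rep n (\<sigma> \<circ> \<tau>) X Y"
  using sub True sign_compose[OF permutes_imp_permutation[OF finite_atLeastAtMost assms(1)]
    permutes_imp_permutation[OF finite_atLeastAtMost assms(2)]]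
  by (auto simp: perm_rep_def image_comp)
 finally show ?thesis .
qed (simp add: perm_rep_def)

text \<open>\<open>Phi\<close> is specified only on adjacent transpositions. A longer transposition
  is a shorter one conjugated by an adjacent one, and every permutation is a product of
  transpositions.\<close>

lemma permutes_adjacent_induct [consumes 1, case_names id adjacent comp]:
 assumes \<pi>: "\<pi> permutes {1..N::nat}" and id: "P id"
  and adj: "\<And>i. i \<in> {1..<N} \<Longrightarrow> P (transpose i (i + 1))"
  and comp: "\<And>\<sigma> \<tau>. \<sigma> permutes {1..N} \<Longrightarrow> \<tau> permutes {1..N} \<Longrightarrow> P \<sigma> \<Longrightarrow> P \<tau> \<Longrightarrow> P (\<sigma> \<circ> \<tau>)"
 shows "P \<pi>"
proof -
 have tr: "transpose a b permutes {1..N}" if "a \<in> {1..N}" "b \<in> {1..N}" for a b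
  using that by (rule permutes_swap_id)
 have up: "a + Suc d \<le> N \<Longrightarrow> a \<in> {1..N} \<Longrightarrow> P (transpose a (a + Suc d))" for a d
 proof (induction d)
  case 0
  thus ?case using adj[of a] by simp
 next
  case (Suc d)
  let ?b = "a + Suc d"
  have b: "?b \<in> {1..<N}" using Suc.prems by auto
  have t: "P (transpose ?b (?b + 1))" "transpose ?b (?b + 1) permutes {1..N}"
   using adj[OF b] tr[of ?b "?b + 1"] b by auto
  have t': "P (transpose a ?b)" "transpose a ?b permutes {1..N}"
   using Suc.IH tr[of a ?b] Suc.prems by auto
  have "transpose (?b + 1) ?b \<circ> transpose ?b a \<circ> transpose (?b + 1) ?b = transpose (?b + 1) a"
   by (rule transpose_comp_triple) auto
  hence "transpose a (a + Suc (Suc d)) = transpose ?b (?b + 1) \<circ> transpose a ?b \<circ> transpose ?b (?b + 1)"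
   by (simp add: transpose_commute)
  moreover have "P (transpose ?b (?b + 1) \<circ> transpose a ?b \<circ> transpose ?b (?b + 1))"
   using t t' by (intro comp permutes_compose)
  ultimately show ?case by (simp only:)
 qed
 have trP: "P (transpose a b)" if ab: "a \<in> {1..N}" "b \<in> {1..N}" "a \<noteq> b" for a b
 proof (cases "a < b")
  case True
  hence "b = a + Suc (b - a - 1)" by simp
  thus ?thesis using up[of a "b - a - 1"] ab by simp
 next
  case False
  hence "a = b + Suc (a - b - 1)" using ab(3) by simp
  thus ?thesis using up[of b "a - b - 1"] ab by (simp add: transpose_commute)
 qed
 show ?thesis
  using \<pi> finite_atLeastAtMost
 proof (induction rule: permutes_induct)
  case id
  show ?case by (rule assms(2))
 next
  case (swap a b p)
  show ?case by (rule comp[OF tr[OF swap(1,2)] swap(4) trP[OF swap(1-3)] swap(5)])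
 qed
qed

lemma QSym_simps:
 "x \<in> carrier (QSym N) \<longleftrightarrow> (\<forall>\<pi>. \<not> \<pi> permutes {1..N} \<longrightarrow> x \<pi> = 0)"
 "x \<otimes>\<^bsub>QSym N\<^esub> y = (\<lambda>\<pi>. \<Sum>\<sigma> | \<sigma> permutes {1..N}. \<Sum>\<tau> | \<tau> permutes {1..N}.
        if \<sigma> \<circ> \<tau> = \<pi> then x \<sigma> * y \<tau> else 0)"
 "\<one>\<^bsub>QSym N\<^esub> = delta id"
 "\<zero>\<^bsub>QSym N\<^esub> = (\<lambda>\<pi>. 0)"
 "x \<oplus>\<^bsub>QSym N\<^esub> y = (\<lambda>\<pi>. x \<pi> + y \<pi>)"
 "c \<odot>\<^bsub>QSym N\<^esub> x = (\<lambda>\<pi>. c * x \<pi>)"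
 by (simp_all add: QSym_def)

lemma perms_finite [simp]: "finite {\<pi>. \<pi> permutes {a..N::nat}}"
 by (simp add: finite_permutations)

lemma delta_perm_carrier: "\<pi> permutes {1..N} \<Longrightarrow> delta \<pi> \<in> carrier (QSym N)"
 by (auto simp: QSym_simps delta_def)

lemma delta_comp:
 assumes "\<sigma> permutes {1..N}" "\<tau> permutes {1..N}"
 shows "delta \<sigma> \<otimes>\<^bsub>QSym N\<^esub> delta \<tau> = delta (\<sigma> \<circ> \<tau>)"
proof
 fix \<pi>
 let ?P = "{\<pi>. \<pi> permutes {1..N}}"
 have "(\<Sum>\<sigma>'\<in>?P. \<Sum>\<tau>'\<in>?P. if \<sigma>' \<circ> \<tau>' = \<pi> then delta \<sigma> \<sigma>' * delta \<tau> \<tau>' else 0) =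
  (\<Sum>\<sigma>'\<in>?P. \<Sum>\<tau>'\<in>?P. if \<tau>' = \<tau> then (if \<sigma>' = \<sigma> then of_bool (\<sigma> \<circ> \<tau> = \<pi>) else 0) else 0)"
  by (intro sum.cong refl) (simp add: delta_def)
 also have "\<dots> = of_bool (\<sigma> \<circ> \<tau> = \<pi>)" using assms by simp
 finally show "(delta \<sigma> \<otimes>\<^bsub>QSym N\<^esub> delta \<tau>) \<pi> = delta (\<sigma> \<circ> \<tau>) \<pi>"
  unfolding QSym_simps by (auto simp: delta_def)
qed

lemma sign_adjacent: "sign (transpose i (Suc i)) = - 1"
 by (simp add: sign_swap_id)

lemma rep_u_gen_minus_one:
 assumes i: "i \<in> {1..<n}"
 shows "rep n (u_gen n i \<ominus>\<^bsub>TLQ n\<^esub> \<one>\<^bsub>TLQ n\<^esub>) X Y = perm_rep n (transpose i (i + 1)) X Y"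
proof -
 have u: "u_gen n i \<in> carrier (TLQ n)"
  unfolding u_gen_def by (rule delta_in_carrier[OF u_diagram_in_diagrams[OF i]])
 have r: "rep n (u_gen n i \<ominus>\<^bsub>TLQ n\<^esub> \<one>\<^bsub>TLQ n\<^esub>) X Y = rep n (u_gen n i) X Y - rep n \<one>\<^bsub>TLQ n\<^esub> X Y"
  by (rule rep_minus[OF u one_in_carrier])
 have tr: "transpose i (i + 1) permutes {1..n}" using i by (intro permutes_swap_id) auto
 show ?thesis
 proof (cases "X \<subseteq> {1..n} \<and> Y \<subseteq> {1..n}")
  case True
  thus ?thesis unfolding r using rep_u_gen[OF i, of X Y]
   by (auto simp: rep_one perm_rep_def sign_adjacent)
 next
  case False
  have "transpose i (i + 1) ` Y \<subseteq> {1..n}" if "Y \<subseteq> {1..n}"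
   using permutes_image[OF tr] that by blast
  hence "\<not> (Y \<subseteq> {1..n} \<and> X = transpose i (i + 1) ` Y)" using False by blast
  hence "perm_rep n (transpose i (i + 1)) X Y = 0" unfolding perm_rep_def by (simp only: if_False)
  moreover have "rep n (u_gen n i) X Y = 0" "rep n \<one>\<^bsub>TLQ n\<^esub> X Y = 0"
   using False rep_outside by blast+
  ultimately show ?thesis unfolding r by simp
 qed
qed

lemma u_gen_carrier: "i \<in> {1..<n} \<Longrightarrow> u_gen n i \<in> carrier (TLQ n)"
 unfolding u_gen_def by (rule delta_in_carrier[OF u_diagram_in_diagrams])

lemma perm_rep_id: "perm_rep n id X Y = rep n \<one>\<^bsub>TLQ n\<^esub> X Y"
 by (auto simp: perm_rep_def rep_one sign_id)

text \<open>The signed permutation matrices lie in the image of \<open>rep\<close>; their preimages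
  are the values from which a homomorphism is extended linearly.\<close>

lemma perm_rep_in_TL:
 assumes "\<pi> permutes {1..N}"
 shows "\<exists>a\<in>carrier (TLQ N). \<forall>X Y. rep N a X Y = perm_rep N \<pi> X Y"
 using assms
proof (induction rule: permutes_adjacent_induct)
 case id
 show ?case by (rule bexI[OF _ one_in_carrier]) (simp only: perm_rep_id simp_thms)
next
 case (adjacent i)
 have "u_gen N i \<ominus>\<^bsub>TLQ N\<^esub> \<one>\<^bsub>TLQ N\<^esub> \<in> carrier (TLQ N)"
  using u_gen_carrier[OF adjacent] by simp
 thus ?case using rep_u_gen_minus_one[OF adjacent] by blast
next
 case (comp \<sigma> \<tau>)
 then obtain a b where a: "a \<in> carrier (TLQ N)" "\<And>X Y. rep N a X Y = perm_rep N \<sigma> X Y"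
  and b: "b \<in> carrier (TLQ N)" "\<And>X Y. rep N b X Y = perm_rep N \<tau> X Y" by blast
 show ?case
  by (rule bexI[OF _ TL_mult_closed[OF a(1) b(1)]])
    (simp only: rep_mult a(2) b(2) perm_rep_comp[OF comp(1,2)] simp_thms)
qed

lemma rep_sum:
 assumes "finite A"
 shows "rep n (\<lambda>D. \<Sum>i\<in>A. c i * a i D) X Y = (\<Sum>i\<in>A. c i * rep n (a i) X Y)"
 using assms
proof (induction A rule: finite_induct)
 case empty
 thus ?case by (simp add: rep_def)
next
 case (insert x F)
 have "rep n (\<lambda>D. \<Sum>i\<in>insert x F. c i * a i D) X Y = rep n (\<lambda>D. c x * a x D + (\<Sum>i\<in>F. c i * a i D)) X Y"
  using insert by simp
 also have "\<dots> = rep n ((c x \<odot>\<^bsub>TLQ n\<^esub> a x) \<oplus>\<^bsub>TLQ n\<^esub> (\<lambda>D. \<Sum>i\<in>F. c i * a i D)) X Y"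
  by (simp add: TL_simps)
 also have "\<dots> = c x * rep n (a x) X Y + rep n (\<lambda>D. \<Sum>i\<in>F. c i * a i D) X Y"
  unfolding rep_add rep_smult ..
 finally show ?case using insert by simp
qed

abbreviation Phi_spec :: "nat \<Rightarrow> (((nat \<Rightarrow> nat) \<Rightarrow> rat) \<Rightarrow> diagram \<Rightarrow> rat) \<Rightarrow> bool" where
 "Phi_spec N h \<equiv> alg_hom UNIV (QSym N) (TLQ N) h \<and> h \<one>\<^bsub>QSym N\<^esub> = \<one>\<^bsub>TLQ N\<^esub> \<and>
   (\<forall>i\<in>{1..<N}. h (delta (transpose i (i + 1))) = u_gen N i \<ominus>\<^bsub>TLQ N\<^esub> \<one>\<^bsub>TLQ N\<^esub>)"

text \<open>\<open>Phi\<close> is chosen by a description, so nothing is known about it before some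
  homomorphism is exhibited. The element belonging to a permutation is determined by its matrix, and
  multiplicativity is checked on matrices.\<close>

lemma Phi_exists: "\<exists>h. Phi_spec N h"
proof -
 let ?P = "{\<pi>. \<pi> permutes {1..N}}"
 obtain a where a: "\<And>\<pi>. \<pi> \<in> ?P \<Longrightarrow> a \<pi> \<in> carrier (TLQ N)"
  and ra: "\<And>\<pi> X Y. \<pi> \<in> ?P \<Longrightarrow> rep N (a \<pi>) X Y = perm_rep N \<pi> X Y"
 proof -
  have "\<forall>\<pi>\<in>?P. \<exists>a. a \<in> carrier (TLQ N) \<and> (\<forall>X Y. rep N a X Y = perm_rep N \<pi> X Y)"
   using perm_rep_in_TL by blast
  then obtain a where "\<forall>\<pi>\<in>?P. a \<pi> \<in> carrier (TLQ N) \<and> (\<forall>X Y. rep N (a \<pi>) X Y = perm_rep N \<pi> X Y)"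
   by (rule bchoice[THEN exE])
  thus thesis using that by blast
 qed
 define h where "h = (\<lambda>x D. \<Sum>\<pi>\<in>?P. x \<pi> * a \<pi> D)"
 have hc: "h x \<in> carrier (TLQ N)" for x
  using a by (auto simp: TL_carrier h_def intro!: sum.neutral)
 have rh: "rep N (h x) X Y = (\<Sum>\<pi>\<in>?P. x \<pi> * perm_rep N \<pi> X Y)" for x X Y
  unfolding h_def rep_sum[OF perms_finite] by (intro sum.cong) (simp_all add: ra)
 have h_delta: "h (delta \<pi>) = b"
  if "\<pi> permutes {1..N}" "b \<in> carrier (TLQ N)" "\<And>X Y. rep N b X Y = perm_rep N \<pi> X Y" for \<pi> b
 proof (rule rep_faithful[OF hc that(2)])
  fix X Y
  have "(\<Sum>\<sigma>\<in>?P. delta \<pi> \<sigma> * perm_rep N \<sigma> X Y) = (\<Sum>\<sigma>\<in>?P. if \<sigma> = \<pi> then perm_rep N \<pi> X Y else 0)"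
   by (intro sum.cong) (simp_all add: delta_def)
  thus "rep N (h (delta \<pi>)) X Y = rep N b X Y" using that by (simp add: rh)
 qed
 have mult: "h (x \<otimes>\<^bsub>QSym N\<^esub> y) = h x \<otimes>\<^bsub>TLQ N\<^esub> h y" for x y
 proof (rule rep_faithful[OF hc TL_mult_closed[OF hc hc]])
  fix X Y
  have "rep N (h (x \<otimes>\<^bsub>QSym N\<^esub> y)) X Y =
   (\<Sum>\<pi>\<in>?P. \<Sum>\<sigma>\<in>?P. \<Sum>\<tau>\<in>?P. if \<sigma> \<circ> \<tau> = \<pi> then x \<sigma> * y \<tau> * perm_rep N \<pi> X Y else 0)"
   unfolding rh QSym_simps sum_distrib_right by (intro sum.cong refl) simp
  also have "\<dots> = (\<Sum>\<sigma>\<in>?P. \<Sum>\<tau>\<in>?P. \<Sum>\<pi>\<in>?P. if \<sigma> \<circ> \<tau> = \<pi> then x \<sigma> * y \<tau> * perm_rep N \<pi> X Y else 0)"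
   by (subst sum.swap, rule sum.cong[OF refl], rule sum.swap)
  also have "\<dots> = (\<Sum>\<sigma>\<in>?P. \<Sum>\<tau>\<in>?P. x \<sigma> * y \<tau> * perm_rep N (\<sigma> \<circ> \<tau>) X Y)"
  proof (intro sum.cong refl)
   fix \<sigma> \<tau> assume "\<sigma> \<in> ?P" "\<tau> \<in> ?P"
   hence "\<sigma> \<circ> \<tau> \<in> ?P" using permutes_compose by blast
   thus "(\<Sum>\<pi>\<in>?P. if \<sigma> \<circ> \<tau> = \<pi> then x \<sigma> * y \<tau> * perm_rep N \<pi> X Y else 0) =
     x \<sigma> * y \<tau> * perm_rep N (\<sigma> \<circ> \<tau>) X Y"
    by (subst sum.delta'[OF perms_finite]) (simp only: if_True)
  qed
  also have "\<dots> = (\<Sum>\<sigma>\<in>?P. \<Sum>\<tau>\<in>?P. \<Sum>Z\<in>Pow {1..N}. x \<sigma> * y \<tau> * (perm_rep N \<sigma> X Z * perm_rep N \<tau> Z Y))"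
   by (intro sum.cong refl) (simp add: perm_rep_comp[symmetric] sum_distrib_left)
  also have "\<dots> = (\<Sum>Z\<in>Pow {1..N}. \<Sum>\<sigma>\<in>?P. \<Sum>\<tau>\<in>?P. x \<sigma> * y \<tau> * (perm_rep N \<sigma> X Z * perm_rep N \<tau> Z Y))"
   by (rule trans[OF sum.cong[OF refl sum.swap] sum.swap])
  also have "\<dots> = rep N (h x \<otimes>\<^bsub>TLQ N\<^esub> h y) X Y"
   unfolding rep_mult rh by (intro sum.cong refl) (simp add: sum_product algebra_simps)
  finally show "rep N (h (x \<otimes>\<^bsub>QSym N\<^esub> y)) X Y = rep N (h x \<otimes>\<^bsub>TLQ N\<^esub> h y) X Y" .
 qed
 have "alg_hom UNIV (QSym N) (TLQ N) h"
  unfolding alg_hom_def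
  using hc mult by (auto simp: h_def QSym_simps(5,6) TL_simps(4,5) fun_eq_iff sum.distrib algebra_simps sum_distrib_left)
 moreover have "h \<one>\<^bsub>QSym N\<^esub> = \<one>\<^bsub>TLQ N\<^esub>"
  unfolding QSym_simps(3) by (rule h_delta[OF permutes_id one_in_carrier]) (simp only: perm_rep_id)
 moreover have "h (delta (transpose i (i + 1))) = u_gen N i \<ominus>\<^bsub>TLQ N\<^esub> \<one>\<^bsub>TLQ N\<^esub>" if i: "i \<in> {1..<N}" for i
 proof (rule h_delta)
  show "transpose i (i + 1) permutes {1..N}" using i by (intro permutes_swap_id) auto
  show "u_gen N i \<ominus>\<^bsub>TLQ N\<^esub> \<one>\<^bsub>TLQ N\<^esub> \<in> carrier (TLQ N)" using u_gen_carrier[OF i] by simp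
 qed (rule rep_u_gen_minus_one[OF i])
 ultimately show ?thesis by blast
qed

lemma Phi_spec: "Phi_spec N (Phi N)"
 unfolding Phi_def by (rule someI_ex[OF Phi_exists])

lemma Phi_closed: "x \<in> carrier (QSym N) \<Longrightarrow> Phi N x \<in> carrier (TLQ N)"
 using Phi_spec[of N] unfolding alg_hom_def by blast

text \<open>True for whichever homomorphism was chosen, because the adjacent transpositions generate
  the group.\<close>

lemma rep_Phi_delta:
 assumes "\<pi> permutes {1..N}"
 shows "rep N (Phi N (delta \<pi>)) X Y = perm_rep N \<pi> X Y"
 using assms
proof (induction arbitrary: X Y rule: permutes_adjacent_induct)
 case id
 have "Phi N (delta id) = \<one>\<^bsub>TLQ N\<^esub>" using Phi_spec[of N] by (simp add: QSym_simps)
 thus ?case by (simp only: perm_rep_id)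
next
 case (adjacent i)
 hence "Phi N (delta (transpose i (i + 1))) = u_gen N i \<ominus>\<^bsub>TLQ N\<^esub> \<one>\<^bsub>TLQ N\<^esub>"
  using Phi_spec[of N] by blast
 thus ?case using rep_u_gen_minus_one[OF adjacent] by simp
next
 case (comp \<sigma> \<tau>)
 have "Phi N (delta \<sigma> \<otimes>\<^bsub>QSym N\<^esub> delta \<tau>) = Phi N (delta \<sigma>) \<otimes>\<^bsub>TLQ N\<^esub> Phi N (delta \<tau>)"
  using Phi_spec[of N] delta_perm_carrier[OF comp(1)] delta_perm_carrier[OF comp(2)]
  unfolding alg_hom_def by blast
 thus ?case
  unfolding delta_comp[OF comp(1,2)] by (simp only: rep_mult comp.IH perm_rep_comp[OF comp(1,2)])
qed

lemma Phi_add: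
 "x \<in> carrier (QSym N) \<Longrightarrow> y \<in> carrier (QSym N) \<Longrightarrow> Phi N (x \<oplus>\<^bsub>QSym N\<^esub> y) = Phi N x \<oplus>\<^bsub>TLQ N\<^esub> Phi N y"
 using Phi_spec[of N] unfolding alg_hom_def by blast

lemma abelian_monoid_QSym: "abelian_monoid (QSym N)"
 by (rule abelian_monoidI) (simp_all add: QSym_simps add_ac)

text \<open>\<open>alg_hom\<close> does not list preservation of zero; it follows from 0 + 0 =
  0.\<close>

lemma rep_Phi_zero: "rep N (Phi N \<zero>\<^bsub>QSym N\<^esub>) X Y = 0"
proof -
 have z: "\<zero>\<^bsub>QSym N\<^esub> \<in> carrier (QSym N)" by (simp add: QSym_simps)
 have "\<zero>\<^bsub>QSym N\<^esub> \<oplus>\<^bsub>QSym N\<^esub> \<zero>\<^bsub>QSym N\<^esub> = \<zero>\<^bsub>QSym N\<^esub>" by (simp add: QSym_simps)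
 hence "rep N (Phi N \<zero>\<^bsub>QSym N\<^esub>) X Y + rep N (Phi N \<zero>\<^bsub>QSym N\<^esub>) X Y = rep N (Phi N \<zero>\<^bsub>QSym N\<^esub>) X Y"
  using Phi_add[OF z z] by (metis rep_add)
 thus ?thesis by simp
qed

lemma JM_closed_rep:
 assumes "i \<le> N"
 shows "JM N i \<in> carrier (QSym N)"
  and "rep N (JM_TL N i) X Y = (\<Sum>j\<in>{1..<i}. perm_rep N (transpose j i) X Y)"
proof -
 interpret Q: abelian_monoid "QSym N" by (rule abelian_monoid_QSym)
 have "(\<Oplus>\<^bsub>QSym N\<^esub>j\<in>A. delta (transpose j i)) \<in> carrier (QSym N) \<and>
  rep N (Phi N (\<Oplus>\<^bsub>QSym N\<^esub>j\<in>A. delta (transpose j i))) X Y = (\<Sum>j\<in>A. perm_rep N (transpose j i) X Y)"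
  if "A \<subseteq> {1..<i}" for A
  using finite_subset[OF that finite_atLeastLessThan] that
 proof (induction A rule: finite_induct)
  case empty
  thus ?case by (simp add: rep_Phi_zero)
 next
  case (insert j A)
  have tr: "transpose k i permutes {1..N}" if "k \<in> insert j A" for k
   using that insert.prems assms by (intro permutes_swap_id) auto
  have f: "(\<lambda>k. delta (transpose k i)) \<in> A \<rightarrow> carrier (QSym N)" "delta (transpose j i) \<in> carrier (QSym N)"
   using tr delta_perm_carrier by blast+
  have IH: "(\<Oplus>\<^bsub>QSym N\<^esub>j\<in>A. delta (transpose j i)) \<in> carrier (QSym N)"
   "rep N (Phi N (\<Oplus>\<^bsub>QSym N\<^esub>j\<in>A. delta (transpose j i))) X Y = (\<Sum>j\<in>A. perm_rep N (transpose j i) X Y)"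
   using insert.IH insert.prems by blast+
  have tj: "transpose j i permutes {1..N}" using tr by blast
  have step: "(\<Oplus>\<^bsub>QSym N\<^esub>j\<in>insert j A. delta (transpose j i)) =
    delta (transpose j i) \<oplus>\<^bsub>QSym N\<^esub> (\<Oplus>\<^bsub>QSym N\<^esub>j\<in>A. delta (transpose j i))"
   by (rule Q.finsum_insert[OF insert.hyps f])
  show ?case
   unfolding step Phi_add[OF f(2) IH(1)] rep_add rep_Phi_delta[OF tj] IH(2) sum.insert[OF insert.hyps]
   using Q.a_closed[OF f(2) IH(1)] by simp
 qed
 from this[OF order_refl] show "JM N i \<in> carrier (QSym N)"
  "rep N (JM_TL N i) X Y = (\<Sum>j\<in>{1..<i}. perm_rep N (transpose j i) X Y)"
  unfolding JM_def JM_TL_def by blast+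
qed

lemma JM_TL_closed: "i \<le> N \<Longrightarrow> JM_TL N i \<in> carrier (TLQ N)"
 unfolding JM_TL_def by (intro Phi_closed JM_closed_rep(1))

section \<open>Highest weight vectors\<close>

text \<open>The operators E and, below, F of sl_2 on tensor space, in coordinates. The elements of a
  set are the strands in the lower state, so raising a basis vector deletes an element and lowering
  it inserts one.\<close>

definition raising :: "nat \<Rightarrow> (nat set \<Rightarrow> rat) \<Rightarrow> nat set \<Rightarrow> rat" where
 "raising n v X = (if X \<subseteq> {1..n} then \<Sum>i\<in>{1..n} - X. v (insert i X) else 0)"

definition lowering :: "nat \<Rightarrow> (nat set \<Rightarrow> rat) \<Rightarrow> nat set \<Rightarrow> rat" where
 "lowering n v X = (if X \<subseteq> {1..n} then \<Sum>i\<in>X. v (X - {i}) else 0)"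

definition act :: "nat \<Rightarrow> (diagram \<Rightarrow> rat) \<Rightarrow> (nat set \<Rightarrow> rat) \<Rightarrow> nat set \<Rightarrow> rat" where
 "act n x v X = (\<Sum>Y\<in>Pow {1..n}. rep n x X Y * v Y)"

text \<open>Vectors are functions on all sets that vanish outside the subsets of {1..n}; thus
  vectors on fewer strands are vectors on more strands, without an embedding map.\<close>

definition tensors :: "nat \<Rightarrow> (nat set \<Rightarrow> rat) set" where
 "tensors n = {v. \<forall>X. \<not> X \<subseteq> {1..n} \<longrightarrow> v X = 0}"

definition scalar_prod :: "nat \<Rightarrow> (nat set \<Rightarrow> rat) \<Rightarrow> (nat set \<Rightarrow> rat) \<Rightarrow> rat" where
 "scalar_prod n v w = (\<Sum>X\<in>Pow {1..n}. v X * w X)"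

lemma tensorsD: "v \<in> tensors n \<Longrightarrow> \<not> X \<subseteq> {1..n} \<Longrightarrow> v X = 0"
 unfolding tensors_def by blast

lemma tensors_mono: "v \<in> tensors k \<Longrightarrow> k \<le> n \<Longrightarrow> v \<in> tensors n"
 unfolding tensors_def by (simp, meson atLeastatMost_subset_iff dual_order.trans order_refl)

lemma raising_tensors [simp]: "raising n v \<in> tensors n"
 by (simp add: tensors_def raising_def)

lemma lowering_tensors [simp]: "lowering n v \<in> tensors n"
 by (simp add: tensors_def lowering_def)

lemma act_tensors [simp]: "act n x v \<in> tensors n"
 by (simp add: tensors_def act_def rep_outside)

lemma act_mult: "act n (x \<otimes>\<^bsub>TLQ n\<^esub> y) v = act n x (act n y v)"
proof
 fix X
 have "act n (x \<otimes>\<^bsub>TLQ n\<^esub> y) v X = (\<Sum>Y\<in>Pow {1..n}. \<Sum>Z\<in>Pow {1..n}. rep n x X Z * rep n y Z Y * v Y)"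
  unfolding act_def rep_mult sum_distrib_right ..
 also have "\<dots> = (\<Sum>Z\<in>Pow {1..n}. \<Sum>Y\<in>Pow {1..n}. rep n x X Z * rep n y Z Y * v Y)" by (rule sum.swap)
 also have "\<dots> = act n x (act n y v) X" unfolding act_def sum_distrib_left mult.assoc ..
 finally show "act n (x \<otimes>\<^bsub>TLQ n\<^esub> y) v X = act n x (act n y v) X" .
qed

lemma act_linear:
 "act n (x \<oplus>\<^bsub>TLQ n\<^esub> y) v X = act n x v X + act n y v X"
 "act n (c \<odot>\<^bsub>TLQ n\<^esub> x) v X = c * act n x v X"
 "act n x (\<lambda>X. v X + w X) X = act n x v X + act n x w X"
 "act n x (\<lambda>X. v X - w X) X = act n x v X - act n x w X"
 "act n x (\<lambda>X. c * v X) X = c * act n x v X"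
 by (simp_all add: act_def rep_add rep_smult algebra_simps sum.distrib sum_subtractf sum_distrib_left)

lemma act_minus:
 assumes "x \<in> carrier (TLQ n)" "y \<in> carrier (TLQ n)"
 shows "act n (x \<ominus>\<^bsub>TLQ n\<^esub> y) v X = act n x v X - act n y v X"
 by (simp add: act_def rep_minus[OF assms] algebra_simps sum_subtractf)

lemma act_one:
 assumes "v \<in> tensors n"
 shows "act n \<one>\<^bsub>TLQ n\<^esub> v = v"
proof
 fix X
 have "act n \<one>\<^bsub>TLQ n\<^esub> v X = (\<Sum>Y\<in>Pow {1..n}. if Y = X then v X else 0)"
  unfolding act_def by (intro sum.cong) (auto simp: rep_one)
 thus "act n \<one>\<^bsub>TLQ n\<^esub> v X = v X" using tensorsD[OF assms, of X] by (cases "X \<subseteq> {1..n}") simp_all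
qed

text \<open>A set with a missing element corresponds to a set with a chosen member. This moves
  raising and lowering from one side of a matrix product or scalar product to the other.\<close>

lemma sum_insert_remove:
 fixes g :: "nat set \<Rightarrow> nat set \<Rightarrow> rat"
 shows "(\<Sum>Z\<in>Pow {1..n}. \<Sum>j\<in>{1..n} - Z. g Z (insert j Z)) = (\<Sum>Y\<in>Pow {1..n}. \<Sum>j\<in>Y. g (Y - {j}) Y)"
proof -
 have fin: "finite Z" if "Z \<in> Pow {1..n}" for Z using that finite_subset by blast
 have "(\<Sum>Z\<in>Pow {1..n}. \<Sum>j\<in>{1..n} - Z. g Z (insert j Z)) =
   (\<Sum>(Z, j)\<in>Sigma (Pow {1..n}) (\<lambda>Z. {1..n} - Z). g Z (insert j Z))"
  by (rule sum.Sigma) simp_all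
 also have "\<dots> = (\<Sum>(Y, j)\<in>Sigma (Pow {1..n}) (\<lambda>Y. Y). g (Y - {j}) Y)"
  by (rule sum.reindex_bij_witness[where i = "\<lambda>(Y, j). (Y - {j}, j)" and j = "\<lambda>(Z, j). (insert j Z, j)"])
    (auto simp: insert_absorb)
 also have "\<dots> = (\<Sum>Y\<in>Pow {1..n}. \<Sum>j\<in>Y. g (Y - {j}) Y)"
  by (rule sum.Sigma[symmetric]) (use fin in auto)
 finally show ?thesis .
qed

lemma lowering_adjoint: "scalar_prod n (lowering n v) w = scalar_prod n v (raising n w)"
proof -
 have "scalar_prod n v (raising n w) = (\<Sum>Z\<in>Pow {1..n}. \<Sum>j\<in>{1..n} - Z. v Z * w (insert j Z))"
  unfolding scalar_prod_def by (intro sum.cong refl) (simp add: raising_def sum_distrib_left)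
 also have "\<dots> = (\<Sum>Y\<in>Pow {1..n}. \<Sum>j\<in>Y. v (Y - {j}) * w Y)"
  by (rule sum_insert_remove[where g = "\<lambda>Z Y. v Z * w Y"])
 also have "\<dots> = scalar_prod n (lowering n v) w"
  unfolding scalar_prod_def by (intro sum.cong refl) (simp add: lowering_def sum_distrib_right)
 finally show ?thesis ..
qed

lemma scalar_prod_self:
 assumes "scalar_prod n v v \<le> 0" "v \<in> tensors n"
 shows "v = (\<lambda>X. 0)"
proof
 fix X
 have "scalar_prod n v v = 0"
  using assms(1) sum_nonneg[of "Pow {1..n}" "\<lambda>X. v X * v X"] by (simp add: scalar_prod_def)
 hence "\<forall>X\<in>Pow {1..n}. v X * v X = 0"
  unfolding scalar_prod_def by (subst (asm) sum_nonneg_eq_0_iff) auto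
 thus "v X = 0" using tensorsD[OF assms(2), of X] by (cases "X \<subseteq> {1..n}") auto
qed

text \<open>The relation EF - FE = H with weight n - 2 |X|. The terms that exchange two different
  strands agree on both sides; those that undo the first step occur once for every strand outside,
  respectively inside, \<open>X\<close>.\<close>

lemma raising_lowering:
 assumes X: "X \<subseteq> {1..n}"
 shows "raising n (lowering n v) X = lowering n (raising n v) X + (of_nat n - 2 * of_nat (card X)) * v X"
proof -
 have fin: "finite X" using X finite_subset by blast
 have cX: "card X \<le> n" using card_mono[OF _ X] by simp
 have "raising n (lowering n v) X = (\<Sum>i\<in>{1..n} - X. v X + (\<Sum>j\<in>X. v (insert i (X - {j}))))"
  unfolding raising_def using X
 proof (simp only: if_True, intro sum.cong refl)
  fix i assume i: "i \<in> {1..n} - X"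
  have "lowering n v (insert i X) = (\<Sum>j\<in>insert i X. v (insert i X - {j}))"
   using i X by (simp add: lowering_def)
  also have "\<dots> = v (insert i X - {i}) + (\<Sum>j\<in>X. v (insert i X - {j}))"
   using i fin by simp
  also have "insert i X - {i} = X" using i by auto
  also have "(\<Sum>j\<in>X. v (insert i X - {j})) = (\<Sum>j\<in>X. v (insert i (X - {j})))"
   using i by (intro sum.cong refl arg_cong[where f = v]) auto
  finally show "lowering n v (insert i X) = v X + (\<Sum>j\<in>X. v (insert i (X - {j})))" .
 qed
 hence 1: "raising n (lowering n v) X = of_nat (n - card X) * v X + (\<Sum>i\<in>{1..n} - X. \<Sum>j\<in>X. v (insert i (X - {j})))"
  using fin X by (simp add: sum.distrib card_Diff_subset)
 have "lowering n (raising n v) X = (\<Sum>j\<in>X. v X + (\<Sum>i\<in>{1..n} - X. v (insert i (X - {j}))))"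
  unfolding lowering_def using X
 proof (simp only: if_True, intro sum.cong refl)
  fix j assume j: "j \<in> X"
  have "{1..n} - (X - {j}) = insert j ({1..n} - X)" using j X by auto
  hence "raising n v (X - {j}) = (\<Sum>i\<in>insert j ({1..n} - X). v (insert i (X - {j})))"
   using X by (auto simp: raising_def)
  also have "\<dots> = v (insert j (X - {j})) + (\<Sum>i\<in>{1..n} - X. v (insert i (X - {j})))"
   using j by simp
  finally show "raising n v (X - {j}) = v X + (\<Sum>i\<in>{1..n} - X. v (insert i (X - {j})))"
   using j by (simp add: insert_absorb)
 qed
 hence 2: "lowering n (raising n v) X = of_nat (card X) * v X + (\<Sum>j\<in>X. \<Sum>i\<in>{1..n} - X. v (insert i (X - {j})))"
  by (simp add: sum.distrib)
 have "(\<Sum>i\<in>{1..n} - X. \<Sum>j\<in>X. v (insert i (X - {j}))) = (\<Sum>j\<in>X. \<Sum>i\<in>{1..n} - X. v (insert i (X - {j})))"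
  by (rule sum.swap)
 thus ?thesis unfolding 1 2 using cX by (simp add: of_nat_diff algebra_simps)
qed

text \<open>For a diagram both sides count, with signs, the ways to complete a set of points to a set that
 contains exactly one end of every arc; the two ends of an arc contribute opposite signs.\<close>

lemma rep_raising:
 assumes X: "X \<subseteq> {1..n}" and Y: "Y \<subseteq> {1..n}"
 shows "(\<Sum>i\<in>{1..n} - X. rep n x (insert i X) Y) = (\<Sum>j\<in>Y. rep n x X (Y - {j}))"
proof -
 have finX: "finite X" "finite Y" using X Y finite_subset by blast+
 let ?s = "\<lambda>k::nat. (-1::rat) ^ k" and ?b = "boundary_pos n"
 have key: "(\<Sum>i\<in>{1..n} - X. ?s i * of_bool (fits D (insert i X) Y)) = (\<Sum>j\<in>Y. ?s j * of_bool (fits D X (Y - {j})))"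
  if D: "D \<in> diagrams n" for D
 proof -
  define S where "S = selection n X Y"
  note mp = mate_props[OF D]
  define tr where "tr = (\<lambda>S. \<forall>p\<in>points n. p \<in> S \<longleftrightarrow> mate D p \<notin> S)"
  \<comment> \<open>Signed indicator of the points whose addition turns \<open>S\<close> into a
    transversal of the arcs; such a point may be replaced by its partner, with the opposite
    sign.\<close>
  define g where "g = (\<lambda>p. if p \<notin> S \<and> tr (insert p S) then ?s (?b p) else 0)"
  have tr_mate: "p \<notin> S \<and> tr (insert p S) \<Longrightarrow> mate D p \<notin> S \<and> tr (insert (mate D p) S)"
   if p: "p \<in> points n" for p
  proof
   assume a: "p \<notin> S \<and> tr (insert p S)"
   have h: "q \<in> insert p S \<longleftrightarrow> mate D q \<notin> insert p S" if "q \<in> points n" for q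
    using a that unfolding tr_def by blast
   show np: "mate D p \<notin> S" using h[OF p] by simp
   show "tr (insert (mate D p) S)" unfolding tr_def
   proof
    fix q assume q: "q \<in> points n"
    consider "q = p" | "q = mate D p" | "q \<noteq> p" "q \<noteq> mate D p" by blast
    thus "q \<in> insert (mate D p) S \<longleftrightarrow> mate D q \<notin> insert (mate D p) S"
    proof cases
     case 1
     thus ?thesis using a mp(2)[OF p] by auto
    next
     case 2
     thus ?thesis using a mp(2,3)[OF p] by auto
    next
     case 3
     hence "mate D q \<noteq> mate D p" "mate D q \<noteq> p" using mp(3)[OF p] mp(3)[OF q] by metis+
     thus ?thesis using h[OF q] 3 by simp
    qed
   qed
  qed
  have g_mate: "g (mate D p) = - g p" if p: "p \<in> points n" for p
  proof -
   have "mate D p \<notin> S \<and> tr (insert (mate D p) S) \<longleftrightarrow> p \<notin> S \<and> tr (insert p S)"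
    using tr_mate[OF p] tr_mate[OF mp(1)[OF p], unfolded mp(3)[OF p]] by (intro iffI) assumption+
   moreover have "?s (?b (mate D p)) = - ?s (?b p)"
    using mate_parity[OF D p] by (cases "even (?b p)") (simp_all add: uminus_power_if)
   ultimately show ?thesis unfolding g_def by simp
  qed
  have bij: "bij_betw (mate D) (points n) (points n)"
   by (rule bij_betw_byWitness[where f' = "mate D"]) (use mp in auto)
  have "(\<Sum>p\<in>points n. g p) = (\<Sum>p\<in>points n. g (mate D p))"
   by (rule sum.reindex_bij_betw[OF bij, symmetric])
  also have "\<dots> = - (\<Sum>p\<in>points n. g p)"
   unfolding sum_negf[symmetric] by (intro sum.cong refl g_mate)
  finally have zero: "(\<Sum>p\<in>points n. g p) = 0" by simp
  have split: "(\<Sum>p\<in>points n. g p) = (\<Sum>i\<in>{1..n}. g (Top i)) + (\<Sum>j\<in>{1..n}. g (Bot j))"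
   unfolding points_def
   by (subst sum.union_disjoint) (auto simp: sum.reindex inj_on_def)
  have T: "(\<Sum>i\<in>{1..n}. g (Top i)) = (\<Sum>i\<in>{1..n} - X. ?s i * of_bool (fits D (insert i X) Y))"
  proof (rule sum.mono_neutral_cong_right)
   show "\<forall>i\<in>{1..n} - ({1..n} - X). g (Top i) = 0" by (auto simp: g_def S_def selection_def)
   fix i assume i: "i \<in> {1..n} - X"
   have "selection n (insert i X) Y = insert (Top i) S" by (auto simp: S_def selection_def)
   hence "fits D (insert i X) Y \<longleftrightarrow> tr (insert (Top i) S)" unfolding fits_selection[OF D] tr_def by simp
   moreover have "Top i \<notin> S" using i by (auto simp: S_def selection_def)
   ultimately show "g (Top i) = ?s i * of_bool (fits D (insert i X) Y)" by (simp add: g_def)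
  qed auto
  have B: "(\<Sum>j\<in>{1..n}. g (Bot j)) = (\<Sum>j\<in>Y. - ?s j * of_bool (fits D X (Y - {j})))"
  proof (rule sum.mono_neutral_cong_right)
   show "\<forall>i\<in>{1..n} - Y. g (Bot i) = 0" by (auto simp: g_def S_def selection_def)
   fix j assume j: "j \<in> Y"
   hence j': "j \<in> {1..n}" using Y by blast
   have "selection n X (Y - {j}) = insert (Bot j) S" using j' by (auto simp: S_def selection_def)
   hence "fits D X (Y - {j}) \<longleftrightarrow> tr (insert (Bot j) S)" unfolding fits_selection[OF D] tr_def by simp
   moreover have "Bot j \<notin> S" using j by (auto simp: S_def selection_def)
   moreover have "?s (?b (Bot j)) = - ?s j"
    using j' by (cases "even j") (auto simp: uminus_power_if)
   ultimately show "g (Bot j) = - ?s j * of_bool (fits D X (Y - {j}))" by (simp add: g_def)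
  qed (use Y in auto)
  show ?thesis using zero unfolding split T B by (simp add: sum_negf)
 qed
 have th1: "theta (insert i X) = - ?s i * theta X" if "i \<in> {1..n} - X" for i
  using that finX by (auto simp: theta_insert uminus_power_if)
 have th2: "theta (Y - {j}) = - ?s j * theta Y" if "j \<in> Y" for j
 proof -
  have "theta Y = theta (insert j (Y - {j}))" using that by (simp add: insert_absorb)
  also have "\<dots> = (if even j then - theta (Y - {j}) else theta (Y - {j}))" using finX by (intro theta_insert) auto
  finally show ?thesis by (auto simp: uminus_power_if)
 qed
 have "(\<Sum>i\<in>{1..n} - X. rep n x (insert i X) Y) =
  (\<Sum>i\<in>{1..n} - X. \<Sum>D\<in>diagrams n. - theta X * theta Y * x D * (?s i * of_bool (fits D (insert i X) Y)))"
  using X Y by (intro sum.cong refl) (simp add: rep_def th1 sum_distrib_left mult_ac)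
 also have "\<dots> = (\<Sum>D\<in>diagrams n. \<Sum>i\<in>{1..n} - X. - theta X * theta Y * x D * (?s i * of_bool (fits D (insert i X) Y)))"
  by (rule sum.swap)
 also have "\<dots> = (\<Sum>D\<in>diagrams n. \<Sum>j\<in>Y. - theta X * theta Y * x D * (?s j * of_bool (fits D X (Y - {j}))))"
  unfolding sum_distrib_left[symmetric] by (intro sum.cong refl) (simp only: key)
 also have "\<dots> = (\<Sum>j\<in>Y. \<Sum>D\<in>diagrams n. - theta X * theta Y * x D * (?s j * of_bool (fits D X (Y - {j}))))"
  by (rule sum.swap)
 also have "\<dots> = (\<Sum>j\<in>Y. rep n x X (Y - {j}))"
 proof (intro sum.cong refl)
  fix j assume j: "j \<in> Y"
  have "Y - {j} \<subseteq> {1..n}" using Y by blast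
  thus "(\<Sum>D\<in>diagrams n. - theta X * theta Y * x D * (?s j * of_bool (fits D X (Y - {j})))) = rep n x X (Y - {j})"
   using X th2[OF j] by (simp add: rep_def sum_distrib_left mult_ac)
 qed
 finally show ?thesis .
qed

text \<open>Exchanging the two states of all strands negates every label, which equality along edges
  does not see, and multiplies both signs \<open>theta\<close> by the same factor, which
  cancels.\<close>

lemma rep_complement:
 assumes X: "X \<subseteq> {1..n}" and Y: "Y \<subseteq> {1..n}"
 shows "rep n x ({1..n} - X) ({1..n} - Y) = rep n x X Y"
proof -
 have th: "theta ({1..n} - Z) = theta {1..n} * theta Z" if Z: "Z \<subseteq> {1..n}" for Z
 proof -
  have "card {i \<in> {1..n}. even i} = card {i \<in> {1..n} - Z. even i} + card {i \<in> Z. even i}"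
   using Z finite_subset[OF Z]
   by (subst card_Un_disjoint[symmetric]) (auto intro!: arg_cong[where f = card])
  hence "theta {1..n} = theta ({1..n} - Z) * theta Z" by (simp add: theta_def power_add)
  hence "theta {1..n} * theta Z = theta ({1..n} - Z) * (theta Z * theta Z)" by (simp only: mult.assoc)
  thus ?thesis by simp
 qed
 have fc: "fits D ({1..n} - X) ({1..n} - Y) \<longleftrightarrow> fits D X Y" if D: "D \<in> diagrams n" for D
 proof -
  have l: "label ({1..n} - X) ({1..n} - Y) p \<longleftrightarrow> \<not> label X Y p" if "p \<in> points n" for p
   using that by (cases p) auto
  show ?thesis unfolding fits_def
  proof (intro iffI allI impI)
   fix a b
   assume f: "\<forall>a b. {a, b} \<in> D \<longrightarrow> label ({1..n} - X) ({1..n} - Y) a = label ({1..n} - X) ({1..n} - Y) b"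
    and e: "{a, b} \<in> D"
   have "label ({1..n} - X) ({1..n} - Y) a = label ({1..n} - X) ({1..n} - Y) b" using f e by blast
   thus "label X Y a \<Longrightarrow> label X Y b" "label X Y b \<Longrightarrow> label X Y a"
    using l[OF diagram_edge(2)[OF D e]] l[OF diagram_edge(3)[OF D e]] by blast+
  next
   fix a b
   assume f: "\<forall>a b. {a, b} \<in> D \<longrightarrow> label X Y a = label X Y b" and e: "{a, b} \<in> D"
   have "label X Y a = label X Y b" using f e by blast
   thus "label ({1..n} - X) ({1..n} - Y) a \<Longrightarrow> label ({1..n} - X) ({1..n} - Y) b"
    "label ({1..n} - X) ({1..n} - Y) b \<Longrightarrow> label ({1..n} - X) ({1..n} - Y) a"
    using l[OF diagram_edge(2)[OF D e]] l[OF diagram_edge(3)[OF D e]] by blast+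
  qed
 qed
 have "theta ({1..n} - X) * theta ({1..n} - Y) = theta X * theta Y"
 proof -
  have "theta ({1..n} - X) * theta ({1..n} - Y) = (theta {1..n} * theta {1..n}) * (theta X * theta Y)"
   unfolding th[OF X] th[OF Y] by (simp only: mult_ac)
  thus ?thesis by simp
 qed
 moreover have "(\<Sum>D\<in>diagrams n. x D * of_bool (fits D ({1..n} - X) ({1..n} - Y))) = (\<Sum>D\<in>diagrams n. x D * of_bool (fits D X Y))"
  by (intro sum.cong refl) (simp only: fc)
 ultimately show ?thesis using X Y unfolding rep_def by auto
qed

text \<open>Lowering is raising seen on complements.\<close>

lemma rep_lowering:
 assumes X: "X \<subseteq> {1..n}" and Y: "Y \<subseteq> {1..n}"
 shows "(\<Sum>i\<in>X. rep n x (X - {i}) Y) = (\<Sum>j\<in>{1..n} - Y. rep n x X (insert j Y))"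
proof -
 let ?c = "\<lambda>Z. {1..n} - Z"
 have cc: "?c (?c Z) = Z" if "Z \<subseteq> {1..n}" for Z using that by blast
 have "(\<Sum>i\<in>X. rep n x (X - {i}) Y) = (\<Sum>i\<in>?c (?c X). rep n x (insert i (?c X)) (?c Y))"
 proof (rule sum.cong)
  fix i assume i: "i \<in> ?c (?c X)"
  have "insert i (?c X) = ?c (X - {i})" using i X by blast
  moreover have "X - {i} \<subseteq> {1..n}" using X by blast
  ultimately show "rep n x (X - {i}) Y = rep n x (insert i (?c X)) (?c Y)"
   using rep_complement[of "X - {i}" n Y x] Y by simp
 qed (use X in blast)
 also have "\<dots> = (\<Sum>j\<in>?c Y. rep n x (?c X) (?c Y - {j}))" by (rule rep_raising) auto
 also have "\<dots> = (\<Sum>j\<in>?c Y. rep n x X (insert j Y))"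
 proof (rule sum.cong[OF refl])
  fix j assume j: "j \<in> ?c Y"
  have "?c Y - {j} = ?c (insert j Y)" by blast
  moreover have "insert j Y \<subseteq> {1..n}" using j Y by blast
  ultimately show "rep n x (?c X) (?c Y - {j}) = rep n x X (insert j Y)"
   using rep_complement[of X n "insert j Y" x] X by simp
 qed
 finally show ?thesis .
qed

lemma act_raising: "act n x (raising n v) = raising n (act n x v)"
proof
 fix X
 show "act n x (raising n v) X = raising n (act n x v) X"
 proof (cases "X \<subseteq> {1..n}")
  case X: True
  have "act n x (raising n v) X = (\<Sum>Z\<in>Pow {1..n}. \<Sum>j\<in>{1..n} - Z. rep n x X Z * v (insert j Z))"
   unfolding act_def by (intro sum.cong refl) (simp add: raising_def sum_distrib_left)
  also have "\<dots> = (\<Sum>Y\<in>Pow {1..n}. \<Sum>j\<in>Y. rep n x X (Y - {j}) * v Y)"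
   by (rule sum_insert_remove[where g = "\<lambda>Z Y. rep n x X Z * v Y"])
  also have "\<dots> = (\<Sum>Y\<in>Pow {1..n}. \<Sum>i\<in>{1..n} - X. rep n x (insert i X) Y * v Y)"
   unfolding sum_distrib_right[symmetric] by (intro sum.cong refl) (simp only: rep_raising[OF X] Pow_iff)
  also have "\<dots> = (\<Sum>i\<in>{1..n} - X. \<Sum>Y\<in>Pow {1..n}. rep n x (insert i X) Y * v Y)" by (rule sum.swap)
  also have "\<dots> = raising n (act n x v) X" using X by (simp add: raising_def act_def)
  finally show ?thesis .
 next
  case False
  thus ?thesis unfolding raising_def[of n "act n x v"] by (simp add: act_def rep_outside)
 qed
qed

lemma act_lowering: "act n x (lowering n v) = lowering n (act n x v)"
proof
 fix X
 show "act n x (lowering n v) X = lowering n (act n x v) X"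
 proof (cases "X \<subseteq> {1..n}")
  case X: True
  have "act n x (lowering n v) X = (\<Sum>Z\<in>Pow {1..n}. \<Sum>j\<in>Z. rep n x X Z * v (Z - {j}))"
   unfolding act_def by (intro sum.cong refl) (simp add: lowering_def sum_distrib_left)
  also have "\<dots> = (\<Sum>Y\<in>Pow {1..n}. \<Sum>j\<in>{1..n} - Y. rep n x X (insert j Y) * v Y)"
   by (rule sum_insert_remove[where g = "\<lambda>Z Y. rep n x X Y * v Z", symmetric])
  also have "\<dots> = (\<Sum>Y\<in>Pow {1..n}. \<Sum>i\<in>X. rep n x (X - {i}) Y * v Y)"
   unfolding sum_distrib_right[symmetric] by (intro sum.cong refl) (simp only: rep_lowering[OF X] Pow_iff)
  also have "\<dots> = (\<Sum>i\<in>X. \<Sum>Y\<in>Pow {1..n}. rep n x (X - {i}) Y * v Y)" by (rule sum.swap)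
  also have "\<dots> = lowering n (act n x v) X" using X by (simp add: lowering_def act_def)
  finally show ?thesis .
 next
  case False
  thus ?thesis unfolding lowering_def[of n "act n x v"] by (simp add: act_def rep_outside)
 qed
qed

section \<open>Ballot sets and the recursive highest weight vectors\<close>

definition ballot :: "nat \<Rightarrow> nat set set" where
 "ballot n = {Q. Q \<subseteq> {1..n} \<and> (\<forall>m\<le>n. 2 * card (Q \<inter> {1..m}) \<le> m)}"

text \<open>Length of the first column minus length of the second among the entries up to
  \<open>k\<close>; equally the sl_2 weight of \<open>hw Q k\<close>.\<close>

definition height :: "nat set \<Rightarrow> nat \<Rightarrow> int" where
 "height Q k = int k - 2 * int (card (Q \<inter> {1..k}))"

definition set_content :: "nat set \<Rightarrow> nat \<Rightarrow> int" where
 "set_content Q i = (if i \<in> Q then 2 - int (card (Q \<inter> {1..i})) else 1 - int (card ({1..i} - Q)))"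

definition extend :: "nat \<Rightarrow> (nat set \<Rightarrow> rat) \<Rightarrow> nat set \<Rightarrow> rat" where
 "extend k v X = (if Suc k \<in> X then v (X - {Suc k}) else 0)"

text \<open>In the recursion the vector for \<open>k\<close> strands is regarded as a vector for \<open>Suc k\<close> strands by
 appending a strand in the state ``not in \<open>X\<close>''; \<open>extend\<close> appends the other state.\<close>

fun hw :: "nat set \<Rightarrow> nat \<Rightarrow> nat set \<Rightarrow> rat" where
 "hw Q 0 = (\<lambda>X. if X = {} then 1 else 0)"
| "hw Q (Suc k) = (if Suc k \<in> Q
   then (\<lambda>X. (of_int (height Q k) + 1) * extend k (hw Q k) X - lowering (Suc k) (hw Q k) X)
   else hw Q k)"

lemma finite_ballot [simp]: "finite (ballot n)"
 by (rule finite_subset[of _ "Pow {1..n}"]) (auto simp: ballot_def)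

lemma Int_interval_Suc: "Q \<inter> {1..Suc k} = (if Suc k \<in> Q then insert (Suc k) (Q \<inter> {1..k}) else Q \<inter> {1..k})"
 by (auto simp: le_Suc_eq)

lemma card_Int_Suc: "card (Q \<inter> {1..Suc k}) = card (Q \<inter> {1..k}) + of_bool (Suc k \<in> Q)"
 unfolding Int_interval_Suc by simp

lemma subset_Suc_cases:
 assumes "X \<subseteq> {1..Suc k}"
 obtains (old) "X \<subseteq> {1..k}" "Suc k \<notin> X"
 | (new) Z where "X = insert (Suc k) Z" "Z \<subseteq> {1..k}" "Suc k \<notin> Z"
proof (cases "Suc k \<in> X")
 case True
 hence "X = insert (Suc k) (X - {Suc k})" by blast
 moreover have "X - {Suc k} \<subseteq> {1..k}" using assms by (auto simp: le_Suc_eq)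
 ultimately show thesis using new by blast
next
 case False
 hence "X \<subseteq> {1..k}" using assms by (auto simp: le_Suc_eq)
 thus thesis using old False by blast
qed

lemma lowering_linear:
 "lowering n (\<lambda>X. v X + w X) X = lowering n v X + lowering n w X"
 "lowering n (\<lambda>X. v X - w X) X = lowering n v X - lowering n w X"
 "lowering n (\<lambda>X. c * v X) X = c * lowering n v X"
 "lowering n (\<lambda>X. 0) X = 0"
 by (simp_all add: lowering_def sum.distrib sum_subtractf sum_distrib_left)

lemma raising_linear:
 "raising n (\<lambda>X. v X + w X) X = raising n v X + raising n w X"
 "raising n (\<lambda>X. v X - w X) X = raising n v X - raising n w X"
 "raising n (\<lambda>X. c * v X) X = c * raising n v X"
 "raising n (\<lambda>X. 0) X = 0"
 by (simp_all add: raising_def sum.distrib sum_subtractf sum_distrib_left)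

lemma tensors_linear:
 "v \<in> tensors n \<Longrightarrow> w \<in> tensors n \<Longrightarrow> (\<lambda>X. v X + w X) \<in> tensors n"
 "v \<in> tensors n \<Longrightarrow> w \<in> tensors n \<Longrightarrow> (\<lambda>X. v X - w X) \<in> tensors n"
 "v \<in> tensors n \<Longrightarrow> (\<lambda>X. c * v X) \<in> tensors n"
 by (simp_all add: tensors_def)

lemma tensors_Suc: "v \<in> tensors k \<Longrightarrow> v \<in> tensors (Suc k)"
 by (erule tensors_mono) simp

lemma tensors_new: "v \<in> tensors k \<Longrightarrow> Suc k \<in> X \<Longrightarrow> v X = 0"
 by (erule tensorsD) auto

lemma extend_tensors: "v \<in> tensors k \<Longrightarrow> extend k v \<in> tensors (Suc k)"
 unfolding tensors_def
proof (rule CollectI, intro allI impI)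
 fix X assume v: "v \<in> {v. \<forall>X. \<not> X \<subseteq> {1..k} \<longrightarrow> v X = 0}" and X: "\<not> X \<subseteq> {1..Suc k}"
 have "X \<subseteq> {1..Suc k}" if sub: "X - {Suc k} \<subseteq> {1..k}"
 proof
  fix x assume "x \<in> X"
  hence "x = Suc k \<or> x \<in> {1..k}" using sub by blast
  thus "x \<in> {1..Suc k}" by auto
 qed
 hence "\<not> X - {Suc k} \<subseteq> {1..k}" using X by blast
 thus "extend k v X = 0" using v by (simp add: extend_def)
qed

lemma raising_Suc:
 assumes v: "v \<in> tensors k"
 shows "raising (Suc k) v = raising k v"
proof
 fix X
 show "raising (Suc k) v X = raising k v X"
 proof (cases "X \<subseteq> {1..Suc k}")
  case True
  thus ?thesis
  proof (cases rule: subset_Suc_cases)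
   case old
   hence "{1..Suc k} - X = insert (Suc k) ({1..k} - X)" by (auto simp: le_Suc_eq)
   thus ?thesis using old True tensors_new[OF v, of "insert (Suc k) X"] by (simp add: raising_def)
  next
   case (new Z)
   have "v (insert i X) = 0" for i using tensors_new[OF v] new by simp
   thus ?thesis using True new by (auto simp: raising_def)
  qed
 next
  case False
  hence "\<not> X \<subseteq> {1..k}" by auto
  thus ?thesis using False unfolding raising_def by simp
 qed
qed

lemma raising_extend:
 assumes v: "v \<in> tensors k"
 shows "raising (Suc k) (extend k v) X = extend k (raising k v) X + v X"
proof (cases "X \<subseteq> {1..Suc k}")
 case True
 thus ?thesis
 proof (cases rule: subset_Suc_cases)
  case old
  hence e: "{1..Suc k} - X = insert (Suc k) ({1..k} - X)" by (auto simp: le_Suc_eq)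
  have "extend k v (insert i X) = 0" if "i \<in> {1..k}" for i
   using that old by (auto simp: extend_def)
  moreover have "extend k v (insert (Suc k) X) = v X" using old by (simp add: extend_def)
  ultimately have "raising (Suc k) (extend k v) X = v X" using True unfolding raising_def e by simp
  thus ?thesis using old by (simp add: extend_def)
 next
  case (new Z)
  have e: "{1..Suc k} - X = {1..k} - Z" using new by (auto simp: le_Suc_eq)
  have "extend k v (insert i X) = v (insert i Z)" if "i \<in> {1..k} - Z" for i
  proof -
   have "insert i X - {Suc k} = insert i Z" using new that by auto
   thus ?thesis using new by (simp add: extend_def)
  qed
  hence "raising (Suc k) (extend k v) X = raising k v Z"
   using True new(2) unfolding raising_def e by (simp del: insert_iff)
  moreover have "extend k (raising k v) X = raising k v Z" using new by (simp add: extend_def)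
  ultimately show ?thesis using tensors_new[OF v, of X] new by simp
 qed
next
 case False
 hence "\<not> X \<subseteq> {1..k}" by auto
 hence "v X = 0" using tensorsD[OF v] by blast
 thus ?thesis
  using False tensorsD[OF extend_tensors[OF raising_tensors]] tensorsD[OF raising_tensors] by simp
qed

lemma lowering_Suc:
 assumes v: "v \<in> tensors k"
 shows "lowering (Suc k) v X = lowering k v X + extend k v X"
proof (cases "X \<subseteq> {1..Suc k}")
 case True
 thus ?thesis
 proof (cases rule: subset_Suc_cases)
  case old
  thus ?thesis using True by (simp add: lowering_def extend_def)
 next
  case (new Z)
  have fin: "finite Z" using new(2) finite_subset by blast
  have "v (X - {i}) = 0" if "i \<in> Z" for i using tensors_new[OF v, of "X - {i}"] that new by auto
  hence "lowering (Suc k) v X = v (X - {Suc k})"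
   using True new fin by (simp add: lowering_def)
  moreover have "\<not> X \<subseteq> {1..k}" using new by auto
  ultimately show ?thesis using new by (simp add: lowering_def extend_def)
 qed
next
 case False
 hence "\<not> X \<subseteq> {1..k}" by auto
 thus ?thesis
  using False tensorsD[OF extend_tensors[OF v]] tensorsD[OF lowering_tensors] by simp
qed

lemma lowering_extend:
 assumes v: "v \<in> tensors k"
 shows "lowering (Suc k) (extend k v) = extend k (lowering k v)"
proof
 fix X
 show "lowering (Suc k) (extend k v) X = extend k (lowering k v) X"
 proof (cases "X \<subseteq> {1..Suc k}")
  case True
  thus ?thesis
  proof (cases rule: subset_Suc_cases)
   case old
   thus ?thesis using True by (simp add: lowering_def extend_def)
  next
   case (new Z)
   have fin: "finite Z" using new(2) finite_subset by blast
   have "extend k v (X - {i}) = v (Z - {i})" if "i \<in> Z" for i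
   proof -
    have "X - {i} - {Suc k} = Z - {i}" using new by auto
    thus ?thesis using new that by (auto simp: extend_def)
   qed
   moreover have "extend k v (X - {Suc k}) = 0" by (simp add: extend_def)
   ultimately have "lowering (Suc k) (extend k v) X = lowering k v Z"
    using True new fin by (simp add: lowering_def)
   thus ?thesis using new by (simp add: extend_def)
  qed
 next
  case False
  thus ?thesis
   using tensorsD[OF extend_tensors[OF lowering_tensors]] tensorsD[OF lowering_tensors] by simp
 qed
qed

lemma hw_tensors: "hw Q k \<in> tensors k"
proof (induction k)
 case 0
 show ?case by (auto simp: tensors_def)
next
 case (Suc k)
 show ?case
  using tensors_Suc[OF Suc] tensors_linear(2)[OF tensors_linear(3)[OF extend_tensors[OF Suc]] lowering_tensors]
  by simp
qed

lemma hw_weight: "hw Q k X \<noteq> 0 \<Longrightarrow> card X = card (Q \<inter> {1..k})"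
proof (induction k arbitrary: X)
 case 0
 thus ?case by (simp split: if_splits)
next
 case (Suc k)
 have "X \<subseteq> {1..Suc k}" using tensorsD[OF hw_tensors] Suc.prems by blast
 hence fin: "finite X" using finite_subset by blast
 show ?case
 proof (cases "Suc k \<in> Q")
  case True
  from Suc.prems True have "extend k (hw Q k) X \<noteq> 0 \<or> lowering (Suc k) (hw Q k) X \<noteq> 0" by auto
  hence "\<exists>i\<in>X. hw Q k (X - {i}) \<noteq> 0"
  proof
   assume "extend k (hw Q k) X \<noteq> 0"
   thus ?thesis by (auto simp: extend_def split: if_splits)
  next
   assume "lowering (Suc k) (hw Q k) X \<noteq> 0"
   hence "(\<Sum>i\<in>X. hw Q k (X - {i})) \<noteq> 0" by (auto simp: lowering_def split: if_splits)
   thus ?thesis by (rule contrapos_np) (auto intro: sum.neutral)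
  qed
  then obtain i where i: "i \<in> X" "hw Q k (X - {i}) \<noteq> 0" by blast
  hence "card (X - {i}) = card (Q \<inter> {1..k})" using Suc.IH by blast
  hence "card X = card (Q \<inter> {1..k}) + 1" using i(1) fin card_Suc_Diff1[of X i] by simp
  thus ?thesis using True card_Int_Suc[of Q k] by simp
 next
  case False
  thus ?thesis using Suc card_Int_Suc[of Q k] by simp
 qed
qed

text \<open>Origin of the coefficient in \<open>hw\<close>: raising sends the extended vector back
  to the old one, while raising after lowering multiplies the old one by its weight on
  \<open>Suc k\<close> strands, which is the height plus one. The two contributions cancel.\<close>

lemma raising_hw: "raising k (hw Q k) = (\<lambda>X. 0)"
proof (induction k)
 case 0
 show ?case by (auto simp: raising_def)
next
 case (Suc k)
 let ?h = "hw Q k"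
 have r0: "raising (Suc k) ?h = (\<lambda>X. 0)" using raising_Suc[OF hw_tensors] Suc by simp
 show ?case
 proof (cases "Suc k \<in> Q")
  case True
  show ?thesis
  proof
   fix X
   have e0: "extend k (\<lambda>X. 0) X = 0" by (simp add: extend_def)
   have "raising (Suc k) (lowering (Suc k) ?h) X = (of_int (height Q k) + 1) * ?h X"
   proof (cases "X \<subseteq> {1..Suc k}")
    case X: True
    show ?thesis
    proof (cases "?h X = 0")
     case False
     thus ?thesis using raising_lowering[OF X, of ?h] hw_weight[OF False]
      by (simp add: r0 lowering_linear(4) height_def)
    qed (use raising_lowering[OF X, of ?h] in \<open>simp add: r0 lowering_linear(4)\<close>)
   next
    case False
    thus ?thesis using tensorsD[OF tensors_Suc[OF hw_tensors] False] by (simp add: raising_def)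
   qed
   thus "raising (Suc k) (hw Q (Suc k)) X = 0"
    using True e0
    by (simp add: raising_linear(2,3) raising_extend[OF hw_tensors] Suc)
  qed
 next
  case False
  thus ?thesis using r0 by simp
 qed
qed

section \<open>Jucys-Murphy elements on highest weight vectors\<close>

definition jm :: "nat \<Rightarrow> (nat set \<Rightarrow> rat) \<Rightarrow> nat set \<Rightarrow> rat" where
 "jm i v X = - (\<Sum>j\<in>{1..<i}. v (transpose j i ` X))"

text \<open>The minus sign in \<open>jm\<close> is the sign of a transposition in
  \<open>perm_rep\<close>.\<close>

lemma act_JM:
 assumes v: "v \<in> tensors n" and i: "i \<le> n"
 shows "act n (JM_TL n i) v = jm i v"
proof
 fix X
 have "(\<Sum>Y\<in>Pow {1..n}. perm_rep n (transpose j i) X Y * v Y) = - v (transpose j i ` X)" if j: "j \<in> {1..<i}" for j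
 proof -
  have inv: "X = transpose j i ` Y \<longleftrightarrow> Y = transpose j i ` X" for Y
   by (auto simp: image_image)
  have "(\<Sum>Y\<in>Pow {1..n}. perm_rep n (transpose j i) X Y * v Y) =
    (\<Sum>Y\<in>Pow {1..n}. if Y = transpose j i ` X then - v (transpose j i ` X) else 0)"
  proof (rule sum.cong[OF refl])
   fix Y assume Y: "Y \<in> Pow {1..n}"
   show "perm_rep n (transpose j i) X Y * v Y = (if Y = transpose j i ` X then - v (transpose j i ` X) else 0)"
    using Y j unfolding perm_rep_def inv by (simp add: sign_swap_id)
  qed
  thus ?thesis using tensorsD[OF v, of "transpose j i ` X"] by simp
 qed
 hence "(\<Sum>j\<in>{1..<i}. \<Sum>Y\<in>Pow {1..n}. perm_rep n (transpose j i) X Y * v Y) = jm i v X"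
  by (simp add: jm_def sum_negf)
 thus "act n (JM_TL n i) v X = jm i v X"
  unfolding act_def JM_closed_rep(2)[OF i] sum_distrib_right by (subst sum.swap)
qed

lemma jm_linear:
 "jm i (\<lambda>X. v X + w X) X = jm i v X + jm i w X"
 "jm i (\<lambda>X. v X - w X) X = jm i v X - jm i w X"
 "jm i (\<lambda>X. c * v X) X = c * jm i v X"
 by (simp_all add: jm_def sum.distrib sum_subtractf sum_distrib_left)

lemma jm_tensors: "v \<in> tensors n \<Longrightarrow> i \<le> n \<Longrightarrow> jm i v \<in> tensors n"
 using act_JM[of v n i] act_tensors[of n "JM_TL n i" v] by simp

lemma jm_lowering:
 assumes "v \<in> tensors n" "i \<le> n"
 shows "jm i (lowering n v) = lowering n (jm i v)"
 using act_JM[OF assms] act_JM[OF lowering_tensors assms(2)] act_lowering by metis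

lemma jm_extend:
 assumes "i \<le> k"
 shows "jm i (extend k v) = extend k (jm i v)"
proof
 fix X
 have fixed: "transpose j i (Suc k) = Suc k" if "j \<in> {1..<i}" for j using that assms by (auto simp: transpose_def)
 have mem: "Suc k \<in> transpose j i ` X \<longleftrightarrow> Suc k \<in> X" if "j \<in> {1..<i}" for j
  using that assms unfolding transpose_image_cases by auto
 have diff: "transpose j i ` X - {Suc k} = transpose j i ` (X - {Suc k})" if "j \<in> {1..<i}" for j
  using fixed[OF that] by (subst image_set_diff) simp_all
 show "jm i (extend k v) X = extend k (jm i v) X"
  using mem diff by (simp add: jm_def extend_def)
qed

text \<open>The last Jucys-Murphy element exchanges the new strand with each old one. With the new
  strand in the upper state the old strands in that state are counted, and the remaining terms add
  up to \<open>raising k h\<close>, which vanishes. With the new strand in the lower state the old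
  lower strands are counted, and the exchanges with upper strands produce the lowering term.\<close>

lemma jm_last:
 assumes h: "h = hw Q k" and q: "q = card (Q \<inter> {1..k})"
 shows "jm (Suc k) h X = - (of_nat k - of_nat q) * h X"
  and "jm (Suc k) (extend k h) X = (1 - of_nat q) * extend k h X - lowering (Suc k) h X"
proof -
 have hT: "h \<in> tensors k" and rh: "raising k h = (\<lambda>X. 0)" unfolding h by (rule hw_tensors, rule raising_hw)
 have wt: "card X = q" if "h X \<noteq> 0" for X using hw_weight that unfolding h q by blast
 have iv: "{1..<Suc k} = {1..k}" by auto
 show "jm (Suc k) h X = - (of_nat k - of_nat q) * h X"
 proof (cases "X \<subseteq> {1..Suc k}")
  case True
  thus ?thesis
  proof (cases rule: subset_Suc_cases)
   case old
   have fin: "finite X" using old finite_subset by blast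
   have "(\<Sum>j\<in>{1..k}. h (transpose j (Suc k) ` X)) = (\<Sum>j\<in>{1..k}. if j \<in> X then 0 else h X)"
    using old tensors_new[OF hT] by (intro sum.cong refl) (simp add: transpose_image_cases)
   also have "\<dots> = (\<Sum>j\<in>{1..k} - X. h X)"
    by (rule sum.mono_neutral_cong_right) auto
   also have "\<dots> = (of_nat k - of_nat (card X)) * h X"
    using old fin card_mono[OF _ old(1)] by (simp add: card_Diff_subset of_nat_diff)
   finally show ?thesis using wt[of X] unfolding jm_def iv by (cases "h X = 0") (simp_all add: algebra_simps)
  next
   case (new Z)
   have hX: "h X = 0" using tensors_new[OF hT] new by simp
   have "(\<Sum>j\<in>{1..k}. h (transpose j (Suc k) ` X)) = (\<Sum>j\<in>{1..k}. if j \<in> Z then 0 else h (insert j Z))"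
   proof (rule sum.cong[OF refl])
    fix j assume j: "j \<in> {1..k}"
    show "h (transpose j (Suc k) ` X) = (if j \<in> Z then 0 else h (insert j Z))"
    proof (cases "j \<in> Z")
     case True
     hence "transpose j (Suc k) ` X = X" using new unfolding transpose_image_cases by simp
     thus ?thesis using hX True by simp
    next
     case False
     hence "transpose j (Suc k) ` X = insert j Z" using new j unfolding transpose_image_cases by auto
     thus ?thesis using False by simp
    qed
   qed
   also have "\<dots> = (\<Sum>j\<in>{1..k} - Z. h (insert j Z))"
    by (rule sum.mono_neutral_cong_right) auto
   also have "\<dots> = raising k h Z" using new(2) by (simp add: raising_def)
   finally show ?thesis using hX unfolding jm_def iv by (simp add: rh)
  qed
 next
  case False
  thus ?thesis using tensorsD[OF tensors_Suc[OF hT] False] tensorsD[OF jm_tensors[OF tensors_Suc[OF hT] order_refl] False] by simp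
 qed
 show "jm (Suc k) (extend k h) X = (1 - of_nat q) * extend k h X - lowering (Suc k) h X"
 proof (cases "X \<subseteq> {1..Suc k}")
  case True
  thus ?thesis
  proof (cases rule: subset_Suc_cases)
   case old
   have "(\<Sum>j\<in>{1..k}. extend k h (transpose j (Suc k) ` X)) = (\<Sum>j\<in>{1..k}. if j \<in> X then h (X - {j}) else 0)"
   proof (rule sum.cong[OF refl])
    fix j assume j: "j \<in> {1..k}"
    show "extend k h (transpose j (Suc k) ` X) = (if j \<in> X then h (X - {j}) else 0)"
    proof (cases "j \<in> X")
     case True
     hence "transpose j (Suc k) ` X = insert (Suc k) (X - {j})" using old unfolding transpose_image_cases by simp
     moreover have "insert (Suc k) (X - {j}) - {Suc k} = X - {j}" using old by auto
     ultimately show ?thesis using True by (simp add: extend_def)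
    next
     case False
     hence "transpose j (Suc k) ` X = X" using old unfolding transpose_image_cases by simp
     thus ?thesis using False old by (simp add: extend_def)
    qed
   qed
   also have "\<dots> = (\<Sum>j\<in>X. h (X - {j}))"
    by (rule sum.mono_neutral_cong_right) (use old in auto)
   also have "\<dots> = lowering (Suc k) h X" using True by (simp add: lowering_def)
   finally show ?thesis using old unfolding jm_def iv by (simp add: extend_def)
  next
   case (new Z)
   have fin: "finite Z" using new(2) finite_subset by blast
   have eX: "extend k h X = h Z" using new by (simp add: extend_def)
   have "(\<Sum>j\<in>{1..k}. extend k h (transpose j (Suc k) ` X)) = (\<Sum>j\<in>{1..k}. if j \<in> Z then h Z else 0)"
   proof (rule sum.cong[OF refl])
    fix j assume j: "j \<in> {1..k}"
    show "extend k h (transpose j (Suc k) ` X) = (if j \<in> Z then h Z else 0)"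
    proof (cases "j \<in> Z")
     case True
     hence "transpose j (Suc k) ` X = X" using new unfolding transpose_image_cases by simp
     thus ?thesis using eX True by simp
    next
     case False
     hence "transpose j (Suc k) ` X = insert j Z" using new j unfolding transpose_image_cases by auto
     moreover have "Suc k \<notin> insert j Z" using new j by auto
     ultimately show ?thesis using False by (simp add: extend_def)
    qed
   qed
   also have "\<dots> = (\<Sum>j\<in>Z. h Z)"
    by (rule sum.mono_neutral_cong_right) (use new in auto)
   also have "\<dots> = of_nat q * h Z" using wt[of Z] by (cases "h Z = 0") simp_all
   finally have 1: "jm (Suc k) (extend k h) X = - of_nat q * h Z" unfolding jm_def iv by simp
   have "h (X - {i}) = 0" if "i \<in> Z" for i using tensors_new[OF hT, of "X - {i}"] that new by auto
   hence "lowering (Suc k) h X = h (X - {Suc k})" using True new fin by (simp add: lowering_def)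
   also have "X - {Suc k} = Z" using new by auto
   finally show ?thesis unfolding 1 eX by (simp add: algebra_simps)
  qed
 next
  case False
  thus ?thesis
   using tensorsD[OF extend_tensors[OF hT] False] tensorsD[OF lowering_tensors False]
    tensorsD[OF jm_tensors[OF extend_tensors[OF hT] order_refl] False] by simp
 qed
qed

text \<open>For older indices the Jucys-Murphy element commutes with extension and lowering. For a
  newest index in \<open>Q\<close>, with q elements of \<open>Q\<close> before it, the extended part
  has coefficient 1 - q, and the lowering terms combine through (height + 1) - (k - q) = 1 - q; so
  the whole vector is an eigenvector.\<close>

lemma jm_hw:
 assumes "1 \<le> i" "i \<le> k"
 shows "jm i (hw Q k) X = of_int (set_content Q i) * hw Q k X"
 using assms
proof (induction k arbitrary: X)
 case 0
 thus ?case by simp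
next
 case (Suc k)
 let ?h = "hw Q k" and ?q = "card (Q \<inter> {1..k})"
 show ?case
 proof (cases "i \<le> k")
  case True
  have IH: "jm i ?h = (\<lambda>X. of_int (set_content Q i) * ?h X)" using Suc.IH True Suc.prems by blast
  show ?thesis
  proof (cases "Suc k \<in> Q")
   case Q: True
   have 1: "jm i (extend k ?h) X = of_int (set_content Q i) * extend k ?h X"
    unfolding jm_extend[OF True] IH by (simp add: extend_def)
   have 2: "jm i (lowering (Suc k) ?h) X = of_int (set_content Q i) * lowering (Suc k) ?h X"
    using jm_lowering[OF tensors_Suc[OF hw_tensors], of i k Q] True unfolding IH by (simp add: lowering_linear)
   show ?thesis using Q by (simp add: jm_linear 1 2 algebra_simps)
  next
   case False
   thus ?thesis using IH by simp
  qed
 next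
  case False
  hence i: "i = Suc k" using Suc.prems by simp
  have qk: "?q \<le> k" using card_mono[of "{1..k}" "Q \<inter> {1..k}"] by simp
  show ?thesis
  proof (cases "Suc k \<in> Q")
   case True
   have c: "set_content Q (Suc k) = 1 - int ?q" using True card_Int_Suc[of Q k] by (simp add: set_content_def)
   have J1: "jm (Suc k) ?h = (\<lambda>X. - (of_nat k - of_nat ?q) * ?h X)" by (rule ext) (rule jm_last(1)[OF refl refl])
   have 2: "jm (Suc k) (lowering (Suc k) ?h) X = - (of_nat k - of_nat ?q) * lowering (Suc k) ?h X"
    unfolding jm_lowering[OF tensors_Suc[OF hw_tensors] order_refl] J1 lowering_linear(3) ..
   have "jm (Suc k) (hw Q (Suc k)) X = (of_int (height Q k) + 1) * jm (Suc k) (extend k ?h) X - jm (Suc k) (lowering (Suc k) ?h) X"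
    using True by (simp add: jm_linear)
   also have "\<dots> = of_int (set_content Q (Suc k)) * hw Q (Suc k) X"
    unfolding 2 jm_last(2)[OF refl refl] c using True by (simp add: height_def algebra_simps)
   finally show ?thesis unfolding i .
  next
   case False
   have "{1..Suc k} - Q = insert (Suc k) ({1..k} - Q \<inter> {1..k})" using False by (auto simp: le_Suc_eq)
   hence "card ({1..Suc k} - Q) = Suc (k - ?q)" by (simp add: card_Diff_subset)
   hence c: "set_content Q (Suc k) = - (int k - int ?q)" using False qk by (simp add: set_content_def of_nat_diff)
   show ?thesis unfolding i c using False jm_last(1)[OF refl refl, of k Q X] by simp
  qed
 qed
qed

lemma hw_cong: "Q \<inter> {1..k} = Q' \<inter> {1..k} \<Longrightarrow> hw Q k = hw Q' k"
proof (induction k)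
 case (Suc k)
 have "Suc k \<in> A \<longleftrightarrow> Suc k \<in> A \<inter> {1..Suc k}" for A by simp
 hence "Suc k \<in> Q \<longleftrightarrow> Suc k \<in> Q'" using Suc.prems by blast
 moreover have "A \<inter> {1..k} = (A \<inter> {1..Suc k}) \<inter> {1..k}" for A by auto
 hence e: "Q \<inter> {1..k} = Q' \<inter> {1..k}" using Suc.prems by metis
 moreover from e have "height Q k = height Q' k" by (simp add: height_def)
 ultimately show ?case using Suc.IH by simp
qed simp

section \<open>Completeness of the highest weight vectors\<close>

lemma ballot_Suc_old: "Q \<in> ballot k \<Longrightarrow> Q \<in> ballot (Suc k) \<and> Suc k \<notin> Q"
proof -
 assume Q: "Q \<in> ballot k"
 hence s: "Suc k \<notin> Q" "Q \<subseteq> {1..k}" by (auto simp: ballot_def)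
 have "2 * card (Q \<inter> {1..m}) \<le> m" if "m \<le> Suc k" for m
 proof (cases "m = Suc k")
  case True
  have "2 * card (Q \<inter> {1..k}) \<le> k" using Q by (simp add: ballot_def)
  thus ?thesis using card_Int_Suc[of Q k] s True by simp
 next
  case False
  thus ?thesis using Q that by (simp add: ballot_def)
 qed
 thus ?thesis using s by (auto simp: ballot_def)
qed

lemma ballot_Suc_new:
 assumes Q: "Q \<in> ballot k" and h: "height Q k \<ge> 1"
 shows "insert (Suc k) Q \<in> ballot (Suc k)"
proof -
 have s: "Suc k \<notin> Q" "Q \<subseteq> {1..k}" using Q by (auto simp: ballot_def)
 have "2 * card (insert (Suc k) Q \<inter> {1..m}) \<le> m" if "m \<le> Suc k" for m
 proof (cases "m = Suc k")
  case True
  have "insert (Suc k) Q \<inter> {1..k} = Q \<inter> {1..k}" by auto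
  thus ?thesis using card_Int_Suc[of "insert (Suc k) Q" k] h True by (simp add: height_def)
 next
  case False
  hence "insert (Suc k) Q \<inter> {1..m} = Q \<inter> {1..m}" using that by auto
  thus ?thesis using Q that False by (simp add: ballot_def)
 qed
 thus ?thesis using s by (auto simp: ballot_def)
qed

inductive_set spanned :: "nat \<Rightarrow> (nat set \<Rightarrow> rat) set" for n where
 base: "Q \<in> ballot n \<Longrightarrow> (lowering n ^^ m) (hw Q n) \<in> spanned n"
| add: "v \<in> spanned n \<Longrightarrow> w \<in> spanned n \<Longrightarrow> (\<lambda>X. v X + w X) \<in> spanned n"
| scale: "v \<in> spanned n \<Longrightarrow> (\<lambda>X. c * v X) \<in> spanned n"

lemma spanned_diff: "v \<in> spanned n \<Longrightarrow> w \<in> spanned n \<Longrightarrow> (\<lambda>X. v X - w X) \<in> spanned n"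
 using spanned.add[OF _ spanned.scale[of w n "-1"], of v] by simp

lemma spanned_lowering: "v \<in> spanned n \<Longrightarrow> lowering n v \<in> spanned n"
proof (induction rule: spanned.induct)
 case (base Q m)
 thus ?case using spanned.base[of Q n "Suc m"] by simp
next
 case (add v w)
 have "lowering n (\<lambda>X. v X + w X) = (\<lambda>X. lowering n v X + lowering n w X)" by (rule ext) (rule lowering_linear)
 thus ?case using spanned.add add.IH by simp
next
 case (scale v c)
 have "lowering n (\<lambda>X. c * v X) = (\<lambda>X. c * lowering n v X)" by (rule ext) (rule lowering_linear)
 thus ?case using spanned.scale scale.IH by simp
qed

lemma empty_ballot: "{} \<in> ballot n"
 by (simp add: ballot_def)

lemma spanned_zero: "(\<lambda>X. 0) \<in> spanned n"
 using spanned.scale[OF spanned.base[where n = n and m = 0, OF empty_ballot], of 0] by simp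

lemma lowering_pow_tensors: "v \<in> tensors n \<Longrightarrow> (lowering n ^^ m) v \<in> tensors n"
 by (cases m) simp_all

text \<open>At height 0 the recursion produces a vector of negative weight killed by the raising operator,
 which vanishes because the scalar product is definite.\<close>

lemma hw_height_zero:
 assumes h: "height Q k = 0" and new: "Suc k \<in> Q"
 shows "hw Q (Suc k) = (\<lambda>X. 0)"
proof -
 let ?v = "hw Q (Suc k)"
 have rl: "raising (Suc k) (lowering (Suc k) ?v) X = - ?v X" for X
 proof (cases "X \<subseteq> {1..Suc k}")
  case True
  show ?thesis
  proof (cases "?v X = 0")
   case False
   have "card X = card (Q \<inter> {1..k}) + 1" using hw_weight[OF False] card_Int_Suc[of Q k] new by simp
   moreover have "int k = 2 * int (card (Q \<inter> {1..k}))" using h by (simp add: height_def)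
   hence "k = 2 * card (Q \<inter> {1..k})" by linarith
   hence "(of_nat k :: rat) = 2 * of_nat (card (Q \<inter> {1..k}))"
    by (metis of_nat_mult of_nat_numeral)
   \<comment> \<open>Height 0 means k = 2q, so the weight is (2q + 1) - 2 (q + 1) = -1.\<close>
   ultimately have c: "of_nat (Suc k) - 2 * of_nat (card X) = (-1 :: rat)" by simp
   thus ?thesis using raising_lowering[OF True, of ?v] unfolding raising_hw lowering_linear(4) c
    by (simp del: hw.simps)
  next
   case z: True
   thus ?thesis using raising_lowering[OF True, of ?v] unfolding raising_hw lowering_linear(4)
    by (simp del: hw.simps)
  qed
 next
  case False
  thus ?thesis using tensorsD[OF hw_tensors False] tensorsD[OF raising_tensors False] by simp
 qed
 have "scalar_prod (Suc k) (lowering (Suc k) ?v) (lowering (Suc k) ?v) = scalar_prod (Suc k) ?v (\<lambda>X. - ?v X)"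
  unfolding lowering_adjoint using rl by (simp add: scalar_prod_def)
 also have "\<dots> = - scalar_prod (Suc k) ?v ?v" unfolding scalar_prod_def by (simp add: sum_negf)
 finally have "scalar_prod (Suc k) ?v ?v \<le> 0"
  using sum_nonneg[of "Pow {1..Suc k}" "\<lambda>X. lowering (Suc k) ?v X * lowering (Suc k) ?v X"]
  unfolding scalar_prod_def by simp
 thus ?thesis by (rule scalar_prod_self[OF _ hw_tensors])
qed

lemma extend_linear:
 "extend k (\<lambda>X. v X + w X) = (\<lambda>X. extend k v X + extend k w X)"
 "extend k (\<lambda>X. c * v X) = (\<lambda>X. c * extend k v X)"
 by (simp_all add: extend_def fun_eq_iff)

lemma lowering_pow_extend:
 assumes v: "v \<in> tensors k"
 shows "(lowering (Suc k) ^^ m) (extend k v) = extend k ((lowering k ^^ m) v)"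
 by (induction m) (simp_all add: lowering_extend lowering_pow_tensors v)

lemma lowering_pow_linear:
 "(lowering n ^^ m) (\<lambda>X. c * v X - w X) = (\<lambda>X. c * (lowering n ^^ m) v X - (lowering n ^^ m) w X)"
proof (induction m)
 case (Suc m)
 show ?case by (rule ext) (simp add: Suc lowering_linear)
qed simp

text \<open>Adding a strand splits the module of \<open>Q\<close> into those of \<open>Q\<close> and
  of \<open>Q\<close> with \<open>Suc k\<close>, the latter being zero at height 0. The extended
  vectors are recovered from these two because the coefficient height plus one in \<open>hw\<close>
  is invertible.\<close>

lemma spanned_Suc:
 assumes "w \<in> spanned k"
 shows "w \<in> spanned (Suc k) \<and> extend k w \<in> spanned (Suc k)"
 using assms
proof (induction rule: spanned.induct)
 case (base Q m)
 let ?h = "hw Q k" and ?S = "lowering (Suc k)" and ?a = "of_int (height Q k) + 1 :: rat"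
 define Q' where "Q' = insert (Suc k) Q"
 have old: "Q \<in> ballot (Suc k)" "Suc k \<notin> Q" using ballot_Suc_old[OF base] by auto
 have "2 * card (Q \<inter> {1..k}) \<le> k" using base by (simp add: ballot_def)
 hence hpos: "height Q k \<ge> 0" unfolding height_def by linarith
 have cut: "Q' \<inter> {1..k} = Q \<inter> {1..k}" unfolding Q'_def by auto
 have hwQ': "hw Q' k = ?h" by (rule hw_cong[OF cut])
 have hQ': "height Q' k = height Q k" unfolding height_def cut ..
 have hQ: "hw Q (Suc k) = ?h" using old by simp
 have hS: "(?S ^^ j) ?h \<in> spanned (Suc k)" for j using spanned.base[OF old(1), of j] unfolding hQ .
 have newvec: "hw Q' (Suc k) = (\<lambda>X. ?a * extend k ?h X - ?S ?h X)"
  by (simp add: Q'_def flip: hwQ' hQ')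
 have new: "(?S ^^ j) (hw Q' (Suc k)) \<in> spanned (Suc k)" for j
 proof (cases "height Q k \<ge> 1")
  case True
  thus ?thesis using spanned.base[OF ballot_Suc_new[OF base]] unfolding Q'_def by blast
 next
  case False
  hence "height Q' k = 0" using hpos hQ' by simp
  hence z: "hw Q' (Suc k) = (\<lambda>X. 0)" by (rule hw_height_zero) (simp add: Q'_def)
  have lz: "?S (\<lambda>X. 0) = (\<lambda>X. 0)" by (rule ext) (rule lowering_linear(4))
  have "(?S ^^ j) (\<lambda>X. 0) = (\<lambda>X. 0)" by (induction j) (simp_all add: lz)
  thus ?thesis unfolding z using spanned_zero by simp
 qed
 have a: "?a \<noteq> 0" using hpos by (simp add: add_nonneg_pos order_less_imp_not_eq2)
 \<comment> \<open>Apply lowering \<open>j\<close> times to the recursion of \<open>hw\<close> and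
   solve for the extended vector; on extended vectors, lowering on \<open>Suc k\<close> strands is
   lowering on \<open>k\<close> strands.\<close>
 have ext: "extend k ((lowering k ^^ j) ?h) \<in> spanned (Suc k)" for j
 proof -
  have "(?S ^^ j) (hw Q' (Suc k)) = (\<lambda>X. ?a * extend k ((lowering k ^^ j) ?h) X - (?S ^^ Suc j) ?h X)"
   unfolding newvec lowering_pow_linear lowering_pow_extend[OF hw_tensors] by (simp add: funpow_swap1)
  hence "extend k ((lowering k ^^ j) ?h) = (\<lambda>X. (1 / ?a) * ((?S ^^ j) (hw Q' (Suc k)) X + (?S ^^ Suc j) ?h X))"
   using a by (simp add: fun_eq_iff)
  thus ?thesis using spanned.scale[OF spanned.add[OF new[of j] hS[of "Suc j"]], of "1 / ?a"] by (simp only:)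
 qed
 moreover have "(lowering k ^^ j) ?h \<in> spanned (Suc k)" for j
 proof (induction j)
  case 0
  thus ?case using hS[of 0] by simp
 next
  case (Suc j)
  let ?u = "(lowering k ^^ j) ?h"
  have u: "?u \<in> tensors k" by (rule lowering_pow_tensors[OF hw_tensors])
  \<comment> \<open>On vectors of \<open>k\<close> strands, lowering on \<open>Suc k\<close> strands
    exceeds lowering on \<open>k\<close> strands by the extension, which is already known to stay in
    the span.\<close>
  have "lowering k ?u = (\<lambda>X. ?S ?u X - extend k ?u X)"
   using lowering_Suc[OF u] by (simp add: fun_eq_iff)
  thus ?case using spanned_diff[OF spanned_lowering[OF Suc] ext] by simp
 qed
 ultimately show ?case by blast
next
 case (add v w)
 thus ?case unfolding extend_linear using spanned.add by blast
next
 case (scale v c)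
 thus ?case unfolding extend_linear using spanned.scale by blast
qed

lemma tensors_spanned: "v \<in> tensors n \<Longrightarrow> v \<in> spanned n"
proof (induction n arbitrary: v)
 case 0
 have "v X = v {} * (lowering 0 ^^ 0) (hw {} 0) X" for X
  using tensorsD[OF 0, of X] by auto
 hence "v = (\<lambda>X. v {} * (lowering 0 ^^ 0) (hw {} 0) X)" by (rule ext)
 thus ?case using spanned.scale[OF spanned.base[OF empty_ballot, of 0 0], of "v {}"] by simp
next
 case (Suc k)
 define v0 where "v0 = (\<lambda>X. if X \<subseteq> {1..k} then v X else 0)"
 define v1 where "v1 = (\<lambda>Z. if Z \<subseteq> {1..k} then v (insert (Suc k) Z) else 0)"
 have T: "v0 \<in> tensors k" "v1 \<in> tensors k" by (simp_all add: tensors_def v0_def v1_def)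
 have "v X = v0 X + extend k v1 X" for X
 proof (cases "X \<subseteq> {1..Suc k}")
  case True
  thus ?thesis
  proof (cases rule: subset_Suc_cases)
   case old
   thus ?thesis by (simp add: v0_def extend_def)
  next
   case (new Z)
   have "\<not> X \<subseteq> {1..k}" using new by auto
   thus ?thesis using new by (simp add: v0_def v1_def extend_def)
  qed
 next
  case False
  thus ?thesis
   using tensorsD[OF Suc.prems False] tensorsD[OF tensors_Suc[OF T(1)] False] tensorsD[OF extend_tensors[OF T(2)] False]
   by simp
 qed
 hence "v = (\<lambda>X. v0 X + extend k v1 X)" by (rule ext)
 thus ?case
  using spanned.add[of v0 "Suc k" "extend k v1"] spanned_Suc[OF Suc.IH[OF T(1)]] spanned_Suc[OF Suc.IH[OF T(2)]] by simp
qed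

text \<open>Every vector is a combination of the \<open>hw\<close> plus something lowered. If
  raising kills the vector, it also kills the lowered part, which is then orthogonal to itself by
  adjointness.\<close>

lemma highest_weight_combination:
 assumes v: "v \<in> tensors n" and r: "raising n v = (\<lambda>X. 0)"
 shows "\<exists>c. v = (\<lambda>X. \<Sum>Q\<in>ballot n. c Q * hw Q n X)"
proof -
 have "\<exists>c w. v = (\<lambda>X. (\<Sum>Q\<in>ballot n. c Q * hw Q n X) + lowering n w X)"
  using tensors_spanned[OF v]
 proof (induction rule: spanned.induct)
  case (base Q m)
  show ?case
  proof (cases m)
   case 0
   have "(\<Sum>P\<in>ballot n. (if P = Q then 1 else 0) * hw P n X) = hw Q n X" for X
   proof -
    have "(\<Sum>P\<in>ballot n. (if P = Q then 1 else 0) * hw P n X) = (\<Sum>P\<in>ballot n. if P = Q then hw Q n X else 0)"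
     by (intro sum.cong) auto
    thus ?thesis using base by simp
   qed
   thus ?thesis using 0
    by (intro exI[of _ "\<lambda>P. if P = Q then 1 else 0"] exI[of _ "\<lambda>X. 0"]) (simp add: lowering_linear(4) fun_eq_iff)
  next
   case (Suc j)
   thus ?thesis by (intro exI[of _ "\<lambda>P. 0"] exI[of _ "(lowering n ^^ j) (hw Q n)"]) simp
  qed
 next
  case (add v w)
  then obtain c w1 d w2 where
   1: "v = (\<lambda>X. (\<Sum>Q\<in>ballot n. c Q * hw Q n X) + lowering n w1 X)" and
   2: "w = (\<lambda>X. (\<Sum>Q\<in>ballot n. d Q * hw Q n X) + lowering n w2 X)" by blast
  show ?case
   by (intro exI[of _ "\<lambda>Q. c Q + d Q"] exI[of _ "\<lambda>X. w1 X + w2 X"])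
     (simp add: 1 2 lowering_linear fun_eq_iff algebra_simps sum.distrib)
 next
  case (scale v e)
  then obtain c w1 where 1: "v = (\<lambda>X. (\<Sum>Q\<in>ballot n. c Q * hw Q n X) + lowering n w1 X)" by blast
  show ?case
   by (intro exI[of _ "\<lambda>Q. e * c Q"] exI[of _ "\<lambda>X. e * w1 X"])
     (simp add: 1 lowering_linear fun_eq_iff algebra_simps sum_distrib_left)
 qed
 then obtain c w where vw: "v = (\<lambda>X. (\<Sum>Q\<in>ballot n. c Q * hw Q n X) + lowering n w X)" by blast
 let ?u = "lowering n w"
 have rs: "raising n (\<lambda>X. \<Sum>Q\<in>ballot n. c Q * hw Q n X) X = 0" for X
 proof -
  have "raising n (\<lambda>X. \<Sum>Q\<in>ballot n. c Q * hw Q n X) X = (\<Sum>Q\<in>ballot n. c Q * raising n (hw Q n) X)"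
   unfolding raising_def using sum.swap[of "\<lambda>i Q. c Q * hw Q n (insert i X)" "ballot n" "{1..n} - X"]
   by (simp add: sum_distrib_left)
  thus ?thesis by (simp add: raising_hw)
 qed
 have "raising n ?u X = 0" for X
  using fun_cong[OF r, of X] rs[of X] unfolding vw by (simp add: raising_linear)
 hence ru: "raising n ?u = (\<lambda>X. 0)" by (rule ext)
 have "scalar_prod n ?u ?u = scalar_prod n w (raising n ?u)" by (rule lowering_adjoint)
 hence "scalar_prod n ?u ?u = 0" unfolding ru by (simp add: scalar_prod_def)
 hence "?u = (\<lambda>X. 0)" by (intro scalar_prod_self[of n]) simp_all
 hence "v = (\<lambda>X. \<Sum>Q\<in>ballot n. c Q * hw Q n X)" using vw by (simp add: fun_eq_iff)
 thus ?thesis by blast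
qed

section \<open>Orthogonality and separation by contents\<close>

lemma jm_symmetric:
 assumes i: "i \<le> n"
 shows "scalar_prod n (jm i v) w = scalar_prod n v (jm i w)"
proof -
 have "(\<Sum>X\<in>Pow {1..n}. v (transpose j i ` X) * w X) = (\<Sum>X\<in>Pow {1..n}. v X * w (transpose j i ` X))"
  if j: "j \<in> {1..<i}" for j
 proof -
  have "transpose j i permutes {1..n}" using j i by (intro permutes_swap_id) auto
  hence im: "transpose j i ` {1..n} = {1..n}" by (rule permutes_image)
  show ?thesis
   by (rule sum.reindex_bij_witness[where i = "(`) (transpose j i)" and j = "(`) (transpose j i)"])
     (use im in \<open>auto simp: image_image\<close>)
 qed
 hence "(\<Sum>j\<in>{1..<i}. \<Sum>X\<in>Pow {1..n}. v (transpose j i ` X) * w X) =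
   (\<Sum>j\<in>{1..<i}. \<Sum>X\<in>Pow {1..n}. v X * w (transpose j i ` X))" by (rule sum.cong[OF refl])
 moreover have "scalar_prod n (jm i v) w = - (\<Sum>j\<in>{1..<i}. \<Sum>X\<in>Pow {1..n}. v (transpose j i ` X) * w X)"
  unfolding scalar_prod_def jm_def by (subst sum.swap) (simp add: sum_distrib_right sum_negf)
 moreover have "scalar_prod n v (jm i w) = - (\<Sum>j\<in>{1..<i}. \<Sum>X\<in>Pow {1..n}. v X * w (transpose j i ` X))"
  unfolding scalar_prod_def jm_def by (subst sum.swap) (simp add: sum_distrib_left sum_negf)
 ultimately show ?thesis by simp
qed

text \<open>At the first difference let c be the number of elements of \<open>P\<close> up to
  \<open>i\<close>. The two contents are 2 - c and c - i; equality would mean 2c = i + 2, against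
  the ballot condition 2c <= i.\<close>

lemma set_content_separates_aux:
 assumes P: "P \<in> ballot n" and i: "i \<in> P" "i \<notin> Q" and eq: "P \<inter> {1..<i} = Q \<inter> {1..<i}"
 shows "set_content P i \<noteq> set_content Q i"
proof -
 have in1: "i \<in> {1..n}" using P i by (auto simp: ballot_def)
 have "P \<inter> {1..i} = insert i (P \<inter> {1..<i})" using i in1 by auto
 hence cP: "card (P \<inter> {1..i}) = Suc (card (P \<inter> {1..<i}))" by simp
 have "{1..i} - Q = {1..i} - P \<inter> {1..<i}" unfolding eq using i by (auto simp: le_less)
 hence cQ: "card ({1..i} - Q) = i - card (P \<inter> {1..<i})" by (simp add: card_Diff_subset subset_iff)
 have "2 * card (P \<inter> {1..i}) \<le> i" using P in1 by (auto simp: ballot_def)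
 thus ?thesis unfolding set_content_def cP cQ using i by (simp add: cP of_nat_diff)
qed

lemma set_content_separates:
 assumes P: "P \<in> ballot n" and Q: "Q \<in> ballot n" and ne: "P \<noteq> Q"
 obtains i where "i \<in> {1..n}" "set_content P i \<noteq> set_content Q i"
proof -
 define i where "i = (LEAST i. (i \<in> P) \<noteq> (i \<in> Q))"
 have ex: "\<exists>i. (i \<in> P) \<noteq> (i \<in> Q)" using ne by blast
 have i: "(i \<in> P) \<noteq> (i \<in> Q)" unfolding i_def by (rule LeastI_ex[OF ex])
 have lt: "(j \<in> P) = (j \<in> Q)" if "j < i" for j using not_less_Least[of j "\<lambda>i. (i \<in> P) \<noteq> (i \<in> Q)"] that unfolding i_def by blast
 have eq: "P \<inter> {1..<i} = Q \<inter> {1..<i}" using lt by auto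
 have "i \<in> {1..n}" using i P Q by (auto simp: ballot_def)
 moreover have "set_content P i \<noteq> set_content Q i"
 proof (cases "i \<in> P")
  case True
  thus ?thesis using set_content_separates_aux[OF P True _ eq] i by blast
 next
  case False
  thus ?thesis using set_content_separates_aux[OF Q _ False eq[symmetric]] i by auto
 qed
 ultimately show thesis by (rule that)
qed

text \<open>Eigenvectors of a symmetric operator for different eigenvalues.\<close>

lemma hw_orthogonal:
 assumes P: "P \<in> ballot n" and Q: "Q \<in> ballot n" and ne: "P \<noteq> Q"
 shows "scalar_prod n (hw P n) (hw Q n) = 0"
proof -
 obtain i where i: "i \<in> {1..n}" "set_content P i \<noteq> set_content Q i" by (rule set_content_separates[OF P Q ne])
 have "jm i (hw P n) = (\<lambda>X. of_int (set_content P i) * hw P n X)" "jm i (hw Q n) = (\<lambda>X. of_int (set_content Q i) * hw Q n X)"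
  using jm_hw i(1) by (auto simp: fun_eq_iff)
 hence "of_int (set_content P i) * scalar_prod n (hw P n) (hw Q n) = of_int (set_content Q i) * scalar_prod n (hw P n) (hw Q n)"
  using jm_symmetric[of i n "hw P n" "hw Q n"] i(1)
  by (simp add: scalar_prod_def sum_distrib_left mult_ac)
 thus ?thesis using i(2) by simp
qed

text \<open>When an element is added, look at \<open>Z\<close> with the new strand inserted: both
  parts of \<open>hw\<close> give the value at \<open>Z\<close>, with coefficients height + 1 and
  -1. The height before a new element of a ballot set is not zero.\<close>

lemma hw_nonzero:
 assumes Q: "Q \<in> ballot n" and "k \<le> n"
 shows "\<exists>X. hw Q k X \<noteq> 0"
 using assms(2)
proof (induction k)
 case 0
 show ?case by (intro exI[of _ "{}"]) simp
next
 case (Suc k)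
 then obtain Z where Z: "hw Q k Z \<noteq> 0" by auto
 show ?case
 proof (cases "Suc k \<in> Q")
  case True
  have Zk: "Z \<subseteq> {1..k}" using tensorsD[OF hw_tensors] Z by blast
  hence fin: "finite Z" and nZ: "Suc k \<notin> Z" using finite_subset by auto
  let ?X = "insert (Suc k) Z"
  have X: "?X \<subseteq> {1..Suc k}" using Zk by auto
  have XZ: "?X - {Suc k} = Z" using nZ by auto
  have "hw Q k (?X - {i}) = 0" if "i \<in> Z" for i
   by (rule tensors_new[OF hw_tensors]) (use that nZ in auto)
  hence "lowering (Suc k) (hw Q k) ?X = hw Q k Z"
   using X XZ fin nZ unfolding lowering_def by simp
  hence v: "hw Q (Suc k) ?X = of_int (height Q k) * hw Q k Z"
   using True XZ by (simp add: extend_def algebra_simps)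
  have "2 * card (Q \<inter> {1..Suc k}) \<le> Suc k" using Q Suc.prems by (auto simp: ballot_def)
  hence "height Q k \<noteq> 0" using card_Int_Suc[of Q k] True unfolding height_def by simp
  thus ?thesis using v Z by (intro exI[of _ ?X]) simp
 qed (use Z in auto)
qed

lemma hw_norm: "Q \<in> ballot n \<Longrightarrow> scalar_prod n (hw Q n) (hw Q n) \<noteq> 0"
 using hw_nonzero[of Q n n] scalar_prod_self[OF _ hw_tensors, of n Q] by fastforce

section \<open>The matrix representation\<close>

definition mat :: "nat \<Rightarrow> (diagram \<Rightarrow> rat) \<Rightarrow> nat set \<Rightarrow> nat set \<Rightarrow> rat" where
 "mat n x P Q = scalar_prod n (hw P n) (act n x (hw Q n)) / scalar_prod n (hw P n) (hw P n)"

lemma scalar_prod_sum: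
 "scalar_prod n v (\<lambda>X. \<Sum>Q\<in>A. c Q * w Q X) = (\<Sum>Q\<in>A. c Q * scalar_prod n v (w Q))"
proof -
 have "scalar_prod n v (\<lambda>X. \<Sum>Q\<in>A. c Q * w Q X) = (\<Sum>X\<in>Pow {1..n}. \<Sum>Q\<in>A. c Q * (v X * w Q X))"
  by (simp add: scalar_prod_def sum_distrib_left mult_ac)
 also have "\<dots> = (\<Sum>Q\<in>A. \<Sum>X\<in>Pow {1..n}. c Q * (v X * w Q X))" by (rule sum.swap)
 finally show ?thesis by (simp add: scalar_prod_def sum_distrib_left)
qed

lemma scalar_prod_hw_sum:
 assumes P: "P \<in> ballot n"
 shows "scalar_prod n (hw P n) (\<lambda>X. \<Sum>Q\<in>ballot n. c Q * hw Q n X) = c P * scalar_prod n (hw P n) (hw P n)"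
proof -
 have "(\<Sum>Q\<in>ballot n. c Q * scalar_prod n (hw P n) (hw Q n)) =
   (\<Sum>Q\<in>ballot n. if Q = P then c P * scalar_prod n (hw P n) (hw P n) else 0)"
  using hw_orthogonal[OF P] by (intro sum.cong) auto
 thus ?thesis unfolding scalar_prod_sum using P by simp
qed

text \<open>The action commutes with raising and so preserves the space of highest weight vectors,
  where orthogonal projection reads off the coordinates.\<close>

lemma act_hw:
 shows "act n x (hw Q n) = (\<lambda>X. \<Sum>P\<in>ballot n. mat n x P Q * hw P n X)"
proof -
 have "raising n (act n x (hw Q n)) = act n x (\<lambda>X. 0)" unfolding act_raising[symmetric] raising_hw ..
 also have "\<dots> = (\<lambda>X. 0)" by (rule ext) (simp add: act_def)
 finally obtain c where c: "act n x (hw Q n) = (\<lambda>X. \<Sum>P\<in>ballot n. c P * hw P n X)"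
  using highest_weight_combination[OF act_tensors] by blast
 have "mat n x P Q = c P" if "P \<in> ballot n" for P
  unfolding mat_def c scalar_prod_hw_sum[OF that] using hw_norm[OF that] by simp
 thus ?thesis unfolding c by (intro ext sum.cong) simp_all
qed

lemma mat_unique:
 assumes "act n x (hw Q n) = (\<lambda>X. \<Sum>P\<in>ballot n. c P * hw P n X)" and P: "P \<in> ballot n"
 shows "mat n x P Q = c P"
 unfolding mat_def assms(1) scalar_prod_hw_sum[OF P] using hw_norm[OF P] by simp

lemma act_sum: "act n x (\<lambda>X. \<Sum>Q\<in>A. c Q * w Q X) X = (\<Sum>Q\<in>A. c Q * act n x (w Q) X)"
proof -
 have "act n x (\<lambda>X. \<Sum>Q\<in>A. c Q * w Q X) X = (\<Sum>Y\<in>Pow {1..n}. \<Sum>Q\<in>A. c Q * (rep n x X Y * w Q Y))"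
  by (simp add: act_def sum_distrib_left mult_ac)
 also have "\<dots> = (\<Sum>Q\<in>A. \<Sum>Y\<in>Pow {1..n}. c Q * (rep n x X Y * w Q Y))" by (rule sum.swap)
 finally show ?thesis by (simp add: act_def sum_distrib_left)
qed

lemma mat_mult:
 assumes "P \<in> ballot n"
 shows "mat n (x \<otimes>\<^bsub>TLQ n\<^esub> y) P Q = (\<Sum>S\<in>ballot n. mat n x P S * mat n y S Q)"
proof (rule mat_unique[OF _ assms])
 show "act n (x \<otimes>\<^bsub>TLQ n\<^esub> y) (hw Q n) = (\<lambda>X. \<Sum>P\<in>ballot n. (\<Sum>S\<in>ballot n. mat n x P S * mat n y S Q) * hw P n X)"
 proof
  fix X
  have "act n (x \<otimes>\<^bsub>TLQ n\<^esub> y) (hw Q n) X = (\<Sum>S\<in>ballot n. mat n y S Q * act n x (hw S n) X)"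
   unfolding act_mult act_hw[of n y] act_sum ..
  also have "\<dots> = (\<Sum>S\<in>ballot n. \<Sum>P\<in>ballot n. mat n x P S * mat n y S Q * hw P n X)"
   unfolding act_hw[of n x] sum_distrib_left by (intro sum.cong refl) simp
  also have "\<dots> = (\<Sum>P\<in>ballot n. \<Sum>S\<in>ballot n. mat n x P S * mat n y S Q * hw P n X)" by (rule sum.swap)
  finally show "act n (x \<otimes>\<^bsub>TLQ n\<^esub> y) (hw Q n) X = (\<Sum>P\<in>ballot n. (\<Sum>S\<in>ballot n. mat n x P S * mat n y S Q) * hw P n X)"
   by (simp add: sum_distrib_right)
 qed
qed

lemma scalar_prod_linear:
 "scalar_prod n u (\<lambda>X. v X + w X) = scalar_prod n u v + scalar_prod n u w"
 "scalar_prod n u (\<lambda>X. v X - w X) = scalar_prod n u v - scalar_prod n u w"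
 "scalar_prod n u (\<lambda>X. c * v X) = c * scalar_prod n u v"
 by (simp_all add: scalar_prod_def algebra_simps sum.distrib sum_subtractf sum_distrib_left)

lemma mat_add: "mat n (x \<oplus>\<^bsub>TLQ n\<^esub> y) P Q = mat n x P Q + mat n y P Q"
proof -
 have "act n (x \<oplus>\<^bsub>TLQ n\<^esub> y) (hw Q n) = (\<lambda>X. act n x (hw Q n) X + act n y (hw Q n) X)" by (rule ext) (rule act_linear)
 thus ?thesis unfolding mat_def by (simp add: scalar_prod_linear add_divide_distrib)
qed

lemma mat_smult: "mat n (c \<odot>\<^bsub>TLQ n\<^esub> x) P Q = c * mat n x P Q"
proof -
 have "act n (c \<odot>\<^bsub>TLQ n\<^esub> x) (hw Q n) = (\<lambda>X. c * act n x (hw Q n) X)" by (rule ext) (rule act_linear)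
 thus ?thesis unfolding mat_def by (simp add: scalar_prod_linear)
qed

lemma mat_minus:
 assumes "x \<in> carrier (TLQ n)" "y \<in> carrier (TLQ n)"
 shows "mat n (x \<ominus>\<^bsub>TLQ n\<^esub> y) P Q = mat n x P Q - mat n y P Q"
proof -
 have "act n (x \<ominus>\<^bsub>TLQ n\<^esub> y) (hw Q n) = (\<lambda>X. act n x (hw Q n) X - act n y (hw Q n) X)" by (rule ext) (rule act_minus[OF assms])
 thus ?thesis unfolding mat_def by (simp add: scalar_prod_linear diff_divide_distrib)
qed

lemma mat_zero: "mat n \<zero>\<^bsub>TLQ n\<^esub> P Q = 0"
 by (simp add: mat_def scalar_prod_def act_def rep_zero)

lemma mat_one:
 assumes "P \<in> ballot n" "Q \<in> ballot n"
 shows "mat n \<one>\<^bsub>TLQ n\<^esub> P Q = of_bool (P = Q)"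
 unfolding mat_def act_one[OF hw_tensors] using hw_orthogonal[OF assms] hw_norm[OF assms(1)] by auto

lemma mat_JM:
 assumes "P \<in> ballot n" "Q \<in> ballot n" "i \<in> {1..n}"
 shows "mat n (JM_TL n i) P Q = (if P = Q then of_int (set_content Q i) else 0)"
proof -
 have "act n (JM_TL n i) (hw Q n) = (\<lambda>X. of_int (set_content Q i) * hw Q n X)"
  using act_JM[OF hw_tensors, of i n Q] jm_hw[of i n Q] assms(3) by (simp add: fun_eq_iff)
 thus ?thesis
  unfolding mat_def using hw_orthogonal[OF assms(1,2)] hw_norm[OF assms(1)] by (auto simp: scalar_prod_linear)
qed

text \<open>The action also commutes with lowering, so its values on highest weight vectors
  determine it on all of tensor space, where \<open>rep\<close> is faithful.\<close>

lemma mat_faithful: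
 assumes x: "x \<in> carrier (TLQ n)" and y: "y \<in> carrier (TLQ n)"
  and eq: "\<And>P Q. P \<in> ballot n \<Longrightarrow> Q \<in> ballot n \<Longrightarrow> mat n x P Q = mat n y P Q"
 shows "x = y"
proof (rule rep_faithful[OF x y])
 have hw_eq: "act n x (hw Q n) = act n y (hw Q n)" if "Q \<in> ballot n" for Q
  unfolding act_hw using eq that by (intro ext sum.cong) simp_all
 have pow: "act n z ((lowering n ^^ m) v) = (lowering n ^^ m) (act n z v)" for z m v
  by (induction m) (simp_all add: act_lowering)
 have all: "act n x v = act n y v" if "v \<in> spanned n" for v
  using that
 proof (induction rule: spanned.induct)
  case (base Q m)
  thus ?case by (simp add: pow hw_eq)
 next
  case (add v w)
  show ?case by (rule ext) (simp add: act_linear add.IH)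
 next
  case (scale v c)
  show ?case by (rule ext) (simp add: act_linear scale.IH)
 qed
 fix X Y assume XY: "X \<subseteq> {1..n}" "Y \<subseteq> {1..n}"
 let ?v = "\<lambda>Z. if Z = Y then 1 else 0 :: rat"
 have "?v \<in> tensors n" using XY by (auto simp: tensors_def)
 hence "act n x ?v X = act n y ?v X" using all tensors_spanned by metis
 thus "rep n x X Y = rep n y X Y" using XY by (simp add: act_def if_distrib cong: if_cong)
qed

section \<open>Two-column tableaux as ballot sets\<close>

definition tab :: "nat \<Rightarrow> nat set \<Rightarrow> tableau" where
 "tab n Q = (\<lambda>i\<in>{1..n}. if i \<in> Q then (card (Q \<inter> {1..i}), 2) else (card ({1..i} - Q), 1))"

definition second_column :: "nat \<Rightarrow> tableau \<Rightarrow> nat set" where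
 "second_column n t = {i \<in> {1..n}. snd (t i) = 2}"

lemma snd_tab: "i \<in> {1..n} \<Longrightarrow> snd (tab n Q i) = (if i \<in> Q then 2 else 1)"
 by (simp add: tab_def)

lemma second_column_tab: "Q \<subseteq> {1..n} \<Longrightarrow> second_column n (tab n Q) = Q"
 by (auto simp: second_column_def tab_def)

lemma card_interval_Diff: "card ({1..i} - Q) = i - card (Q \<inter> {1..i})"
proof -
 have "{1..i} - Q = {1..i} - Q \<inter> {1..i}" by auto
 thus ?thesis by (simp add: card_Diff_subset)
qed

lemma card_Int_le: "card (Q \<inter> {1..i::nat}) \<le> i"
 using card_mono[of "{1..i}" "Q \<inter> {1..i}"] by simp

lemma card_Int_mono: "i \<le> j \<Longrightarrow> card (A \<inter> {1..i::nat}) \<le> card (A \<inter> {1..j})"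
 by (intro card_mono) auto

lemma card_Int_strict: "i < j \<Longrightarrow> j \<in> A \<Longrightarrow> card (A \<inter> {1..i::nat}) < card (A \<inter> {1..j})"
proof -
 assume "i < j" "j \<in> A"
 hence "j \<in> A \<inter> {1..j}" "j \<notin> A \<inter> {1..i}" "A \<inter> {1..i} \<subseteq> A \<inter> {1..j}" by auto
 thus ?thesis by (intro psubset_card_mono) auto
qed

lemma Diff_as_Int: "{1..i::nat} - Q = (- Q) \<inter> {1..i}"
 by auto

lemma content_tab:
 assumes "i \<in> {1..n}"
 shows "content (tab n Q) i = set_content Q i"
 using assms by (simp add: content_def set_content_def tab_def)

lemma Par2_nth_mono:
 assumes "sorted_wrt (\<ge>) l" "r' \<le> r" "r < length l"
 shows "(l ! r :: nat) \<le> l ! r'"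
 using assms sorted_wrt_iff_nth_less[of "(\<ge>)" l] by (cases "r' = r") auto

lemma Std2D:
 assumes t: "t \<in> Std2 n"
 obtains l where "l \<in> Par2 n" "t \<in> Std l" "sum_list l = n" "bij_betw t {1..n} (cells l)" "t \<in> extensional {1..n}"
  and "\<And>i j. i \<in> {1..n} \<Longrightarrow> j \<in> {1..n} \<Longrightarrow> fst (t i) = fst (t j) \<Longrightarrow> snd (t i) < snd (t j) \<Longrightarrow> i < j"
  and "\<And>i j. i \<in> {1..n} \<Longrightarrow> j \<in> {1..n} \<Longrightarrow> snd (t i) = snd (t j) \<Longrightarrow> fst (t i) < fst (t j) \<Longrightarrow> i < j"
proof -
 obtain l where l: "l \<in> Par2 n" "t \<in> Std l" using t by (auto simp: Std2_def)
 hence s: "sum_list l = n" by (simp add: Par2_def)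
 show thesis
  using l(2) unfolding Std_def s mem_Collect_eq by (intro that[OF l s]) blast+
qed

text \<open>Within a column the cells above an entry hold smaller entries and those below larger
  ones. Consequently the columns of the entries determine the whole tableau.\<close>

lemma Std2_row:
 assumes t: "t \<in> Std2 n" and i: "i \<in> {1..n}"
 shows "fst (t i) = card {j \<in> {1..i}. snd (t j) = snd (t i)}"
proof -
 obtain l where l: "l \<in> Par2 n" "sum_list l = n" "bij_betw t {1..n} (cells l)"
  and col: "\<And>i j. i \<in> {1..n} \<Longrightarrow> j \<in> {1..n} \<Longrightarrow> snd (t i) = snd (t j) \<Longrightarrow> fst (t i) < fst (t j) \<Longrightarrow> i < j"
  using Std2D[OF t] by metis
 have srt: "sorted_wrt (\<ge>) l" using l(1) by (simp add: Par2_def)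
 have ti: "t i \<in> cells l" using l(3) i by (auto simp: bij_betw_def)
 let ?J = "{j \<in> {1..i}. snd (t j) = snd (t i)}"
 have inj: "inj_on t {1..n}" using l(3) by (simp add: bij_betw_def)
 have "bij_betw (fst \<circ> t) ?J {1..fst (t i)}"
  unfolding bij_betw_def
 proof
  show "inj_on (fst \<circ> t) ?J"
  proof (rule inj_onI)
   fix x y assume "x \<in> ?J" "y \<in> ?J" "(fst \<circ> t) x = (fst \<circ> t) y"
   hence "t x = t y" "x \<in> {1..n}" "y \<in> {1..n}" using i by (auto simp: prod_eq_iff)
   thus "x = y" using inj by (auto dest: inj_onD)
  qed
  show "(fst \<circ> t) ` ?J = {1..fst (t i)}"
  proof (intro equalityI subsetI)
   fix r assume "r \<in> (fst \<circ> t) ` ?J"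
   then obtain j where j: "j \<in> {1..i}" "snd (t j) = snd (t i)" "r = fst (t j)" by auto
   hence jn: "j \<in> {1..n}" using i by auto
   hence "t j \<in> cells l" using l(3) by (auto simp: bij_betw_def)
   hence "1 \<le> r" using j by (auto simp: cells_def)
   moreover have "\<not> fst (t i) < fst (t j)" using col[OF i jn] j by auto
   ultimately show "r \<in> {1..fst (t i)}" using j by simp
  next
   fix r assume r: "r \<in> {1..fst (t i)}"
   have "l ! (fst (t i) - 1) \<le> l ! (r - 1)"
    using ti r by (intro Par2_nth_mono[OF srt]) (auto simp: cells_def)
   hence "(r, snd (t i)) \<in> cells l" using ti r by (auto simp: cells_def)
   hence "(r, snd (t i)) \<in> t ` {1..n}" using l(3) by (simp add: bij_betw_def)
   then obtain j where j: "j \<in> {1..n}" "t j = (r, snd (t i))" by (metis imageE)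
   have "j \<le> i"
   proof (cases "r = fst (t i)")
    case True
    hence "t j = t i" using j by simp
    thus ?thesis using inj i j(1) by (auto dest: inj_onD)
   next
    case False
    thus ?thesis using col[OF j(1) i] j r by auto
   qed
   thus "r \<in> (fst \<circ> t) ` ?J" using j by (intro image_eqI[of _ _ j]) auto
  qed
 qed
 thus ?thesis by (simp add: bij_betw_same_card)
qed

text \<open>Every entry of the second column has a smaller left neighbour in the first; sending it
  there is an injection that proves the ballot condition.\<close>

lemma Std2_ballot:
 assumes t: "t \<in> Std2 n"
 shows "second_column n t \<in> ballot n" and "t = tab n (second_column n t)"
proof -
 let ?Q = "second_column n t"
 obtain l where l: "l \<in> Par2 n" "sum_list l = n" "bij_betw t {1..n} (cells l)" "t \<in> extensional {1..n}"
  and row: "\<And>i j. i \<in> {1..n} \<Longrightarrow> j \<in> {1..n} \<Longrightarrow> fst (t i) = fst (t j) \<Longrightarrow> snd (t i) < snd (t j) \<Longrightarrow> i < j"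
  using Std2D[OF t] by metis
 have snds: "snd (t i) = 1 \<or> snd (t i) = 2" if "i \<in> {1..n}" for i
 proof -
  have "t i \<in> cells l" using l(3) that by (auto simp: bij_betw_def)
  hence c: "1 \<le> snd (t i)" "snd (t i) \<le> l ! (fst (t i) - 1)" "fst (t i) - 1 < length l"
   by (auto simp: cells_def)
  hence "l ! (fst (t i) - 1) \<in> set l" by simp
  hence "l ! (fst (t i) - 1) \<le> 2" using l(1) by (auto simp: Par2_def)
  thus ?thesis using c by linarith
 qed
 show "t = tab n ?Q"
 proof
  fix i
  show "t i = tab n ?Q i"
  proof (cases "i \<in> {1..n}")
   case i: True
   show ?thesis
   proof (cases "snd (t i) = 2")
    case True
    have "{j \<in> {1..i}. snd (t j) = snd (t i)} = ?Q \<inter> {1..i}" using True i by (auto simp: second_column_def)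
    moreover have "i \<in> ?Q" using i True by (simp add: second_column_def)
    ultimately show ?thesis using Std2_row[OF t i] i True unfolding tab_def by (simp add: prod_eq_iff)
   next
    case False
    hence 1: "snd (t i) = 1" using snds i by blast
    have "{j \<in> {1..i}. snd (t j) = snd (t i)} = {1..i} - ?Q"
    proof (intro equalityI subsetI)
     fix j assume j: "j \<in> {1..i} - ?Q"
     hence "j \<in> {1..n}" using i by auto
     thus "j \<in> {j \<in> {1..i}. snd (t j) = snd (t i)}" using snds[of j] j 1 by (auto simp: second_column_def)
    qed (use 1 in \<open>auto simp: second_column_def\<close>)
    moreover have "i \<notin> ?Q" using False by (simp add: second_column_def)
    ultimately show ?thesis using Std2_row[OF t i] i 1 unfolding tab_def by (simp add: prod_eq_iff)
   qed
  next
   case False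
   thus ?thesis using l(4) unfolding tab_def by (auto simp: extensional_def)
  qed
 qed
 have inj: "inj_on t {1..n}" using l(3) by (simp add: bij_betw_def)
 have "\<forall>i\<in>?Q. \<exists>j. j \<in> {1..n} \<and> t j = (fst (t i), 1)"
 proof
  fix i assume "i \<in> ?Q"
  hence "i \<in> {1..n}" "snd (t i) = 2" by (auto simp: second_column_def)
  hence "t i \<in> cells l" "snd (t i) = 2" using l(3) by (auto simp: bij_betw_def)
  hence "(fst (t i), 1) \<in> cells l" by (auto simp: cells_def)
  hence "(fst (t i), 1) \<in> t ` {1..n}" using l(3) by (simp add: bij_betw_def)
  thus "\<exists>j. j \<in> {1..n} \<and> t j = (fst (t i), 1)" by (metis imageE)
 qed
 then obtain g where g: "\<And>i. i \<in> ?Q \<Longrightarrow> g i \<in> {1..n} \<and> t (g i) = (fst (t i), 1)" using bchoice[of ?Q] by meson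
 have "2 * card (?Q \<inter> {1..m}) \<le> m" if m: "m \<le> n" for m
 proof -
  have "card (?Q \<inter> {1..m}) \<le> card ({1..m} - ?Q)"
  proof (rule card_inj_on_le[of g])
   show "inj_on g (?Q \<inter> {1..m})"
   proof (rule inj_onI)
    fix x y assume xy: "x \<in> ?Q \<inter> {1..m}" "y \<in> ?Q \<inter> {1..m}" "g x = g y"
    hence "fst (t x) = fst (t y)" using g[of x] g[of y] by simp
    hence "t x = t y" using xy by (auto simp: second_column_def prod_eq_iff)
    thus "x = y" using xy inj by (auto simp: second_column_def dest: inj_onD)
   qed
   show "g ` (?Q \<inter> {1..m}) \<subseteq> {1..m} - ?Q"
   proof
    fix j assume "j \<in> g ` (?Q \<inter> {1..m})"
    then obtain i where i: "i \<in> ?Q" "i \<le> m" "j = g i" by auto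
    hence "i \<in> {1..n}" "snd (t i) = 2" by (auto simp: second_column_def)
    hence "j < i" using row[of j i] g[OF i(1)] i(3) by simp
    thus "j \<in> {1..m} - ?Q" using g[OF i(1)] i by (auto simp: second_column_def)
   qed
  qed simp
  thus ?thesis unfolding card_interval_Diff by linarith
 qed
 thus "?Q \<in> ballot n" by (auto simp: ballot_def second_column_def)
qed

lemma ballotD: "Q \<in> ballot n \<Longrightarrow> m \<le> n \<Longrightarrow> 2 * card (Q \<inter> {1..m}) \<le> m"
 by (simp add: ballot_def)

lemma ballot_subset: "Q \<in> ballot n \<Longrightarrow> Q \<subseteq> {1..n}"
 by (simp add: ballot_def)

lemma inj_on_tab: "inj_on (tab n Q) {1..n}"
proof (rule inj_onI)
 fix x y assume xy: "x \<in> {1..n}" "y \<in> {1..n}" "tab n Q x = tab n Q y"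
 have "snd (tab n Q x) = snd (tab n Q y)" by (simp only: xy(3))
 hence same: "x \<in> Q \<longleftrightarrow> y \<in> Q" unfolding snd_tab[OF xy(1)] snd_tab[OF xy(2)] by (simp split: if_splits)
 define A where "A = (if x \<in> Q then Q else - Q)"
 have fsts: "fst (tab n Q x) = fst (tab n Q y)" by (simp only: xy(3))
 have "card (A \<inter> {1..x}) = card (A \<inter> {1..y})"
  using fsts same xy(1,2) unfolding tab_def A_def Diff_as_Int by (simp split: if_splits)
 moreover have "x \<in> A" "y \<in> A" using same by (auto simp: A_def)
 ultimately show "x = y" using card_Int_strict[of x y A] card_Int_strict[of y x A] by (metis less_irrefl linorder_neqE_nat)
qed

lemma tab_Std:
 assumes Q: "Q \<in> ballot n"
 shows "\<exists>l\<in>Par2 n. tab n Q \<in> Std l"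
proof -
 define a where "a = card Q"
 \<comment> \<open>The row lengths of the shape with columns of lengths \<open>n - a\<close> and
   \<open>a\<close>.\<close>
 define l where "l = replicate a 2 @ replicate (n - 2 * a) (1::nat)"
 have sub: "Q \<subseteq> {1..n}" by (rule ballot_subset[OF Q])
 hence Qn: "Q \<inter> {1..n} = Q" by blast
 have a2: "2 * a \<le> n" using ballotD[OF Q order_refl] unfolding Qn a_def .
 have sum: "sum_list l = n" using a2 by (simp add: l_def sum_list_replicate)
 have srt: "sorted_wrt (\<ge>) l" by (auto simp: l_def sorted_wrt_iff_nth_less nth_append)
 have Par: "l \<in> Par2 n" unfolding Par2_def using sum srt by (auto simp: l_def)
 have nth: "l ! (r - 1) = (if r \<le> a then 2 else 1)" if "1 \<le> r" "r \<le> length l" for r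
  using that by (auto simp: l_def nth_append)
 have len: "length l = n - a" using a2 by (simp add: l_def)
 have cells: "cells l = {1..a} \<times> {2} \<union> {1..n - a} \<times> {1}"
 proof (intro equalityI subsetI)
  fix x assume "x \<in> cells l"
  hence x: "1 \<le> fst x" "fst x \<le> length l" "1 \<le> snd x" "snd x \<le> l ! (fst x - 1)" by (auto simp: cells_def)
  hence "snd x \<le> (if fst x \<le> a then 2 else 1)" using nth[of "fst x"] by simp
  hence "(snd x = 1) \<or> (snd x = 2 \<and> fst x \<le> a)" using x by (auto split: if_splits)
  thus "x \<in> {1..a} \<times> {2} \<union> {1..n - a} \<times> {1}" using x len by (cases x) auto
 next
  fix x assume "x \<in> {1..a} \<times> {2::nat} \<union> {1..n - a} \<times> {1::nat}"
  thus "x \<in> cells l" using a2 len nth[of "fst x"] by (cases x) (auto simp: cells_def)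
 qed
 have img: "tab n Q ` {1..n} \<subseteq> cells l"
 proof
  fix x assume "x \<in> tab n Q ` {1..n}"
  then obtain i where i: "i \<in> {1..n}" "x = tab n Q i" by blast
  show "x \<in> cells l"
  proof (cases "i \<in> Q")
   case True
   have "0 < card (Q \<inter> {1..i})" using True i by (auto simp: card_gt_0_iff)
   moreover have "card (Q \<inter> {1..i}) \<le> a" using card_Int_mono[of i n Q] i unfolding Qn a_def by simp
   ultimately show ?thesis unfolding cells using i True by (simp add: tab_def)
  next
   case False
   have "0 < card ({1..i} - Q)" using False i by (auto simp: card_gt_0_iff)
   moreover have "card ({1..i} - Q) \<le> card ({1..n} - Q)" using i by (intro card_mono) auto
   moreover have "card ({1..n} - Q) = n - a" unfolding card_interval_Diff Qn a_def ..
   ultimately show ?thesis unfolding cells using i False by (simp add: tab_def)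
  qed
 qed
 have "card (cells l) = a + (n - a)" unfolding cells by (subst card_Un_disjoint) (auto simp: card_cartesian_product)
 hence cc: "card (cells l) = n" using a2 by simp
 have "finite (cells l)" unfolding cells by simp
 hence surj: "tab n Q ` {1..n} = cells l"
  using img card_image[OF inj_on_tab[of n Q]] cc by (intro card_subset_eq) auto
 have "tab n Q \<in> Std l" unfolding Std_def sum
 proof (intro CollectI conjI ballI)
  show "tab n Q \<in> extensional {1..n}" by (simp add: tab_def)
  show "bij_betw (tab n Q) {1..n} (cells l)" using inj_on_tab surj by (simp add: bij_betw_def)
  fix i j assume i: "i \<in> {1..n}" and j: "j \<in> {1..n}"
  show "fst (tab n Q i) = fst (tab n Q j) \<and> snd (tab n Q i) < snd (tab n Q j) \<longrightarrow> i < j"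
  proof (intro impI, elim conjE)
   assume f: "fst (tab n Q i) = fst (tab n Q j)" and s: "snd (tab n Q i) < snd (tab n Q j)"
   have ij: "i \<notin> Q" "j \<in> Q" using s i j by (auto simp: snd_tab split: if_splits)
   have e: "card ({1..i} - Q) = card (Q \<inter> {1..j})" using f i j ij by (simp add: tab_def)
   \<comment> \<open>Otherwise the first column would be strictly longer up to \<open>i\<close> than
     up to \<open>j\<close>, where by the ballot condition it is already at least as long as the
     second.\<close>
   show "i < j"
   proof (rule ccontr)
    assume "\<not> i < j"
    hence "j < i" using ij by (metis linorder_neqE_nat)
    hence "card ({1..j} - Q) < card ({1..i} - Q)" unfolding Diff_as_Int using ij by (intro card_Int_strict) auto
    moreover have "card (Q \<inter> {1..j}) \<le> card ({1..j} - Q)"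
     using ballotD[OF Q, of j] j unfolding card_interval_Diff by simp
    ultimately show False using e by simp
   qed
  qed
  show "snd (tab n Q i) = snd (tab n Q j) \<and> fst (tab n Q i) < fst (tab n Q j) \<longrightarrow> i < j"
  proof (intro impI, elim conjE)
   assume s: "snd (tab n Q i) = snd (tab n Q j)" and f: "fst (tab n Q i) < fst (tab n Q j)"
   have same: "i \<in> Q \<longleftrightarrow> j \<in> Q" using s unfolding snd_tab[OF i] snd_tab[OF j] by (simp split: if_splits)
   define A where "A = (if i \<in> Q then Q else - Q)"
   have "card (A \<inter> {1..i}) < card (A \<inter> {1..j})"
    using f i j same unfolding tab_def A_def Diff_as_Int by (simp split: if_splits)
   thus "i < j" using card_Int_mono[of j i A] by (meson leD not_le_imp_less)
  qed
 qed
 thus ?thesis using Par by blast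
qed

lemma Std2_eq: "Std2 n = tab n ` ballot n"
proof (intro equalityI subsetI)
 fix t assume "t \<in> Std2 n"
 thus "t \<in> tab n ` ballot n" using Std2_ballot by blast
next
 fix t assume "t \<in> tab n ` ballot n"
 thus "t \<in> Std2 n" using tab_Std unfolding Std2_def by blast
qed

lemma tab_Std2: "Q \<in> ballot n \<Longrightarrow> tab n Q \<in> Std2 n"
 by (simp add: Std2_eq)

lemma tab_eq_iff: "P \<subseteq> {1..n} \<Longrightarrow> Q \<subseteq> {1..n} \<Longrightarrow> tab n P = tab n Q \<longleftrightarrow> P = Q"
 using second_column_tab by metis

lemma inj_on_tab_ballot: "inj_on (tab n) (ballot n)"
 using tab_eq_iff ballot_subset by (auto simp: inj_on_def)

lemma transpose_adjacent_count:
 fixes k i :: nat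
 assumes "i \<noteq> k" and that: "k \<ge> 1"
 shows "card (transpose k (k + 1) ` Q \<inter> {1..i}) = card (Q \<inter> {1..i})"
proof -
 let ?s = "transpose k (k + 1)"
 have "?s ` {1..i} = {1..i}"
  using assms that by (intro transpose_image_eq) auto
 hence "?s ` Q \<inter> {1..i} = ?s ` (Q \<inter> {1..i})" by (subst image_Int) auto
 thus ?thesis by (simp add: card_image)
qed

lemma swap_entries_tab:
 assumes k: "k \<in> {1..<n}" and Q: "Q \<subseteq> {1..n}" and x: "k \<in> Q \<longleftrightarrow> k + 1 \<notin> Q"
 shows "swap_entries (tab n Q) k = tab n (transpose k (k + 1) ` Q)"
proof
 fix i
 let ?s = "transpose k (k + 1)" let ?R = "?s ` Q"
 have mem: "?s j \<in> ?R \<longleftrightarrow> j \<in> Q" for j by (rule inj_image_mem_iff) simp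
 have mem': "j \<in> ?R \<longleftrightarrow> ?s j \<in> Q" for j using mem[of "?s j"] by simp
 show "swap_entries (tab n Q) k i = tab n ?R i"
 proof (cases "i \<in> {1..n}")
  case i: True
  obtain k' where k': "k = Suc k'" using k by (cases k) auto
  have c0: "card (?R \<inter> {1..k'}) = card (Q \<inter> {1..k'})" using transpose_adjacent_count[of k' k Q] k k' by simp
  have c1: "card (?R \<inter> {1..Suc k'}) = card (Q \<inter> {1..k'}) + of_bool (k + 1 \<in> Q)"
   using card_Int_Suc[of ?R k'] c0 mem'[of k] k' by simp
  have d0: "card (Q \<inter> {1..k}) = card (Q \<inter> {1..k'}) + of_bool (k \<in> Q)"
   using card_Int_Suc[of Q k'] k' by simp
  have d1: "card (Q \<inter> {1..Suc k}) = card (Q \<inter> {1..k'}) + 1"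
   using card_Int_Suc[of Q k] d0 x by (auto simp: of_bool_def)
  have d2: "card (?R \<inter> {1..Suc k}) = card (Q \<inter> {1..k'}) + 1"
   using transpose_adjacent_count[of "Suc k" k Q] k d1 by simp
  define q where "q = card (Q \<inter> {1..k'})"
  have C: "card (?R \<inter> {1..k}) = q + of_bool (k + 1 \<in> Q)" "card (Q \<inter> {1..k}) = q + of_bool (k \<in> Q)"
   "card (Q \<inter> {1..k + 1}) = q + 1" "card (?R \<inter> {1..k + 1}) = q + 1"
   using c1 d0 d1 d2 unfolding q_def k' by simp_all
  have R: "k \<in> ?R \<longleftrightarrow> k + 1 \<in> Q" "k + 1 \<in> ?R \<longleftrightarrow> k \<in> Q" using mem'[of k] mem'[of "k + 1"] by simp_all
  have kn: "k \<in> {1..n}" "k + 1 \<in> {1..n}" using k by auto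
  consider "i = k" | "i = k + 1" | "i \<noteq> k" "i \<noteq> k + 1" by blast
  thus ?thesis
  proof cases
   case 1
   have "tab n Q (k + 1) = tab n ?R k"
    unfolding tab_def restrict_apply if_P[OF kn(1)] if_P[OF kn(2)] R card_interval_Diff C
    using x by (cases "k \<in> Q") simp_all
   thus ?thesis using 1 by (simp add: swap_entries_def)
  next
   case 2
   have "tab n Q k = tab n ?R (k + 1)"
    unfolding tab_def restrict_apply if_P[OF kn(1)] if_P[OF kn(2)] R card_interval_Diff C
    using x by (cases "k \<in> Q") simp_all
   thus ?thesis using 2 by (simp add: swap_entries_def)
  next
   case 3
   hence "?s i = i" by simp
   thus ?thesis
    using i mem'[of i] transpose_adjacent_count[of i k Q] 3 k
    by (simp add: swap_entries_def tab_def card_interval_Diff del: One_nat_def)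
  qed
 next
  case False
  hence "?s i = i" using k by (auto simp: transpose_def)
  hence "swap_entries (tab n Q) k i = tab n Q i" by (simp add: swap_entries_def)
  thus ?thesis unfolding tab_def restrict_apply if_not_P[OF False] .
 qed
qed

lemma swap_entries_Std2:
 assumes k: "k \<in> {1..<n}" and Q: "Q \<in> ballot n"
 shows "swap_entries (tab n Q) k \<in> Std2 n \<longleftrightarrow>
  (k \<in> Q \<longleftrightarrow> k + 1 \<notin> Q) \<and> transpose k (k + 1) ` Q \<in> ballot n"
proof
 let ?s = "transpose k (k + 1)"
 assume t: "swap_entries (tab n Q) k \<in> Std2 n"
 have per: "?s permutes {1..n}" using k by (intro permutes_swap_id) auto
 have "second_column n (swap_entries (tab n Q) k) = ?s ` Q"
 proof (rule Set.set_eqI)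
  fix j
  have "j \<in> ?s ` Q \<longleftrightarrow> ?s j \<in> Q" using inj_image_mem_iff[of ?s "?s j" Q] by simp
  moreover have "j \<in> {1..n} \<longleftrightarrow> ?s j \<in> {1..n}" using permutes_in_image[OF per] by simp
  ultimately show "j \<in> second_column n (swap_entries (tab n Q) k) \<longleftrightarrow> j \<in> ?s ` Q"
   using snd_tab[of "?s j" n Q] ballot_subset[OF Q] by (auto simp: second_column_def swap_entries_def)
 qed
 hence b: "?s ` Q \<in> ballot n" "swap_entries (tab n Q) k = tab n (?s ` Q)"
  using Std2_ballot[OF t] by simp_all
 moreover have "k \<in> Q \<longleftrightarrow> k + 1 \<notin> Q"
 proof (rule ccontr)
  assume "\<not> (k \<in> Q \<longleftrightarrow> k + 1 \<notin> Q)"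
  hence "?s ` Q = Q" by (intro transpose_image_eq) blast
  \<comment> \<open>With both entries in one column the second column is unchanged, so the exchanged
    tableau would be the old one, against injectivity.\<close>
  hence "tab n Q (?s k) = tab n Q k" using b(2) by (simp add: swap_entries_def fun_eq_iff) (metis transpose_apply_first)
  hence "tab n Q (k + 1) = tab n Q k" by simp
  thus False using inj_onD[OF inj_on_tab, of n Q "k + 1" k] k by auto
 qed
 ultimately show "(k \<in> Q \<longleftrightarrow> k + 1 \<notin> Q) \<and> ?s ` Q \<in> ballot n" by blast
next
 assume "(k \<in> Q \<longleftrightarrow> k + 1 \<notin> Q) \<and> transpose k (k + 1) ` Q \<in> ballot n"
 thus "swap_entries (tab n Q) k \<in> Std2 n"
  using swap_entries_tab[OF k ballot_subset[OF Q]] tab_Std2 by simp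
qed

text \<open>Exchanging entries keeps the set of cells, so a standard result has the old
  shape.\<close>

lemma Std_swap_iff:
 assumes l: "l \<in> Par2 n" and s: "s \<in> Std l" and k: "k \<in> {1..<n}"
 shows "swap_entries s k \<in> Std l \<longleftrightarrow> swap_entries s k \<in> Std2 n"
proof
 assume t: "swap_entries s k \<in> Std2 n"
 let ?t = "swap_entries s k"
 have n: "sum_list l = n" using l by (simp add: Par2_def)
 obtain l' where l': "l' \<in> Par2 n" "?t \<in> Std l'" using t by (auto simp: Std2_def)
 hence n': "sum_list l' = n" by (simp add: Par2_def)
 have per: "transpose k (k + 1) permutes {1..n}" using k by (intro permutes_swap_id) auto
 have "cells l' = ?t ` {1..n}" using l'(2) n' by (auto simp: Std_def bij_betw_def)
 also have "\<dots> = s ` {1..n}" unfolding swap_entries_def image_comp[symmetric] permutes_image[OF per] ..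
 also have "\<dots> = cells l" using s n by (auto simp: Std_def bij_betw_def)
 finally show "?t \<in> Std l" using l'(2) unfolding Std_def n n' by simp
qed (use l in \<open>auto simp: Std2_def\<close>)

section \<open>The idempotents as diagonal matrix units\<close>

lemma finite_contents: "finite (contents N)"
proof -
 have "contents N \<subseteq> (\<lambda>(Q, i). set_content Q i) ` (ballot N \<times> {1..N})"
 proof
  fix x assume "x \<in> contents N"
  then obtain Q i where "Q \<in> ballot N" "i \<in> {1..N}" "x = set_content Q i"
   unfolding contents_def Std2_eq by (auto simp: content_tab)
  thus "x \<in> (\<lambda>(Q, i). set_content Q i) ` (ballot N \<times> {1..N})"
   by (intro image_eqI[of _ _ "(Q, i)"]) simp_all
 qed
 thus ?thesis by (rule finite_subset) simp
qed

lemma set_content_in_contents: "Q \<in> ballot N \<Longrightarrow> i \<in> {1..N} \<Longrightarrow> set_content Q i \<in> contents N"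
 unfolding contents_def using tab_Std2[of Q N] content_tab[of i N Q] by (metis (mono_tags, lifting) mem_Collect_eq)

lemma list_mult_closed:
 "set xs \<subseteq> carrier (TLQ n) \<Longrightarrow> list_mult (TLQ n) xs \<in> carrier (TLQ n)"
 by (induction xs) (auto simp: list_mult_def one_in_carrier intro: TL_mult_closed)

lemma list_mult_Cons: "list_mult (TLQ n) (x # xs) = x \<otimes>\<^bsub>TLQ n\<^esub> list_mult (TLQ n) xs"
 by (simp add: list_mult_def)

lemma list_mult_Nil: "list_mult (TLQ n) [] = \<one>\<^bsub>TLQ n\<^esub>"
 by (simp add: list_mult_def)

lemma mat_list_mult_diag:
 assumes "\<And>x P Q. x \<in> set xs \<Longrightarrow> P \<in> ballot n \<Longrightarrow> Q \<in> ballot n \<Longrightarrow> mat n x P Q = (if P = Q then d x Q else 0)"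
  and "P \<in> ballot n" "Q \<in> ballot n"
 shows "mat n (list_mult (TLQ n) xs) P Q = (if P = Q then (\<Prod>x\<leftarrow>xs. d x Q) else 0)"
 using assms
proof (induction xs arbitrary: P Q)
 case Nil
 thus ?case by (simp add: list_mult_Nil mat_one)
next
 case (Cons x xs)
 have "mat n (list_mult (TLQ n) (x # xs)) P Q = (\<Sum>S\<in>ballot n. mat n x P S * mat n (list_mult (TLQ n) xs) S Q)"
  unfolding list_mult_Cons by (rule mat_mult[OF Cons.prems(2)])
 also have "\<dots> = (\<Sum>S\<in>ballot n. if S = P then d x P * (if P = Q then (\<Prod>x\<leftarrow>xs. d x Q) else 0) else 0)"
  using Cons.IH Cons.prems by (intro sum.cong refl) simp
 finally show ?case using Cons.prems(2) by simp
qed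

text \<open>The index pairs are separated from the factors so that the scalars by which the factors
  act can be multiplied along the same list.\<close>

definition EE_list :: "nat \<Rightarrow> tableau \<Rightarrow> (int \<times> nat) list" where
 "EE_list N t = [(c, i). c \<leftarrow> sorted_list_of_set (contents N), i \<leftarrow> [1..<N + 1], c \<noteq> content t i]"

definition EE_factor :: "nat \<Rightarrow> tableau \<Rightarrow> int \<times> nat \<Rightarrow> diagram \<Rightarrow> rat" where
 "EE_factor N t = (\<lambda>(c, i). (1 / of_int (content t i - c)) \<odot>\<^bsub>TLQ N\<^esub>
    (JM_TL N i \<ominus>\<^bsub>TLQ N\<^esub> of_int c \<odot>\<^bsub>TLQ N\<^esub> \<one>\<^bsub>TLQ N\<^esub>))"

lemma EE_eq_list_mult: "EE N t = list_mult (TLQ N) (map (EE_factor N t) (EE_list N t))"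
 unfolding EE_def EE_list_def EE_factor_def by (simp add: map_concat comp_def if_distrib del: upt_Suc of_int_diff cong: if_cong)

lemma set_EE_list: "set (EE_list N t) = {(c, i). c \<in> contents N \<and> i \<in> {1..N} \<and> c \<noteq> content t i}"
 unfolding EE_list_def by (auto simp: finite_contents)

lemma EE_factor_closed: "i \<le> N \<Longrightarrow> EE_factor N t (c, i) \<in> carrier (TLQ N)"
 unfolding EE_factor_def
 by (simp add: smult_closed one_in_carrier JM_TL_closed)

lemma EE_closed: "EE N t \<in> carrier (TLQ N)"
 unfolding EE_eq_list_mult by (rule list_mult_closed) (auto simp: set_EE_list intro: EE_factor_closed)

lemma mat_EE_factor:
 assumes "P \<in> ballot N" "Q \<in> ballot N" "i \<in> {1..N}"
 shows "mat N (EE_factor N t (c, i)) P Q =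
  (if P = Q then of_int (set_content Q i - c) / of_int (content t i - c) else 0)"
 using assms(3) unfolding EE_factor_def
 by (simp add: mat_smult mat_minus JM_TL_closed smult_closed one_in_carrier mat_JM[OF assms] mat_one[OF assms(1,2)])

text \<open>Interpolation: for \<open>P = S\<close> every factor is 1. Otherwise some entry
  \<open>i\<close> has different contents, and the factor with c the content of \<open>P\<close> at
  \<open>i\<close> is zero.\<close>

lemma EE_coefficient:
 assumes P: "P \<in> ballot N" and S: "S \<in> ballot N"
 shows "(\<Prod>(c, i)\<leftarrow>EE_list N (tab N S). of_int (set_content P i - c) / of_int (content (tab N S) i - c)) =
  (if P = S then 1 else 0 :: rat)"
proof (cases "P = S")
 case True
 have "(\<Prod>x\<leftarrow>xs. case x of (c, i) \<Rightarrow> of_int (set_content P i - c) / of_int (content (tab N S) i - c)) = (1::rat)"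
  if "set xs \<subseteq> set (EE_list N (tab N S))" for xs
  using that by (induction xs) (auto simp: set_EE_list content_tab True)
 thus ?thesis using True by auto
next
 case False
 obtain i where i: "i \<in> {1..N}" "set_content P i \<noteq> set_content S i" by (rule set_content_separates[OF P S False])
 hence "(set_content P i, i) \<in> set (EE_list N (tab N S))"
  using set_content_in_contents[OF P i(1)] by (simp add: set_EE_list content_tab)
 hence "0 \<in> set (map (\<lambda>(c, i). of_int (set_content P i - c) / of_int (content (tab N S) i - c) :: rat) (EE_list N (tab N S)))"
  by force
 thus ?thesis using False by (simp only: prod_list_zero_iff if_False)
qed

lemma mat_EE:
 assumes P: "P \<in> ballot N" and Q: "Q \<in> ballot N" and S: "S \<in> ballot N"
 shows "mat N (EE N (tab N S)) P Q = (if P = Q \<and> Q = S then 1 else 0)"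
proof -
 let ?t = "tab N S"
 define d where "d = (\<lambda>x Q. mat N x Q Q)"
 have "mat N (EE N ?t) P Q = (if P = Q then (\<Prod>x\<leftarrow>map (EE_factor N ?t) (EE_list N ?t). d x Q) else 0)"
  unfolding EE_eq_list_mult
 proof (rule mat_list_mult_diag[OF _ P Q])
  fix x P Q assume x: "x \<in> set (map (EE_factor N ?t) (EE_list N ?t))" and PQ: "P \<in> ballot N" "Q \<in> ballot N"
  obtain c i where "x = EE_factor N ?t (c, i)" "i \<in> {1..N}" using x by (auto simp: set_EE_list)
  thus "mat N x P Q = (if P = Q then d x Q else 0)"
   using mat_EE_factor[OF PQ] mat_EE_factor[OF PQ(2,2)] unfolding d_def by simp
 qed
 also have "(\<Prod>x\<leftarrow>map (EE_factor N ?t) (EE_list N ?t). d x Q) =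
   (\<Prod>(c, i)\<leftarrow>EE_list N ?t. of_int (set_content Q i - c) / of_int (content ?t i - c))"
  unfolding map_map comp_def
  by (intro arg_cong[where f = prod_list] map_cong refl) (auto simp: set_EE_list d_def mat_EE_factor Q)
 finally show ?thesis unfolding EE_coefficient[OF Q S] by auto
qed

section \<open>Half-diagrams and the seminormal basis\<close>

fun half :: "nat set \<Rightarrow> nat \<Rightarrow> nat set \<times> (nat \<times> nat) set" where
 "half Q 0 = ({}, {})"
| "half Q (Suc m) = (let (V, A) = half Q m in
   if Suc m \<notin> Q then (insert (Suc m) V, A) else (V - {Max V}, insert (Max V, Suc m) A))"

lemma half_diagram_tab: "m \<le> n \<Longrightarrow> half_diagram (tab n Q) m = half Q m"
proof (induction m)
 case (Suc m)
 hence "snd (tab n Q (Suc m)) = (if Suc m \<in> Q then 2 else 1)" by (intro snd_tab) auto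
 thus ?case using Suc by (auto simp: Let_def split: prod.splits)
qed simp

text \<open>Invariant of the construction. The number of vacant lines is the height, so a line is
  available whenever an arc has to be drawn; no vacant line lies under an arc, so the lines can
  later be joined to another half without crossings.\<close>

definition half_state :: "nat set \<Rightarrow> nat \<Rightarrow> nat set \<Rightarrow> (nat \<times> nat) set \<Rightarrow> bool" where
 "half_state Q m V A \<longleftrightarrow> finite V \<and> finite A \<and> int (card V) = height Q m \<and>
   snd ` A = Q \<inter> {1..m} \<and> fst ` A \<union> V = {1..m} - Q \<and> fst ` A \<inter> V = {} \<and> inj_on fst A \<and> inj_on snd A \<and>
   (\<forall>a b. (a, b) \<in> A \<longrightarrow> a < b) \<and> (\<forall>a b v. (a, b) \<in> A \<longrightarrow> v \<in> V \<longrightarrow> \<not> (a < v \<and> v < b)) \<and>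
   (\<forall>a b c d. (a, b) \<in> A \<longrightarrow> (c, d) \<in> A \<longrightarrow> \<not> (a < c \<and> c < b \<and> b < d))"

lemma height_Suc: "height Q (Suc m) = height Q m + (if Suc m \<in> Q then -1 else 1)"
 using card_Int_Suc[of Q m] by (simp add: height_def)

lemma height_nonneg: "Q \<in> ballot n \<Longrightarrow> m \<le> n \<Longrightarrow> 0 \<le> height Q m"
 using ballotD[of Q n m] unfolding height_def by linarith

lemma half_state:
 assumes Q: "Q \<in> ballot n"
 shows "m \<le> n \<Longrightarrow> half_state Q m (fst (half Q m)) (snd (half Q m))"
proof (induction m)
 case 0
 show ?case by (simp add: half_state_def height_def)
next
 case (Suc m)
 obtain V A where VA: "half Q m = (V, A)" by (cases "half Q m")
 have S: "half_state Q m V A" using Suc VA by simp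
 hence st: "finite V" "finite A" "int (card V) = height Q m" "snd ` A = Q \<inter> {1..m}" "fst ` A \<union> V = {1..m} - Q"
  "fst ` A \<inter> V = {}" "inj_on fst A" "inj_on snd A"
  and lt: "\<And>a b. (a, b) \<in> A \<Longrightarrow> a < b"
  and vac: "\<And>a b v. (a, b) \<in> A \<Longrightarrow> v \<in> V \<Longrightarrow> \<not> (a < v \<and> v < b)"
  and ncr: "\<And>a b c d. (a, b) \<in> A \<Longrightarrow> (c, d) \<in> A \<Longrightarrow> \<not> (a < c \<and> c < b \<and> b < d)"
  unfolding half_state_def by blast+
 have bnd: "b \<le> m" if "(a, b) \<in> A" for a b
  using st(4) that by (metis Int_iff atLeastAtMost_iff image_eqI snd_conv)
 have Vm: "v \<in> {1..m} - Q" if "v \<in> V" for v using st(5) that by blast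
 show ?case
 proof (cases "Suc m \<in> Q")
  case False
  have h: "half Q (Suc m) = (insert (Suc m) V, A)" using False VA by simp
  have "Suc m \<notin> V" using Vm[of "Suc m"] by auto
  hence c: "int (card (insert (Suc m) V)) = height Q (Suc m)" using st(1,3) False by (simp add: height_Suc)
  have i1: "Q \<inter> {1..Suc m} = Q \<inter> {1..m}" using Int_interval_Suc[of Q m] False by simp
  have i2: "{1..Suc m} - Q = insert (Suc m) ({1..m} - Q)" using False by (auto simp: le_Suc_eq)
  have "Suc m \<notin> {1..m} - Q" by simp
  hence f: "Suc m \<notin> fst ` A" using st(5) by blast
  have v': "\<not> (a < v \<and> v < b)" if "(a, b) \<in> A" "v \<in> insert (Suc m) V" for a b v
   using vac[OF that(1), of v] that(2) bnd[OF that(1)] by auto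
  show ?thesis unfolding h half_state_def fst_conv snd_conv i1 i2
  proof (intro conjI)
   show "fst ` A \<union> insert (Suc m) V = insert (Suc m) ({1..m} - Q)" using st(5) by blast
   show "fst ` A \<inter> insert (Suc m) V = {}" using st(6) f by (simp only: Int_insert_right if_False)
   show "\<forall>a b v. (a, b) \<in> A \<longrightarrow> v \<in> insert (Suc m) V \<longrightarrow> \<not> (a < v \<and> v < b)" using v' by blast
   show "\<forall>a b. (a, b) \<in> A \<longrightarrow> a < b" using lt by blast
   show "\<forall>a b c d. (a, b) \<in> A \<longrightarrow> (c, d) \<in> A \<longrightarrow> \<not> (a < c \<and> c < b \<and> b < d)" using ncr by blast
  qed (use st c in simp_all)
 next
  case True
  have h: "half Q (Suc m) = (V - {Max V}, insert (Max V, Suc m) A)" using True VA by simp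
  have "0 \<le> height Q (Suc m)" using height_nonneg[OF Q Suc.prems] .
  \<comment> \<open>The ballot condition at \<open>Suc m\<close> leaves a vacant line for the new
    arc; only then is \<open>Max V\<close> meaningful.\<close>
  hence "card V \<noteq> 0" using st(3) True by (simp add: height_Suc)
  hence ne: "V \<noteq> {}" by auto
  define M where "M = Max V"
  have M: "M \<in> V" "\<And>v. v \<in> V \<Longrightarrow> v \<le> M" using ne st(1) by (auto simp: M_def)
  have Mm: "M \<le> m" "M \<notin> Q" using Vm[OF M(1)] by auto
  have "card V = Suc (card (V - {M}))" using card_Suc_Diff1[OF st(1) M(1)] by simp
  hence c: "int (card (V - {M})) = height Q (Suc m)" using st(3) True by (simp add: height_Suc)
  have i1: "Q \<inter> {1..Suc m} = insert (Suc m) (Q \<inter> {1..m})" using Int_interval_Suc[of Q m] True by simp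
  have i2: "{1..Suc m} - Q = {1..m} - Q" using True by (auto simp: le_Suc_eq)
  have fM: "M \<notin> fst ` A" using st(6) M(1) by blast
  have sM: "Suc m \<notin> snd ` A" using st(4) by auto
  have v': "\<not> (a < v \<and> v < b)" if "(a, b) \<in> insert (M, Suc m) A" "v \<in> V - {M}" for a b v
  proof (cases "(a, b) = (M, Suc m)")
   case True
   thus ?thesis using M(2)[of v] that(2) by auto
  next
   case False
   thus ?thesis using vac[of a b v] that by blast
  qed
  have n': "\<not> (a < c \<and> c < b \<and> b < d)" if "(a, b) \<in> insert (M, Suc m) A" "(c, d) \<in> insert (M, Suc m) A" for a b c d
  proof (cases "(a, b) = (M, Suc m)")
   case ab: True
   have "d \<le> Suc m" using that(2) bnd[of c d] by auto
   thus ?thesis using ab by simp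
  next
   case ab: False
   hence ab': "(a, b) \<in> A" using that(1) by blast
   show ?thesis
   proof (cases "(c, d) = (M, Suc m)")
    case True
    thus ?thesis using vac[OF ab' M(1)] by blast
   next
    case False
    thus ?thesis using ncr[OF ab'] that(2) by blast
   qed
  qed
  have l': "a < b" if "(a, b) \<in> insert (M, Suc m) A" for a b
   using that lt[of a b] Mm by auto
  show ?thesis unfolding h half_state_def fst_conv snd_conv i1 i2 M_def[symmetric]
  proof (intro conjI)
   show "snd ` insert (M, Suc m) A = insert (Suc m) (Q \<inter> {1..m})" using st(4) by simp
   show "fst ` insert (M, Suc m) A \<union> (V - {M}) = {1..m} - Q" using st(5) M(1) by auto
   show "fst ` insert (M, Suc m) A \<inter> (V - {M}) = {}" using st(6) by auto
   show "inj_on fst (insert (M, Suc m) A)" using st(7) fM by (auto simp: inj_on_insert)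
   show "inj_on snd (insert (M, Suc m) A)" using st(8) sM by (auto simp: inj_on_insert)
   show "\<forall>a b. (a, b) \<in> insert (M, Suc m) A \<longrightarrow> a < b" using l' by blast
   show "\<forall>a b v. (a, b) \<in> insert (M, Suc m) A \<longrightarrow> v \<in> V - {M} \<longrightarrow> \<not> (a < v \<and> v < b)" using v' by blast
   show "\<forall>a b c d. (a, b) \<in> insert (M, Suc m) A \<longrightarrow> (c, d) \<in> insert (M, Suc m) A \<longrightarrow> \<not> (a < c \<and> c < b \<and> b < d)"
    using n' by blast
  qed (use st c in simp_all)
 qed
qed

definition through :: "nat set \<Rightarrow> nat set \<Rightarrow> (nat \<times> nat) set" where
 "through V W = set (zip (sorted_list_of_set V) (sorted_list_of_set W))"

lemma through_props:
 assumes fin: "finite V" "finite W" and c: "card V = card W"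
 shows "(v, w) \<in> through V W \<Longrightarrow> v \<in> V" "(v, w) \<in> through V W \<Longrightarrow> w \<in> W"
  and "v \<in> V \<Longrightarrow> \<exists>w. (v, w) \<in> through V W" "w \<in> W \<Longrightarrow> \<exists>v. (v, w) \<in> through V W"
  and "(v, w) \<in> through V W \<Longrightarrow> (v', w') \<in> through V W \<Longrightarrow> v < v' \<longleftrightarrow> w < w'"
  and "(v, w) \<in> through V W \<Longrightarrow> (v', w') \<in> through V W \<Longrightarrow> v = v' \<longleftrightarrow> w = w'"
proof -
 let ?x = "sorted_list_of_set V" and ?y = "sorted_list_of_set W"
 have len: "length ?x = card V" "length ?y = card V" using fin c by simp_all
 have Z: "(v, w) \<in> through V W \<longleftrightarrow> (\<exists>i<card V. v = ?x ! i \<and> w = ?y ! i)" for v w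
  unfolding through_def set_zip using len by auto
 have xs: "set ?x = V" "set ?y = W" using fin by simp_all
 have x: "?x ! i < ?x ! j \<longleftrightarrow> i < j" if "i < card V" "j < card V" for i j
 proof -
  have m: "?x ! i < ?x ! j" if "i < j" "j < card V" for i j
   using sorted_wrt_nth_less[OF strict_sorted_list_of_set[of V] that(1)] that(2) len by simp
  show ?thesis using m[of i j] m[of j i] that by (metis less_asym linorder_neqE_nat less_irrefl)
 qed
 have y: "?y ! i < ?y ! j \<longleftrightarrow> i < j" if "i < card V" "j < card V" for i j
 proof -
  have m: "?y ! i < ?y ! j" if "i < j" "j < card V" for i j
   using sorted_wrt_nth_less[OF strict_sorted_list_of_set[of W] that(1)] that(2) len by simp
  show ?thesis using m[of i j] m[of j i] that by (metis less_asym linorder_neqE_nat less_irrefl)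
 qed
 show "(v, w) \<in> through V W \<Longrightarrow> v \<in> V" unfolding Z using len xs by (metis nth_mem)
 show "(v, w) \<in> through V W \<Longrightarrow> w \<in> W" unfolding Z using len xs by (metis nth_mem)
 show "v \<in> V \<Longrightarrow> \<exists>w. (v, w) \<in> through V W" unfolding Z using len xs by (metis in_set_conv_nth)
 show "w \<in> W \<Longrightarrow> \<exists>v. (v, w) \<in> through V W" unfolding Z using len xs by (metis in_set_conv_nth)
 show lt: "v < v' \<longleftrightarrow> w < w'" if "(v, w) \<in> through V W" "(v', w') \<in> through V W" for v w v' w'
  using that x y unfolding Z by blast
 show "(v, w) \<in> through V W \<Longrightarrow> (v', w') \<in> through V W \<Longrightarrow> v = v' \<longleftrightarrow> w = w'"
  using lt[of v w v' w'] lt[of v' w' v w] by (metis less_irrefl linorder_neqE_nat)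
qed

definition glue :: "nat set \<Rightarrow> (nat \<times> nat) set \<Rightarrow> nat set \<Rightarrow> (nat \<times> nat) set \<Rightarrow> diagram" where
 "glue V A W B = {{Top a, Top b} | a b. (a, b) \<in> A} \<union> {{Bot a, Bot b} | a b. (a, b) \<in> B} \<union>
   {{Top a, Bot b} | a b. (a, b) \<in> through V W}"

lemma C_diagram_tab:
 "C_diagram n (tab n P) (tab n Q) = glue (fst (half P n)) (snd (half P n)) (fst (half Q n)) (snd (half Q n))"
 unfolding C_diagram_def glue_def through_def half_diagram_tab[OF order_refl] ..

lemma glue_cases:
 assumes "E \<in> glue V A W B"
 obtains (top) a b where "(a, b) \<in> A" "E = {Top a, Top b}"
 | (bot) a b where "(a, b) \<in> B" "E = {Bot a, Bot b}"
 | (thru) a b where "(a, b) \<in> through V W" "E = {Top a, Bot b}"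
 using assms unfolding glue_def by blast

text \<open>Crossings are excluded by the types of the two edges: two arcs on one side by the
  half-diagram, an arc and a through line because no vacant line is covered, two through lines
  because they are joined in order, and the rest by their places on the boundary.\<close>

lemma glue_in_diagrams:
 assumes S: "half_state P n V A" and T: "half_state Q n W B" and c: "card V = card W"
 shows "glue V A W B \<in> diagrams n"
proof -
 have s: "finite V" "snd ` A = P \<inter> {1..n}" "fst ` A \<union> V = {1..n} - P"
  "fst ` A \<inter> V = {}" "inj_on fst A" "inj_on snd A"
  and slt: "\<And>a b. (a, b) \<in> A \<Longrightarrow> a < b"
  and svac: "\<And>a b v. (a, b) \<in> A \<Longrightarrow> v \<in> V \<Longrightarrow> \<not> (a < v \<and> v < b)"
  and sncr: "\<And>a b c d. (a, b) \<in> A \<Longrightarrow> (c, d) \<in> A \<Longrightarrow> \<not> (a < c \<and> c < b \<and> b < d)"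
  using S unfolding half_state_def by blast+
 have t: "finite W" "snd ` B = Q \<inter> {1..n}" "fst ` B \<union> W = {1..n} - Q"
  "fst ` B \<inter> W = {}" "inj_on fst B" "inj_on snd B"
  and tlt: "\<And>a b. (a, b) \<in> B \<Longrightarrow> a < b"
  and tvac: "\<And>a b v. (a, b) \<in> B \<Longrightarrow> v \<in> W \<Longrightarrow> \<not> (a < v \<and> v < b)"
  and tncr: "\<And>a b c d. (a, b) \<in> B \<Longrightarrow> (c, d) \<in> B \<Longrightarrow> \<not> (a < c \<and> c < b \<and> b < d)"
  using T unfolding half_state_def by blast+
 note th = through_props[OF s(1) t(1) c]
 have An: "a \<in> {1..n} - P" "b \<in> P \<inter> {1..n}" if "(a, b) \<in> A" for a b
  using s(2,3) that by (metis UnCI image_eqI fst_conv, metis image_eqI snd_conv)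
 have Bn: "a \<in> {1..n} - Q" "b \<in> Q \<inter> {1..n}" if "(a, b) \<in> B" for a b
  using t(2,3) that by (metis UnCI image_eqI fst_conv, metis image_eqI snd_conv)
 have Vn: "v \<in> {1..n} - P" if "v \<in> V" for v using s(3) that by blast
 have Wn: "v \<in> {1..n} - Q" if "v \<in> W" for v using t(3) that by blast
 have AV: "a \<notin> V" if "(a, b) \<in> A" for a b using s(4) that by force
 have BW: "a \<notin> W" if "(a, b) \<in> B" for a b using t(4) that by force
 have Aeq: "a = a' \<longleftrightarrow> b = b'" if "(a, b) \<in> A" "(a', b') \<in> A" for a b a' b'
  using inj_onD[OF s(5), of "(a, b)" "(a', b')"] inj_onD[OF s(6), of "(a, b)" "(a', b')"] that by auto
 have Beq: "a = a' \<longleftrightarrow> b = b'" if "(a, b) \<in> B" "(a', b') \<in> B" for a b a' b'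
  using inj_onD[OF t(5), of "(a, b)" "(a', b')"] inj_onD[OF t(6), of "(a, b)" "(a', b')"] that by auto
 have coverA: "(\<exists>y. (x, y) \<in> A \<or> (y, x) \<in> A) \<or> x \<in> V" if "x \<in> {1..n}" for x
 proof -
  have "x \<in> snd ` A \<or> x \<in> fst ` A \<union> V" using that s(2,3) by blast
  thus ?thesis by force
 qed
 have coverB: "(\<exists>y. (x, y) \<in> B \<or> (y, x) \<in> B) \<or> x \<in> W" if "x \<in> {1..n}" for x
 proof -
  have "x \<in> snd ` B \<or> x \<in> fst ` B \<union> W" using that t(2,3) by blast
  thus ?thesis by force
 qed
 let ?D = "glue V A W B"
 have inD: "(a, b) \<in> A \<Longrightarrow> {Top a, Top b} \<in> ?D" "(a, b) \<in> B \<Longrightarrow> {Bot a, Bot b} \<in> ?D"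
  "(a, b) \<in> through V W \<Longrightarrow> {Top a, Bot b} \<in> ?D" for a b
  unfolding glue_def by blast+
 have ptsD: "E \<subseteq> points n" "card E = 2" if "E \<in> ?D" for E
 proof -
  from that have "E \<subseteq> points n \<and> card E = 2"
  proof (cases rule: glue_cases)
   case (top a b)
   thus ?thesis using An[OF top(1)] slt[OF top(1)] by simp
  next
   case (bot a b)
   thus ?thesis using Bn[OF bot(1)] tlt[OF bot(1)] by simp
  next
   case (thru a b)
   thus ?thesis using Vn[OF th(1)[OF thru(1)]] Wn[OF th(2)[OF thru(1)]] by simp
  qed
  thus "E \<subseteq> points n" "card E = 2" by blast+
 qed
 have "partition_on (points n) ?D"
 proof (rule partition_onI)
  show "\<Union> ?D = points n"
  proof
   show "\<Union> ?D \<subseteq> points n" using ptsD(1) by blast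
   show "points n \<subseteq> \<Union> ?D"
   proof
    fix p assume p: "p \<in> points n"
    show "p \<in> \<Union> ?D"
    proof (cases p)
     case (Top x)
     hence "x \<in> {1..n}" using p by simp
     from coverA[OF this] consider y where "(x, y) \<in> A" | y where "(y, x) \<in> A" | y where "(x, y) \<in> through V W"
      using th(3)[of x] by blast
     thus ?thesis using inD Top by cases blast+
    next
     case (Bot x)
     hence "x \<in> {1..n}" using p by simp
     from coverB[OF this] consider y where "(x, y) \<in> B" | y where "(y, x) \<in> B" | y where "(y, x) \<in> through V W"
      using th(4)[of x] by blast
     thus ?thesis using inD Bot by cases blast+
    qed
   qed
  qed
  fix E F assume E: "E \<in> ?D" and F: "F \<in> ?D" and ne: "E \<noteq> F"
  from E show "disjnt E F"
  proof (cases rule: glue_cases)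
   case e: (top a b)
   from F show ?thesis
   proof (cases rule: glue_cases)
    case f: (top x y)
    have "a \<noteq> x" "b \<noteq> y" using Aeq[OF e(1) f(1)] ne e f by auto
    moreover have "a \<noteq> y" "b \<noteq> x" using An[OF e(1)] An[OF f(1)] by auto
    ultimately show ?thesis using e f by (simp add: disjnt_def)
   next
    case f: (bot x y)
    thus ?thesis using e by (simp add: disjnt_def)
   next
    case f: (thru x y)
    have "a \<noteq> x" using AV[OF e(1)] th(1)[OF f(1)] by auto
    moreover have "b \<noteq> x" using An[OF e(1)] Vn[OF th(1)[OF f(1)]] by auto
    ultimately show ?thesis using e f by (simp add: disjnt_def)
   qed
  next
   case e: (bot a b)
   from F show ?thesis
   proof (cases rule: glue_cases)
    case f: (top x y)
    thus ?thesis using e by (simp add: disjnt_def)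
   next
    case f: (bot x y)
    have "a \<noteq> x" "b \<noteq> y" using Beq[OF e(1) f(1)] ne e f by auto
    moreover have "a \<noteq> y" "b \<noteq> x" using Bn[OF e(1)] Bn[OF f(1)] by auto
    ultimately show ?thesis using e f by (simp add: disjnt_def)
   next
    case f: (thru x y)
    have "a \<noteq> y" using BW[OF e(1)] th(2)[OF f(1)] by auto
    moreover have "b \<noteq> y" using Bn[OF e(1)] Wn[OF th(2)[OF f(1)]] by auto
    ultimately show ?thesis using e f by (simp add: disjnt_def)
   qed
  next
   case e: (thru a b)
   from F show ?thesis
   proof (cases rule: glue_cases)
    case f: (top x y)
    have "x \<noteq> a" using AV[OF f(1)] th(1)[OF e(1)] by auto
    moreover have "y \<noteq> a" using An[OF f(1)] Vn[OF th(1)[OF e(1)]] by auto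
    ultimately show ?thesis using e f by (simp add: disjnt_def)
   next
    case f: (bot x y)
    have "x \<noteq> b" using BW[OF f(1)] th(2)[OF e(1)] by auto
    moreover have "y \<noteq> b" using Bn[OF f(1)] Wn[OF th(2)[OF e(1)]] by auto
    ultimately show ?thesis using e f by (simp add: disjnt_def)
   next
    case f: (thru x y)
    have "a \<noteq> x" "b \<noteq> y" using th(6)[OF e(1) f(1)] ne e f by auto
    thus ?thesis using e f by (simp add: disjnt_def)
   qed
  qed
 next
  show "{} \<notin> ?D"
  proof
   assume "{} \<in> ?D"
   from ptsD(2)[OF this] show False by simp
  qed
 qed
 moreover have "noncrossing n ?D" unfolding noncrossing_def
 proof (rule notI, elim exE conjE)
  let ?b = "boundary_pos n"
  fix x y z w
  assume E: "{x, z} \<in> ?D" and F: "{y, w} \<in> ?D" and o: "?b x < ?b y" "?b y < ?b z" "?b z < ?b w"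
  \<comment> \<open>Edges are oriented along the boundary walk, which runs from right to left at the
    bottom; hence the reversed ends there.\<close>
  have or: "(\<exists>a b. (a, b) \<in> A \<and> x = Top a \<and> z = Top b \<and> b \<le> n) \<or>
    (\<exists>a b. (a, b) \<in> B \<and> x = Bot b \<and> z = Bot a \<and> b \<le> n) \<or>
    (\<exists>a b. (a, b) \<in> through V W \<and> x = Top a \<and> z = Bot b \<and> a \<le> n \<and> b \<le> n)"
   if "{x, z} \<in> ?D" "?b x < ?b z" for x z
   using that(1)
  proof (cases rule: glue_cases)
   case (top a b)
   hence "x = Top a \<and> z = Top b" using that(2) slt[OF top(1)] by (auto simp: doubleton_eq_iff)
   thus ?thesis using top(1) An[OF top(1)] by auto
  next
   case (bot a b)
   hence "x = Bot b \<and> z = Bot a" using that(2) tlt[OF bot(1)] Bn[OF bot(1)] by (auto simp: doubleton_eq_iff)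
   thus ?thesis using bot(1) Bn[OF bot(1)] by auto
  next
   case (thru a b)
   hence "x = Top a \<and> z = Bot b" using that(2) Vn[OF th(1)[OF thru(1)]] Wn[OF th(2)[OF thru(1)]]
    by (auto simp: doubleton_eq_iff)
   thus ?thesis using thru(1) Vn[OF th(1)[OF thru(1)]] Wn[OF th(2)[OF thru(1)]] by auto
  qed
  have xz: "?b x < ?b z" "?b y < ?b w" using o by auto
  from or[OF E xz(1)] or[OF F xz(2)] show False
  proof (elim disjE exE conjE)
   fix a b a' b' assume "(a, b) \<in> A" "x = Top a" "z = Top b" "(a', b') \<in> A" "y = Top a'" "w = Top b'"
   thus False using o sncr[of a b a' b'] by simp
  next
   fix a b a' b' assume "(a, b) \<in> A" "x = Top a" "z = Top b" "(a', b') \<in> B" "y = Bot b'" "b \<le> n" "b' \<le> n"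
   thus False using o by simp
  next
   fix a b a' b' assume "(a, b) \<in> A" "x = Top a" "z = Top b" "(a', b') \<in> through V W" "y = Top a'"
   thus False using o svac[of a b a'] th(1) by simp
  next
   fix a b a' b' assume "x = Bot b" "b \<le> n" "y = Top a'" "w = Top b'" "b' \<le> n" "z = Bot a"
   thus False using o by simp
  next
   fix a b a' b' assume h: "(a, b) \<in> B" "x = Bot b" "z = Bot a" "(a', b') \<in> B" "y = Bot b'" "w = Bot a'" "b \<le> n" "b' \<le> n"
   have "a' < a" "a < b'" "b' < b" using o h by auto
   thus False using tncr[OF h(4,1)] by blast
  next
   fix a b a' b' assume "x = Bot b" "b \<le> n" "y = Top a'" "a' \<le> n"
   thus False using o by simp
  next
   fix a b a' b' assume "z = Bot b" "b \<le> n" "w = Top b'" "b' \<le> n"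
   thus False using o by simp
  next
   fix a b a' b' assume h: "(a, b) \<in> through V W" "z = Bot b" "(a', b') \<in> B" "y = Bot b'" "w = Bot a'" "b \<le> n" "b' \<le> n"
   have "a' < b" "b < b'" using o h by auto
   thus False using tvac[OF h(3) th(2)[OF h(1)]] by blast
  next
   fix a b a' b' assume h: "(a, b) \<in> through V W" "x = Top a" "z = Bot b" "(a', b') \<in> through V W" "y = Top a'" "w = Bot b'"
    "b \<le> n" "b' \<le> n"
   have "a < a'" "b' < b" using o h by auto
   thus False using th(5)[OF h(1,4)] by simp
  qed
 qed
 ultimately show ?thesis using ptsD(2) by (simp add: diagrams_def)
qed

text \<open>The parities needed to undo the twist in \<open>label\<close> come from planarity:
  \<open>mate_parity\<close> applies to the glued diagram.\<close>

lemma fits_glue: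
 assumes D: "glue V A W B \<in> diagrams n"
 shows "fits (glue V A W B) X Y \<longleftrightarrow> (\<forall>(a, b)\<in>A. a \<in> X \<longleftrightarrow> b \<notin> X) \<and> (\<forall>(a, b)\<in>B. a \<in> Y \<longleftrightarrow> b \<notin> Y) \<and>
   (\<forall>(a, b)\<in>through V W. a \<in> X \<longleftrightarrow> b \<in> Y)"
  and "(a, b) \<in> A \<Longrightarrow> even a \<longleftrightarrow> odd b"
proof -
 let ?D = "glue V A W B"
 have inD: "(a, b) \<in> A \<Longrightarrow> {Top a, Top b} \<in> ?D" "(a, b) \<in> B \<Longrightarrow> {Bot a, Bot b} \<in> ?D"
  "(a, b) \<in> through V W \<Longrightarrow> {Top a, Bot b} \<in> ?D" for a b
  unfolding glue_def by blast+
 have par: "even (boundary_pos n q) \<longleftrightarrow> odd (boundary_pos n p)" if "{p, q} \<in> ?D" for p q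
  using mate_parity[OF D diagram_edge(2)[OF D that]] diagram_edge(4)[OF D that] by simp
 show pA: "even a \<longleftrightarrow> odd b" if "(a, b) \<in> A" for a b
  using par[OF inD(1)[OF that]] by auto
 have pB: "even a \<longleftrightarrow> odd b" if "(a, b) \<in> B" for a b
  using par[OF inD(2)[OF that]] diagram_edge(2,3)[OF D inD(2)[OF that]] by auto
 have pT: "even a \<longleftrightarrow> even b" if "(a, b) \<in> through V W" for a b
  using par[OF inD(3)[OF that]] diagram_edge(2,3)[OF D inD(3)[OF that]] by auto
 show "fits ?D X Y \<longleftrightarrow> (\<forall>(a, b)\<in>A. a \<in> X \<longleftrightarrow> b \<notin> X) \<and> (\<forall>(a, b)\<in>B. a \<in> Y \<longleftrightarrow> b \<notin> Y) \<and>
   (\<forall>(a, b)\<in>through V W. a \<in> X \<longleftrightarrow> b \<in> Y)" (is "_ \<longleftrightarrow> ?r")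
 proof
  assume f: "fits ?D X Y"
  have f': "label X Y p = label X Y q" if "{p, q} \<in> ?D" for p q using f that unfolding fits_def by blast
  have "a \<in> X \<longleftrightarrow> b \<notin> X" if "(a, b) \<in> A" for a b using f'[OF inD(1)[OF that]] pA[OF that] by auto
  moreover have "a \<in> Y \<longleftrightarrow> b \<notin> Y" if "(a, b) \<in> B" for a b using f'[OF inD(2)[OF that]] pB[OF that] by auto
  moreover have "a \<in> X \<longleftrightarrow> b \<in> Y" if "(a, b) \<in> through V W" for a b using f'[OF inD(3)[OF that]] pT[OF that] by auto
  ultimately show ?r by blast
 next
  assume r: ?r
  show "fits ?D X Y" unfolding fits_def
  proof (intro allI impI)
   fix p q assume "{p, q} \<in> ?D"
   thus "label X Y p = label X Y q"
   proof (cases rule: glue_cases)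
    case (top a b)
    have "a \<in> X \<longleftrightarrow> b \<notin> X" using r top(1) by blast
    hence "label X Y (Top a) = label X Y (Top b)" using pA[OF top(1)] by auto
    thus ?thesis using top(2) by (auto simp: doubleton_eq_iff)
   next
    case (bot a b)
    have "a \<in> Y \<longleftrightarrow> b \<notin> Y" using r bot(1) by blast
    hence "label X Y (Bot a) = label X Y (Bot b)" using pB[OF bot(1)] by auto
    thus ?thesis using bot(2) by (auto simp: doubleton_eq_iff)
   next
    case (thru a b)
    have "a \<in> X \<longleftrightarrow> b \<in> Y" using r thru(1) by blast
    hence "label X Y (Top a) = label X Y (Bot b)" using pT[OF thru(1)] by auto
    thus ?thesis using thru(2) by (auto simp: doubleton_eq_iff)
   qed
  qed
 qed
qed

text \<open>The half-diagram as a vector: every arc is an antisymmetric pair and every vacant line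
  is in the upper state, that is, outside \<open>X\<close>.\<close>

definition cup_vector :: "nat set \<Rightarrow> nat \<Rightarrow> nat set \<Rightarrow> rat" where
 "cup_vector Q k X = theta X * of_bool (X \<subseteq> {1..k} \<and> (\<forall>(a, b)\<in>snd (half Q k). a \<in> X \<longleftrightarrow> b \<notin> X) \<and>
   X \<inter> fst (half Q k) = {})"

text \<open>The arcs correspond to the elements of \<open>Q\<close>, so one end of every arc already
  exhausts the allowed number of elements.\<close>

lemma transversal_card:
 assumes S: "half_state Q k V A" and Y: "Y \<subseteq> {1..k}" and tr: "\<forall>(a, b)\<in>A. a \<in> Y \<longleftrightarrow> b \<notin> Y"
  and c: "card Y = card (Q \<inter> {1..k})"
 shows "Y \<inter> V = {}"
proof -
 have s: "finite V" "finite A" "snd ` A = Q \<inter> {1..k}" "fst ` A \<union> V = {1..k} - Q"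
  "fst ` A \<inter> V = {}" "inj_on fst A" "inj_on snd A"
  using S unfolding half_state_def by blast+
 define g where "g = (\<lambda>(a, b). if a \<in> Y then a else b :: nat)"
 have An: "a \<in> {1..k} - Q" "b \<in> Q" if "(a, b) \<in> A" for a b
  using s(3,4) that by (metis UnCI image_eqI fst_conv, metis IntD1 image_eqI snd_conv)
 have AV: "a \<notin> V" if "(a, b) \<in> A" for a b using s(5) that by force
 have VQ: "v \<notin> Q" if "v \<in> V" for v using s(4) that by blast
 have inj: "inj_on g A"
 proof (rule inj_onI)
  fix x y assume xy: "x \<in> A" "y \<in> A" "g x = g y"
  obtain a b where x: "x = (a, b)" by (cases x)
  obtain c d where y: "y = (c, d)" by (cases y)
  have "a = c \<or> b = d" using xy An[of a b] An[of c d] unfolding x y g_def by (auto split: if_splits)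
  thus "x = y" using inj_onD[OF s(6), of x y] inj_onD[OF s(7), of x y] xy x y by auto
 qed
 have sub: "g ` A \<subseteq> Y - V"
 proof
  fix z assume "z \<in> g ` A"
  then obtain a b where ab: "(a, b) \<in> A" "z = g (a, b)" by auto
  have "a \<in> Y \<longleftrightarrow> b \<notin> Y" using tr ab(1) by blast
  moreover have "b \<notin> V" using An(2)[OF ab(1)] VQ by blast
  ultimately show "z \<in> Y - V" using ab(2) AV[OF ab(1)] by (auto simp: g_def)
 qed
 have finY: "finite Y" using Y finite_subset by blast
 have "card A = card Y" using card_image[OF s(7)] s(3) c by simp
 hence "card Y \<le> card (Y - V)" using card_mono[OF _ sub] finY card_image[OF inj] by simp
 hence "Y - V = Y" using finY by (intro card_seteq) auto
 thus ?thesis by blast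
qed

text \<open>In the weight of \<open>hw Q n\<close> the arcs use up all elements and leave none for
  the through lines. On such vectors the diagram has rank one: pair with the lower half, then output
  the upper half.\<close>

lemma act_C:
 assumes P: "P \<in> ballot n" and Q: "Q \<in> ballot n" and c: "card P = card Q"
 shows "C_diagram n (tab n P) (tab n Q) \<in> diagrams n"
  and "act n (delta (C_diagram n (tab n P) (tab n Q))) (hw Q n) =
   (\<lambda>X. scalar_prod n (cup_vector Q n) (hw Q n) * cup_vector P n X)"
proof -
 obtain V A where VA: "half P n = (V, A)" by (cases "half P n")
 obtain W B where WB: "half Q n = (W, B)" by (cases "half Q n")
 have S: "half_state P n V A" using half_state[OF P order_refl] VA by simp
 have T: "half_state Q n W B" using half_state[OF Q order_refl] WB by simp
 have "Q \<inter> {1..n} = Q" "P \<inter> {1..n} = P" using ballot_subset P Q by blast+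
 hence "height P n = height Q n" unfolding height_def using c by simp
 hence cVW: "card V = card W" using S T unfolding half_state_def by linarith
 let ?C = "C_diagram n (tab n P) (tab n Q)"
 have C: "?C = glue V A W B" unfolding C_diagram_tab VA WB by simp
 show D: "?C \<in> diagrams n" unfolding C by (rule glue_in_diagrams[OF S T cVW])
 note D' = D[unfolded C]
 have th: "\<And>v. v \<in> V \<Longrightarrow> \<exists>w. (v, w) \<in> through V W" "\<And>v w. (v, w) \<in> through V W \<Longrightarrow> v \<in> V" "\<And>v w. (v, w) \<in> through V W \<Longrightarrow> w \<in> W"
 proof -
  have "finite V" using S unfolding half_state_def by (rule conjunct1)
  moreover have "finite W" using T unfolding half_state_def by (rule conjunct1)
  ultimately show "\<And>v. v \<in> V \<Longrightarrow> \<exists>w. (v, w) \<in> through V W" "\<And>v w. (v, w) \<in> through V W \<Longrightarrow> v \<in> V"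
   "\<And>v w. (v, w) \<in> through V W \<Longrightarrow> w \<in> W"
   using through_props(3)[OF _ _ cVW] through_props(1)[OF _ _ cVW] through_props(2)[OF _ _ cVW] by simp_all
 qed
 show "act n (delta ?C) (hw Q n) = (\<lambda>X. scalar_prod n (cup_vector Q n) (hw Q n) * cup_vector P n X)"
 proof
  fix X
  show "act n (delta ?C) (hw Q n) X = scalar_prod n (cup_vector Q n) (hw Q n) * cup_vector P n X"
  proof (cases "X \<subseteq> {1..n}")
   case X: True
   have "rep n (delta ?C) X Y * hw Q n Y = cup_vector Q n Y * hw Q n Y * cup_vector P n X" if Y: "Y \<in> Pow {1..n}" for Y
   proof (cases "hw Q n Y = 0")
    case False
    hence cY: "card Y = card (Q \<inter> {1..n})" by (rule hw_weight)
    have Y': "Y \<subseteq> {1..n}" using Y by blast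
    have "fits ?C X Y \<longleftrightarrow> ((\<forall>(a, b)\<in>A. a \<in> X \<longleftrightarrow> b \<notin> X) \<and> X \<inter> V = {}) \<and> ((\<forall>(a, b)\<in>B. a \<in> Y \<longleftrightarrow> b \<notin> Y) \<and> Y \<inter> W = {})"
    proof
     assume "fits ?C X Y"
     hence f: "\<forall>(a, b)\<in>A. a \<in> X \<longleftrightarrow> b \<notin> X" "\<forall>(a, b)\<in>B. a \<in> Y \<longleftrightarrow> b \<notin> Y" "\<forall>(a, b)\<in>through V W. a \<in> X \<longleftrightarrow> b \<in> Y"
      unfolding C fits_glue(1)[OF D'] by blast+
     have YW: "Y \<inter> W = {}" by (rule transversal_card[OF T Y' f(2) cY])
     have "X \<inter> V = {}"
     proof (rule ccontr)
      assume "X \<inter> V \<noteq> {}"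
      then obtain v where v: "v \<in> X" "v \<in> V" by blast
      then obtain w where w: "(v, w) \<in> through V W" using th(1) by blast
      hence "w \<in> Y" "w \<in> W" using f(3) v th(3) by blast+
      thus False using YW by blast
     qed
     thus "((\<forall>(a, b)\<in>A. a \<in> X \<longleftrightarrow> b \<notin> X) \<and> X \<inter> V = {}) \<and> ((\<forall>(a, b)\<in>B. a \<in> Y \<longleftrightarrow> b \<notin> Y) \<and> Y \<inter> W = {})"
      using f YW by blast
    next
     assume r: "((\<forall>(a, b)\<in>A. a \<in> X \<longleftrightarrow> b \<notin> X) \<and> X \<inter> V = {}) \<and> ((\<forall>(a, b)\<in>B. a \<in> Y \<longleftrightarrow> b \<notin> Y) \<and> Y \<inter> W = {})"
     moreover have "\<forall>(a, b)\<in>through V W. a \<in> X \<longleftrightarrow> b \<in> Y" using r th(2,3) by blast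
     ultimately show "fits ?C X Y" unfolding C fits_glue(1)[OF D'] by blast
    qed
    hence ob: "of_bool (fits ?C X Y) = of_bool ((\<forall>(a, b)\<in>A. a \<in> X \<longleftrightarrow> b \<notin> X) \<and> X \<inter> V = {}) *
      (of_bool ((\<forall>(a, b)\<in>B. a \<in> Y \<longleftrightarrow> b \<notin> Y) \<and> Y \<inter> W = {}) :: rat)"
     by (simp only: of_bool_conj)
    have cP: "cup_vector P n X = theta X * of_bool ((\<forall>(a, b)\<in>A. a \<in> X \<longleftrightarrow> b \<notin> X) \<and> X \<inter> V = {})"
     unfolding cup_vector_def VA using X by simp
    have cQ: "cup_vector Q n Y = theta Y * of_bool ((\<forall>(a, b)\<in>B. a \<in> Y \<longleftrightarrow> b \<notin> Y) \<and> Y \<inter> W = {})"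
     unfolding cup_vector_def WB using Y' by simp
    show ?thesis unfolding rep_delta[OF D X Y'] cP cQ ob by (simp only: mult_ac)
   qed simp
   hence "act n (delta ?C) (hw Q n) X = (\<Sum>Y\<in>Pow {1..n}. cup_vector Q n Y * hw Q n Y * cup_vector P n X)"
    unfolding act_def by (rule sum.cong[OF refl])
   thus ?thesis by (simp add: scalar_prod_def sum_distrib_right)
  next
   case False
   thus ?thesis using tensorsD[OF act_tensors False] by (simp add: cup_vector_def)
  qed
 qed
qed

text \<open>Inserting a vacant line gives zero by definition, and the two ends of an arc contribute
  opposite signs because their parities differ.\<close>

lemma raising_cup_vector:
 assumes Q: "Q \<in> ballot n" and k: "k \<le> n"
 shows "raising k (cup_vector Q k) = (\<lambda>X. 0)"
proof
 fix X
 obtain V A where VA: "half Q k = (V, A)" by (cases "half Q k")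
 have S: "half_state Q k V A" using half_state[OF Q k] VA by simp
 hence s: "finite V" "finite A" "snd ` A = Q \<inter> {1..k}" "fst ` A \<union> V = {1..k} - Q"
  "fst ` A \<inter> V = {}" "inj_on fst A" "inj_on snd A" "\<And>a b. (a, b) \<in> A \<Longrightarrow> a < b"
  unfolding half_state_def by blast+
 have par: "even a \<longleftrightarrow> odd b" if "(a, b) \<in> A" for a b
  by (rule fits_glue(2)[OF glue_in_diagrams[OF S S refl] that])
 have An: "a \<in> {1..k} - Q" "b \<in> Q \<inter> {1..k}" if "(a, b) \<in> A" for a b
  using s(3,4) that by (metis UnCI image_eqI fst_conv, metis image_eqI snd_conv)
 have AV: "a \<notin> V" "b \<notin> V" if "(a, b) \<in> A" for a b using s(4,5) An[OF that] that by force+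
 have Aeq: "a = a' \<longleftrightarrow> b = b'" if "(a, b) \<in> A" "(a', b') \<in> A" for a b a' b'
  using inj_onD[OF s(6), of "(a, b)" "(a', b')"] inj_onD[OF s(7), of "(a, b)" "(a', b')"] that by auto
 let ?w = "cup_vector Q k"
 have w: "?w X = theta X * of_bool (X \<subseteq> {1..k} \<and> (\<forall>(a, b)\<in>A. a \<in> X \<longleftrightarrow> b \<notin> X) \<and> X \<inter> V = {})" for X
  unfolding cup_vector_def VA by simp
 show "raising k ?w X = 0"
 proof (cases "X \<subseteq> {1..k}")
  case X: True
  have finX: "finite X" using X finite_subset by blast
  define g where "g = (\<lambda>i. if i \<in> X then 0 else ?w (insert i X))"
  have "raising k ?w X = (\<Sum>i\<in>{1..k}. g i)"
   unfolding raising_def using X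
   by (simp add: g_def) (rule sum.mono_neutral_cong_left, auto)
  also have "{1..k} = (fst ` A \<union> V) \<union> snd ` A" using s(3,4) by blast
  also have "(\<Sum>i\<in>(fst ` A \<union> V) \<union> snd ` A. g i) = (\<Sum>i\<in>fst ` A \<union> V. g i) + (\<Sum>i\<in>snd ` A. g i)"
   by (rule sum.union_disjoint) (use s in auto)
  also have "(\<Sum>i\<in>fst ` A \<union> V. g i) = (\<Sum>i\<in>fst ` A. g i) + (\<Sum>i\<in>V. g i)"
   by (rule sum.union_disjoint) (use s in auto)
  also have "(\<Sum>i\<in>V. g i) = 0" by (rule sum.neutral) (auto simp: g_def w)
  also have "(\<Sum>i\<in>fst ` A. g i) = (\<Sum>x\<in>A. g (fst x))" using s(6) by (simp add: sum.reindex)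
  also have "(\<Sum>i\<in>snd ` A. g i) = (\<Sum>x\<in>A. g (snd x))" using s(7) by (simp add: sum.reindex)
  finally have "raising k ?w X = (\<Sum>x\<in>A. g (fst x) + g (snd x))" by (simp add: sum.distrib)
  moreover have "g (fst x) + g (snd x) = 0" if "x \<in> A" for x
  proof -
   obtain a b where x: "x = (a, b)" by (cases x)
   have ab: "(a, b) \<in> A" using that x by simp
   have "g a + g b = 0"
   proof (cases "a \<in> X \<or> b \<in> X")
    case True
    have "?w (insert a X) = 0" if "b \<in> X" using ab that unfolding w by auto
    moreover have "?w (insert b X) = 0" if "a \<in> X" using ab that unfolding w by auto
    ultimately show ?thesis using True by (auto simp: g_def)
   next
    case False
    have "a \<noteq> b" using s(8)[OF ab] by simp
    have tr: "(\<forall>(c, d)\<in>A. c \<in> insert a X \<longleftrightarrow> d \<notin> insert a X) \<longleftrightarrow> (\<forall>(c, d)\<in>A. c \<in> insert b X \<longleftrightarrow> d \<notin> insert b X)"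
    proof (intro ball_cong refl)
     fix y assume y: "y \<in> A"
     obtain c d where cd: "y = (c, d)" by (cases y)
     show "(case y of (c, d) \<Rightarrow> c \<in> insert a X \<longleftrightarrow> d \<notin> insert a X) \<longleftrightarrow> (case y of (c, d) \<Rightarrow> c \<in> insert b X \<longleftrightarrow> d \<notin> insert b X)"
     proof (cases "c = a")
      case True
      hence "d = b" using Aeq[OF ab, of c d] y cd by simp
      thus ?thesis using True False cd \<open>a \<noteq> b\<close> by simp
     next
      case ca: False
      hence "d \<noteq> b" using Aeq[OF ab, of c d] y cd by simp
      moreover have "c \<noteq> b" "d \<noteq> a" using An[of c d] An[OF ab] y cd by auto
      ultimately show ?thesis using ca cd by simp
     qed
    qed
    have "a \<in> {1..k}" "b \<in> {1..k}" using An[OF ab] by auto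
    moreover have "theta (insert a X) = - theta (insert b X)"
     using False par[OF ab] finX by (simp add: theta_insert)
    ultimately show ?thesis using False AV[OF ab] X unfolding g_def w tr by simp
   qed
   thus ?thesis using x by simp
  qed
  ultimately show ?thesis by simp
 next
  case False
  thus ?thesis by (simp add: raising_def)
 qed
qed

lemma scalar_prod_commute: "scalar_prod n v w = scalar_prod n w v"
 by (simp add: scalar_prod_def mult.commute)

lemma sum_Pow_Suc:
 fixes f :: "nat set \<Rightarrow> rat"
 shows "(\<Sum>X\<in>Pow {1..Suc k}. f X) = (\<Sum>X\<in>Pow {1..k}. f X) + (\<Sum>X\<in>Pow {1..k}. f (insert (Suc k) X))"
proof -
 have e: "{1..Suc k} = insert (Suc k) {1..k}" by auto
 have inj: "inj_on (insert (Suc k)) (Pow {1..k})"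
 proof (rule inj_on_inverseI[of _ "\<lambda>X. X - {Suc k}"])
  fix X assume "X \<in> Pow {1..k}"
  hence "Suc k \<notin> X" by auto
  thus "insert (Suc k) X - {Suc k} = X" by simp
 qed
 have disj: "Pow {1..k} \<inter> insert (Suc k) ` Pow {1..k} = {}" by auto
 have fin: "finite (Pow {1..k})" "finite (insert (Suc k) ` Pow {1..k})" by simp_all
 show ?thesis
  unfolding e Pow_insert sum.union_disjoint[OF fin disj] sum.reindex[OF inj] comp_def ..
qed

text \<open>This keeps the \<open>f_basis\<close> elements from vanishing. When an arc ends at
  \<open>Suc k\<close>, the lowering part of \<open>hw\<close> is orthogonal to the cup vector,
  which raising kills; the extended part reproduces the previous pairing up to a sign and the
  positive factor height plus one.\<close>

lemma cup_vector_hw: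
 assumes Q: "Q \<in> ballot n"
 shows "k \<le> n \<Longrightarrow> scalar_prod k (cup_vector Q k) (hw Q k) \<noteq> 0"
proof (induction k)
 case 0
 show ?case by (simp add: scalar_prod_def cup_vector_def theta_def)
next
 case (Suc k)
 obtain V A where VA: "half Q k = (V, A)" by (cases "half Q k")
 have S: "half_state Q k V A" using half_state[OF Q, of k] VA Suc.prems by simp
 hence s: "finite V" "finite A" "snd ` A = Q \<inter> {1..k}" "fst ` A \<union> V = {1..k} - Q" "int (card V) = height Q k"
  unfolding half_state_def by blast+
 have An: "a \<in> {1..k}" "b \<in> {1..k}" if "(a, b) \<in> A" for a b
 proof -
  have "a \<in> fst ` A \<union> V" "b \<in> snd ` A" using that by force+
  thus "a \<in> {1..k}" "b \<in> {1..k}" using s(3,4) by blast+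
 qed
 have Vn: "v \<in> {1..k}" if "v \<in> V" for v using s(4) that by blast
 have hT: "hw Q k \<in> tensors k" by (rule hw_tensors)
 have w: "cup_vector Q k X = theta X * of_bool (X \<subseteq> {1..k} \<and> (\<forall>(a, b)\<in>A. a \<in> X \<longleftrightarrow> b \<notin> X) \<and> X \<inter> V = {})" for X
  unfolding cup_vector_def VA by simp
 show ?case
 proof (cases "Suc k \<in> Q")
  case False
  have h: "half Q (Suc k) = (insert (Suc k) V, A)" using False VA by simp
  have "cup_vector Q (Suc k) X = cup_vector Q k X" if "X \<in> Pow {1..k}" for X
  proof -
   have "X \<subseteq> {1..k}" "X \<subseteq> {1..Suc k}" "Suc k \<notin> X" using that by auto
   thus ?thesis unfolding cup_vector_def h VA by simp
  qed
  hence "scalar_prod (Suc k) (cup_vector Q (Suc k)) (hw Q (Suc k)) = scalar_prod k (cup_vector Q k) (hw Q k)"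
   unfolding scalar_prod_def sum_Pow_Suc using False tensors_new[OF hT] by simp
  thus ?thesis using Suc by simp
 next
  case True
  define M where "M = Max V"
  have h: "half Q (Suc k) = (V - {M}, insert (M, Suc k) A)" using True VA by (simp add: M_def)
  have hp: "0 \<le> height Q (Suc k)" using height_nonneg[OF Q Suc.prems] .
  hence "card V \<noteq> 0" using s(5) True by (simp add: height_Suc)
  hence M: "M \<in> V" unfolding M_def using s(1) by (intro Max_in) auto
  \<comment> \<open>With \<open>Suc k\<close> chosen, the arc from \<open>M\<close> forces
    \<open>M\<close> out, exactly as when \<open>M\<close> was vacant; so the previous half-diagram
    reappears.\<close>
  have new: "cup_vector Q (Suc k) (insert (Suc k) Z) = (if even (Suc k) then -1 else 1) * cup_vector Q k Z"
   if Z: "Z \<subseteq> {1..k}" for Z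
  proof -
   have "Suc k \<notin> Z" "finite Z" using Z finite_subset by auto
   hence th: "theta (insert (Suc k) Z) = (if even (Suc k) then -1 else 1) * theta Z" by (simp add: theta_insert)
   have sub: "insert (Suc k) Z \<subseteq> {1..Suc k}" using Z by auto
   have arcs: "(\<forall>(a, b)\<in>A. a \<in> insert (Suc k) Z \<longleftrightarrow> b \<notin> insert (Suc k) Z) \<longleftrightarrow> (\<forall>(a, b)\<in>A. a \<in> Z \<longleftrightarrow> b \<notin> Z)"
   proof (intro ball_cong refl)
    fix x assume "x \<in> A"
    thus "(case x of (a, b) \<Rightarrow> a \<in> insert (Suc k) Z \<longleftrightarrow> b \<notin> insert (Suc k) Z) \<longleftrightarrow> (case x of (a, b) \<Rightarrow> a \<in> Z \<longleftrightarrow> b \<notin> Z)"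
     using An[of "fst x" "snd x"] by (cases x) auto
   qed
   have "Suc k \<notin> V" using Vn[of "Suc k"] by auto
   moreover have "M \<noteq> Suc k" using Vn[OF M] by auto
   ultimately have "(\<forall>(a, b)\<in>insert (M, Suc k) A. a \<in> insert (Suc k) Z \<longleftrightarrow> b \<notin> insert (Suc k) Z) \<and> insert (Suc k) Z \<inter> (V - {M}) = {} \<longleftrightarrow>
     (\<forall>(a, b)\<in>A. a \<in> Z \<longleftrightarrow> b \<notin> Z) \<and> Z \<inter> V = {}"
    unfolding ball_simps(7) arcs using M by auto
   thus ?thesis unfolding w cup_vector_def[of Q "Suc k"] h fst_conv snd_conv th using Z sub by simp
  qed
  let ?w = "cup_vector Q (Suc k)" and ?h = "hw Q k"
  have lw: "lowering (Suc k) ?h X = lowering k ?h X + extend k ?h X" for X by (rule lowering_Suc[OF hT])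
  have "scalar_prod (Suc k) ?w (lowering (Suc k) ?h) = scalar_prod (Suc k) ?h (raising (Suc k) ?w)"
   unfolding scalar_prod_commute[of _ ?w] lowering_adjoint ..
  hence 0: "scalar_prod (Suc k) ?w (lowering (Suc k) ?h) = 0"
   unfolding raising_cup_vector[OF Q Suc.prems] by (simp add: scalar_prod_def)
  have "scalar_prod (Suc k) ?w (extend k ?h) = (\<Sum>Z\<in>Pow {1..k}. ?w (insert (Suc k) Z) * ?h Z)"
  proof -
   have "extend k ?h X = 0" "extend k ?h (insert (Suc k) X) = ?h X" if "X \<in> Pow {1..k}" for X
   proof -
    have "Suc k \<notin> X" using that by auto
    thus "extend k ?h X = 0" "extend k ?h (insert (Suc k) X) = ?h X" by (simp_all add: extend_def)
   qed
   thus ?thesis unfolding scalar_prod_def sum_Pow_Suc by simp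
  qed
  also have "\<dots> = (if even (Suc k) then -1 else 1) * scalar_prod k (cup_vector Q k) ?h"
   unfolding scalar_prod_def sum_distrib_left by (intro sum.cong refl) (simp add: new)
  finally have 1: "scalar_prod (Suc k) ?w (extend k ?h) = (if even (Suc k) then -1 else 1) * scalar_prod k (cup_vector Q k) ?h" .
  have "scalar_prod (Suc k) ?w (hw Q (Suc k)) = (of_int (height Q k) + 1) * scalar_prod (Suc k) ?w (extend k ?h)"
   using True 0 by (simp add: scalar_prod_linear)
  moreover have "of_int (height Q k) + 1 \<noteq> (0::rat)"
  proof -
   have "0 < height Q k + 1" using hp True by (simp add: height_Suc)
   hence "(0::rat) < of_int (height Q k + 1)" by (simp only: of_int_0_less_iff)
   thus ?thesis by simp
  qed
  ultimately show ?thesis using 1 Suc by auto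
 qed
qed

text \<open>The coordinate of the cup vector at \<open>hw P n\<close>. Its product with
  \<open>bot_coeff\<close> is the scalar by which an \<open>f_basis\<close> element differs from a
  matrix unit.\<close>

definition top_coeff :: "nat \<Rightarrow> nat set \<Rightarrow> rat" where
 "top_coeff n P = scalar_prod n (hw P n) (cup_vector P n) / scalar_prod n (hw P n) (hw P n)"

definition bot_coeff :: "nat \<Rightarrow> nat set \<Rightarrow> rat" where
 "bot_coeff n Q = scalar_prod n (cup_vector Q n) (hw Q n)"

lemma coeff_nonzero:
 assumes "Q \<in> ballot n"
 shows "top_coeff n Q \<noteq> 0" "bot_coeff n Q \<noteq> 0"
 using cup_vector_hw[OF assms order_refl] hw_norm[OF assms]
 unfolding top_coeff_def bot_coeff_def scalar_prod_commute[of n "hw Q n" "cup_vector Q n"] by simp_all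

lemma mat_C:
 assumes P: "P \<in> ballot n" and Q: "Q \<in> ballot n" and c: "card P = card Q"
 shows "mat n (delta (C_diagram n (tab n P) (tab n Q))) P Q = top_coeff n P * bot_coeff n Q"
 unfolding mat_def act_C(2)[OF P Q c] scalar_prod_linear(3) top_coeff_def bot_coeff_def by simp

lemma f_basis_closed:
 assumes P: "P \<in> ballot n" and Q: "Q \<in> ballot n" and c: "card P = card Q"
 shows "f_basis n (tab n P) (tab n Q) \<in> carrier (TLQ n)"
 unfolding f_basis_def
 by (intro TL_mult_closed EE_closed delta_in_carrier act_C(1)[OF P Q c])

lemma mat_f_basis:
 assumes P: "P \<in> ballot n" and Q: "Q \<in> ballot n" and c: "card P = card Q" and R: "R \<in> ballot n" and S: "S \<in> ballot n"
 shows "mat n (f_basis n (tab n P) (tab n Q)) R S = (if R = P \<and> S = Q then top_coeff n P * bot_coeff n Q else 0)"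
proof -
 let ?C = "delta (C_diagram n (tab n P) (tab n Q))"
 have 1: "mat n (EE n (tab n P) \<otimes>\<^bsub>TLQ n\<^esub> ?C) R U = (if R = P then mat n ?C P U else 0)" if "U \<in> ballot n" for U
 proof -
  have "mat n (EE n (tab n P) \<otimes>\<^bsub>TLQ n\<^esub> ?C) R U = (\<Sum>T\<in>ballot n. if T = P then (if R = P then mat n ?C P U else 0) else 0)"
   unfolding mat_mult[OF R] by (intro sum.cong refl) (auto simp: mat_EE[OF R _ P])
  thus ?thesis using P by simp
 qed
 have "mat n (f_basis n (tab n P) (tab n Q)) R S = (\<Sum>T\<in>ballot n. if T = Q then (if R = P \<and> S = Q then mat n ?C P Q else 0) else 0)"
  unfolding f_basis_def
 proof (subst mat_mult[OF R], rule sum.cong[OF refl])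
  fix T assume T: "T \<in> ballot n"
  show "mat n (EE n (tab n P) \<otimes>\<^bsub>TLQ n\<^esub> ?C) R T * mat n (EE n (tab n Q)) T S =
    (if T = Q then (if R = P \<and> S = Q then mat n ?C P Q else 0) else 0)"
   unfolding 1[OF T] mat_EE[OF T S Q] by (cases "T = Q"; cases "R = P"; cases "T = S") simp_all
 qed
 thus ?thesis unfolding mat_C[OF P Q c] using Q by simp
qed

lemma Std_card:
 assumes l: "l \<in> Par2 n" and "tab n P \<in> Std l" "tab n Q \<in> Std l" "P \<subseteq> {1..n}" "Q \<subseteq> {1..n}"
 shows "card P = card Q"
proof -
 have "card R = card {x \<in> cells l. snd x = 2}" if R: "tab n R \<in> Std l" "R \<subseteq> {1..n}" for R
 proof -
  have b: "bij_betw (tab n R) {1..n} (cells l)" using R l by (simp add: Std_def Par2_def)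
  have "bij_betw (tab n R) R {x \<in> cells l. snd x = 2}"
   unfolding bij_betw_def
  proof
   show "inj_on (tab n R) R" using inj_on_tab R(2) by (rule inj_on_subset)
   show "tab n R ` R = {x \<in> cells l. snd x = 2}"
   proof (intro equalityI subsetI)
    fix x assume "x \<in> tab n R ` R"
    thus "x \<in> {x \<in> cells l. snd x = 2}" using b R(2) snd_tab[of _ n R] unfolding bij_betw_def by auto
   next
    fix x assume x: "x \<in> {x \<in> cells l. snd x = 2}"
    then obtain i where "i \<in> {1..n}" "x = tab n R i" using b unfolding bij_betw_def by blast
    thus "x \<in> tab n R ` R" using x snd_tab[of i n R] by (auto split: if_splits)
   qed
  qed
  thus ?thesis by (rule bij_betw_same_card)
 qed
 thus ?thesis using assms by metis
qed

section \<open>The elements psi\<close>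

lemma mat_sum:
 assumes "finite A"
 shows "mat n (\<lambda>D. \<Sum>i\<in>A. c i * a i D) P Q = (\<Sum>i\<in>A. c i * mat n (a i) P Q)"
 using assms
proof (induction A rule: finite_induct)
 case empty
 thus ?case using mat_zero[of n P Q] by (simp add: TL_simps)
next
 case (insert x F)
 have "mat n (\<lambda>D. \<Sum>i\<in>insert x F. c i * a i D) P Q = mat n (\<lambda>D. c x * a x D + (\<Sum>i\<in>F. c i * a i D)) P Q"
  using insert by simp
 also have "\<dots> = mat n ((c x \<odot>\<^bsub>TLQ n\<^esub> a x) \<oplus>\<^bsub>TLQ n\<^esub> (\<lambda>D. \<Sum>i\<in>F. c i * a i D)) P Q"
  by (simp add: TL_simps)
 also have "\<dots> = c x * mat n (a x) P Q + mat n (\<lambda>D. \<Sum>i\<in>F. c i * a i D) P Q"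
  unfolding mat_add mat_smult ..
 finally show ?case using insert by simp
qed

text \<open>The description defining \<open>psi\<close> needs existence as well as uniqueness. The
  matrices respecting the sizes of ballot sets are spanned by those of the \<open>f_basis\<close>
  elements, which are nonzero multiples of matrix units.\<close>

lemma mat_surjective:
 assumes M: "\<And>R P. R \<in> ballot n \<Longrightarrow> P \<in> ballot n \<Longrightarrow> M R P \<noteq> 0 \<Longrightarrow> card R = card P"
 shows "\<exists>x\<in>carrier (TLQ n). \<forall>R\<in>ballot n. \<forall>P\<in>ballot n. mat n x R P = M R P"
proof -
 define A where "A = {(R, P) \<in> ballot n \<times> ballot n. card R = card P}"
 have finA: "finite A" unfolding A_def by (rule finite_subset[of _ "ballot n \<times> ballot n"]) auto
 define c where "c = (\<lambda>(R, P). M R P / (top_coeff n R * bot_coeff n P))"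
 define f where "f = (\<lambda>(R, P). f_basis n (tab n R) (tab n P))"
 define x where "x = (\<lambda>D. \<Sum>i\<in>A. c i * f i D)"
 have fc: "f i \<in> carrier (TLQ n)" if "i \<in> A" for i
  using that f_basis_closed unfolding A_def f_def by auto
 have "f i D = 0" if "i \<in> A" "D \<notin> diagrams n" for i D
  using fc[OF that(1)] that(2) unfolding TL_carrier by blast
 hence "x \<in> carrier (TLQ n)" unfolding TL_carrier x_def by simp
 moreover have "mat n x R P = M R P" if R: "R \<in> ballot n" and P: "P \<in> ballot n" for R P
 proof -
  have "mat n x R P = (\<Sum>i\<in>A. c i * mat n (f i) R P)" unfolding x_def by (rule mat_sum[OF finA])
  also have "\<dots> = (\<Sum>i\<in>A. if i = (R, P) then M R P else 0)"
  proof (rule sum.cong[OF refl])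
   fix i assume i: "i \<in> A"
   obtain R' P' where i': "i = (R', P')" by (cases i)
   have b: "R' \<in> ballot n" "P' \<in> ballot n" "card R' = card P'" using i unfolding A_def i' by auto
   show "c i * mat n (f i) R P = (if i = (R, P) then M R P else 0)"
    using mat_f_basis[OF b R P] coeff_nonzero(1)[OF b(1)] coeff_nonzero(2)[OF b(2)]
    by (auto simp: c_def f_def i')
  qed
  also have "\<dots> = (if (R, P) \<in> A then M R P else 0)" using finA by simp
  also have "\<dots> = M R P" using M[OF R P] R P unfolding A_def by auto
  finally show ?thesis .
 qed
 ultimately show ?thesis by blast
qed

definition swp :: "nat \<Rightarrow> nat set \<Rightarrow> nat set" where
 "swp k Q = transpose k (k + 1) ` Q"

lemma swp_mem: "x \<in> swp k Q \<longleftrightarrow> (if x = k then k + 1 \<in> Q else if x = k + 1 then k \<in> Q else x \<in> Q)"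
proof -
 have "x \<in> swp k Q \<longleftrightarrow> transpose k (k + 1) x \<in> Q"
  unfolding swp_def using inj_image_mem_iff[of "transpose k (k + 1)" "transpose k (k + 1) x" Q] by simp
 thus ?thesis by (simp add: transpose_def)
qed

lemma swp_swp [simp]: "swp k (swp k Q) = Q"
 by (simp add: swp_def image_image)

lemma card_swp [simp]: "card (swp k Q) = card Q"
 unfolding swp_def by (rule card_image) simp

definition exchangeable :: "nat \<Rightarrow> nat \<Rightarrow> nat set \<Rightarrow> bool" where
 "exchangeable n k P \<longleftrightarrow> (k \<in> P \<longleftrightarrow> k + 1 \<notin> P) \<and> P \<in> ballot n \<and> swp k P \<in> ballot n"

lemma exchangeable_swp: "exchangeable n k (swp k P) \<longleftrightarrow> exchangeable n k P"
 unfolding exchangeable_def by (auto simp: swp_mem)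

definition axial_set :: "nat set \<Rightarrow> nat \<Rightarrow> int" where
 "axial_set P k = set_content P k - set_content P (k + 1)"

lemma axial_tab: "k \<in> {1..<n} \<Longrightarrow> axial (tab n P) k = axial_set P k"
 by (simp add: axial_def axial_set_def content_tab)

lemma set_content_height: "set_content Q i = (if i \<in> Q then 2 - int (card (Q \<inter> {1..i})) else 1 - (int i - int (card (Q \<inter> {1..i}))))"
 using card_Int_le[of Q i] unfolding set_content_def card_interval_Diff by (simp add: of_nat_diff)

text \<open>Axial distances in terms of heights, which are what the residue arguments for long words
  follow.\<close>

lemma axial_set_eq:
 "axial_set P k = (if k \<in> P \<longleftrightarrow> k + 1 \<in> P then 1 else if k \<in> P then height P k + 2 else - height P k)"
 unfolding axial_set_def set_content_height height_def using card_Int_Suc[of P k] by auto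

lemma height_swp:
 assumes "k \<ge> 1" "m \<noteq> k"
 shows "height (swp k P) m = height P m"
 unfolding height_def swp_def using transpose_adjacent_count[OF assms(2,1)] by simp

lemma height_swp_self:
 assumes "k \<ge> 1" "k \<in> P \<longleftrightarrow> k + 1 \<notin> P"
 shows "height (swp k P) k = height P k + (if k \<in> P then 2 else -2)"
proof -
 have "height (swp k P) (Suc k) = height P (Suc k)" using height_swp[OF assms(1)] by simp
 thus ?thesis using assms(2) by (auto simp: height_Suc swp_mem split: if_splits)
qed

text \<open>Both sets satisfy the ballot condition at \<open>k\<close>, where their heights differ
  by 2; this keeps the distance away from 0, 1 and -1.\<close>

lemma exchangeable_axial:
 assumes "exchangeable n k P" "k \<in> {1..<n}"
 shows "axial_set P k \<ge> 2 \<or> axial_set P k \<le> -2"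
proof -
 have x: "k \<in> P \<longleftrightarrow> k + 1 \<notin> P" and P: "P \<in> ballot n" and S: "swp k P \<in> ballot n"
  using assms(1) unfolding exchangeable_def by blast+
 have "0 \<le> height P k" "0 \<le> height (swp k P) k" using height_nonneg[OF P] height_nonneg[OF S] assms(2) by auto
 thus ?thesis using height_swp_self[OF _ x] assms(2) x unfolding axial_set_eq by (auto split: if_splits)
qed

text \<open>Every branch of the coefficient is nonzero once r is none of 0, 1 and -1.\<close>

lemma psi_beta_nonzero:
 assumes "exchangeable n k P" "k \<in> {1..<n}"
 shows "psi_beta p n k (tab n P) \<noteq> 0"
proof -
 have P: "P \<in> ballot n" and x: "(k \<in> P \<longleftrightarrow> k + 1 \<notin> P) \<and> swp k P \<in> ballot n"
  using assms(1) unfolding exchangeable_def by blast+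
 have std: "swap_entries (tab n P) k \<in> Std2 n"
  using swap_entries_Std2[OF assms(2) P] x unfolding swp_def by blast
 define r where "r = axial_set P k"
 have r: "r \<ge> 2 \<or> r \<le> -2" using exchangeable_axial[OF assms] unfolding r_def .
 have rr: "axial (tab n P) k = r" unfolding r_def by (rule axial_tab[OF assms(2)])
 have nz: "of_int r \<noteq> (0::rat)" "1 - of_int r \<noteq> (0::rat)" using r by auto
 have "(of_int r)\<^sup>2 - 1 \<noteq> (0::rat)"
 proof
  assume "(of_int r)\<^sup>2 - 1 = (0::rat)"
  hence "of_int (r * r) = (of_int 1 :: rat)" by (simp add: power2_eq_square)
  hence "r * r = 1" by (simp only: of_int_eq_iff)
  moreover have "4 \<le> r * r"
   using r mult_mono[of 2 r 2 r] mult_mono[of 2 "- r" 2 "- r"] by auto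
  ultimately show False by simp
 qed
 hence al: "psi_alpha n k (tab n P) \<noteq> 0"
  unfolding psi_alpha_def Let_def rr using nz by simp
 show ?thesis unfolding psi_beta_def Let_def rr using std al nz by simp
qed

text \<open>An \<open>f_basis\<close> element is a matrix unit scaled by \<open>top_coeff\<close> of
  its row and \<open>bot_coeff\<close> of its column; only the row changes under \<open>psi\<close>,
  hence the quotient of top coefficients.\<close>

definition psi_mat :: "nat \<Rightarrow> nat \<Rightarrow> nat \<Rightarrow> nat set \<Rightarrow> nat set \<Rightarrow> rat" where
 "psi_mat p n k R P =
   (if exchangeable n k P \<and> R = swp k P then psi_beta p n k (tab n P) * top_coeff n R / top_coeff n P else 0) -
   (if [axial_set P k = 0] (mod int p) \<and> R = P then 1 / of_int (axial_set P k) else 0)"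

abbreviation psi_spec :: "nat \<Rightarrow> nat \<Rightarrow> nat \<Rightarrow> (diagram \<Rightarrow> rat) \<Rightarrow> bool" where
 "psi_spec p n k x \<equiv> x \<in> carrier (TLQ n) \<and>
    (\<forall>l\<in>Par2 n. \<forall>s\<in>Std l. \<forall>a\<in>Std l.
      x \<otimes>\<^bsub>TLQ n\<^esub> f_basis n s a =
       (if swap_entries s k \<in> Std l
       then psi_beta p n k s \<odot>\<^bsub>TLQ n\<^esub> f_basis n (swap_entries s k) a
       else \<zero>\<^bsub>TLQ n\<^esub>)
       \<ominus>\<^bsub>TLQ n\<^esub>
       (if [axial s k = 0] (mod int p)
       then (1 / of_int (axial s k)) \<odot>\<^bsub>TLQ n\<^esub> f_basis n s a
       else \<zero>\<^bsub>TLQ n\<^esub>))"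

lemma mat_mult_f_basis:
 assumes b: "P \<in> ballot n" "Q \<in> ballot n" "card P = card Q" and R: "R \<in> ballot n" and S: "S \<in> ballot n"
 shows "mat n (x \<otimes>\<^bsub>TLQ n\<^esub> f_basis n (tab n P) (tab n Q)) R S =
  (if S = Q then mat n x R P * (top_coeff n P * bot_coeff n Q) else 0)"
proof -
 have "(\<Sum>T\<in>ballot n. mat n x R T * mat n (f_basis n (tab n P) (tab n Q)) T S) =
  (\<Sum>T\<in>ballot n. if T = P then (if S = Q then mat n x R P * (top_coeff n P * bot_coeff n Q) else 0) else 0)"
  by (intro sum.cong refl) (simp add: mat_f_basis[OF b _ S])
 thus ?thesis unfolding mat_mult[OF R] using b(1) by simp
qed

lemma psi_rhs:
 fixes p :: nat
 assumes l: "l \<in> Par2 n" "tab n P \<in> Std l" "tab n Q \<in> Std l" and P: "P \<in> ballot n" and Q: "Q \<in> ballot n"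
  and k: "k \<in> {1..<n}"
 defines "y \<equiv> (if swap_entries (tab n P) k \<in> Std l
       then psi_beta p n k (tab n P) \<odot>\<^bsub>TLQ n\<^esub> f_basis n (swap_entries (tab n P) k) (tab n Q)
       else \<zero>\<^bsub>TLQ n\<^esub>)
       \<ominus>\<^bsub>TLQ n\<^esub>
       (if [axial (tab n P) k = 0] (mod int p)
       then (1 / of_int (axial (tab n P) k)) \<odot>\<^bsub>TLQ n\<^esub> f_basis n (tab n P) (tab n Q)
       else \<zero>\<^bsub>TLQ n\<^esub>)"
 shows "y \<in> carrier (TLQ n)"
  and "R \<in> ballot n \<Longrightarrow> S \<in> ballot n \<Longrightarrow>
   mat n y R S = (if S = Q then psi_mat p n k R P * (top_coeff n P * bot_coeff n Q) else 0)"
proof -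
 have c: "card P = card Q" using Std_card[OF l] ballot_subset P Q by blast
 have ex: "swap_entries (tab n P) k \<in> Std l \<longleftrightarrow> exchangeable n k P"
  unfolding Std_swap_iff[OF l(1,2) k] swap_entries_Std2[OF k P] exchangeable_def swp_def using P by blast
 have sw: "swap_entries (tab n P) k = tab n (swp k P)" if "exchangeable n k P"
  using swap_entries_tab[OF k ballot_subset[OF P]] that unfolding exchangeable_def swp_def by blast
 let ?z = "\<zero>\<^bsub>TLQ n\<^esub>"
 have zc: "?z \<in> carrier (TLQ n)" by simp
 define y1 where "y1 = (if exchangeable n k P then psi_beta p n k (tab n P) \<odot>\<^bsub>TLQ n\<^esub> f_basis n (tab n (swp k P)) (tab n Q) else ?z)"
 define y2 where "y2 = (if [axial_set P k = 0] (mod int p) then (1 / of_int (axial_set P k)) \<odot>\<^bsub>TLQ n\<^esub> f_basis n (tab n P) (tab n Q) else ?z)"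
 have y: "y = y1 \<ominus>\<^bsub>TLQ n\<^esub> y2"
  unfolding y_def y1_def y2_def ex axial_tab[OF k] using sw by (cases "exchangeable n k P") simp_all
 have ballot_swp: "swp k P \<in> ballot n" if "exchangeable n k P" using that unfolding exchangeable_def by blast
 have y1c: "y1 \<in> carrier (TLQ n)" unfolding y1_def
  using f_basis_closed[OF ballot_swp Q] c zc by (auto intro: smult_closed)
 have y2c: "y2 \<in> carrier (TLQ n)" unfolding y2_def
  using f_basis_closed[OF P Q c] zc by (auto intro: smult_closed)
 show "y \<in> carrier (TLQ n)" unfolding y using y1c y2c by simp
 assume R: "R \<in> ballot n" and S: "S \<in> ballot n"
 have m1: "mat n y1 R S = (if S = Q \<and> exchangeable n k P \<and> R = swp k P then psi_beta p n k (tab n P) * (top_coeff n R * bot_coeff n Q) else 0)"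
 proof (cases "exchangeable n k P")
  case True
  have "card (swp k P) = card Q" using c by simp
  thus ?thesis using True mat_f_basis[OF ballot_swp[OF True] Q _ R S]
   unfolding y1_def by (auto simp: mat_smult)
 qed (simp add: y1_def mat_zero)
 have m2: "mat n y2 R S = (if S = Q \<and> [axial_set P k = 0] (mod int p) \<and> R = P then (top_coeff n P * bot_coeff n Q) / of_int (axial_set P k) else 0)"
 proof (cases "[axial_set P k = 0] (mod int p)")
  case True
  have "mat n y2 R S = 1 / of_int (axial_set P k) * (if R = P \<and> S = Q then top_coeff n P * bot_coeff n Q else 0)"
   unfolding y2_def if_P[OF True] mat_smult mat_f_basis[OF P Q c R S] ..
  thus ?thesis using True by auto
 qed (simp add: y2_def mat_zero)
 show "mat n y R S = (if S = Q then psi_mat p n k R P * (top_coeff n P * bot_coeff n Q) else 0)"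
  unfolding y mat_minus[OF y1c y2c] m1 m2 psi_mat_def using coeff_nonzero(1)[OF P]
  by (auto simp: algebra_simps)
qed

text \<open>Taking both tableaux equal already recovers a column of the matrix, so the condition
  over all pairs amounts to one matrix identity.\<close>

lemma psi_spec_iff:
 assumes k: "k \<in> {1..<n}" and x: "x \<in> carrier (TLQ n)"
 shows "psi_spec p n k x \<longleftrightarrow> (\<forall>R\<in>ballot n. \<forall>P\<in>ballot n. mat n x R P = psi_mat p n k R P)"
proof
 assume spec: "psi_spec p n k x"
 show "\<forall>R\<in>ballot n. \<forall>P\<in>ballot n. mat n x R P = psi_mat p n k R P"
 proof (intro ballI)
  fix R P assume R: "R \<in> ballot n" and P: "P \<in> ballot n"
  obtain l where l: "l \<in> Par2 n" "tab n P \<in> Std l" using tab_Std[OF P] by blast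
  note eq = bspec[OF bspec[OF bspec[OF conjunct2[OF spec] l(1)] l(2)] l(2)]
  have "mat n x R P * (top_coeff n P * bot_coeff n P) = mat n (x \<otimes>\<^bsub>TLQ n\<^esub> f_basis n (tab n P) (tab n P)) R P"
   using mat_mult_f_basis[OF P P refl R P, of x] by simp
  also have "\<dots> = psi_mat p n k R P * (top_coeff n P * bot_coeff n P)"
   unfolding eq psi_rhs(2)[OF l(1,2,2) P P k R P, of p] by simp
  finally show "mat n x R P = psi_mat p n k R P" using coeff_nonzero[OF P] by simp
 qed
next
 assume m: "\<forall>R\<in>ballot n. \<forall>P\<in>ballot n. mat n x R P = psi_mat p n k R P"
 show "psi_spec p n k x"
 proof (rule conjI[OF x], intro ballI)
  fix l s a assume l: "l \<in> Par2 n" and s: "s \<in> Std l" and a: "a \<in> Std l"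
  have "s \<in> Std2 n" "a \<in> Std2 n" using l s a by (auto simp: Std2_def)
  then obtain P Q where P: "P \<in> ballot n" "s = tab n P" and Q: "Q \<in> ballot n" "a = tab n Q" unfolding Std2_eq by blast
  have c: "card P = card Q" using Std_card[OF l] s a ballot_subset P Q by blast
  show "x \<otimes>\<^bsub>TLQ n\<^esub> f_basis n s a =
       (if swap_entries s k \<in> Std l
       then psi_beta p n k s \<odot>\<^bsub>TLQ n\<^esub> f_basis n (swap_entries s k) a
       else \<zero>\<^bsub>TLQ n\<^esub>)
       \<ominus>\<^bsub>TLQ n\<^esub>
       (if [axial s k = 0] (mod int p)
       then (1 / of_int (axial s k)) \<odot>\<^bsub>TLQ n\<^esub> f_basis n s a
       else \<zero>\<^bsub>TLQ n\<^esub>)"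
   unfolding P(2) Q(2)
  proof (rule mat_faithful)
   note l' = l s[unfolded P(2)] a[unfolded Q(2)]
   show "x \<otimes>\<^bsub>TLQ n\<^esub> f_basis n (tab n P) (tab n Q) \<in> carrier (TLQ n)"
    by (rule TL_mult_closed[OF x f_basis_closed[OF P(1) Q(1) c]])
   show "(if swap_entries (tab n P) k \<in> Std l
       then psi_beta p n k (tab n P) \<odot>\<^bsub>TLQ n\<^esub> f_basis n (swap_entries (tab n P) k) (tab n Q)
       else \<zero>\<^bsub>TLQ n\<^esub>)
       \<ominus>\<^bsub>TLQ n\<^esub>
       (if [axial (tab n P) k = 0] (mod int p)
       then (1 / of_int (axial (tab n P) k)) \<odot>\<^bsub>TLQ n\<^esub> f_basis n (tab n P) (tab n Q)
       else \<zero>\<^bsub>TLQ n\<^esub>) \<in> carrier (TLQ n)"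
    by (rule psi_rhs(1)[OF l' P(1) Q(1) k])
   fix R S assume RS: "R \<in> ballot n" "S \<in> ballot n"
   have "mat n x R P = psi_mat p n k R P" using m RS(1) P(1) by blast
   thus "mat n (x \<otimes>\<^bsub>TLQ n\<^esub> f_basis n (tab n P) (tab n Q)) R S =
    mat n ((if swap_entries (tab n P) k \<in> Std l
       then psi_beta p n k (tab n P) \<odot>\<^bsub>TLQ n\<^esub> f_basis n (swap_entries (tab n P) k) (tab n Q)
       else \<zero>\<^bsub>TLQ n\<^esub>)
       \<ominus>\<^bsub>TLQ n\<^esub>
       (if [axial (tab n P) k = 0] (mod int p)
       then (1 / of_int (axial (tab n P) k)) \<odot>\<^bsub>TLQ n\<^esub> f_basis n (tab n P) (tab n Q)
       else \<zero>\<^bsub>TLQ n\<^esub>)) R S"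
    unfolding mat_mult_f_basis[OF P(1) Q(1) c RS] psi_rhs(2)[OF l' P(1) Q(1) k RS] by simp
  qed
 qed
qed

lemma psi_props:
 assumes k: "k \<in> {1..<n}"
 shows "psi p n k \<in> carrier (TLQ n)"
  and "R \<in> ballot n \<Longrightarrow> P \<in> ballot n \<Longrightarrow> mat n (psi p n k) R P = psi_mat p n k R P"
proof -
 have "card R = card P" if "psi_mat p n k R P \<noteq> 0" for R P
  using that unfolding psi_mat_def by (auto split: if_splits)
 then obtain x where x: "x \<in> carrier (TLQ n)" "\<forall>R\<in>ballot n. \<forall>P\<in>ballot n. mat n x R P = psi_mat p n k R P"
  using mat_surjective[of n "psi_mat p n k"] by blast
 have sx: "psi_spec p n k x" using psi_spec_iff[OF k x(1)] x(2) by blast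
 have uniq: "y = x" if "psi_spec p n k y" for y
 proof (rule mat_faithful[OF _ x(1)])
  show yc: "y \<in> carrier (TLQ n)" using that by blast
  fix P Q assume "P \<in> ballot n" "Q \<in> ballot n"
  thus "mat n y P Q = mat n x P Q" using that psi_spec_iff[OF k yc] x(2) by simp
 qed
 have "psi p n k = x" unfolding psi_def by (rule the_equality, rule sx, rule uniq)
 thus "psi p n k \<in> carrier (TLQ n)"
  "R \<in> ballot n \<Longrightarrow> P \<in> ballot n \<Longrightarrow> mat n (psi p n k) R P = psi_mat p n k R P"
  using x by blast+
qed

section \<open>Words in the elements psi\<close>

definition psi_word :: "nat \<Rightarrow> nat \<Rightarrow> nat list \<Rightarrow> diagram \<Rightarrow> rat" where
 "psi_word p n ks = list_mult (TLQ n) (map (psi p n) ks)"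

lemma psi_word_closed: "set ks \<subseteq> {1..<n} \<Longrightarrow> psi_word p n ks \<in> carrier (TLQ n)"
 unfolding psi_word_def by (rule list_mult_closed) (auto intro!: psi_props(1))

lemma list_mult_append:
 assumes "set xs \<subseteq> carrier (TLQ n)" "set ys \<subseteq> carrier (TLQ n)"
 shows "list_mult (TLQ n) (xs @ ys) = list_mult (TLQ n) xs \<otimes>\<^bsub>TLQ n\<^esub> list_mult (TLQ n) ys"
 using assms(1)
proof (induction xs)
 case Nil
 thus ?case using list_mult_closed[OF assms(2)] by (simp add: list_mult_Nil)
next
 case (Cons x xs)
 thus ?case
  using list_mult_closed[of xs n] list_mult_closed[OF assms(2)] by (simp add: list_mult_Cons TL.m_assoc)
qed

lemma list_mult_concat:
 assumes "\<And>xs. xs \<in> set xss \<Longrightarrow> set xs \<subseteq> carrier (TLQ n)"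
 shows "list_mult (TLQ n) (map (list_mult (TLQ n)) xss) = list_mult (TLQ n) (concat xss)"
 using assms
proof (induction xss)
 case (Cons xs xss)
 hence "set (concat xss) \<subseteq> carrier (TLQ n)" by auto
 thus ?case using Cons by (simp add: list_mult_Cons list_mult_append)
qed (simp add: list_mult_Nil)

lemma mat_psi_word_Cons:
 assumes "k \<in> {1..<n}" "R \<in> ballot n"
 shows "mat n (psi_word p n (k # ks)) R P = (\<Sum>S\<in>ballot n. psi_mat p n k R S * mat n (psi_word p n ks) S P)"
proof -
 have "mat n (psi_word p n (k # ks)) R P = (\<Sum>S\<in>ballot n. mat n (psi p n k) R S * mat n (psi_word p n ks) S P)"
  unfolding psi_word_def list.map list_mult_Cons by (rule mat_mult[OF assms(2)])
 thus ?thesis using psi_props(2)[OF assms(1,2)] by simp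
qed

definition psi_swap :: "nat \<Rightarrow> nat \<Rightarrow> nat \<Rightarrow> nat set \<Rightarrow> rat" where
 "psi_swap p n k P = psi_beta p n k (tab n P) * top_coeff n (swp k P) / top_coeff n P"

lemma psi_swap_nonzero:
 assumes "exchangeable n k P" "k \<in> {1..<n}"
 shows "psi_swap p n k P \<noteq> 0"
 using psi_beta_nonzero[OF assms] coeff_nonzero(1) assms(1) unfolding psi_swap_def exchangeable_def by auto

lemma psi_mat_eq:
 "psi_mat p n k R S = (if exchangeable n k R \<and> S = swp k R then psi_swap p n k S else 0) -
   (if S = R \<and> [axial_set R k = 0] (mod int p) then 1 / of_int (axial_set R k) else 0)"
proof -
 have "exchangeable n k S \<and> R = swp k S \<longleftrightarrow> exchangeable n k R \<and> S = swp k R"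
  using exchangeable_swp swp_swp by metis
 thus ?thesis unfolding psi_mat_def psi_swap_def by auto
qed

lemma psi_sum_eq:
 assumes R: "R \<in> ballot n"
 shows "(\<Sum>S\<in>ballot n. psi_mat p n k R S * v S) =
  (if exchangeable n k R then psi_swap p n k (swp k R) * v (swp k R) else 0) -
  (if [axial_set R k = 0] (mod int p) then v R / of_int (axial_set R k) else 0)"
proof -
 have e: "psi_mat p n k R S * v S =
   (if S = swp k R then (if exchangeable n k R then psi_swap p n k (swp k R) * v (swp k R) else 0) else 0) -
   (if S = R then (if [axial_set R k = 0] (mod int p) then v R / of_int (axial_set R k) else 0) else 0)" for S
  unfolding psi_mat_eq by (auto simp: algebra_simps)
 have "swp k R \<in> ballot n" if "exchangeable n k R" using that unfolding exchangeable_def by blast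
 thus ?thesis unfolding e sum_subtractf using R by simp
qed

lemma mat_psi_word_Nil: "R \<in> ballot n \<Longrightarrow> P \<in> ballot n \<Longrightarrow> mat n (psi_word p n []) R P = of_bool (R = P)"
 unfolding psi_word_def by (simp add: list_mult_Nil mat_one)

text \<open>A row of \<open>psi\<close> has at most two entries, one for exchanging and one for
  staying, so an entry of a word is a sum over paths of ballot sets.\<close>

lemma mat_psi_word_step:
 assumes "k \<in> {1..<n}" "R \<in> ballot n"
 shows "mat n (psi_word p n (k # ks)) R P =
  (if exchangeable n k R then psi_swap p n k (swp k R) * mat n (psi_word p n ks) (swp k R) P else 0) -
  (if [axial_set R k = 0] (mod int p) then mat n (psi_word p n ks) R P / of_int (axial_set R k) else 0)"
 unfolding mat_psi_word_Cons[OF assms] by (rule psi_sum_eq[OF assms(2)])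

lemma mat_psi_word_append:
 assumes "set ks \<subseteq> {1..<n}" "set ls \<subseteq> {1..<n}" "R \<in> ballot n"
 shows "mat n (psi_word p n (ks @ ls)) R P = (\<Sum>S\<in>ballot n. mat n (psi_word p n ks) R S * mat n (psi_word p n ls) S P)"
proof -
 have "set (map (psi p n) ks) \<subseteq> carrier (TLQ n)" "set (map (psi p n) ls) \<subseteq> carrier (TLQ n)"
  using assms(1,2) by (auto intro!: psi_props(1))
 hence "psi_word p n (ks @ ls) = psi_word p n ks \<otimes>\<^bsub>TLQ n\<^esub> psi_word p n ls"
  unfolding psi_word_def map_append by (rule list_mult_append)
 thus ?thesis by (simp add: mat_mult[OF assms(3)])
qed

lemma psi_word_support:
 assumes "set ks \<subseteq> {1..<n}" "R \<in> ballot n" "P \<in> ballot n" "mat n (psi_word p n ks) R P \<noteq> 0"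
 shows "card R = card P" "\<And>x. (\<And>k. k \<in> set ks \<Longrightarrow> x \<noteq> k \<and> x \<noteq> k + 1) \<Longrightarrow> x \<in> R \<longleftrightarrow> x \<in> P"
proof -
 have "card R = card P \<and> (\<forall>x. (\<forall>k\<in>set ks. x \<noteq> k \<and> x \<noteq> k + 1) \<longrightarrow> (x \<in> R \<longleftrightarrow> x \<in> P))"
  using assms(1,2,4)
 proof (induction ks arbitrary: R)
  case Nil
  thus ?case using mat_psi_word_Nil[OF Nil.prems(2) assms(3)] by (auto split: if_splits)
 next
  case (Cons k ks)
  have k: "k \<in> {1..<n}" using Cons.prems(1) by simp
  have "(exchangeable n k R \<and> mat n (psi_word p n ks) (swp k R) P \<noteq> 0) \<or> mat n (psi_word p n ks) R P \<noteq> 0"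
   using Cons.prems(3) unfolding mat_psi_word_step[OF k Cons.prems(2)] by (auto split: if_splits)
  thus ?case
  proof
   assume a: "exchangeable n k R \<and> mat n (psi_word p n ks) (swp k R) P \<noteq> 0"
   hence "swp k R \<in> ballot n" unfolding exchangeable_def by blast
   hence "card (swp k R) = card P \<and> (\<forall>x. (\<forall>k\<in>set ks. x \<noteq> k \<and> x \<noteq> k + 1) \<longrightarrow> (x \<in> swp k R \<longleftrightarrow> x \<in> P))"
    using Cons.IH[of "swp k R"] Cons.prems(1) a by simp
   thus ?thesis by (auto simp: swp_mem)
  next
   assume "mat n (psi_word p n ks) R P \<noteq> 0"
   thus ?thesis using Cons.IH[of R] Cons.prems by simp
  qed
 qed
 thus "card R = card P" "\<And>x. (\<And>k. k \<in> set ks \<Longrightarrow> x \<noteq> k \<and> x \<noteq> k + 1) \<Longrightarrow> x \<in> R \<longleftrightarrow> x \<in> P" by blast+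
qed

definition total :: "nat set \<Rightarrow> int" where
 "total Q = int (\<Sum>Q)"

lemma total_swp:
 assumes "finite Q"
 shows "total (swp k Q) = total Q + (if k \<in> Q \<and> k + 1 \<notin> Q then 1 else if k \<notin> Q \<and> k + 1 \<in> Q then -1 else 0)"
proof (cases "k \<in> Q \<longleftrightarrow> k + 1 \<in> Q")
 case True
 hence "swp k Q = Q" unfolding swp_def by (rule transpose_image_eq)
 thus ?thesis using True by auto
next
 case False
 define Z where "Z = Q - {k, k + 1}"
 have fin: "finite Z" "k \<notin> Z" "k + 1 \<notin> Z" using assms by (auto simp: Z_def)
 show ?thesis
 proof (cases "k \<in> Q")
  case True
  hence "Q = insert k Z" "swp k Q = insert (k + 1) Z" using False by (auto simp: Z_def swp_mem split: if_splits)
  thus ?thesis using fin True False by (simp add: total_def)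
 next
  case k: False
  hence "Q = insert (k + 1) Z" "swp k Q = insert k Z" using False by (auto simp: Z_def swp_mem split: if_splits)
  thus ?thesis using fin k False by (simp add: total_def)
 qed
qed

lemma ballot_finite: "Q \<in> ballot n \<Longrightarrow> finite Q"
 using ballot_subset finite_subset by blast

lemma finite_swp: "finite Q \<Longrightarrow> finite (swp k Q)"
 by (simp add: swp_def)

lemma total_foldr_swp:
 assumes "finite P"
 shows "total P - int (length ks) \<le> total (foldr swp ks P)" and "finite (foldr swp ks P)"
proof -
 have "total P - int (length ks) \<le> total (foldr swp ks P) \<and> finite (foldr swp ks P)"
 proof (induction ks)
  case (Cons k ks)
  thus ?case using total_swp[of "foldr swp ks P" k] by (simp add: finite_swp)
 qed (use assms in simp)
 thus "total P - int (length ks) \<le> total (foldr swp ks P)" "finite (foldr swp ks P)" by blast+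
qed

text \<open>Moving a second-column entry from \<open>k\<close> to \<open>k + 1\<close> raises the
  height at \<open>k\<close> by 2 and leaves the other heights alone.\<close>

lemma swp_down_ballot:
 assumes Q: "Q \<in> ballot n" and k: "k \<in> {1..<n}" and d: "k \<in> Q" "k + 1 \<notin> Q"
 shows "swp k Q \<in> ballot n"
proof -
 have "2 * card (swp k Q \<inter> {1..m}) \<le> m" if m: "m \<le> n" for m
 proof (cases "m = k")
  case True
  have "height (swp k Q) k = height Q k + 2" using height_swp_self[of k Q] k d by simp
  hence "0 \<le> height (swp k Q) k" using height_nonneg[OF Q, of k] k by simp
  thus ?thesis unfolding True height_def by linarith
 next
  case False
  hence "height (swp k Q) m = height Q m" using height_swp[of k m Q] k by simp
  thus ?thesis using height_nonneg[OF Q m] unfolding height_def by linarith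
 qed
 moreover have "swp k Q \<subseteq> {1..n}" using ballot_subset[OF Q] k by (auto simp: swp_mem split: if_splits)
 ultimately show ?thesis by (simp add: ballot_def)
qed

text \<open>Every factor lowers the sum of the entries of the second column by at most 1; if the word is as
 short as the total decrease, then only the path that exchanges at every step contributes.\<close>

lemma psi_word_shortest:
 assumes ks: "set ks \<subseteq> {1..<n}" and P: "P \<in> ballot n"
 shows "R \<in> ballot n \<Longrightarrow> mat n (psi_word p n ks) R P \<noteq> 0 \<Longrightarrow>
   total P - int (length ks) \<le> total R \<and> (total R = total P - int (length ks) \<longrightarrow> R = foldr swp ks P)"
  and "foldr swp ks P \<in> ballot n \<Longrightarrow> total (foldr swp ks P) = total P - int (length ks) \<Longrightarrow>
   mat n (psi_word p n ks) (foldr swp ks P) P \<noteq> 0"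
proof -
 have "(\<forall>R\<in>ballot n. mat n (psi_word p n ks) R P \<noteq> 0 \<longrightarrow>
   total P - int (length ks) \<le> total R \<and> (total R = total P - int (length ks) \<longrightarrow> R = foldr swp ks P)) \<and>
  (foldr swp ks P \<in> ballot n \<longrightarrow> total (foldr swp ks P) = total P - int (length ks) \<longrightarrow>
   mat n (psi_word p n ks) (foldr swp ks P) P \<noteq> 0)"
  using ks
 proof (induction ks)
  case Nil
  thus ?case using mat_psi_word_Nil[OF _ P] P by auto
 next
  case (Cons k ks)
  have k: "k \<in> {1..<n}" using Cons.prems by simp
  let ?m = "mat n (psi_word p n ks)" and ?l = "int (length ks)"
  have sub: "set ks \<subseteq> {1..<n}" using Cons.prems by simp
  note IH = Cons.IH[OF sub]
  have IH1: "total P - ?l \<le> total R" "total R = total P - ?l \<Longrightarrow> R = foldr swp ks P"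
   if "R \<in> ballot n" "?m R P \<noteq> 0" for R using conjunct1[OF IH] that by blast+
  have IH2: "?m (foldr swp ks P) P \<noteq> 0" if "foldr swp ks P \<in> ballot n" "total (foldr swp ks P) = total P - ?l"
   using conjunct2[OF IH] that by blast
  show ?case
  proof (intro conjI ballI impI)
   fix R assume R: "R \<in> ballot n" and nz: "mat n (psi_word p n (k # ks)) R P \<noteq> 0"
   have "(swp k R \<in> ballot n \<and> ?m (swp k R) P \<noteq> 0) \<or> ?m R P \<noteq> 0"
    using nz unfolding mat_psi_word_step[OF k R] exchangeable_def by (auto split: if_splits)
   hence "total P - int (length (k # ks)) \<le> total R \<and> (total R = total P - int (length (k # ks)) \<longrightarrow> R = foldr swp (k # ks) P)"
   proof
    assume a: "swp k R \<in> ballot n \<and> ?m (swp k R) P \<noteq> 0"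
    have t: "total (swp k R) \<le> total R + 1" using total_swp[OF ballot_finite[OF R], of k] by auto
    have g: "total P - ?l \<le> total (swp k R)" using IH1(1) a by blast
    have "R = foldr swp (k # ks) P" if "total R = total P - int (length (k # ks))"
    proof -
     have "total (swp k R) = total P - ?l" using t g that by simp
     hence "swp k R = foldr swp ks P" using IH1(2) a by blast
     hence "swp k (swp k R) = swp k (foldr swp ks P)" by simp
     thus ?thesis by simp
    qed
    thus ?thesis using t g by simp
   next
    assume "?m R P \<noteq> 0"
    thus ?thesis using IH1(1)[OF R] by auto
   qed
   thus "total P - int (length (k # ks)) \<le> total R"
    "total R = total P - int (length (k # ks)) \<Longrightarrow> R = foldr swp (k # ks) P" by blast+
  next
   let ?S = "foldr swp ks P"
   assume R: "foldr swp (k # ks) P \<in> ballot n"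
    and t: "total (foldr swp (k # ks) P) = total P - int (length (k # ks))"
   have R': "swp k ?S \<in> ballot n" using R by simp
   have f: "finite ?S" "total P - ?l \<le> total ?S" using total_foldr_swp[OF ballot_finite[OF P], of ks] by auto
   have t': "total (swp k ?S) = total P - ?l - 1" using t by simp
   \<comment> \<open>The rest of the word lowers the total by at most its length, so this letter has
     to lower it by exactly 1.\<close>
   have d: "k \<notin> ?S" "k + 1 \<in> ?S" "total ?S = total P - ?l"
    using total_swp[OF f(1), of k] t' f(2) by (auto split: if_splits)
   have kR: "k \<in> swp k ?S" "k + 1 \<notin> swp k ?S" using d by (auto simp: swp_mem)
   have S: "?S \<in> ballot n" using swp_down_ballot[OF R' k kR] by simp
   have ex: "exchangeable n k (swp k ?S)" unfolding exchangeable_def using kR R' S by simp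
   have "?m ?S P \<noteq> 0" by (rule IH2[OF S d(3)])
   \<comment> \<open>Staying at this letter would require the shorter word to reach a total below
     its range.\<close>
   moreover have "?m (swp k ?S) P = 0"
    using IH1(1)[OF R'] t' by force
   moreover have "psi_swap p n k ?S \<noteq> 0"
    using psi_swap_nonzero[OF _ k, of ?S] ex exchangeable_swp by blast
   ultimately show "mat n (psi_word p n (k # ks)) (foldr swp (k # ks) P) P \<noteq> 0"
    using mat_psi_word_step[OF k R', of p ks P] ex by simp
  qed
 qed
 thus "R \<in> ballot n \<Longrightarrow> mat n (psi_word p n ks) R P \<noteq> 0 \<Longrightarrow>
   total P - int (length ks) \<le> total R \<and> (total R = total P - int (length ks) \<longrightarrow> R = foldr swp ks P)"
  "foldr swp ks P \<in> ballot n \<Longrightarrow> total (foldr swp ks P) = total P - int (length ks) \<Longrightarrow>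
   mat n (psi_word p n ks) (foldr swp ks P) P \<noteq> 0"
  by blast+
qed

text \<open>The exchanges of such a word act on disjoint pairs of entries.\<close>

definition spread :: "nat list \<Rightarrow> bool" where
 "spread ks \<longleftrightarrow> distinct ks \<and> (\<forall>k\<in>set ks. k + 1 \<notin> set ks)"

lemma spread_Cons: "spread (k # ks) \<Longrightarrow> spread ks \<and> (\<forall>j\<in>set ks. j \<noteq> k \<and> j \<noteq> k + 1 \<and> j + 1 \<noteq> k)"
 by (auto simp: spread_def)

lemma foldr_swp_mem:
 assumes "spread ks"
 shows "x \<in> foldr swp ks P \<longleftrightarrow> (if x \<in> set ks then x + 1 \<in> P else if x \<in> (\<lambda>k. k + 1) ` set ks then x - 1 \<in> P else x \<in> P)"
 using assms
proof (induction ks arbitrary: x)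
 case (Cons k ks)
 note s = spread_Cons[OF Cons.prems]
 have IH: "y \<in> foldr swp ks P \<longleftrightarrow> (if y \<in> set ks then y + 1 \<in> P else if y \<in> (\<lambda>k. k + 1) ` set ks then y - 1 \<in> P else y \<in> P)" for y
  using Cons.IH s by blast
 have n: "k \<notin> set ks" "k + 1 \<notin> set ks" "k \<notin> (\<lambda>k. k + 1) ` set ks" "k + 1 \<notin> (\<lambda>k. k + 1) ` set ks"
  using s by auto
 consider "x = k" | "x = k + 1" | "x \<noteq> k" "x \<noteq> k + 1" by blast
 thus ?case
 proof cases
  case 1
  thus ?thesis using IH[of "k + 1"] n by (simp add: swp_mem)
 next
  case 2
  thus ?thesis using IH[of k] n by (simp add: swp_mem)
 next
  case 3
  thus ?thesis using IH[of x] by (simp add: swp_mem)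
 qed
qed simp

text \<open>The height bound makes the exchanged set a ballot set. The axial distances before and
  after the exchange are minus and plus the height, so the last condition excludes the residue-zero
  term on both sides.\<close>

definition liftable :: "nat \<Rightarrow> nat set \<Rightarrow> nat \<Rightarrow> bool" where
 "liftable p S k \<longleftrightarrow> k \<notin> S \<and> k + 1 \<in> S \<and> 2 \<le> height S k \<and> \<not> int p dvd height S k"

lemma liftable_ballot:
 assumes S: "S \<in> ballot n" and k: "k \<in> {1..<n}" and l: "k \<notin> S" "k + 1 \<in> S" "2 \<le> height S k"
 shows "swp k S \<in> ballot n"
proof -
 have "2 * card (swp k S \<inter> {1..m}) \<le> m" if m: "m \<le> n" for m
 proof (cases "m = k")
  case True
  have "height (swp k S) k = height S k - 2" using height_swp_self[of k S] k l by simp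
  hence "0 \<le> height (swp k S) k" using l by simp
  thus ?thesis unfolding True height_def by linarith
 next
  case False
  hence "height (swp k S) m = height S m" using height_swp[of k m S] k by simp
  thus ?thesis using height_nonneg[OF S m] unfolding height_def by linarith
 qed
 moreover have "swp k S \<subseteq> {1..n}" using ballot_subset[OF S] k by (auto simp: swp_mem split: if_splits)
 ultimately show ?thesis by (simp add: ballot_def)
qed

lemma liftable_swp:
 assumes "liftable p S j" "k \<ge> 1" "j \<noteq> k" "j \<noteq> k + 1" "j + 1 \<noteq> k"
 shows "liftable p (swp k S) j"
 using assms height_swp[OF assms(2), of j S] unfolding liftable_def by (simp add: swp_mem)

lemma not_cong_axial:
 assumes "liftable p S k" and that: "k \<ge> 1"
 shows "\<not> [axial_set S k = 0] (mod int p)" "\<not> [axial_set (swp k S) k = 0] (mod int p)"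
proof -
 have S: "k \<notin> S" "k + 1 \<in> S" "\<not> int p dvd height S k" using assms unfolding liftable_def by blast+
 have "axial_set S k = - height S k" using S by (simp add: axial_set_eq)
 thus "\<not> [axial_set S k = 0] (mod int p)" using S(3) by (simp add: cong_0_iff)
 have "height (swp k S) k = height S k - 2" using height_swp_self[OF that, of S] S by simp
 hence "axial_set (swp k S) k = height S k" using S by (simp add: axial_set_eq swp_mem)
 thus "\<not> [axial_set (swp k S) k = 0] (mod int p)" using S(3) by (simp add: cong_0_iff)
qed

text \<open>Without entries of equal residue the factors just exchange, both on the columns (from the right
 end of the word) and on the rows (from its left end) of the matrix.\<close>

lemma psi_word_column:
 assumes "spread ks" "set ks \<subseteq> {1..<n}" "P \<in> ballot n" "\<And>k. k \<in> set ks \<Longrightarrow> liftable p P k"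
 shows "foldr swp ks P \<in> ballot n \<and> (\<exists>c. c \<noteq> 0 \<and>
  (\<forall>R\<in>ballot n. mat n (psi_word p n ks) R P = (if R = foldr swp ks P then c else 0))) \<and>
  (\<forall>j\<ge>1. (\<forall>k\<in>set ks. j \<noteq> k \<and> j \<noteq> k + 1 \<and> j + 1 \<noteq> k) \<longrightarrow> liftable p P j \<longrightarrow> liftable p (foldr swp ks P) j)"
 using assms
proof (induction ks)
 case Nil
 thus ?case using mat_psi_word_Nil[of _ n P p] by (auto intro!: exI[of _ 1])
next
 case (Cons k ks)
 note s = spread_Cons[OF Cons.prems(1)]
 have k: "k \<in> {1..<n}" using Cons.prems(2) by simp
 let ?S = "foldr swp ks P"
 obtain c where S: "?S \<in> ballot n" and c: "c \<noteq> 0" "\<And>R. R \<in> ballot n \<Longrightarrow> mat n (psi_word p n ks) R P = (if R = ?S then c else 0)"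
  and lift: "\<And>j. j \<ge> 1 \<Longrightarrow> (\<forall>k\<in>set ks. j \<noteq> k \<and> j \<noteq> k + 1 \<and> j + 1 \<noteq> k) \<Longrightarrow> liftable p P j \<Longrightarrow> liftable p ?S j"
  using Cons.IH s Cons.prems by auto
 have "\<forall>j\<in>set ks. k \<noteq> j \<and> k \<noteq> j + 1 \<and> k + 1 \<noteq> j" using s by auto
 hence l: "liftable p ?S k" using lift[of k] Cons.prems(4) k by simp
 hence kS: "k \<notin> ?S" "k + 1 \<in> ?S" "2 \<le> height ?S k" unfolding liftable_def by blast+
 have b: "swp k ?S \<in> ballot n" by (rule liftable_ballot[OF S k kS])
 have ex: "exchangeable n k ?S" unfolding exchangeable_def using kS S b by blast
 have nc: "\<not> [axial_set ?S k = 0] (mod int p)" using not_cong_axial(1)[OF l] k by simp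
 have "mat n (psi_word p n (k # ks)) R P = (if R = swp k ?S then psi_swap p n k ?S * c else 0)" if R: "R \<in> ballot n" for R
 proof -
  have 1: "exchangeable n k R \<and> mat n (psi_word p n ks) (swp k R) P \<noteq> 0 \<Longrightarrow> R = swp k ?S"
   using c(2)[of "swp k R"] unfolding exchangeable_def by (metis swp_swp)
  have ex': "exchangeable n k (swp k ?S)" using ex exchangeable_swp by blast
  show ?thesis
  proof (cases "R = swp k ?S")
   case True
   have "mat n (psi_word p n ks) (swp k ?S) P = 0" if "[axial_set (swp k ?S) k = 0] (mod int p)"
    using not_cong_axial(2)[OF l] k that by simp
   thus ?thesis using mat_psi_word_step[OF k R, of p ks P] ex' True c(2)[OF S] by auto
  next
   case False
   hence z1: "exchangeable n k R \<Longrightarrow> mat n (psi_word p n ks) (swp k R) P = 0" using 1 by blast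
   have "[axial_set R k = 0] (mod int p) \<Longrightarrow> mat n (psi_word p n ks) R P = 0"
    using c(2)[OF R] nc by auto
   thus ?thesis using mat_psi_word_step[OF k R, of p ks P] z1 False by auto
  qed
 qed
 moreover have "psi_swap p n k ?S * c \<noteq> 0" using psi_swap_nonzero[OF ex k] c(1) by simp
 moreover have "liftable p (swp k ?S) j" if "j \<ge> 1" "\<forall>i\<in>set (k # ks). j \<noteq> i \<and> j \<noteq> i + 1 \<and> j + 1 \<noteq> i" "liftable p P j" for j
  using liftable_swp[OF lift[of j], of k] that k by simp
 ultimately show ?case using b by (intro conjI exI[of _ "psi_swap p n k ?S * c"]) auto
qed

lemma psi_word_row:
 assumes "spread ks" "set ks \<subseteq> {1..<n}" "P \<in> ballot n" "\<And>k. k \<in> set ks \<Longrightarrow> liftable p P k"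
 shows "\<exists>c. c \<noteq> 0 \<and>
  (\<forall>R\<in>ballot n. mat n (psi_word p n ks) P R = (if R = foldr swp (rev ks) P then c else 0))"
 using assms
proof (induction ks arbitrary: P)
 case Nil
 thus ?case using mat_psi_word_Nil[of P n _ p] by (auto intro!: exI[of _ 1])
next
 case (Cons k ks)
 note s = spread_Cons[OF Cons.prems(1)]
 have k: "k \<in> {1..<n}" using Cons.prems(2) by simp
 have l: "liftable p P k" using Cons.prems(4) by simp
 hence kS: "k \<notin> P" "k + 1 \<in> P" "2 \<le> height P k" unfolding liftable_def by blast+
 have b: "swp k P \<in> ballot n" by (rule liftable_ballot[OF Cons.prems(3) k kS])
 have ex: "exchangeable n k P" unfolding exchangeable_def using kS Cons.prems(3) b by blast
 have nc: "\<not> [axial_set P k = 0] (mod int p)" using not_cong_axial(1)[OF l] k by simp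
 have "liftable p (swp k P) j" if "j \<in> set ks" for j
  using liftable_swp[of p P j k] Cons.prems(4) s k that by simp
 then obtain c where c: "c \<noteq> 0" "\<And>R. R \<in> ballot n \<Longrightarrow> mat n (psi_word p n ks) (swp k P) R = (if R = foldr swp (rev ks) (swp k P) then c else 0)"
  using Cons.IH[of "swp k P"] s Cons.prems(2) b by auto
 have "mat n (psi_word p n (k # ks)) P R = (if R = foldr swp (rev (k # ks)) P then psi_swap p n k (swp k P) * c else 0)"
  if "R \<in> ballot n" for R
  using mat_psi_word_step[OF k Cons.prems(3), of p ks R] ex nc c(2)[OF that] by simp
 moreover have "psi_swap p n k (swp k P) * c \<noteq> 0"
  using psi_swap_nonzero[of n k "swp k P" p] ex exchangeable_swp k c(1) by simp
 ultimately show ?case by blast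
qed

text \<open>Every letter has equal residues and contributes its diagonal coefficient, the inverse of
  the height. A path that leaves \<open>P\<close> at one letter cannot return, since the other
  letters do not touch that pair.\<close>

lemma psi_word_diagonal:
 assumes "spread ks" "set ks \<subseteq> {1..<n}" "P \<in> ballot n"
  and "\<And>k. k \<in> set ks \<Longrightarrow> k \<notin> P \<and> k + 1 \<in> P \<and> 0 < height P k \<and> int p dvd height P k"
 shows "mat n (psi_word p n ks) P P \<noteq> 0"
 using assms
proof (induction ks)
 case Nil
 thus ?case using mat_psi_word_Nil[of P n P p] by simp
next
 case (Cons k ks)
 note s = spread_Cons[OF Cons.prems(1)]
 have k: "k \<in> {1..<n}" using Cons.prems(2) by simp
 have kP: "k \<notin> P" "k + 1 \<in> P" "0 < height P k" "int p dvd height P k" using Cons.prems(4)[of k] by auto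
 have ax: "axial_set P k = - height P k" using kP by (simp add: axial_set_eq)
 have "mat n (psi_word p n ks) (swp k P) P = 0" if b: "swp k P \<in> ballot n"
 proof (rule ccontr)
  assume "mat n (psi_word p n ks) (swp k P) P \<noteq> 0"
  hence "k \<in> swp k P \<longleftrightarrow> k \<in> P"
   using s by (intro psi_word_support(2)[OF _ b Cons.prems(3)]) (use Cons.prems(2) in auto)
  thus False using kP by (simp add: swp_mem)
 qed
 moreover have "mat n (psi_word p n ks) P P \<noteq> 0" using Cons s by simp
 ultimately show ?case
  using mat_psi_word_step[OF k Cons.prems(3), of p ks P] kP unfolding ax exchangeable_def
  by (auto simp: cong_0_iff)
qed

text \<open>The window \<open>{a..<a + 2 * p}\<close> is the union of two neighbouring blocks. Applying the factors
 of \<open>Psi\<close> with indices \<open>1, 2, \<dots>\<close> to a set containing just the upper half of the window yields the sets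
 \<open>rising\<close>; by the symmetric sets \<open>falling\<close> the lower half is reached.\<close>

definition rung :: "nat \<Rightarrow> nat \<Rightarrow> nat \<Rightarrow> nat list" where
 "rung p a j = map (\<lambda>m. a + p + 2 * m - j) [0..<j]"

definition rising :: "nat \<Rightarrow> nat \<Rightarrow> nat set \<Rightarrow> nat \<Rightarrow> nat set" where
 "rising p a P j = {x. if a \<le> x \<and> x < a + 2 * p
   then a + p + j \<le> x \<or> (a + p \<le> x + j \<and> x < a + p + j \<and> even (x + a + p + j)) else x \<in> P}"

definition falling :: "nat \<Rightarrow> nat \<Rightarrow> nat set \<Rightarrow> nat \<Rightarrow> nat set" where
 "falling p a P j = {x. if a \<le> x \<and> x < a + 2 * p
   then x + j < a + p \<or> (a + p \<le> x + j \<and> x < a + p + j \<and> odd (x + a + p + j)) else x \<in> P}"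

lemma set_rung:
 assumes "j \<le> p"
 shows "x \<in> set (rung p a j) \<longleftrightarrow> a + p \<le> x + j \<and> x < a + p + j \<and> even (x + a + p + j)"
proof
 assume "x \<in> set (rung p a j)"
 then obtain m where m: "m < j" "x = a + p + 2 * m - j" by (auto simp: rung_def)
 hence "x + j = a + p + 2 * m" using assms by simp
 moreover from this have "even (x + j + (a + p))" by simp
 hence "even (x + a + p + j)" by (simp add: ac_simps)
 ultimately show "a + p \<le> x + j \<and> x < a + p + j \<and> even (x + a + p + j)" using m(1) by simp
next
 assume x: "a + p \<le> x + j \<and> x < a + p + j \<and> even (x + a + p + j)"
 define d where "d = x + j - (a + p)"
 have d: "x + j = a + p + d" using x by (simp add: d_def)
 have e: "x + a + p + j = 2 * (a + p) + d" using d by simp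
 have "even (2 * (a + p) + d)" using x unfolding e by blast
 hence "even d" by simp
 then obtain m where m: "d = 2 * m" by blast
 hence "m < j" "x = a + p + 2 * m - j" using d x by auto
 thus "x \<in> set (rung p a j)" by (auto simp: rung_def)
qed

lemma spread_rung: "j \<le> p \<Longrightarrow> spread (rung p a j)"
proof -
 assume j: "j \<le> p"
 have "distinct (rung p a j)" unfolding rung_def using j by (auto simp: distinct_map inj_on_def)
 thus ?thesis unfolding spread_def by (auto simp: set_rung[OF j])
qed

lemma spread_rev: "spread ks \<Longrightarrow> spread (rev ks)"
 by (simp add: spread_def)

lemma rung_window:
 assumes "j \<le> p" "k \<in> set (rung p a j)"
 shows "a \<le> k" "k + 1 < a + 2 * p"
proof -
 obtain m where "m < j" "k = a + p + 2 * m - j" using assms(2) by (auto simp: rung_def)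
 thus "a \<le> k" "k + 1 < a + 2 * p" using assms(1) by auto
qed

lemma rising_zero:
 assumes "\<And>x. a \<le> x \<Longrightarrow> x < a + p \<Longrightarrow> x \<notin> P" "\<And>x. a + p \<le> x \<Longrightarrow> x < a + 2 * p \<Longrightarrow> x \<in> P"
 shows "rising p a P 0 = P"
 using assms by (auto simp: rising_def not_le)

lemma rising_mem: "a \<le> x \<Longrightarrow> x < a + 2 * p \<Longrightarrow>
  x \<in> rising p a P j \<longleftrightarrow> a + p + j \<le> x \<or> (a + p \<le> x + j \<and> x < a + p + j \<and> even (x + a + p + j))"
 by (simp only: rising_def mem_Collect_eq simp_thms if_True)

lemma falling_mem: "a \<le> x \<Longrightarrow> x < a + 2 * p \<Longrightarrow>
  x \<in> falling p a P j \<longleftrightarrow> x + j < a + p \<or> (a + p \<le> x + j \<and> x < a + p + j \<and> odd (x + a + p + j))"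
 by (simp only: falling_def mem_Collect_eq simp_thms if_True)

lemma foldr_swp_eqI:
 assumes ks: "spread ks"
  and ex: "\<And>k. k \<in> set ks \<Longrightarrow> (k \<in> W' \<longleftrightarrow> k + 1 \<in> W) \<and> (k + 1 \<in> W' \<longleftrightarrow> k \<in> W)"
  and stay: "\<And>x. x \<notin> set ks \<Longrightarrow> \<not> (1 \<le> x \<and> x - 1 \<in> set ks) \<Longrightarrow> x \<in> W \<longleftrightarrow> x \<in> W'"
 shows "foldr swp ks W = W'"
proof (rule Set.set_eqI)
 fix x
 consider "x \<in> set ks" | k where "x = k + 1" "k \<in> set ks" "x \<notin> set ks"
  | "x \<notin> set ks" "x \<notin> (\<lambda>k. k + 1) ` set ks" by blast
 thus "x \<in> foldr swp ks W \<longleftrightarrow> x \<in> W'"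
 proof cases
  case 1
  thus ?thesis using foldr_swp_mem[OF ks] ex[OF 1] by simp
 next
  case 2
  have "x \<in> (\<lambda>k. k + 1) ` set ks" using 2 by blast
  hence "x \<in> foldr swp ks W \<longleftrightarrow> k \<in> W" using foldr_swp_mem[OF ks] 2 by simp
  thus ?thesis using ex[OF 2(2)] 2(1) by blast
 next
  case 3
  have "\<not> (1 \<le> x \<and> x - 1 \<in> set ks)"
  proof
   assume "1 \<le> x \<and> x - 1 \<in> set ks"
   hence "x \<in> (\<lambda>k. k + 1) ` set ks" by (intro image_eqI[of _ _ "x - 1"]) auto
   thus False using 3 by blast
  qed
  from stay[OF 3(1) this] show ?thesis using foldr_swp_mem[OF ks] 3 by simp
 qed
qed

text \<open>Before rung \<open>j + 1\<close> the window is first empty, then alternates over 2j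
  places starting with an element, then is full. The rung exchanges the pairs that start one place
  earlier and so widens the alternating zone by one place at each end.\<close>

lemma rising_step:
 assumes j: "Suc j \<le> p" and ks: "spread ks" "set ks = set (rung p a (Suc j))"
 shows "foldr swp ks (rising p a P j) = rising p a P (Suc j)"
proof (rule foldr_swp_eqI[OF ks(1)])
 have m: "y \<in> set ks \<longleftrightarrow> a + p \<le> y + Suc j \<and> y < a + p + Suc j \<and> even (y + a + p + Suc j)" for y
  unfolding ks(2) by (rule set_rung[OF j])
 {
  fix k assume k: "k \<in> set ks"
  have x: "a \<le> k" "k < a + 2 * p" "a \<le> k + 1" "k + 1 < a + 2 * p"
   using rung_window[OF j, of k a] k ks(2) by auto
  have par: "even (k + a + p + j) \<longleftrightarrow> False" "even (k + a + p + Suc j) \<longleftrightarrow> True"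
   "even (k + 1 + a + p + j) \<longleftrightarrow> True" "even (k + 1 + a + p + Suc j) \<longleftrightarrow> False"
   using k unfolding m by simp_all
  have "k \<noteq> a + p + j" using k unfolding m by auto
  thus "(k \<in> rising p a P (Suc j) \<longleftrightarrow> k + 1 \<in> rising p a P j) \<and> (k + 1 \<in> rising p a P (Suc j) \<longleftrightarrow> k \<in> rising p a P j)"
   using k j unfolding m rising_mem[OF x(1,2)] rising_mem[OF x(3,4)] par by auto
 }
 fix x assume x: "x \<notin> set ks" and pred: "\<not> (1 \<le> x \<and> x - 1 \<in> set ks)"
 show "x \<in> rising p a P j \<longleftrightarrow> x \<in> rising p a P (Suc j)"
 proof (cases "a \<le> x \<and> x < a + 2 * p")
  case True
  hence w: "a \<le> x" "x < a + 2 * p" by blast+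
  define E where "E \<longleftrightarrow> even (x + a + p + j)"
  have par: "even (x + a + p + Suc j) \<longleftrightarrow> \<not> E" by (simp add: E_def)
  have "1 \<le> x \<Longrightarrow> even (x - 1 + a + p + Suc j) \<longleftrightarrow> E" by (simp add: E_def)
  hence "1 \<le> x \<Longrightarrow> \<not> (a + p \<le> x + j \<and> x < a + p + Suc (Suc j) \<and> E)" using pred unfolding m by auto
  thus ?thesis using x j unfolding m rising_mem[OF w] par E_def[symmetric] by (cases "x = 0") auto
 qed (auto simp: rising_def)
qed

lemma falling_step:
 assumes j: "Suc j \<le> p" and ks: "spread ks" "set ks = set (rung p a (Suc j))"
 shows "foldr swp ks (falling p a P (Suc j)) = falling p a P j"
proof (rule foldr_swp_eqI[OF ks(1)])
 have m: "y \<in> set ks \<longleftrightarrow> a + p \<le> y + Suc j \<and> y < a + p + Suc j \<and> even (y + a + p + Suc j)" for y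
  unfolding ks(2) by (rule set_rung[OF j])
 {
  fix k assume k: "k \<in> set ks"
  have x: "a \<le> k" "k < a + 2 * p" "a \<le> k + 1" "k + 1 < a + 2 * p"
   using rung_window[OF j, of k a] k ks(2) by auto
  have par: "even (k + a + p + j) \<longleftrightarrow> False" "even (k + a + p + Suc j) \<longleftrightarrow> True"
   "even (k + 1 + a + p + j) \<longleftrightarrow> True" "even (k + 1 + a + p + Suc j) \<longleftrightarrow> False"
   using k unfolding m by simp_all
  have "k \<noteq> a + p + j" using k unfolding m by auto
  thus "(k \<in> falling p a P j \<longleftrightarrow> k + 1 \<in> falling p a P (Suc j)) \<and> (k + 1 \<in> falling p a P j \<longleftrightarrow> k \<in> falling p a P (Suc j))"
   using k j unfolding m falling_mem[OF x(1,2)] falling_mem[OF x(3,4)] par by auto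
 }
 fix x assume x: "x \<notin> set ks" and pred: "\<not> (1 \<le> x \<and> x - 1 \<in> set ks)"
 show "x \<in> falling p a P (Suc j) \<longleftrightarrow> x \<in> falling p a P j"
 proof (cases "a \<le> x \<and> x < a + 2 * p")
  case True
  hence w: "a \<le> x" "x < a + 2 * p" by blast+
  define E where "E \<longleftrightarrow> even (x + a + p + j)"
  have par: "even (x + a + p + Suc j) \<longleftrightarrow> \<not> E" by (simp add: E_def)
  have "1 \<le> x \<Longrightarrow> even (x - 1 + a + p + Suc j) \<longleftrightarrow> E" by (simp add: E_def)
  hence "1 \<le> x \<Longrightarrow> \<not> (a + p \<le> x + j \<and> x < a + p + Suc (Suc j) \<and> E)" using pred unfolding m by auto
  thus ?thesis using x j unfolding m falling_mem[OF w] par E_def[symmetric] by (cases "x = 0") auto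
 qed (auto simp: falling_def)
qed

text \<open>Both patterns consist of the places at even distance from \<open>a\<close>: the rising
  one alternates over the whole window, the falling one over all but its two end places, which
  already have the right values.\<close>

lemma rising_falling:
 assumes "1 \<le> p"
 shows "rising p a P p = falling p a P (p - 1)"
proof (rule Set.set_eqI)
 fix x
 obtain q where q: "p = Suc q" using assms by (cases p) auto
 show "x \<in> rising p a P p \<longleftrightarrow> x \<in> falling p a P (p - 1)"
 proof (cases "a \<le> x \<and> x < a + 2 * p")
  case True
  hence x: "a \<le> x" "x < a + 2 * p" by blast+
  define E where "E \<longleftrightarrow> even (x + a + p + q)"
  have par: "even (x + a + p + p) \<longleftrightarrow> \<not> E" by (simp add: E_def q)
  have q1: "p - 1 = q" using q by simp
  have ends: "x = a \<Longrightarrow> \<not> E" "x = a + 2 * q + 1 \<Longrightarrow> E" by (simp_all add: E_def q)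
  have "x \<in> rising p a P p \<longleftrightarrow> \<not> E" using x unfolding rising_mem[OF x] par by auto
  moreover have "x \<in> falling p a P q \<longleftrightarrow> \<not> E"
  proof (cases "x = a \<or> x = a + 2 * q + 1")
   case True
   thus ?thesis using ends x q unfolding falling_mem[OF x] E_def[symmetric] by auto
  next
   case False
   thus ?thesis using x q unfolding falling_mem[OF x] E_def[symmetric] by auto
  qed
  ultimately show ?thesis unfolding q1 by blast
 qed (auto simp: rising_def falling_def)
qed

text \<open>The height climbs through the \<open>p - j\<close> places that are still empty and then
  zigzags over the alternating zone, so it is the same at all letters of one rung.\<close>

lemma rung_liftable:
 assumes j: "Suc j \<le> p" and a: "1 \<le> a" and k: "k \<in> set (rung p a (Suc j))"
 shows "k \<notin> rising p a P j" "k + 1 \<in> rising p a P j"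
  and "height (rising p a P j) k = height P (a - 1) + int p - int j"
proof -
 let ?W = "rising p a P j"
 have kk: "a + p \<le> k + Suc j" "k < a + p + Suc j" "even (k + a + p + Suc j)" using k set_rung[OF j] by auto
 have wk: "a \<le> k" "k + 1 < a + 2 * p" using rung_window[OF j k] by auto
 have wk': "a \<le> k + 1" "k < a + 2 * p" using wk by auto
 have pk: "even (k + a + p + j) \<longleftrightarrow> False" "even (k + 1 + a + p + j) \<longleftrightarrow> True" using kk(3) by simp_all
 have "k \<noteq> a + p + j" using kk(3) by auto
 thus "k \<notin> ?W" using kk(1,2) unfolding rising_mem[OF wk(1) wk'(2)] pk by simp
 show "k + 1 \<in> ?W" using kk(1,2) unfolding rising_mem[OF wk'(1) wk(2)] pk by auto
 have start: "height ?W (a - 1) = height P (a - 1)"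
 proof -
  have "?W \<inter> {1..a - 1} = P \<inter> {1..a - 1}" using a by (auto simp: rising_def)
  thus ?thesis by (simp add: height_def)
 qed
 have run: "height ?W (a - 1 + d) = height P (a - 1) + int d" if "d \<le> p - j" for d
  using that
 proof (induction d)
  case (Suc d)
  have "d + j < p" using Suc.prems by simp
  hence "Suc (a - 1 + d) \<notin> ?W" using a by (simp add: rising_def)
  thus ?case using Suc height_Suc[of ?W "a - 1 + d"] by simp
 qed (simp add: start del: One_nat_def)
 obtain m where m: "m < Suc j" "k = a + p + 2 * m - Suc j" using k by (auto simp: rung_def simp del: upt_Suc)
 have "height ?W (a + p + 2 * m - Suc j) = height P (a - 1) + int p - int j" if "m < Suc j" for m
  using that
 proof (induction m)
  case 0
  have "a - 1 + (p - j) = a + p + 2 * 0 - Suc j" using a j by simp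
  thus ?case using run[of "p - j"] j by (simp add: of_nat_diff)
 next
  case (Suc m)
  define y where "y = a + p + 2 * m - Suc j"
  have y: "y + Suc j = a + p + 2 * m" using j by (simp add: y_def)
  have yk: "y \<in> set (rung p a (Suc j))" using Suc.prems by (auto simp: rung_def y_def simp del: upt_Suc)
  have zk: "y + 2 \<in> set (rung p a (Suc j))"
  proof -
   have "y + 2 = a + p + 2 * Suc m - Suc j" using j by (simp add: y_def)
   thus ?thesis unfolding rung_def set_map using Suc.prems by (intro image_eqI[of _ _ "Suc m"]) auto
  qed
  have ks: "a + p \<le> y + Suc j" "even (y + a + p + Suc j)" "y + 2 < a + p + Suc j"
   using yk zk unfolding set_rung[OF j] by blast+
  have wy: "a \<le> Suc y" "Suc y < a + 2 * p" "a \<le> Suc (Suc y)" "Suc (Suc y) < a + 2 * p"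
   using rung_window[OF j yk] rung_window[OF j zk] by auto
  have py: "even (Suc y + a + p + j) \<longleftrightarrow> True" "even (Suc (Suc y) + a + p + j) \<longleftrightarrow> False" using ks(2) by simp_all
  have y1: "Suc y \<in> ?W" using ks unfolding rising_mem[OF wy(1,2)] py by auto
  have "Suc (Suc y) \<noteq> a + p + j"
  proof
   assume "Suc (Suc y) = a + p + j"
   hence "Suc (Suc y) + a + p + j = 2 * (a + p + j)" by simp
   hence "even (Suc (Suc y) + a + p + j)" by (metis dvd_triv_left)
   thus False using py(2) by blast
  qed
  hence y2: "Suc (Suc y) \<notin> ?W" using ks unfolding rising_mem[OF wy(3,4)] py by auto
  have "height ?W (Suc (Suc y)) = height ?W y" using y1 y2 by (simp add: height_Suc)
  moreover have "a + p + 2 * Suc m - Suc j = Suc (Suc y)" using j by (simp add: y_def)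
  ultimately show ?case using Suc unfolding y_def by simp
 qed
 thus "height ?W k = height P (a - 1) + int p - int j" using m by blast
qed

section \<open>The word of a window\<close>

definition ascent :: "nat \<Rightarrow> nat \<Rightarrow> nat \<Rightarrow> nat list" where
 "ascent p a q = concat (map (rung p a) [1..<Suc q])"

text \<open>A product acts on columns from its right end; so \<open>descent\<close>, which ends in
  the shortest rung, is the part that lets the pattern rise.\<close>

definition descent :: "nat \<Rightarrow> nat \<Rightarrow> nat \<Rightarrow> nat list" where
 "descent p a q = concat (map (rung p a) (rev [1..<Suc q]))"

lemma ascent_Suc: "ascent p a (Suc q) = ascent p a q @ rung p a (Suc q)"
 by (simp add: ascent_def)

lemma descent_Suc: "descent p a (Suc q) = rung p a (Suc q) @ descent p a q"
 by (simp add: descent_def)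

definition block_word :: "nat \<Rightarrow> nat \<Rightarrow> nat list" where
 "block_word p a = ascent p a p @ descent p a (p - 1)"

lemma block_word_split: "1 \<le> p \<Longrightarrow> block_word p a = ascent p a (p - 1) @ rung p a p @ descent p a (p - 1)"
 unfolding block_word_def using ascent_Suc[of p a "p - 1"] by simp

lemma ascent_window:
 assumes "q \<le> p" "k \<in> set (ascent p a q)"
 shows "a \<le> k" "k + 1 < a + 2 * p"
proof -
 obtain j where "j \<in> set [1..<Suc q]" "k \<in> set (rung p a j)"
  using assms(2) unfolding ascent_def set_concat set_map by blast
 hence j: "j \<le> q" "k \<in> set (rung p a j)" by (simp_all del: upt_Suc)
 have "j \<le> p" using j assms(1) by simp
 from rung_window[OF this j(2)] show "a \<le> k" "k + 1 < a + 2 * p" .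
qed

lemma descent_set: "set (descent p a q) = set (ascent p a q)"
 by (simp add: ascent_def descent_def)

lemma block_word_window:
 assumes "k \<in> set (block_word p a)"
 shows "a \<le> k" "k + 1 < a + 2 * p"
proof -
 have "k \<in> set (ascent p a p) \<or> k \<in> set (ascent p a (p - 1))"
  using assms unfolding block_word_def by (simp add: descent_set)
 thus "a \<le> k" "k + 1 < a + 2 * p" using ascent_window[of p p k a] ascent_window[of "p - 1" p k a] by auto
qed

lemma length_ascent: "2 * length (ascent p a q) = q * (q + 1)"
 by (induction q) (simp_all add: ascent_Suc rung_def ascent_def[of p a 0])

lemma length_descent: "length (descent p a q) = length (ascent p a q)"
 by (induction q) (simp_all add: ascent_Suc descent_Suc, simp add: ascent_def descent_def)

text \<open>There are p (p + 1) / 2 letters up to the longest rung and p (p - 1) / 2 after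
  it.\<close>

lemma length_block_word:
 assumes "1 \<le> p"
 shows "length (block_word p a) = p * p"
proof -
 obtain q where q: "p = Suc q" using assms by (cases p) auto
 have "2 * length (block_word p a) = p * (p + 1) + q * (q + 1)"
  unfolding block_word_def using length_ascent[of p a p] length_ascent[of p a q] by (simp add: length_descent q)
 thus ?thesis unfolding q by simp
qed

lemma foldr_ascent: "q \<le> p \<Longrightarrow> foldr swp (ascent p a q) (falling p a P q) = falling p a P 0"
proof (induction q)
 case (Suc q)
 have "foldr swp (rung p a (Suc q)) (falling p a P (Suc q)) = falling p a P q"
  by (rule falling_step[OF Suc.prems spread_rung[OF Suc.prems] refl])
 thus ?case using Suc by (simp add: ascent_Suc)
qed (simp add: ascent_def)

lemma foldr_descent: "q \<le> p \<Longrightarrow> rising p a P 0 = P \<Longrightarrow> foldr swp (descent p a q) P = rising p a P q"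
proof (induction q)
 case (Suc q)
 have "foldr swp (rung p a (Suc q)) (rising p a P q) = rising p a P (Suc q)"
  by (rule rising_step[OF Suc.prems(1) spread_rung[OF Suc.prems(1)] refl])
 thus ?case using Suc by (simp add: descent_Suc)
qed (simp add: descent_def)

lemma foldr_block_word:
 assumes p: "1 \<le> p" and P: "rising p a P 0 = P"
 shows "foldr swp (block_word p a) P = falling p a P 0"
proof -
 have "foldr swp (rung p a p) (rising p a P (p - 1)) = rising p a P p"
  using rising_step[of "p - 1" p "rung p a p" a P] spread_rung[of p p a] p by simp
 thus ?thesis
  unfolding block_word_split[OF p] using foldr_descent[of "p - 1" p a P] P rising_falling[OF p, of a P] foldr_ascent[of "p - 1" p a P] by simp
qed

text \<open>Each of the \<open>p\<close> elements of the upper half moves down by \<open>p\<close>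
  places. The drop equals the length of the word, which makes the exchange a shortest path.\<close>

lemma total_falling:
 assumes P: "finite P" "\<And>x. a \<le> x \<Longrightarrow> x < a + p \<Longrightarrow> x \<notin> P" "\<And>x. a + p \<le> x \<Longrightarrow> x < a + 2 * p \<Longrightarrow> x \<in> P"
 shows "total (falling p a P 0) = total P - int (p * p)"
proof -
 define Z where "Z = {x \<in> P. \<not> (a \<le> x \<and> x < a + 2 * p)}"
 have finZ: "finite Z" using P(1) by (simp add: Z_def)
 have 1: "P = Z \<union> {a + p..<a + p + p}" using P(2,3) by (auto simp: Z_def not_less)
 have 2: "falling p a P 0 = Z \<union> {a..<a + p}" by (auto simp: falling_def Z_def)
 have d: "Z \<inter> {a + p..<a + p + p} = {}" "Z \<inter> {a..<a + p} = {}" by (auto simp: Z_def)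
 have "\<Sum>{a + p..<a + p + p} = (\<Sum>x = a..<a + p. x + p)"
  using sum.shift_bounds_nat_ivl[of "\<lambda>x. x" a p "a + p"] by simp
 also have "\<dots> = \<Sum>{a..<a + p} + p * p" by (simp add: sum.distrib)
 finally have s: "\<Sum>{a + p..<a + p + p} = \<Sum>{a..<a + p} + p * p" .
 have "\<Sum>P = \<Sum>Z + \<Sum>{a + p..<a + p + p}" by (subst 1, rule sum.union_disjoint) (use finZ d in auto)
 moreover have "\<Sum>(falling p a P 0) = \<Sum>Z + \<Sum>{a..<a + p}" unfolding 2 by (rule sum.union_disjoint) (use finZ d in auto)
 ultimately show ?thesis unfolding total_def s by simp
qed

context
 fixes p n a :: nat and P :: "nat set"
 assumes p: "2 \<le> p" and a: "1 \<le> a" and n: "a + 2 * p \<le> n + 1" and P: "P \<in> ballot n"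
  and low: "\<And>x. a \<le> x \<Longrightarrow> x < a + p \<Longrightarrow> x \<notin> P" and high: "\<And>x. a + p \<le> x \<Longrightarrow> x < a + 2 * p \<Longrightarrow> x \<in> P"
  and h0: "int p dvd height P (a - 1) + 1"
begin

lemma rung_range: "j \<le> p \<Longrightarrow> set (rung p a j) \<subseteq> {1..<n}"
 using rung_window[of j p _ a] a n by fastforce

lemma ascent_range: "q \<le> p \<Longrightarrow> set (ascent p a q) \<subseteq> {1..<n}"
 using ascent_window[of q p _ a] a n by fastforce

lemma block_word_range: "set (block_word p a) \<subseteq> {1..<n}"
 using block_word_window[of _ p a] a n by fastforce

lemma height_start: "0 \<le> height P (a - 1)"
 by (rule height_nonneg[OF P]) (use n p in simp)

text \<open>By \<open>h0\<close> the height at rung \<open>j + 1\<close> is congruent to -(j + 1)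
  modulo \<open>p\<close>, so only the rung of length \<open>p\<close> can meet equal
  residues.\<close>

lemma liftable_rung:
 assumes j: "Suc j < p" and k: "k \<in> set (rung p a (Suc j))"
 shows "liftable p (rising p a P j) k"
proof -
 have j': "Suc j \<le> p" using j by simp
 note r = rung_liftable[OF j' a k, of P]
 have "\<not> int p dvd height P (a - 1) + int p - int j"
 proof
  assume d: "int p dvd height P (a - 1) + int p - int j"
  have "int p dvd height P (a - 1) + 1 + int p" using h0 by (rule dvd_add) simp
  from dvd_diff[OF this d] have "int p dvd int (Suc j)" by (simp add: algebra_simps)
  hence "p dvd Suc j" by (simp only: int_dvd_int_iff)
  thus False using j dvd_imp_le by fastforce
 qed
 moreover have "2 \<le> height P (a - 1) + int p - int j" using height_start j by linarith
 ultimately show ?thesis unfolding liftable_def r(3) using r(1,2) by blast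
qed

lemma rising0: "rising p a P 0 = P"
 using low high by (rule rising_zero)

text \<open>Rungs shorter than \<open>p\<close> purely exchange, so the column of \<open>P\<close>
  keeps a single nonzero entry, at the pattern reached so far.\<close>

lemma descent_column:
 "q < p \<Longrightarrow> rising p a P q \<in> ballot n \<and>
  (\<exists>c. c \<noteq> 0 \<and> (\<forall>R\<in>ballot n. mat n (psi_word p n (descent p a q)) R P = (if R = rising p a P q then c else 0)))"
proof (induction q)
 case 0
 thus ?case using P rising0 mat_psi_word_Nil[OF _ P, of _ p] by (auto simp: descent_def intro!: exI[of _ 1])
next
 case (Suc q)
 have q: "Suc q \<le> p" using Suc.prems by simp
 obtain c where W: "rising p a P q \<in> ballot n"
  and c: "c \<noteq> 0" "\<And>R. R \<in> ballot n \<Longrightarrow> mat n (psi_word p n (descent p a q)) R P = (if R = rising p a P q then c else 0)"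
  using Suc by auto
 let ?r = "rung p a (Suc q)"
 obtain c' where b: "foldr swp ?r (rising p a P q) \<in> ballot n"
  and c': "c' \<noteq> 0" "\<And>R. R \<in> ballot n \<Longrightarrow> mat n (psi_word p n ?r) R (rising p a P q) = (if R = foldr swp ?r (rising p a P q) then c' else 0)"
  using psi_word_column[OF spread_rung[OF q] rung_range[OF q] W liftable_rung[OF Suc.prems]] by auto
 have st: "foldr swp ?r (rising p a P q) = rising p a P (Suc q)"
  by (rule rising_step[OF q spread_rung[OF q] refl])
 have dr: "set (descent p a q) \<subseteq> {1..<n}" unfolding descent_set using ascent_range q by simp
 have "mat n (psi_word p n (descent p a (Suc q))) R P = (if R = rising p a P (Suc q) then c' * c else 0)" if R: "R \<in> ballot n" for R
 proof -
  have "mat n (psi_word p n (descent p a (Suc q))) R P =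
   (\<Sum>S\<in>ballot n. mat n (psi_word p n ?r) R S * mat n (psi_word p n (descent p a q)) S P)"
   unfolding descent_Suc by (rule mat_psi_word_append[OF rung_range[OF q] dr R])
  also have "\<dots> = (\<Sum>S\<in>ballot n. if S = rising p a P q then mat n (psi_word p n ?r) R (rising p a P q) * c else 0)"
   by (intro sum.cong refl) (simp add: c(2) del: One_nat_def)
  also have "\<dots> = mat n (psi_word p n ?r) R (rising p a P q) * c" using W by simp
  finally show ?thesis using c'(2)[OF R] st by simp
 qed
 thus ?case using b st c(1) c'(1) by (intro conjI exI[of _ "c' * c"]) auto
qed

text \<open>The same rungs, read from the left end, concentrate the row of \<open>P\<close> at the
  same pattern, since the exchanges within a rung may be made in either order.\<close>

lemma ascent_row:
 "q < p \<Longrightarrow> \<exists>c. c \<noteq> 0 \<and> (\<forall>R\<in>ballot n. mat n (psi_word p n (ascent p a q)) P R = (if R = rising p a P q then c else 0))"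
proof (induction q)
 case 0
 thus ?case using P rising0 mat_psi_word_Nil[OF P, of _ p] by (auto simp: ascent_def intro!: exI[of _ 1])
next
 case (Suc q)
 have q: "Suc q \<le> p" using Suc.prems by simp
 obtain c where c: "c \<noteq> 0" "\<And>R. R \<in> ballot n \<Longrightarrow> mat n (psi_word p n (ascent p a q)) P R = (if R = rising p a P q then c else 0)"
  using Suc by auto
 have W: "rising p a P q \<in> ballot n" using descent_column[of q] Suc.prems by simp
 let ?r = "rung p a (Suc q)"
 obtain c' where c': "c' \<noteq> 0" "\<And>R. R \<in> ballot n \<Longrightarrow> mat n (psi_word p n ?r) (rising p a P q) R = (if R = foldr swp (rev ?r) (rising p a P q) then c' else 0)"
  using psi_word_row[OF spread_rung[OF q] rung_range[OF q] W liftable_rung[OF Suc.prems]] by auto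
 have st: "foldr swp (rev ?r) (rising p a P q) = rising p a P (Suc q)"
  by (rule rising_step[OF q spread_rev[OF spread_rung[OF q]]]) simp
 have ar: "set (ascent p a q) \<subseteq> {1..<n}" using ascent_range q by simp
 have "mat n (psi_word p n (ascent p a (Suc q))) P R = (if R = rising p a P (Suc q) then c * c' else 0)" if R: "R \<in> ballot n" for R
 proof -
  have "mat n (psi_word p n (ascent p a (Suc q))) P R =
   (\<Sum>S\<in>ballot n. mat n (psi_word p n (ascent p a q)) P S * mat n (psi_word p n ?r) S R)"
   unfolding ascent_Suc by (rule mat_psi_word_append[OF ar rung_range[OF q] P])
  also have "\<dots> = (\<Sum>S\<in>ballot n. if S = rising p a P q then c * mat n (psi_word p n ?r) (rising p a P q) R else 0)"
   by (intro sum.cong refl) (simp add: c(2) del: One_nat_def)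
  also have "\<dots> = c * mat n (psi_word p n ?r) (rising p a P q) R" using W by simp
  finally show ?thesis using c'(2)[OF R] st by simp
 qed
 thus ?case using c(1) c'(1) by (intro exI[of _ "c * c'"]) auto
qed

text \<open>The two outer parts of the word lead from \<open>P\<close> to the same pattern, the one
  after \<open>p - 1\<close> rungs. The middle rung has a nonzero diagonal entry there, the height
  being a positive multiple of \<open>p\<close>.\<close>

lemma block_word_diagonal: "mat n (psi_word p n (block_word p a)) P P \<noteq> 0"
proof -
 have q: "p - 1 < p" "Suc (p - 1) = p" "Suc (p - 1) \<le> p" using p by auto
 let ?W = "rising p a P (p - 1)"
 obtain c where W: "?W \<in> ballot n"
  and c: "c \<noteq> 0" "\<And>R. R \<in> ballot n \<Longrightarrow> mat n (psi_word p n (descent p a (p - 1))) R P = (if R = ?W then c else 0)"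
  using descent_column[OF q(1)] by auto
 obtain d where d: "d \<noteq> 0" "\<And>R. R \<in> ballot n \<Longrightarrow> mat n (psi_word p n (ascent p a (p - 1))) P R = (if R = ?W then d else 0)"
  using ascent_row[OF q(1)] by auto
 have mid: "mat n (psi_word p n (rung p a p)) ?W ?W \<noteq> 0"
 proof (rule psi_word_diagonal[OF spread_rung rung_range W])
  fix k assume k: "k \<in> set (rung p a p)"
  note r = rung_liftable[OF q(3) a, of k P, unfolded q(2), OF k]
  have "height ?W k = height P (a - 1) + 1" using r(3) p by (simp add: of_nat_diff)
  thus "k \<notin> ?W \<and> k + 1 \<in> ?W \<and> 0 < height ?W k \<and> int p dvd height ?W k"
   using r(1,2) h0 height_start by simp
 qed simp_all
 have ar: "set (ascent p a (p - 1)) \<subseteq> {1..<n}" by (rule ascent_range) simp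
 have dr: "set (descent p a (p - 1)) \<subseteq> {1..<n}" unfolding descent_set by (rule ar)
 have rr: "set (rung p a p) \<subseteq> {1..<n}" by (rule rung_range) simp
 have "mat n (psi_word p n (block_word p a)) P P =
  (\<Sum>S\<in>ballot n. mat n (psi_word p n (ascent p a (p - 1))) P S * mat n (psi_word p n (rung p a p @ descent p a (p - 1))) S P)"
  unfolding block_word_split[OF order_trans[OF one_le_numeral p]]
  by (rule mat_psi_word_append[OF ar _ P]) (use dr rr in simp)
 also have "\<dots> = (\<Sum>S\<in>ballot n. if S = ?W then d * mat n (psi_word p n (rung p a p @ descent p a (p - 1))) ?W P else 0)"
  by (intro sum.cong refl) (simp add: d(2) del: One_nat_def)
 also have "\<dots> = d * mat n (psi_word p n (rung p a p @ descent p a (p - 1))) ?W P" using W by simp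
 also have "mat n (psi_word p n (rung p a p @ descent p a (p - 1))) ?W P =
  (\<Sum>S\<in>ballot n. mat n (psi_word p n (rung p a p)) ?W S * mat n (psi_word p n (descent p a (p - 1))) S P)"
  by (rule mat_psi_word_append[OF rr dr W])
 also have "\<dots> = (\<Sum>S\<in>ballot n. if S = ?W then mat n (psi_word p n (rung p a p)) ?W ?W * c else 0)"
  by (intro sum.cong refl) (simp add: c(2) del: One_nat_def)
 also have "\<dots> = mat n (psi_word p n (rung p a p)) ?W ?W * c" using W by simp
 finally show ?thesis using c(1) d(1) mid by simp
qed

lemma block_word_exchange:
 assumes "falling p a P 0 \<in> ballot n"
 shows "mat n (psi_word p n (block_word p a)) (falling p a P 0) P \<noteq> 0"
proof -
 have p1: "1 \<le> p" using p by simp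
 have f: "foldr swp (block_word p a) P = falling p a P 0" by (rule foldr_block_word[OF p1 rising0])
 have "total (falling p a P 0) = total P - int (p * p)"
  by (rule total_falling[OF ballot_finite[OF P] low high])
 thus ?thesis
  using psi_word_shortest(2)[OF block_word_range P, of p] assms length_block_word[OF p1, of a] unfolding f by simp
qed

end

text \<open>The last letter of the word is the rung of length 1, namely \<open>a + p - 1\<close>. If
  it and its successor share a column, the axial distance is 1, so this letter neither exchanges nor
  has a diagonal term.\<close>

lemma block_word_same_column:
 assumes p: "2 \<le> p" and a: "1 \<le> a" and n: "a + 2 * p \<le> n + 1" and P: "P \<in> ballot n" and R: "R \<in> ballot n"
  and same: "a + p - 1 \<in> P \<longleftrightarrow> a + p \<in> P"
 shows "mat n (psi_word p n (block_word p a)) R P = 0"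
proof -
 let ?k = "a + p - 1"
 have r1: "rung p a 1 = [?k]" by (simp add: rung_def)
 have "\<exists>ks. descent p a (Suc q) = ks @ [?k]" for q
 proof (induction q)
  case 0
  show ?case using r1 by (simp add: descent_Suc descent_def)
 next
  case (Suc q)
  then obtain ks where "descent p a (Suc q) = ks @ [?k]" by blast
  thus ?case by (simp add: descent_Suc[of p a "Suc q"])
 qed
 moreover have "p - 1 = Suc (p - 2)" using p by simp
 ultimately obtain ks where "descent p a (p - 1) = ks @ [?k]" by metis
 hence w: "block_word p a = (ascent p a p @ ks) @ [?k]" unfolding block_word_def by simp
 have rng: "set (block_word p a) \<subseteq> {1..<n}" using block_word_window[of _ p a] a n by fastforce
 hence k: "?k \<in> {1..<n}" unfolding w by auto
 have z: "mat n (psi_word p n [?k]) S P = 0" if S: "S \<in> ballot n" for S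
 proof (cases "S = P")
  case True
  have "\<not> exchangeable n ?k P" using same a unfolding exchangeable_def by auto
  moreover have "axial_set P ?k = 1" using same a by (simp add: axial_set_eq)
  moreover have "\<not> [1 = 0] (mod int p)" using p by (simp add: cong_0_iff)
  ultimately show ?thesis using mat_psi_word_step[OF k P, of p "[]" P] True by simp
 next
  case False
  have "\<not> exchangeable n ?k P" using same a unfolding exchangeable_def by auto
  hence "exchangeable n ?k S \<Longrightarrow> swp ?k S \<noteq> P" using exchangeable_swp by blast
  hence "exchangeable n ?k S \<Longrightarrow> mat n (psi_word p n []) (swp ?k S) P = 0"
   using mat_psi_word_Nil[OF _ P] unfolding exchangeable_def by simp
  thus ?thesis using mat_psi_word_step[OF k S, of p "[]" P] False mat_psi_word_Nil[OF S P, of p] by simp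
 qed
 have "mat n (psi_word p n (block_word p a)) R P =
  (\<Sum>S\<in>ballot n. mat n (psi_word p n (ascent p a p @ ks)) R S * mat n (psi_word p n [?k]) S P)"
  using rng unfolding w by (intro mat_psi_word_append R) auto
 also have "\<dots> = 0" by (rule sum.neutral) (simp add: z del: One_nat_def)
 finally show ?thesis .
qed

section \<open>The class of the one-column tableau\<close>

text \<open>Block 0 consists of 0 and the first \<open>p - 1\<close> entries. The sets considered do
  not contain 0, so these entries lie in the first column; this accounts for the shift by
  \<open>p - 1\<close> in the numbering of the blocks.\<close>

definition block_constant :: "nat \<Rightarrow> nat \<Rightarrow> nat set \<Rightarrow> bool" where
 "block_constant p n Q \<longleftrightarrow> (\<forall>x\<le>n. x \<in> Q \<longleftrightarrow> x div p * p \<in> Q)"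

lemma block_constantD: "block_constant p n Q \<Longrightarrow> x \<le> n \<Longrightarrow> x \<in> Q \<longleftrightarrow> x div p * p \<in> Q"
 unfolding block_constant_def by blast

lemma block_constant_mono: "block_constant p n Q \<Longrightarrow> m \<le> n \<Longrightarrow> block_constant p m Q"
 unfolding block_constant_def using order_trans by blast

definition block_indices :: "nat \<Rightarrow> nat set \<Rightarrow> nat set" where
 "block_indices p Q = {j. j * p \<in> Q}"

text \<open>The correction term completes a started second-column block; it is zero at the end of a
  block.\<close>

lemma block_card:
 assumes p: "1 \<le> p" and Q: "0 \<notin> Q" and const: "block_constant p x Q"
 shows "card (Q \<inter> {1..x}) + (if x \<in> Q then p - 1 - x mod p else 0) = p * card (block_indices p Q \<inter> {1..x div p})"
 using const
proof (induction x)
 case 0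
 thus ?case using Q by simp
next
 case (Suc x)
 note c = block_constantD[OF Suc.prems]
 note IH = Suc.IH[OF block_constant_mono[OF Suc.prems le_SucI[OF order_refl]]]
 show ?case
 proof (cases "Suc x mod p = 0")
  case True
  hence d1: "Suc x div p = Suc (x div p)" by (simp add: div_Suc)
  have "Suc x = Suc x div p * p" using True by (simp add: mod_eq_0_iff_dvd)
  hence d: "Suc x div p = Suc (x div p)" "Suc x = Suc (x div p) * p" unfolding d1 by simp_all
  have m: "p - 1 - x mod p = 0" using True p by (cases "Suc (x mod p) = p") (auto simp: mod_Suc)
  have b: "Suc (x div p) \<in> block_indices p Q \<longleftrightarrow> Suc x \<in> Q" using d(2) by (simp add: block_indices_def)
  show ?thesis using IH p unfolding m d(1) card_Int_Suc b True by (auto simp: distrib_left)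
 next
  case False
  hence d: "Suc x div p = x div p" "Suc x mod p = Suc (x mod p)" by (auto simp: div_Suc mod_Suc split: if_splits)
  have lt: "Suc (x mod p) < p" using mod_less_divisor[of p "Suc x"] p unfolding d(2) by simp
  have b: "Suc x \<in> Q \<longleftrightarrow> x \<in> Q" using c[of x, OF le_SucI[OF order_refl]] c[of "Suc x", OF order_refl] unfolding d(1) by (simp only:)
  show ?thesis using IH lt unfolding d card_Int_Suc b by auto
 qed
qed

definition class_sets :: "nat \<Rightarrow> nat \<Rightarrow> nat set set" where
 "class_sets p n = {Q \<in> ballot n. tab n Q \<in> one_column_class p n}"

lemma class_sets_iff:
 "Q \<in> class_sets p n \<longleftrightarrow> Q \<in> ballot n \<and> (\<forall>i\<in>{1..n}.
   if i \<in> Q then int p dvd int i + 1 - int (card (Q \<inter> {1..i})) else int p dvd int (card (Q \<inter> {1..i})))"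
proof -
 have "[content (tab n Q) i = content (one_column n) i] (mod int p) \<longleftrightarrow>
   (if i \<in> Q then int p dvd int i + 1 - int (card (Q \<inter> {1..i})) else int p dvd int (card (Q \<inter> {1..i})))"
  if i: "i \<in> {1..n}" for i
 proof -
  have e: "content (one_column n) i = 1 - int i" using i by (simp add: content_def one_column_def)
  show ?thesis
   unfolding content_tab[OF i] e set_content_height cong_iff_dvd_diff by (simp add: algebra_simps)
 qed
 thus ?thesis unfolding class_sets_def one_column_class_def using tab_Std2 by auto
qed

lemma one_column_class_eq: "one_column_class p n = tab n ` class_sets p n"
proof (intro equalityI subsetI)
 fix t assume t: "t \<in> one_column_class p n"
 hence "t \<in> Std2 n" by (simp add: one_column_class_def)
 thus "t \<in> tab n ` class_sets p n" using t by (auto simp: Std2_eq class_sets_def)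
qed (auto simp: class_sets_def)

lemma class_sets_ballot: "class_sets p n \<subseteq> ballot n"
 by (auto simp: class_sets_def)

lemma zero_notin_ballot: "Q \<in> ballot n \<Longrightarrow> 0 \<notin> Q"
 using ballot_subset by fastforce

lemma small_dvd_absurd: "int p dvd int p * int k - int r \<Longrightarrow> 0 < r \<Longrightarrow> r < p \<Longrightarrow> False"
proof -
 assume d: "int p dvd int p * int k - int r" and r: "0 < r" "r < p"
 have "int p dvd int p * int k - (int p * int k - int r)" by (rule dvd_diff[OF _ d]) simp
 hence "p dvd r" by (simp only: diff_diff_eq2 add_diff_cancel_left' int_dvd_int_iff)
 thus False using r dvd_imp_le by fastforce
qed

text \<open>The column can change at \<open>x + 1\<close> only if \<open>p\<close> divides
  \<open>x + 1\<close>. Leaving the second column needs a count divisible by \<open>p\<close>, which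
  \<open>block_card\<close> forbids inside a block; when entering it the count so far is divisible
  by \<open>p\<close>, and the congruence of contents makes \<open>x + 1\<close> divisible as
  well.\<close>

lemma class_sets_block_constant:
 assumes p: "1 \<le> p" and Q: "Q \<in> class_sets p n"
 shows "block_constant p n Q"
proof -
 have Qb: "Q \<in> ballot n" and cond: "\<And>i. i \<in> {1..n} \<Longrightarrow> i \<in> Q \<Longrightarrow> int p dvd int i + 1 - int (card (Q \<inter> {1..i}))"
  "\<And>i. i \<in> {1..n} \<Longrightarrow> i \<notin> Q \<Longrightarrow> int p dvd int (card (Q \<inter> {1..i}))"
  using Q unfolding class_sets_iff by (auto split: if_splits)
 have Q0: "0 \<notin> Q" by (rule zero_notin_ballot[OF Qb])
 have "block_constant p x Q" if "x \<le> n" for x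
  using that
 proof (induction x)
  case 0
  thus ?case by (simp add: block_constant_def)
 next
  case (Suc x)
  hence IH: "block_constant p x Q" by simp
  note F = block_card[OF p Q0 IH]
  have xn: "Suc x \<in> {1..n}" using Suc.prems by simp
  have "Suc x \<in> Q \<longleftrightarrow> Suc x div p * p \<in> Q"
  proof (cases "Suc x mod p = 0")
   case True
   thus ?thesis by (simp add: mod_eq_0_iff_dvd)
  next
   case False
   hence d: "Suc x div p = x div p" "Suc x mod p = Suc (x mod p)" by (auto simp: div_Suc mod_Suc split: if_splits)
   have lt: "Suc (x mod p) < p" using mod_less_divisor[of p "Suc x"] p unfolding d(2) by simp
   have "Suc x \<in> Q \<longleftrightarrow> x \<in> Q"
   proof (rule ccontr)
    assume ne: "(Suc x \<in> Q) \<noteq> (x \<in> Q)"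
    show False
    proof (cases "x \<in> Q")
     case True
     let ?k = "card (block_indices p Q \<inter> {1..x div p})"
     have "Suc x \<notin> Q" using ne True by simp
     hence "int p dvd int (card (Q \<inter> {1..x}))" using cond(2)[OF xn] unfolding card_Int_Suc by simp
     moreover have "int (card (Q \<inter> {1..x})) = int p * int ?k - int (p - 1 - x mod p)"
     proof -
      have "card (Q \<inter> {1..x}) + (p - 1 - x mod p) = p * ?k" using F True by simp
      from arg_cong[OF this, of int] show ?thesis by simp
     qed
     ultimately have "int p dvd int p * int ?k - int (p - 1 - x mod p)" by (simp only:)
     thus False by (rule small_dvd_absurd) (use lt in auto)
    next
     case False
     have "Suc x \<in> Q" using ne False by simp
     hence "int p dvd int (Suc x) - int (card (Q \<inter> {1..x}))" using cond(1)[OF xn] unfolding card_Int_Suc by (simp add: algebra_simps)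
     moreover have "int p dvd int (card (Q \<inter> {1..x}))" using F False by simp
     ultimately have "int p dvd int (Suc x) - int (card (Q \<inter> {1..x})) + int (card (Q \<inter> {1..x}))" by (rule dvd_add)
     hence "p dvd Suc x" by (simp only: diff_add_cancel int_dvd_int_iff)
     thus False using \<open>Suc x mod p \<noteq> 0\<close> by simp
    qed
   qed
   moreover have "x \<in> Q \<longleftrightarrow> x div p * p \<in> Q" by (rule block_constantD[OF IH order_refl])
   ultimately show ?thesis unfolding d(1) by (simp only:)
  qed
  thus ?case using IH unfolding block_constant_def le_Suc_eq by blast
 qed
 thus ?thesis by simp
qed

text \<open>By \<open>block_card\<close> a second-column entry at offset r in its block sees a count
  congruent to r + 1, and a first-column entry sees a multiple of \<open>p\<close>; these are the
  required congruences.\<close>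

lemma block_constant_class_sets:
 assumes p: "1 \<le> p" and Qb: "Q \<in> ballot n" and c: "block_constant p n Q"
 shows "Q \<in> class_sets p n"
 unfolding class_sets_iff
proof (intro conjI ballI Qb)
 fix i assume i: "i \<in> {1..n}"
 have ci: "block_constant p i Q" using c i by (intro block_constant_mono[OF c]) simp
 note F = block_card[OF p zero_notin_ballot[OF Qb] ci]
 let ?k = "card (block_indices p Q \<inter> {1..i div p})"
 show "if i \<in> Q then int p dvd int i + 1 - int (card (Q \<inter> {1..i})) else int p dvd int (card (Q \<inter> {1..i}))"
 proof (cases "i \<in> Q")
  case True
  have "i mod p < p" using p by simp
  hence "card (Q \<inter> {1..i}) + p = p * ?k + 1 + i mod p" using F True by simp
  from arg_cong[OF this, of int] have "int (card (Q \<inter> {1..i})) = int p * int ?k + 1 + int (i mod p) - int p" by simp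
  moreover have "int i = int p * int (i div p) + int (i mod p)"
   unfolding of_nat_mult[symmetric] of_nat_add[symmetric] by simp
  ultimately have "int i + 1 - int (card (Q \<inter> {1..i})) = int p * (int (i div p) - int ?k + 1)" by (simp add: algebra_simps)
  thus ?thesis using True by simp
 qed (use F in simp)
qed

lemma block_constant_eqI:
 assumes "block_constant p n Q" "block_constant p n R" "Q \<subseteq> {1..n}" "R \<subseteq> {1..n}" "block_indices p Q = block_indices p R"
 shows "Q = R"
proof (rule Set.set_eqI)
 fix x
 have "x div p \<in> block_indices p Q \<longleftrightarrow> x div p \<in> block_indices p R" by (simp add: assms(5))
 hence "x div p * p \<in> Q \<longleftrightarrow> x div p * p \<in> R" by (simp add: block_indices_def)
 thus "x \<in> Q \<longleftrightarrow> x \<in> R"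
  using block_constantD[OF assms(1), of x] block_constantD[OF assms(2), of x] assms(3,4) by (cases "x \<le> n") auto
qed

section \<open>Exchanging two neighbouring blocks\<close>

definition swap_blocks :: "nat \<Rightarrow> nat \<Rightarrow> nat \<Rightarrow> nat set \<Rightarrow> nat set" where
 "swap_blocks p n i P = {x \<in> {1..n}. transpose i (i + 1) (x div p) * p \<in> P}"

text \<open>The cut at \<open>m\<close> drops a possible incomplete block at the end, which
  \<open>f_tableau\<close> does not see.\<close>

definition folded :: "nat \<Rightarrow> nat \<Rightarrow> nat set \<Rightarrow> nat set" where
 "folded p m Q = block_indices p Q \<inter> {1..m}"

context
 fixes p n m :: nat
 assumes p: "2 \<le> p" and lower: "(m + 1) * p \<le> n + 1" and upper: "n + 1 < (m + 2) * p"
begin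

lemma p_pos: "1 \<le> p" using p by simp

lemma classD:
 assumes "P \<in> class_sets p n"
 shows "P \<in> ballot n" "block_constant p n P" "P \<subseteq> {1..n}" "0 \<notin> P"
 using assms class_sets_ballot class_sets_block_constant[OF p_pos assms] ballot_subset zero_notin_ballot by blast+

lemma mem_block:
 assumes "P \<in> class_sets p n" "j \<in> {1..m}" "j * p \<le> x" "x < (j + 1) * p"
 shows "x \<in> {1..n}" "x \<in> P \<longleftrightarrow> j \<in> folded p m P"
proof -
 have "x div p = j" using assms(3,4) by (intro div_nat_eqI) (auto simp: mult.commute)
 moreover have "(j + 1) * p \<le> (m + 1) * p" using assms(2) by (intro mult_le_mono1) simp
 moreover have "1 * 1 \<le> j * p" using assms(2) p by (intro mult_le_mono) auto
 ultimately have x: "x \<le> n" "1 \<le> x" "x div p = j" using assms(3,4) lower by linarith+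
 show "x \<in> {1..n}" using x by simp
 show "x \<in> P \<longleftrightarrow> j \<in> folded p m P"
  using block_constantD[OF classD(2)[OF assms(1)] x(1)] assms(2) unfolding x(3) folded_def block_indices_def by auto
qed

lemma card_block_end:
 assumes P: "P \<in> class_sets p n" and j: "j \<le> m"
 shows "card (P \<inter> {1..j * p + (p - 1)}) = p * card (folded p m P \<inter> {1..j})" "j * p + (p - 1) \<le> n"
proof -
 have "(j + 1) * p \<le> (m + 1) * p" using j by (intro mult_le_mono1) simp
 hence "j * p + p \<le> n + 1" using lower unfolding distrib_right by linarith
 thus le: "j * p + (p - 1) \<le> n" using p by linarith
 have d1: "(j * p + (p - 1)) mod p = p - 1" unfolding mod_mult_self3 using p by simp
 have d2: "(j * p + (p - 1)) div p = j" by (intro div_nat_eqI) (use p in \<open>auto simp: algebra_simps\<close>)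
 have "block_indices p P \<inter> {1..j} = folded p m P \<inter> {1..j}" using j by (auto simp: folded_def)
 thus "card (P \<inter> {1..j * p + (p - 1)}) = p * card (folded p m P \<inter> {1..j})"
  using block_card[OF p_pos classD(4)[OF P] block_constant_mono[OF classD(2)[OF P] le]] unfolding d1 d2 diff_self_eq_0 if_cancel add_0_right by simp
qed

text \<open>At the end of block \<open>j\<close> there are (j + 1) p - 1 entries. If c is the number
  of second-column blocks, then 2pc < p (j + 1), hence 2c <= j.\<close>

lemma folded_ballot:
 assumes P: "P \<in> class_sets p n"
 shows "folded p m P \<in> ballot m"
 unfolding ballot_def
proof (intro CollectI conjI allI impI)
 show "folded p m P \<subseteq> {1..m}" by (simp add: folded_def)
 fix j assume j: "j \<le> m"
 have "2 * (p * card (folded p m P \<inter> {1..j})) \<le> j * p + (p - 1)"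
  using ballotD[OF classD(1)[OF P] card_block_end(2)[OF P j]] unfolding card_block_end(1)[OF P j] .
 moreover have "j * p + (p - 1) < p * (j + 1)" using p by (simp add: algebra_simps)
 ultimately have "p * (2 * card (folded p m P \<inter> {1..j})) < p * (j + 1)" by (simp add: algebra_simps)
 hence "2 * card (folded p m P \<inter> {1..j}) < j + 1" by (simp only: mult_less_cancel1)
 thus "2 * card (folded p m P \<inter> {1..j}) \<le> j" by simp
qed

text \<open>Before a block the number of entries is -1 modulo \<open>p\<close>, and the second
  column holds a multiple of \<open>p\<close> of them. This supplies the hypothesis
  \<open>h0\<close> of a window.\<close>

lemma height_block_start:
 assumes P: "P \<in> class_sets p n" and i: "i \<in> {1..m}"
 shows "int p dvd height P (i * p - 1) + 1"
proof -
 obtain j where j: "i = Suc j" "j \<le> m" using i by (cases i) auto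
 have e: "i * p - 1 = j * p + (p - 1)" using p j(1) by simp
 have h: "height P (i * p - 1) = int (j * p + (p - 1)) - 2 * int (p * card (folded p m P \<inter> {1..j}))"
  unfolding height_def e card_block_end(1)[OF P j(2)] ..
 have "int (j * p + (p - 1)) + 1 = int (j * p + (p - 1) + 1)" by simp
 also have "j * p + (p - 1) + 1 = p * (j + 1)" using p by simp
 finally have "height P (i * p - 1) + 1 = int p * (int (j + 1) - 2 * int (card (folded p m P \<inter> {1..j})))"
  unfolding h by (simp add: algebra_simps)
 thus ?thesis by simp
qed

lemma f_tableau_tab:
 assumes P: "P \<in> class_sets p n"
 shows "f_tableau p m (tab n P) = tab m (folded p m P)"
 unfolding f_tableau_def
proof (rule the_equality)
 have blk: "(\<forall>b\<in>block p j. snd (tab n P b) = 1) \<longleftrightarrow> j \<notin> folded p m P" if j: "j \<in> {1..m}" for j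
 proof -
  have b: "b \<in> block p j \<Longrightarrow> snd (tab n P b) = 1 \<longleftrightarrow> j \<notin> folded p m P" for b
   using mem_block[OF P j, of b] by (simp add: block_def snd_tab)
  have "j * p \<in> block p j" using p by (simp add: block_def)
  thus ?thesis using b by blast
 qed
 have s1: "snd (tab m J j) = 1 \<longleftrightarrow> j \<notin> J" if "j \<in> {1..m}" for J j using that by (simp add: snd_tab)
 show "tab m (folded p m P) \<in> Std2 m \<and> (\<forall>j\<in>{1..m}. snd (tab m (folded p m P) j) = 1 \<longleftrightarrow> (\<forall>b\<in>block p j. snd (tab n P b) = 1))"
  using tab_Std2[OF folded_ballot[OF P]] blk s1 by simp
 fix v assume v: "v \<in> Std2 m \<and> (\<forall>j\<in>{1..m}. snd (v j) = 1 \<longleftrightarrow> (\<forall>b\<in>block p j. snd (tab n P b) = 1))"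
 then obtain J where J: "J \<in> ballot m" "v = tab m J" unfolding Std2_eq by blast
 have "j \<in> J \<longleftrightarrow> j \<in> folded p m P" if "j \<in> {1..m}" for j
  using v blk[OF that] s1[OF that] that unfolding J(2) by blast
 hence "J = folded p m P" using ballot_subset[OF J(1)] by (auto simp: folded_def)
 thus "v = tab m (folded p m P)" using J(2) by simp
qed

context
 fixes i :: nat
 assumes i: "i \<in> {1..<m}"
begin

lemma window_bounds: "1 \<le> i * p" "i * p + 2 * p \<le> n + 1" "(i + 1) * p = i * p + p"
proof -
 show "1 \<le> i * p" using i p by simp
 have "(i + 2) * p \<le> (m + 1) * p" using i by (intro mult_le_mono1) simp
 thus "i * p + 2 * p \<le> n + 1" using lower by (simp add: algebra_simps)
qed simp

lemma transpose_block_in: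
 assumes "P \<in> class_sets p n" "transpose i (i + 1) j * p \<in> P"
 shows "1 \<le> j * p" "j * p \<le> n"
proof -
 have "1 \<le> j * p \<and> j * p \<le> n"
 proof (cases "j \<in> {i, i + 1}")
  case True
  thus ?thesis using window_bounds p by auto
 next
  case False
  hence "j * p \<in> P" using assms(2) by (simp add: transpose_def)
  thus ?thesis using classD(3)[OF assms(1)] by auto
 qed
 thus "1 \<le> j * p" "j * p \<le> n" by blast+
qed

lemma swap_blocks_indices:
 assumes P: "P \<in> class_sets p n"
 shows "block_constant p n (swap_blocks p n i P)" "block_indices p (swap_blocks p n i P) = swp i (block_indices p P)"
  and "swap_blocks p n i P \<subseteq> {1..n}"
proof -
 have sw: "j \<in> swp i K \<longleftrightarrow> transpose i (i + 1) j \<in> K" for j and K :: "nat set"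
  by (auto simp: swp_mem transpose_def)
 show idx: "block_indices p (swap_blocks p n i P) = swp i (block_indices p P)"
 proof (rule Set.set_eqI)
  fix j
  have "j * p div p = j" using p by simp
  thus "j \<in> block_indices p (swap_blocks p n i P) \<longleftrightarrow> j \<in> swp i (block_indices p P)"
   using transpose_block_in[OF P, of j] unfolding block_indices_def swap_blocks_def sw by auto
 qed
 show "block_constant p n (swap_blocks p n i P)" unfolding block_constant_def
 proof (intro allI impI)
  fix x assume x: "x \<le> n"
  have "x div p * p \<in> swap_blocks p n i P \<longleftrightarrow> transpose i (i + 1) (x div p) * p \<in> P"
   using transpose_block_in[OF P, of "x div p"] p unfolding swap_blocks_def by auto
  moreover have "x \<in> swap_blocks p n i P \<longleftrightarrow> transpose i (i + 1) (x div p) * p \<in> P"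
  proof -
   have "x \<ge> 1" if "transpose i (i + 1) (x div p) * p \<in> P" using transpose_block_in(1)[OF P that] by (cases x) auto
   thus ?thesis using x unfolding swap_blocks_def by auto
  qed
  ultimately show "x \<in> swap_blocks p n i P \<longleftrightarrow> x div p * p \<in> swap_blocks p n i P" by simp
 qed
qed (auto simp: swap_blocks_def)

lemma folded_swap_blocks:
 assumes P: "P \<in> class_sets p n"
 shows "folded p m (swap_blocks p n i P) = swp i (folded p m P)"
 unfolding folded_def swap_blocks_indices(2)[OF P] using i by (auto simp: swp_mem split: if_splits)

lemma swap_blocks_swap_blocks:
 assumes P: "P \<in> class_sets p n" and S: "swap_blocks p n i P \<in> class_sets p n"
 shows "swap_blocks p n i (swap_blocks p n i P) = P"
 using swap_blocks_indices(2)[OF P] swap_blocks_indices(2)[OF S]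
 by (intro block_constant_eqI[OF swap_blocks_indices(1)[OF S] classD(2)[OF P] swap_blocks_indices(3)[OF S] classD(3)[OF P]]) simp

text \<open>Up to block \<open>m\<close> the ballot condition of the folded set suffices, even when
  a started second-column block is counted in full. Beyond it the exchange does not change the
  counts.\<close>

lemma swap_blocks_class:
 assumes P: "P \<in> class_sets p n" and b: "swp i (folded p m P) \<in> ballot m"
 shows "swap_blocks p n i P \<in> class_sets p n"
proof -
 let ?Q = "swap_blocks p n i P"
 note Q = swap_blocks_indices[OF P]
 note fold = folded_swap_blocks[OF P]
 have Q0: "0 \<notin> ?Q" by (simp add: swap_blocks_def)
 have i1: "1 \<le> i" using i by simp
 have "2 * card (?Q \<inter> {1..x}) \<le> x" if x: "x \<le> n" for x
 proof (cases "x div p \<le> m")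
  case True
  let ?j = "x div p"
  have F: "card (?Q \<inter> {1..x}) + (if x \<in> ?Q then p - 1 - x mod p else 0) = p * card (block_indices p ?Q \<inter> {1..?j})"
   by (rule block_card[OF p_pos Q0 block_constant_mono[OF Q(1) x]])
  have e: "block_indices p ?Q \<inter> {1..?j} = folded p m ?Q \<inter> {1..?j}" using True by (auto simp: folded_def)
  have "2 * card (block_indices p ?Q \<inter> {1..?j}) \<le> ?j" unfolding e fold by (rule ballotD[OF b True])
  hence "p * (2 * card (block_indices p ?Q \<inter> {1..?j})) \<le> p * ?j" by (rule mult_le_mono2)
  moreover have "p * ?j + x mod p = x" by simp
  moreover have "2 * card (?Q \<inter> {1..x}) \<le> 2 * (p * card (block_indices p ?Q \<inter> {1..?j}))" using F by simp
  ultimately show ?thesis by linarith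
 next
  case False
  have FQ: "card (?Q \<inter> {1..x}) + (if x \<in> ?Q then p - 1 - x mod p else 0) = p * card (block_indices p ?Q \<inter> {1..x div p})"
   by (rule block_card[OF p_pos Q0 block_constant_mono[OF Q(1) x]])
  have FP: "card (P \<inter> {1..x}) + (if x \<in> P then p - 1 - x mod p else 0) = p * card (block_indices p P \<inter> {1..x div p})"
   by (rule block_card[OF p_pos classD(4)[OF P] block_constant_mono[OF classD(2)[OF P] x]])
  have ne: "x div p \<noteq> i" "x div p \<noteq> i + 1" using False i by auto
  have cc: "card (block_indices p ?Q \<inter> {1..x div p}) = card (block_indices p P \<inter> {1..x div p})"
   unfolding Q(2) swp_def by (rule transpose_adjacent_count[OF ne(1) i1])
  have "x div p \<in> block_indices p ?Q \<longleftrightarrow> x div p \<in> block_indices p P" unfolding Q(2) swp_mem using ne by simp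
  hence "x \<in> ?Q \<longleftrightarrow> x \<in> P" 
   using block_constantD[OF Q(1) x] block_constantD[OF classD(2)[OF P] x] unfolding block_indices_def by blast
  hence "card (?Q \<inter> {1..x}) = card (P \<inter> {1..x})" using FQ FP unfolding cc by simp
  thus ?thesis using ballotD[OF classD(1)[OF P] x] by simp
 qed
 hence "?Q \<in> ballot n" using Q(3) by (simp add: ballot_def)
 thus "?Q \<in> class_sets p n" by (rule block_constant_class_sets[OF p_pos _ Q(1)])
qed

lemma folded_block_indices: "j \<in> {1..m} \<Longrightarrow> j \<in> folded p m P \<longleftrightarrow> j \<in> block_indices p P"
 by (simp add: folded_def)

lemma window_mem:
 assumes P: "P \<in> class_sets p n"
 shows "i * p \<le> x \<Longrightarrow> x < i * p + p \<Longrightarrow> x \<in> P \<longleftrightarrow> i \<in> folded p m P"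
  and "i * p + p \<le> x \<Longrightarrow> x < i * p + 2 * p \<Longrightarrow> x \<in> P \<longleftrightarrow> i + 1 \<in> folded p m P"
 using mem_block(2)[OF P, of i x] mem_block(2)[OF P, of "i + 1" x] i by (auto simp: algebra_simps)

lemma swap_blocks_falling:
 assumes P: "P \<in> class_sets p n" and lo: "i \<notin> folded p m P" and hi: "i + 1 \<in> folded p m P"
 shows "swap_blocks p n i P = falling p (i * p) P 0"
proof (rule Set.set_eqI)
 fix x
 have ij: "i \<in> {1..m}" "i + 1 \<in> {1..m}" using i by auto
 have lo': "i * p \<notin> P" and hi': "i * p + p \<in> P" using lo hi ij by (simp_all add: folded_block_indices block_indices_def algebra_simps)
 consider (low) "i * p \<le> x" "x < i * p + p" | (high) "i * p + p \<le> x" "x < i * p + 2 * p"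
  | (out) "x < i * p \<or> i * p + 2 * p \<le> x" by linarith
 thus "x \<in> swap_blocks p n i P \<longleftrightarrow> x \<in> falling p (i * p) P 0"
 proof cases
  case low
  hence "x div p = i" by (intro div_nat_eqI) (auto simp: algebra_simps)
  moreover have "x \<in> {1..n}" using low window_bounds unfolding atLeastAtMost_iff by linarith
  ultimately show ?thesis using low hi' by (auto simp: swap_blocks_def falling_def add.commute)
 next
  case high
  hence "x div p = i + 1" by (intro div_nat_eqI) (auto simp: algebra_simps)
  thus ?thesis using high lo' by (auto simp: swap_blocks_def falling_def)
 next
  case out
  have "x div p \<noteq> i" "x div p \<noteq> i + 1"
  proof -
   have e: "x = x div p * p + x mod p" "x mod p < p" using p by simp_all
   show "x div p \<noteq> i"
   proof
    assume "x div p = i"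
    hence "x = i * p + x mod p" using e(1) by simp
    thus False using e(2) out by linarith
   qed
   show "x div p \<noteq> i + 1"
   proof
    assume "x div p = i + 1"
    hence "x = (i + 1) * p + x mod p" using e(1) by simp
    thus False using e(2) out unfolding window_bounds(3) by linarith
   qed
  qed
  hence "x \<in> swap_blocks p n i P \<longleftrightarrow> x \<in> {1..n} \<and> x div p * p \<in> P" by (simp add: swap_blocks_def)
  also have "\<dots> \<longleftrightarrow> x \<in> P" using block_constantD[OF classD(2)[OF P], of x] classD(3)[OF P] by (cases "x \<in> {1..n}") auto
  finally show ?thesis using out by (auto simp: falling_def)
 qed
qed

text \<open>The word touches only the window and keeps the number of elements. Among block-constant
  sets this leaves the original and the exchanged one; equal columns on both halves of the window
  would change the cardinality.\<close>

lemma block_word_columns: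
 assumes R: "R \<in> class_sets p n" and P: "P \<in> class_sets p n"
  and nz: "mat n (psi_word p n (block_word p (i * p))) R P \<noteq> 0"
 shows "i \<in> folded p m P \<longleftrightarrow> i + 1 \<notin> folded p m P" "R = P \<or> R = swap_blocks p n i P"
proof -
 have ij: "i \<in> {1..m}" "i + 1 \<in> {1..m}" using i by auto
 have mid: "i * p + p - 1 \<in> P \<longleftrightarrow> i \<in> folded p m P" "i * p + p \<in> P \<longleftrightarrow> i + 1 \<in> folded p m P"
  using window_mem[OF P, of "i * p + p - 1"] window_mem[OF P, of "i * p + p"] p by auto
 show x: "i \<in> folded p m P \<longleftrightarrow> i + 1 \<notin> folded p m P"
 proof (rule ccontr)
  assume "\<not> ?thesis"
  hence "i * p + p - 1 \<in> P \<longleftrightarrow> i * p + p \<in> P" using mid by blast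
  from block_word_same_column[OF p window_bounds(1,2) classD(1)[OF P] classD(1)[OF R] this] show False using nz by simp
 qed
 have rng: "set (block_word p (i * p)) \<subseteq> {1..<n}" 
 proof
  fix k assume "k \<in> set (block_word p (i * p))"
  thus "k \<in> {1..<n}" using block_word_window[of k p "i * p"] window_bounds unfolding atLeastLessThan_iff by linarith
 qed
 note sup = psi_word_support[OF rng classD(1)[OF R] classD(1)[OF P] nz]
 let ?W = "{i * p..<i * p + 2 * p}"
 have out: "x \<in> R \<longleftrightarrow> x \<in> P" if "x \<notin> ?W" for x
 proof (rule sup(2))
  fix k assume "k \<in> set (block_word p (i * p))"
  thus "x \<noteq> k \<and> x \<noteq> k + 1" using block_word_window[of k p "i * p"] that by auto
 qed
 have fin: "finite P" "finite R" using classD(3)[OF P] classD(3)[OF R] finite_subset by blast+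
 have notsame: "i \<in> folded p m R \<longleftrightarrow> i + 1 \<notin> folded p m R"
 proof (rule ccontr)
  assume s: "\<not> ?thesis"
  have wR: "x \<in> R \<longleftrightarrow> i \<in> folded p m R" if "x \<in> ?W" for x
   using window_mem[OF R, of x] s that by (cases "x < i * p + p") auto
  have ex: "i * p + p \<in> ?W" "i * p \<in> ?W" using p by auto
  have px: "i * p \<in> P \<longleftrightarrow> i \<in> folded p m P" using window_mem(1)[OF P, of "i * p"] p by simp
  show False
  proof (cases "i \<in> folded p m R")
   case True
   have "P \<subseteq> R" using out wR True by blast
   moreover have "P \<noteq> R" using wR[OF ex(1)] wR[OF ex(2)] True mid(2) px x by blast
   ultimately have "card P < card R" using fin by (intro psubset_card_mono) auto
   thus False using sup(1) by simp
  next
   case False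
   have "R \<subseteq> P" using out wR False by blast
   moreover have "P \<noteq> R" using wR[OF ex(1)] wR[OF ex(2)] False mid(2) px x by blast
   ultimately have "card R < card P" using fin by (intro psubset_card_mono) auto
   thus False using sup(1) by simp
  qed
 qed
 have off: "j \<in> block_indices p R \<longleftrightarrow> j \<in> block_indices p P" if "j \<noteq> i" "j \<noteq> i + 1" for j
 proof -
  have "j * p \<notin> ?W"
  proof
   assume a: "j * p \<in> ?W"
   hence "i * p \<le> j * p" "j * p < (i + 2) * p" by (auto simp: algebra_simps)
   hence "i \<le> j" "j < i + 2" using p unfolding mult_less_cancel2 mult_le_cancel2 by auto
   thus False using that by auto
  qed
  thus ?thesis unfolding block_indices_def mem_Collect_eq by (rule out)
 qed
 show "R = P \<or> R = swap_blocks p n i P"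
 proof (cases "i \<in> block_indices p R \<longleftrightarrow> i \<in> block_indices p P")
  case True
  hence "i + 1 \<in> block_indices p R \<longleftrightarrow> i + 1 \<in> block_indices p P"
   using notsame x unfolding folded_block_indices[OF ij(1)] folded_block_indices[OF ij(2)] by blast
  hence "j \<in> block_indices p R \<longleftrightarrow> j \<in> block_indices p P" for j
   using True off[of j] by (cases "j = i"; cases "j = i + 1") simp_all
  hence "block_indices p R = block_indices p P" by blast
  thus ?thesis using block_constant_eqI[OF classD(2)[OF R] classD(2)[OF P] classD(3)[OF R] classD(3)[OF P]] by blast
 next
  case False
  hence "i \<in> block_indices p R \<longleftrightarrow> i + 1 \<in> block_indices p P" "i + 1 \<in> block_indices p R \<longleftrightarrow> i \<in> block_indices p P"
   using notsame x unfolding folded_block_indices[OF ij(1)] folded_block_indices[OF ij(2)] by blast+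
  hence "j \<in> block_indices p R \<longleftrightarrow> j \<in> swp i (block_indices p P)" for j
   using off[of j] unfolding swp_mem by (cases "j = i"; cases "j = i + 1") simp_all
  hence "block_indices p R = swp i (block_indices p P)" by blast
  thus ?thesis
   using block_constant_eqI[OF classD(2)[OF R] swap_blocks_indices(1)[OF P] classD(3)[OF R] swap_blocks_indices(3)[OF P]]
    swap_blocks_indices(2)[OF P] by simp
 qed
qed

lemma block_word_entries:
 assumes P: "P \<in> class_sets p n" and lo: "i \<notin> folded p m P" and hi: "i + 1 \<in> folded p m P"
 shows "mat n (psi_word p n (block_word p (i * p))) P P \<noteq> 0"
  and "swap_blocks p n i P \<in> ballot n \<Longrightarrow> mat n (psi_word p n (block_word p (i * p))) (swap_blocks p n i P) P \<noteq> 0"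
proof -
 have ij: "i \<in> {1..m}" using i by auto
 have low: "x \<notin> P" if "i * p \<le> x" "x < i * p + p" for x using window_mem(1)[OF P that] lo by simp
 have high: "x \<in> P" if "i * p + p \<le> x" "x < i * p + 2 * p" for x using window_mem(2)[OF P that] hi by simp
 show "mat n (psi_word p n (block_word p (i * p))) P P \<noteq> 0"
  by (rule block_word_diagonal[OF p window_bounds(1,2) classD(1)[OF P] low high height_block_start[OF P ij]])
 assume b: "swap_blocks p n i P \<in> ballot n"
 show "mat n (psi_word p n (block_word p (i * p))) (swap_blocks p n i P) P \<noteq> 0"
  unfolding swap_blocks_falling[OF P lo hi]
  by (rule block_word_exchange[OF p window_bounds(1,2) classD(1)[OF P] low high height_block_start[OF P ij] b[unfolded swap_blocks_falling[OF P lo hi]]])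
qed

end

end

section \<open>Jucys-Murphy recursion\<close>

definition s_gen :: "nat \<Rightarrow> nat \<Rightarrow> diagram \<Rightarrow> rat" where
 "s_gen n i = u_gen n i \<ominus>\<^bsub>TLQ n\<^esub> \<one>\<^bsub>TLQ n\<^esub>"

lemma s_gen_closed: "i \<in> {1..<n} \<Longrightarrow> s_gen n i \<in> carrier (TLQ n)"
 unfolding s_gen_def by (intro TL.minus_closed u_gen_carrier one_in_carrier)

lemma u_gen_eq: "i \<in> {1..<n} \<Longrightarrow> u_gen n i = s_gen n i \<oplus>\<^bsub>TLQ n\<^esub> \<one>\<^bsub>TLQ n\<^esub>"
 unfolding s_gen_def TL_minus[OF u_gen_carrier one_in_carrier] by (simp add: TL_simps)

lemma act_s_gen:
 assumes v: "v \<in> tensors n" and i: "i \<in> {1..<n}"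
 shows "act n (s_gen n i) v X = - v (transpose i (i + 1) ` X)"
proof -
 let ?t = "transpose i (i + 1)"
 have inv: "X = ?t ` Y \<longleftrightarrow> Y = ?t ` X" for Y by (auto simp: image_image)
 have "act n (s_gen n i) v X = (\<Sum>Y\<in>Pow {1..n}. perm_rep n ?t X Y * v Y)"
  unfolding act_def s_gen_def rep_u_gen_minus_one[OF i] ..
 also have "\<dots> = (\<Sum>Y\<in>Pow {1..n}. if Y = ?t ` X then - v (?t ` X) else 0)"
 proof (rule sum.cong[OF refl])
  fix Y assume Y: "Y \<in> Pow {1..n}"
  show "perm_rep n ?t X Y * v Y = (if Y = ?t ` X then - v (?t ` X) else 0)"
   using Y unfolding perm_rep_def inv by (simp add: sign_swap_id)
 qed
 also have "\<dots> = - v (?t ` X)" using tensorsD[OF v, of "?t ` X"] by simp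
 finally show ?thesis .
qed

lemma act_faithful:
 assumes "x \<in> carrier (TLQ n)" "y \<in> carrier (TLQ n)" "\<And>v X. v \<in> tensors n \<Longrightarrow> act n x v X = act n y v X"
 shows "x = y"
proof (rule mat_faithful[OF assms(1,2)])
 fix P Q
 have "act n x (hw Q n) = act n y (hw Q n)" by (rule ext) (rule assms(3)[OF hw_tensors])
 thus "mat n x P Q = mat n y P Q" by (simp add: mat_def)
qed

lemma s_gen_square:
 assumes i: "i \<in> {1..<n}"
 shows "s_gen n i \<otimes>\<^bsub>TLQ n\<^esub> s_gen n i = \<one>\<^bsub>TLQ n\<^esub>"
proof (rule act_faithful[OF TL_mult_closed[OF s_gen_closed[OF i] s_gen_closed[OF i]] one_in_carrier])
 fix v X assume v: "v \<in> tensors n"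
 show "act n (s_gen n i \<otimes>\<^bsub>TLQ n\<^esub> s_gen n i) v X = act n \<one>\<^bsub>TLQ n\<^esub> v X"
  unfolding act_mult act_one[OF v] act_s_gen[OF act_tensors i] act_s_gen[OF v i] by (simp add: image_image)
qed

text \<open>L_(i+1) s_i = s_i L_i + 1: conjugation by s_i turns the transposition of j and i + 1
  into that of j and i, and the one extra term, s_i itself, squares to 1.\<close>

lemma JM_s_gen:
 assumes i: "i \<in> {1..<n}"
 shows "JM_TL n (i + 1) \<otimes>\<^bsub>TLQ n\<^esub> s_gen n i = s_gen n i \<otimes>\<^bsub>TLQ n\<^esub> JM_TL n i \<oplus>\<^bsub>TLQ n\<^esub> \<one>\<^bsub>TLQ n\<^esub>"
proof (rule act_faithful)
 have le: "i + 1 \<le> n" "i \<le> n" using i by auto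
 note c = JM_TL_closed[OF le(1)] JM_TL_closed[OF le(2)] s_gen_closed[OF i]
 show "JM_TL n (i + 1) \<otimes>\<^bsub>TLQ n\<^esub> s_gen n i \<in> carrier (TLQ n)" by (rule TL_mult_closed[OF c(1,3)])
 show "s_gen n i \<otimes>\<^bsub>TLQ n\<^esub> JM_TL n i \<oplus>\<^bsub>TLQ n\<^esub> \<one>\<^bsub>TLQ n\<^esub> \<in> carrier (TLQ n)"
  by (rule TL.a_closed[OF TL_mult_closed[OF c(3,2)] one_in_carrier])
 fix v X assume v: "v \<in> tensors n"
 let ?t = "transpose i (i + 1)"
 have tr: "?t ` transpose j (i + 1) ` X = transpose j i ` ?t ` X" if "j \<in> {1..<i}" for j
  unfolding image_image using that by (intro image_cong refl) (auto simp: transpose_def)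
 have "act n (JM_TL n (i + 1) \<otimes>\<^bsub>TLQ n\<^esub> s_gen n i) v X = - (\<Sum>j\<in>{1..<i + 1}. - v (?t ` transpose j (i + 1) ` X))"
  unfolding act_mult act_JM[OF act_tensors le(1)] jm_def act_s_gen[OF v i] ..
 also have "\<dots> = (\<Sum>j\<in>{1..<i + 1}. v (?t ` transpose j (i + 1) ` X))" by (simp add: sum_negf)
 also have "{1..<i + 1} = insert i {1..<i}" using i by auto
 also have "(\<Sum>j\<in>insert i {1..<i}. v (?t ` transpose j (i + 1) ` X)) = v (?t ` ?t ` X) + (\<Sum>j\<in>{1..<i}. v (?t ` transpose j (i + 1) ` X))"
  by (rule sum.insert) auto
 also have "?t ` ?t ` X = X" by (simp add: image_image)
 also have "(\<Sum>j\<in>{1..<i}. v (?t ` transpose j (i + 1) ` X)) = (\<Sum>j\<in>{1..<i}. v (transpose j i ` ?t ` X))"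
  by (intro sum.cong refl arg_cong[where f = v] tr)
 also have "v X + \<dots> = - (- (\<Sum>j\<in>{1..<i}. v (transpose j i ` ?t ` X))) + v X" by simp
 also have "\<dots> = act n (s_gen n i \<otimes>\<^bsub>TLQ n\<^esub> JM_TL n i \<oplus>\<^bsub>TLQ n\<^esub> \<one>\<^bsub>TLQ n\<^esub>) v X"
  unfolding act_linear act_mult act_one[OF v] act_s_gen[OF act_tensors i]
  unfolding act_JM[OF v le(2)] jm_def ..
 finally show "act n (JM_TL n (i + 1) \<otimes>\<^bsub>TLQ n\<^esub> s_gen n i) v X =
  act n (s_gen n i \<otimes>\<^bsub>TLQ n\<^esub> JM_TL n i \<oplus>\<^bsub>TLQ n\<^esub> \<one>\<^bsub>TLQ n\<^esub>) v X" .
qed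

lemma JM_Suc:
 assumes i: "i \<in> {1..<n}"
 shows "JM_TL n (i + 1) = (s_gen n i \<otimes>\<^bsub>TLQ n\<^esub> JM_TL n i) \<otimes>\<^bsub>TLQ n\<^esub> s_gen n i \<oplus>\<^bsub>TLQ n\<^esub> s_gen n i"
proof -
 have le: "i + 1 \<le> n" "i \<le> n" using i by auto
 note c = JM_TL_closed[OF le(1)] JM_TL_closed[OF le(2)] s_gen_closed[OF i]
 have "JM_TL n (i + 1) = (JM_TL n (i + 1) \<otimes>\<^bsub>TLQ n\<^esub> s_gen n i) \<otimes>\<^bsub>TLQ n\<^esub> s_gen n i"
  unfolding TL.m_assoc[OF c(1,3,3)] s_gen_square[OF i] TL.r_one[OF c(1)] ..
 thus ?thesis
  unfolding JM_s_gen[OF i] TL.l_distr[OF TL_mult_closed[OF c(3,2)] one_in_carrier c(3)] TL.l_one[OF c(3)] .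
qed

text \<open>Diagonal matrices commute, and \<open>mat\<close> is faithful.\<close>

lemma JM_commute:
 assumes "i \<in> {1..n}" "j \<in> {1..n}"
 shows "JM_TL n i \<otimes>\<^bsub>TLQ n\<^esub> JM_TL n j = JM_TL n j \<otimes>\<^bsub>TLQ n\<^esub> JM_TL n i"
proof (rule mat_faithful)
 have le: "i \<le> n" "j \<le> n" using assms by auto
 note c = JM_TL_closed[OF le(1)] JM_TL_closed[OF le(2)]
 show "JM_TL n i \<otimes>\<^bsub>TLQ n\<^esub> JM_TL n j \<in> carrier (TLQ n)" "JM_TL n j \<otimes>\<^bsub>TLQ n\<^esub> JM_TL n i \<in> carrier (TLQ n)"
  using TL_mult_closed[OF c] TL_mult_closed[OF c(2,1)] .
 fix P Q assume PQ: "P \<in> ballot n" "Q \<in> ballot n"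
 have d: "(\<Sum>S\<in>ballot n. mat n (JM_TL n k) P S * mat n (JM_TL n l) S Q) =
   (if P = Q then of_int (set_content P k * set_content P l) else 0)" if "k \<in> {1..n}" "l \<in> {1..n}" for k l
 proof -
  have "(\<Sum>S\<in>ballot n. mat n (JM_TL n k) P S * mat n (JM_TL n l) S Q) =
    (\<Sum>S\<in>ballot n. if S = P then of_int (set_content P k) * mat n (JM_TL n l) P Q else 0)"
   by (intro sum.cong refl) (simp add: mat_JM[OF PQ(1) _ that(1)] del: One_nat_def)
  also have "\<dots> = of_int (set_content P k) * mat n (JM_TL n l) P Q" using PQ(1) by simp
  finally show ?thesis unfolding mat_JM[OF PQ that(2)] by simp
 qed
 show "mat n (JM_TL n i \<otimes>\<^bsub>TLQ n\<^esub> JM_TL n j) P Q = mat n (JM_TL n j \<otimes>\<^bsub>TLQ n\<^esub> JM_TL n i) P Q"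
  unfolding mat_mult[OF PQ(1)] d[OF assms] d[OF assms(2,1)] by (simp add: mult.commute)
qed

lemma set_content_one: "Q \<in> ballot n \<Longrightarrow> 1 \<le> n \<Longrightarrow> set_content Q 1 = 0"
proof -
 assume "Q \<in> ballot n" "1 \<le> n"
 hence "2 * card (Q \<inter> {1..1}) \<le> 1" by (rule ballotD)
 hence "card (Q \<inter> {1..1}) = 0" by linarith
 moreover from this have "1 \<notin> Q" by auto
 ultimately show ?thesis unfolding set_content_height by simp
qed

text \<open>Base of the induction, written as 0 times the unit so that linearity of a homomorphism
  applies directly.\<close>

lemma JM_first:
 assumes "1 \<le> n"
 shows "JM_TL n 1 = (0 :: rat) \<odot>\<^bsub>TLQ n\<^esub> \<one>\<^bsub>TLQ n\<^esub>"
proof (rule mat_faithful[OF JM_TL_closed[OF assms] smult_closed[OF one_in_carrier]])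
 fix P Q assume PQ: "P \<in> ballot n" "Q \<in> ballot n"
 have "1 \<in> {1..n}" using assms by simp
 thus "mat n (JM_TL n 1) P Q = mat n (0 \<odot>\<^bsub>TLQ n\<^esub> \<one>\<^bsub>TLQ n\<^esub>) P Q"
  unfolding mat_JM[OF PQ \<open>1 \<in> {1..n}\<close>] set_content_one[OF PQ(2) assms] mat_smult by simp
qed

lemma set_content_swp:
 assumes k: "k \<in> {1..<n}" and Q: "Q \<subseteq> {1..n}" and x: "k \<in> Q \<longleftrightarrow> k + 1 \<notin> Q"
 shows "set_content (swp k Q) k = set_content Q (k + 1)" "set_content (swp k Q) (k + 1) = set_content Q k"
proof -
 have e: "swap_entries (tab n Q) k = tab n (swp k Q)" unfolding swp_def by (rule swap_entries_tab[OF assms])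
 have kn: "k \<in> {1..n}" "k + 1 \<in> {1..n}" using k by auto
 show "set_content (swp k Q) k = set_content Q (k + 1)"
  unfolding content_tab[OF kn(1), symmetric] content_tab[OF kn(2), symmetric] e[symmetric]
  by (simp add: content_def swap_entries_def)
 show "set_content (swp k Q) (k + 1) = set_content Q k"
  unfolding content_tab[OF kn(1), symmetric] content_tab[OF kn(2), symmetric] e[symmetric]
  by (simp add: content_def swap_entries_def)
qed

section \<open>Propagating eigenvalues\<close>

text \<open>Linear algebra of the induction step: \<open>S\<close> is the matrix of an involution s,
  \<open>c\<close> lists the eigenvalues of a diagonal operator L, and \<open>M\<close> is the
  matrix of s L s + s, about which only commutation with L is known in addition.\<close>

locale involution_step =
 fixes C :: "'a set" and S M :: "'a \<Rightarrow> 'a \<Rightarrow> rat" and c :: "'a \<Rightarrow> rat"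
 assumes fin: "finite C"
  and M: "\<And>R Q. R \<in> C \<Longrightarrow> Q \<in> C \<Longrightarrow> M R Q = (\<Sum>T\<in>C. S R T * c T * S T Q) + S R Q"
  and square: "\<And>R Q. R \<in> C \<Longrightarrow> Q \<in> C \<Longrightarrow> (\<Sum>T\<in>C. S R T * S T Q) = of_bool (R = Q)"
  and commute: "\<And>R Q. R \<in> C \<Longrightarrow> Q \<in> C \<Longrightarrow> M R Q * c Q = c R * M R Q"
begin

text \<open>If a column of \<open>S\<close> is a multiple of a unit vector, the factor squares to 1,
  and s L s + s shifts the eigenvalue by this factor.\<close>

lemma single:
 assumes P: "P \<in> C" and z: "\<And>T. T \<in> C \<Longrightarrow> T \<noteq> P \<Longrightarrow> S T P = 0"
 shows "S P P = 1 \<or> S P P = -1" and "R \<in> C \<Longrightarrow> M R P = (if R = P then c P + S P P else 0)"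
proof -
 have col: "(\<Sum>T\<in>C. f T * S T P) = f P * S P P" for f
 proof -
  have "(\<Sum>T\<in>C. f T * S T P) = (\<Sum>T\<in>C. if T = P then f P * S P P else 0)"
   by (intro sum.cong refl) (simp add: z)
  thus ?thesis using P fin by simp
 qed
 have sq: "S P P * S P P = 1" using square[OF P P] unfolding col by simp
 hence "(S P P - 1) * (S P P + 1) = 0" by (simp add: algebra_simps)
 thus "S P P = 1 \<or> S P P = -1" by (auto simp: eq_neg_iff_add_eq_0)
 assume R: "R \<in> C"
 have "M R P = S R P * c P * S P P + S R P" unfolding M[OF R P] col ..
 thus "M R P = (if R = P then c P + S P P else 0)" using z[OF R] sq by (cases "R = P") auto
qed

text \<open>As the eigenvalues differ, commutation kills the off-diagonal entries of
  \<open>M\<close> between \<open>P\<close> and \<open>P'\<close>. Since \<open>S P' P\<close> is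
  nonzero, this fixes x = -1 / (c P - c P'), the diagonal coefficient of the seminormal form; the
  involution gives u = -x, and the eigenvalues change places.\<close>

lemma exchange:
 assumes P: "P \<in> C" "P' \<in> C" "P \<noteq> P'" "c P \<noteq> c P'"
  and z: "\<And>T. T \<in> C \<Longrightarrow> T \<noteq> P \<Longrightarrow> T \<noteq> P' \<Longrightarrow> S T P = 0" "\<And>T. T \<in> C \<Longrightarrow> T \<noteq> P \<Longrightarrow> T \<noteq> P' \<Longrightarrow> S T P' = 0"
  and nz: "S P' P \<noteq> 0" and R: "R \<in> C"
 shows "M R P = (if R = P then c P' else 0)" "M R P' = (if R = P' then c P else 0)"
proof -
 define x y w u where "x = S P P" and "y = S P P'" and "w = S P' P" and "u = S P' P'"
 have cols: "(\<Sum>T\<in>C. f T * S T Q) = f P * S P Q + f P' * S P' Q" if "Q = P \<or> Q = P'" for f Q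
 proof -
  have "(\<Sum>T\<in>C. f T * S T Q) = (\<Sum>T\<in>{P, P'}. f T * S T Q)"
   using that z P by (intro sum.mono_neutral_right fin) auto
  thus ?thesis using P(3) by simp
 qed
 have sq: "x * x + y * w = 1" "w * x + u * w = 0"
  using square[OF P(1,1)] square[OF P(2,1)] P(3) unfolding cols[OF disjI1[OF refl]] by (auto simp: x_def y_def w_def u_def)
 have "w * (x + u) = 0" using sq(2) by (simp add: algebra_simps)
 hence u: "u = - x" using nz by (simp add: w_def add_eq_0_iff)
 have MP: "M T P = S T P * c P * x + S T P' * c P' * w + S T P" if "T \<in> C" for T
  unfolding M[OF that P(1)] cols[OF disjI1[OF refl]] by (simp add: x_def w_def)
 have MP': "M T P' = S T P * c P * y + S T P' * c P' * u + S T P'" if "T \<in> C" for T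
  unfolding M[OF that P(2)] cols[OF disjI2[OF refl]] by (simp add: y_def u_def)
 have off: "M P' P = 0" "M P P' = 0" using commute[OF P(2,1)] commute[OF P(1,2)] P(4) by (auto simp: mult.commute)
 have "w * (x * (c P - c P') + 1) = 0"
  using off(1) unfolding MP[OF P(2)] w_def[symmetric] u_def[symmetric] u by (simp add: algebra_simps)
 hence xc: "x * (c P - c P') = -1" using nz by (simp add: w_def add_eq_0_iff)
 have yw: "y * w = 1 - x * x" using sq(1) by simp
 have "M P P = c P * (x * x) + c P' * (y * w) + x"
  unfolding MP[OF P(1)] x_def[symmetric] y_def[symmetric] by (simp add: algebra_simps)
 also have "\<dots> = c P' + x * (x * (c P - c P') + 1)" unfolding yw by (simp add: algebra_simps)
 finally have PP: "M P P = c P'" unfolding xc by simp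
 have "M P' P' = c P * (y * w) + c P' * (u * u) + u"
  unfolding MP'[OF P(2)] w_def[symmetric] u_def[symmetric] by (simp add: algebra_simps)
 also have "\<dots> = c P - x * (x * (c P - c P') + 1)" unfolding yw u by (simp add: algebra_simps)
 finally have PP': "M P' P' = c P" unfolding xc by simp
 show "M R P = (if R = P then c P' else 0)"
  using PP off MP[OF R] z[OF R] by (cases "R = P"; cases "R = P'") auto
 show "M R P' = (if R = P' then c P else 0)"
  using PP' off MP'[OF R] z[OF R] by (cases "R = P"; cases "R = P'") auto
qed

end

section \<open>Matrices of the elements in the image\<close>

lemma mat_finsum_EE:
 assumes A: "A \<subseteq> ballot n" and R: "R \<in> ballot n" and P: "P \<in> ballot n"
 shows "(\<Oplus>\<^bsub>TLQ n\<^esub>t\<in>tab n ` A. EE n t) \<in> carrier (TLQ n)"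
  and "mat n (\<Oplus>\<^bsub>TLQ n\<^esub>t\<in>tab n ` A. EE n t) R P = (if R = P \<and> P \<in> A then 1 else 0)"
proof -
 have EEc: "EE n \<in> tab n ` B \<rightarrow> carrier (TLQ n)" for B using EE_closed by blast
 show "(\<Oplus>\<^bsub>TLQ n\<^esub>t\<in>tab n ` A. EE n t) \<in> carrier (TLQ n)" by (rule TL.finsum_closed[OF EEc])
 have "finite A" using A finite_ballot finite_subset by blast
 thus "mat n (\<Oplus>\<^bsub>TLQ n\<^esub>t\<in>tab n ` A. EE n t) R P = (if R = P \<and> P \<in> A then 1 else 0)" using A
 proof (induction A rule: finite_induct)
  case empty
  thus ?case by (simp add: mat_zero)
 next
  case (insert a A)
  have "tab n a \<notin> tab n ` A" using insert.hyps(2) insert.prems inj_on_tab_ballot[of n] by (auto dest: inj_onD)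
  hence "(\<Oplus>\<^bsub>TLQ n\<^esub>t\<in>tab n ` insert a A. EE n t) = EE n (tab n a) \<oplus>\<^bsub>TLQ n\<^esub> (\<Oplus>\<^bsub>TLQ n\<^esub>t\<in>tab n ` A. EE n t)"
   unfolding image_insert using insert.hyps(1) EEc EE_closed by (intro TL.finsum_insert) auto
  thus ?case
   using insert mat_EE[OF R P, of a] by (auto simp: mat_add)
 qed
qed

lemma mat_mult_diag_right:
 assumes R: "R \<in> ballot n" and P: "P \<in> ballot n" and d: "\<And>T. T \<in> ballot n \<Longrightarrow> mat n y T P = (if T = P then c else 0)"
 shows "mat n (x \<otimes>\<^bsub>TLQ n\<^esub> y) R P = mat n x R P * c"
proof -
 have "(\<Sum>T\<in>ballot n. mat n x R T * mat n y T P) = (\<Sum>T\<in>ballot n. if T = P then mat n x R P * c else 0)"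
  by (intro sum.cong refl) (simp add: d)
 thus ?thesis unfolding mat_mult[OF R] using P by simp
qed

lemma mat_mult_diag_left:
 assumes R: "R \<in> ballot n" and d: "\<And>T. T \<in> ballot n \<Longrightarrow> mat n x R T = (if T = R then c else 0)"
 shows "mat n (x \<otimes>\<^bsub>TLQ n\<^esub> y) R P = c * mat n y R P"
proof -
 have "(\<Sum>T\<in>ballot n. mat n x R T * mat n y T P) = (\<Sum>T\<in>ballot n. if T = R then c * mat n y R P else 0)"
  by (intro sum.cong refl) (simp add: d)
 thus ?thesis unfolding mat_mult[OF R] using R by simp
qed

lemma mat_e_class:
 assumes "R \<in> ballot n" "P \<in> ballot n"
 shows "mat n (e_class p n) R P = (if R = P \<and> P \<in> class_sets p n then 1 else 0)"
 unfolding e_class_def one_column_class_eq by (rule mat_finsum_EE(2)[OF class_sets_ballot assms])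

lemma e_class_closed: "e_class p n \<in> carrier (TLQ n)"
 unfolding e_class_def one_column_class_eq
 by (rule mat_finsum_EE(1)[OF class_sets_ballot empty_ballot empty_ballot])

lemma mat_e_class_mult:
 assumes R: "R \<in> ballot n" and P: "P \<in> ballot n"
 shows "mat n (e_class p n \<otimes>\<^bsub>TLQ n\<^esub> x) R P = (if R \<in> class_sets p n then mat n x R P else 0)"
  and "mat n (x \<otimes>\<^bsub>TLQ n\<^esub> e_class p n) R P = (if P \<in> class_sets p n then mat n x R P else 0)"
proof -
 have "mat n (e_class p n) R T = (if T = R then of_bool (R \<in> class_sets p n) else 0)" if "T \<in> ballot n" for T
  using mat_e_class[OF R that, of p] by auto
 from mat_mult_diag_left[OF R this] show "mat n (e_class p n \<otimes>\<^bsub>TLQ n\<^esub> x) R P = (if R \<in> class_sets p n then mat n x R P else 0)"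
  by simp
 have "mat n (e_class p n) T P = (if T = P then of_bool (P \<in> class_sets p n) else 0)" if "T \<in> ballot n" for T
  using mat_e_class[OF that P, of p] by auto
 from mat_mult_diag_right[OF R P this] show "mat n (x \<otimes>\<^bsub>TLQ n\<^esub> e_class p n) R P = (if P \<in> class_sets p n then mat n x R P else 0)"
  by simp
qed

text \<open>The idempotents at both ends cut the matrix of the word down to the class; the word is
  that of the window starting at \<open>i * p\<close>.\<close>

lemma mat_UU:
 assumes p: "1 \<le> p" and i: "1 \<le> i" "(i + 2) * p \<le> n + 1"
  and R: "R \<in> ballot n" and P: "P \<in> ballot n"
 shows "mat n (UU p n i) R P =
  (if R \<in> class_sets p n \<and> P \<in> class_sets p n then mat n (psi_word p n (block_word p (i * p))) R P else 0)"
proof -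
 let ?A = "TLQ n"
 have bnd: "1 \<le> i * p" "i * p + 2 * p \<le> n + 1" using p i by (simp_all add: algebra_simps)
 have Psi: "Psi p n i j = psi_word p n (rung p (i * p) j)" for j
 proof -
  \<comment> \<open>The index I + 1 in the definition of \<open>Psi\<close> is the middle
    \<open>i * p + p\<close> of the window.\<close>
  have "(i + 1) * p - 1 + 1 + 2 * m - j = i * p + p + 2 * m - j" for m using p by simp
  thus ?thesis unfolding Psi_def Let_def psi_word_def rung_def map_map comp_def by simp
 qed
 have rng: "set (rung p (i * p) j) \<subseteq> {1..<n}" if "j \<le> p" for j
 proof
  fix k assume "k \<in> set (rung p (i * p) j)"
  thus "k \<in> {1..<n}" using rung_window[OF that, of k "i * p"] bnd unfolding atLeastLessThan_iff by linarith
 qed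
 have psi_c: "psi p n k \<in> carrier ?A" if "k \<in> set (rung p (i * p) j)" "j \<le> p" for k j
  using rng[OF that(2)] that(1) by (auto intro!: psi_props(1))
 have prod: "set (map (Psi p n i) js) \<subseteq> carrier ?A"
   "list_mult ?A (map (Psi p n i) js) = psi_word p n (concat (map (rung p (i * p)) js))"
  if js: "set js \<subseteq> {..p}" for js
 proof -
  show "set (map (Psi p n i) js) \<subseteq> carrier ?A"
   using js psi_word_closed[OF rng] unfolding set_map Psi by blast
  have "list_mult ?A (map (Psi p n i) js) = list_mult ?A (map (list_mult ?A) (map (\<lambda>j. map (psi p n) (rung p (i * p) j)) js))"
   unfolding map_map comp_def Psi psi_word_def ..
  also have "\<dots> = list_mult ?A (concat (map (\<lambda>j. map (psi p n) (rung p (i * p) j)) js))"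
  proof (rule list_mult_concat)
   fix xs assume "xs \<in> set (map (\<lambda>j. map (psi p n) (rung p (i * p) j)) js)"
   then obtain j where "j \<le> p" "xs = map (psi p n) (rung p (i * p) j)" using js by auto
   thus "set xs \<subseteq> carrier ?A" using psi_c[of _ j] by (auto simp del: One_nat_def)
  qed
  also have "concat (map (\<lambda>j. map (psi p n) (rung p (i * p) j)) js) = map (psi p n) (concat (map (rung p (i * p)) js))"
   unfolding map_concat map_map comp_def ..
  finally show "list_mult ?A (map (Psi p n i) js) = psi_word p n (concat (map (rung p (i * p)) js))"
   unfolding psi_word_def .
 qed
 define up where "up = [1..<p + 1]"
 define down where "down = rev [1..<p]"
 have ups: "set up \<subseteq> {..p}" "set down \<subseteq> {..p}" by (auto simp: up_def down_def)
 have words: "psi_word p n (concat (map (rung p (i * p)) up)) = psi_word p n (ascent p (i * p) p)"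
   "psi_word p n (concat (map (rung p (i * p)) down)) = psi_word p n (descent p (i * p) (p - 1))"
  using p by (simp_all add: up_def down_def ascent_def descent_def del: upt_Suc)
 have ranges: "set (ascent p (i * p) p) \<subseteq> {1..<n}" "set (descent p (i * p) (p - 1)) \<subseteq> {1..<n}"
 proof -
  have w: "set (block_word p (i * p)) \<subseteq> {1..<n}"
  proof
   fix k assume "k \<in> set (block_word p (i * p))"
   thus "k \<in> {1..<n}" using block_word_window[of k p "i * p"] bnd unfolding atLeastLessThan_iff by linarith
  qed
  thus "set (ascent p (i * p) p) \<subseteq> {1..<n}" "set (descent p (i * p) (p - 1)) \<subseteq> {1..<n}"
   unfolding block_word_def by auto
 qed
 note e = e_class_closed[of p n]
 have e1: "list_mult ?A [e_class p n] = e_class p n" using e by (simp add: list_mult_Cons list_mult_Nil)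
 have uu: "UU p n i = e_class p n \<otimes>\<^bsub>?A\<^esub> (psi_word p n (ascent p (i * p) p) \<otimes>\<^bsub>?A\<^esub>
   (psi_word p n (descent p (i * p) (p - 1)) \<otimes>\<^bsub>?A\<^esub> e_class p n))"
  unfolding UU_def up_def[symmetric] down_def[symmetric] append_Cons append_Nil list_mult_Cons
  using prod(1)[OF ups(1)] prod(1)[OF ups(2)] e
  by (simp add: list_mult_append e1 prod(2)[OF ups(1)] prod(2)[OF ups(2)] words)
 have "mat n (UU p n i) R P = (if R \<in> class_sets p n then \<Sum>T\<in>ballot n. mat n (psi_word p n (ascent p (i * p) p)) R T *
   mat n (psi_word p n (descent p (i * p) (p - 1)) \<otimes>\<^bsub>?A\<^esub> e_class p n) T P else 0)"
  unfolding uu mat_e_class_mult(1)[OF R P] by (simp only: mat_mult[OF R])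
 also have "\<dots> = (if R \<in> class_sets p n \<and> P \<in> class_sets p n then \<Sum>T\<in>ballot n. mat n (psi_word p n (ascent p (i * p) p)) R T *
   mat n (psi_word p n (descent p (i * p) (p - 1))) T P else 0)"
  by (simp add: mat_e_class_mult(2)[OF _ P] cong: sum.cong)
 finally show ?thesis unfolding block_word_def mat_psi_word_append[OF ranges R] .
qed

section \<open>The images of the idempotents\<close>

context
 fixes p n m :: nat and h :: "(diagram \<Rightarrow> rat) \<Rightarrow> diagram \<Rightarrow> rat"
 assumes p: "2 \<le> p" and lower: "(m + 1) * p \<le> n + 1" and upper: "n + 1 < (m + 2) * p"
  and hom: "alg_hom UNIV (TLQ m) (TLQ n) h" and h_one: "h \<one>\<^bsub>TLQ m\<^esub> = e_class p n"
  and h_gen: "\<And>i. i \<in> {1..<m} \<Longrightarrow> h (u_gen m i) = UU p n i"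
begin

lemma h_closed: "x \<in> carrier (TLQ m) \<Longrightarrow> h x \<in> carrier (TLQ n)"
 and h_add: "x \<in> carrier (TLQ m) \<Longrightarrow> y \<in> carrier (TLQ m) \<Longrightarrow> h (x \<oplus>\<^bsub>TLQ m\<^esub> y) = h x \<oplus>\<^bsub>TLQ n\<^esub> h y"
 and h_mult: "x \<in> carrier (TLQ m) \<Longrightarrow> y \<in> carrier (TLQ m) \<Longrightarrow> h (x \<otimes>\<^bsub>TLQ m\<^esub> y) = h x \<otimes>\<^bsub>TLQ n\<^esub> h y"
 and h_smult: "x \<in> carrier (TLQ m) \<Longrightarrow> h (c \<odot>\<^bsub>TLQ m\<^esub> x) = c \<odot>\<^bsub>TLQ n\<^esub> h x"
 using hom unfolding alg_hom_def by (blast, blast, blast, blast)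

text \<open>The unit goes to the idempotent e of the class, so every image equals e times itself and
  itself times e.\<close>

lemma mat_h_outside:
 assumes x: "x \<in> carrier (TLQ m)" and R: "R \<in> ballot n" and P: "P \<in> ballot n"
  and out: "R \<notin> class_sets p n \<or> P \<notin> class_sets p n"
 shows "mat n (h x) R P = 0"
proof -
 have "h x = e_class p n \<otimes>\<^bsub>TLQ n\<^esub> h x"
  unfolding h_one[symmetric] h_mult[OF one_in_carrier x, symmetric] TL.l_one[OF x] ..
 hence l: "mat n (h x) R P = (if R \<in> class_sets p n then mat n (h x) R P else 0)"
  using mat_e_class_mult(1)[OF R P, where p = p and x = "h x"] by simp
 have "h x = h x \<otimes>\<^bsub>TLQ n\<^esub> e_class p n"
  unfolding h_one[symmetric] h_mult[OF x one_in_carrier, symmetric] TL.r_one[OF x] ..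
 hence r: "mat n (h x) R P = (if P \<in> class_sets p n then mat n (h x) R P else 0)"
  using mat_e_class_mult(2)[OF R P, where p = p and x = "h x"] by simp
 show ?thesis
 proof (cases "R \<in> class_sets p n")
  case True
  thus ?thesis using r out by simp
 qed (use l in simp)
qed

lemma mat_h_mult:
 assumes x: "x \<in> carrier (TLQ m)" and y: "y \<in> carrier (TLQ m)" and R: "R \<in> class_sets p n" and P: "P \<in> class_sets p n"
 shows "mat n (h (x \<otimes>\<^bsub>TLQ m\<^esub> y)) R P = (\<Sum>T\<in>class_sets p n. mat n (h x) R T * mat n (h y) T P)"
proof -
 have b: "R \<in> ballot n" "P \<in> ballot n" using R P class_sets_ballot by blast+
 have "mat n (h x) R T * mat n (h y) T P = 0" if "T \<in> ballot n" "T \<notin> class_sets p n" for T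
  using mat_h_outside[OF x b(1) that(1)] that(2) by simp
 thus ?thesis
  unfolding h_mult[OF x y] mat_mult[OF b(1)]
  by (intro sum.mono_neutral_right finite_ballot class_sets_ballot) auto
qed

lemma mat_h_one:
 assumes R: "R \<in> class_sets p n" and P: "P \<in> class_sets p n"
 shows "mat n (h \<one>\<^bsub>TLQ m\<^esub>) R P = of_bool (R = P)"
proof -
 have b: "R \<in> ballot n" "P \<in> ballot n" using R P class_sets_ballot by blast+
 show ?thesis unfolding h_one mat_e_class[OF b] using P by simp
qed

text \<open>The generator is s_i plus the unit, and the unit acts as the identity on the
  class.\<close>

lemma mat_h_s_gen:
 assumes i: "i \<in> {1..<m}" and R: "R \<in> class_sets p n" and P: "P \<in> class_sets p n"
 shows "mat n (h (s_gen m i)) R P = mat n (psi_word p n (block_word p (i * p))) R P - of_bool (R = P)"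
proof -
 have b: "R \<in> ballot n" "P \<in> ballot n" using R P class_sets_ballot by blast+
 have "(i + 2) * p \<le> (m + 1) * p" using i by (intro mult_le_mono1) simp
 hence bnd: "1 \<le> p" "1 \<le> i" "(i + 2) * p \<le> n + 1" using i p lower by auto
 have "UU p n i = h (s_gen m i) \<oplus>\<^bsub>TLQ n\<^esub> h \<one>\<^bsub>TLQ m\<^esub>"
  unfolding h_gen[OF i, symmetric] h_add[OF s_gen_closed[OF i] one_in_carrier, symmetric] u_gen_eq[OF i] ..
 hence "mat n (UU p n i) R P = mat n (h (s_gen m i)) R P + of_bool (R = P)"
  using mat_h_one[OF R P] by (simp add: mat_add)
 thus ?thesis using R P unfolding mat_UU[OF bnd b] by simp
qed

lemma finite_class_sets: "finite (class_sets p n)"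
 using class_sets_ballot finite_ballot by (rule finite_subset)

text \<open>The involution argument on the class has three cases for the blocks i and i + 1. In one
  column, \<open>UU\<close> kills the column and s_i acts by -1. If exchanging them is standard,
  \<open>exchange\<close> applies. If it is not, the nonzero diagonal entry of \<open>UU\<close>
  rules out -1 and leaves 1.\<close>

lemma JM_step:
 assumes i: "i \<in> {1..<m}"
  and IH: "\<And>R P. R \<in> class_sets p n \<Longrightarrow> P \<in> class_sets p n \<Longrightarrow>
   mat n (h (JM_TL m i)) R P = (if R = P then of_int (set_content (folded p m P) i) else 0)"
  and R: "R \<in> class_sets p n" and P: "P \<in> class_sets p n"
 shows "mat n (h (JM_TL m (i + 1))) R P = (if R = P then of_int (set_content (folded p m P) (i + 1)) else 0)"
proof -
 let ?C = "class_sets p n"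
 have le: "i + 1 \<le> m" "i \<le> m" "i \<in> {1..m}" "i + 1 \<in> {1..m}" using i by auto
 note cl = JM_TL_closed[OF le(1)] JM_TL_closed[OF le(2)] s_gen_closed[OF i]
 define S where "S = mat n (h (s_gen m i))"
 define M where "M = mat n (h (JM_TL m (i + 1)))"
 define c where "c = (\<lambda>Q. of_int (set_content (folded p m Q) i) :: rat)"
 note context_facts = p lower upper
 have diag_r: "(\<Sum>T\<in>?C. f T * mat n (h (JM_TL m i)) T Q) = f Q * c Q" if "Q \<in> ?C" for f Q
 proof -
  have "(\<Sum>T\<in>?C. f T * mat n (h (JM_TL m i)) T Q) = (\<Sum>T\<in>?C. if T = Q then f Q * c Q else 0)"
   by (intro sum.cong refl) (simp add: IH that c_def)
  thus ?thesis using that finite_class_sets by simp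
 qed
 have diag_l: "(\<Sum>T\<in>?C. mat n (h (JM_TL m i)) Q T * f T) = c Q * f Q" if "Q \<in> ?C" for f Q
 proof -
  have "(\<Sum>T\<in>?C. mat n (h (JM_TL m i)) Q T * f T) = (\<Sum>T\<in>?C. if T = Q then c Q * f Q else 0)"
   by (intro sum.cong refl) (simp add: IH that c_def)
  thus ?thesis using that finite_class_sets by simp
 qed
 interpret involution_step ?C S M c
 proof
  show "finite ?C" by (rule finite_class_sets)
  fix A B assume A: "A \<in> ?C" and B: "B \<in> ?C"
  have sl: "mat n (h (s_gen m i \<otimes>\<^bsub>TLQ m\<^esub> JM_TL m i)) A T = S A T * c T" if "T \<in> ?C" for T
   unfolding mat_h_mult[OF cl(3,2) A that] diag_r[OF that] S_def ..
  have "M A B = mat n (h ((s_gen m i \<otimes>\<^bsub>TLQ m\<^esub> JM_TL m i) \<otimes>\<^bsub>TLQ m\<^esub> s_gen m i)) A B + S A B"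
   unfolding M_def JM_Suc[OF i] h_add[OF TL_mult_closed[OF TL_mult_closed[OF cl(3,2)] cl(3)] cl(3)] mat_add S_def ..
  also have "\<dots> = (\<Sum>T\<in>?C. S A T * c T * S T B) + S A B"
   unfolding mat_h_mult[OF TL_mult_closed[OF cl(3,2)] cl(3) A B] S_def[symmetric]
   by (intro arg_cong2[where f = "(+)"] sum.cong refl) (simp add: sl)
  finally show "M A B = (\<Sum>T\<in>?C. S A T * c T * S T B) + S A B" .
  show "(\<Sum>T\<in>?C. S A T * S T B) = of_bool (A = B)"
   unfolding S_def mat_h_mult[OF cl(3,3) A B, symmetric] s_gen_square[OF i] by (rule mat_h_one[OF A B])
  have "mat n (h (JM_TL m (i + 1) \<otimes>\<^bsub>TLQ m\<^esub> JM_TL m i)) A B = mat n (h (JM_TL m i \<otimes>\<^bsub>TLQ m\<^esub> JM_TL m (i + 1))) A B"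
   unfolding JM_commute[OF le(4,3)] ..
  thus "M A B * c B = c A * M A B"
   unfolding mat_h_mult[OF cl(1,2) A B] mat_h_mult[OF cl(2,1) A B] diag_r[OF B] diag_l[OF A] M_def .
 qed
 have S: "S A B = mat n (psi_word p n (block_word p (i * p))) A B - of_bool (A = B)" if "A \<in> ?C" "B \<in> ?C" for A B
  unfolding S_def by (rule mat_h_s_gen[OF i that])
 let ?J = "folded p m P"
 have Jb: "?J \<in> ballot m" by (rule folded_ballot[OF context_facts P])
 have supp: "S A B = 0" if "A \<in> ?C" "B \<in> ?C" "A \<noteq> B" "A \<noteq> swap_blocks p n i B" for A B
  using block_word_columns(2)[OF context_facts i that(1,2)] that unfolding S[OF that(1,2)] by auto
 have "M R P = (if R = P then of_int (set_content ?J (i + 1)) else 0)"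
 proof (cases "i \<in> ?J \<longleftrightarrow> i + 1 \<notin> ?J")
  case same: False
  have z: "mat n (psi_word p n (block_word p (i * p))) T P = 0" if "T \<in> ?C" for T
   using block_word_columns(1)[OF context_facts i that P] same by blast
  have s: "S T P = 0" if "T \<in> ?C" "T \<noteq> P" for T using z[OF that(1)] that(2) unfolding S[OF that(1) P] by simp
  have SP: "S P P = -1" unfolding S[OF P P] using z[OF P] by simp
  have "axial_set ?J i = 1" using same unfolding axial_set_eq by auto
  hence "set_content ?J (i + 1) = set_content ?J i - 1" by (simp add: axial_set_def)
  thus ?thesis using single(2)[OF P s R] unfolding SP c_def by simp
 next
  case x: True
  show ?thesis
  proof (cases "swp i ?J \<in> ballot m")
   case b: True
   \<comment> \<open>Stated for a set with block \<open>i\<close> in the first and block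
     \<open>i + 1\<close> in the second column, where entries of the word are known to be nonzero;
     it yields both columns at once and so also covers the exchanged set.\<close>
   have exch: "M A T = (if A = T then of_int (set_content (folded p m T) (i + 1)) else 0) \<and>
     M A (swap_blocks p n i T) = (if A = swap_blocks p n i T then of_int (set_content (folded p m (swap_blocks p n i T)) (i + 1)) else 0)"
    if T: "T \<in> ?C" and lo: "i \<notin> folded p m T" and hi: "i + 1 \<in> folded p m T" and bT: "swp i (folded p m T) \<in> ballot m"
     and A: "A \<in> ?C" for T A
   proof -
    let ?T = "swap_blocks p n i T"
    have T': "?T \<in> ?C" by (rule swap_blocks_class[OF context_facts i T bT])
    note fold = folded_swap_blocks[OF context_facts i T]
    have invo: "swap_blocks p n i ?T = T" by (rule swap_blocks_swap_blocks[OF context_facts i T T'])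
    have xT: "i \<in> folded p m T \<longleftrightarrow> i + 1 \<notin> folded p m T" using lo hi by blast
    have TJ: "folded p m T \<in> ballot m" by (rule folded_ballot[OF context_facts T])
    note sc = set_content_swp[OF i ballot_subset[OF TJ] xT]
    have ne: "T \<noteq> ?T"
    proof
     assume "T = ?T"
     hence "folded p m T = swp i (folded p m T)" using fold by simp
     hence "i \<in> folded p m T \<longleftrightarrow> i \<in> swp i (folded p m T)" by simp
     thus False using lo hi by (simp add: swp_mem)
    qed
    have "exchangeable m i (folded p m T)" unfolding exchangeable_def using xT TJ bT by blast
    from exchangeable_axial[OF this i] have "axial_set (folded p m T) i \<noteq> 0" by auto
    hence cne: "c T \<noteq> c ?T" unfolding c_def fold sc axial_set_def by simp
    have nz: "S ?T T \<noteq> 0"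
     unfolding S[OF T' T] using ne block_word_entries(2)[OF context_facts i T lo hi] T' class_sets_ballot by auto
    have z: "B \<in> ?C \<Longrightarrow> B \<noteq> T \<Longrightarrow> B \<noteq> ?T \<Longrightarrow> S B T = 0" "B \<in> ?C \<Longrightarrow> B \<noteq> T \<Longrightarrow> B \<noteq> ?T \<Longrightarrow> S B ?T = 0" for B
     using supp[OF _ T, of B] supp[OF _ T', of B] unfolding invo by blast+
    note ex = exchange[OF T T' ne cne z nz A]
    have "c ?T = of_int (set_content (folded p m T) (i + 1))" "c T = of_int (set_content (folded p m ?T) (i + 1))"
     unfolding c_def fold sc by simp_all
    thus ?thesis using ex by simp
   qed
   show ?thesis
   proof (cases "i \<in> ?J")
    case False
    thus ?thesis using exch[OF P _ _ b R] x by blast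
   next
    case True
    let ?T = "swap_blocks p n i P"
    have T: "?T \<in> ?C" by (rule swap_blocks_class[OF context_facts i P b])
    note fold = folded_swap_blocks[OF context_facts i P]
    have invo: "swap_blocks p n i ?T = P" by (rule swap_blocks_swap_blocks[OF context_facts i P T])
    have "i \<notin> folded p m ?T" "i + 1 \<in> folded p m ?T" "swp i (folded p m ?T) \<in> ballot m"
     unfolding fold using True x Jb by (simp_all add: swp_mem)
    from exch[OF T this R] show ?thesis unfolding invo by blast
   qed
  next
   case b: False
   \<comment> \<open>Moving a second-column entry to a later place never violates the ballot
     condition, so only the opposite order can fail.\<close>
   have lo: "i \<notin> ?J" using swp_down_ballot[OF Jb i] x b by blast
   hence hi: "i + 1 \<in> ?J" using x by blast
   have notin: "swap_blocks p n i P \<notin> ?C"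
    using folded_ballot[OF context_facts, of "swap_blocks p n i P"] b unfolding folded_swap_blocks[OF context_facts i P] by blast
   have s: "S T P = 0" if "T \<in> ?C" "T \<noteq> P" for T
    by (rule supp[OF that(1) P that(2)]) (use that(1) notin in blast)
   have "S P P \<noteq> -1" unfolding S[OF P P] using block_word_entries(1)[OF context_facts i P lo hi] by simp
   hence SP: "S P P = 1" using single(1)[OF P s] by blast
   have "0 \<le> height ?J (i + 1)" by (rule height_nonneg[OF Jb le(1)])
   hence "1 \<le> height ?J i" using hi height_Suc[of ?J i] by simp
   \<comment> \<open>The exchange can fail only at height 1. Then the axial distance is -1 and the
     content grows by 1, in agreement with \<open>S P P = 1\<close>.\<close>
   moreover have "\<not> 2 \<le> height ?J i" using liftable_ballot[OF Jb i lo hi] b by blast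
   ultimately have "axial_set ?J i = -1" unfolding axial_set_eq using lo hi by simp
   hence "set_content ?J (i + 1) = set_content ?J i + 1" by (simp add: axial_set_def)
   thus ?thesis using single(2)[OF P s R] unfolding SP c_def by simp
  qed
 qed
 thus ?thesis unfolding M_def .
qed

lemma mat_h_JM:
 assumes "i \<in> {1..m}" "R \<in> class_sets p n" "P \<in> class_sets p n"
 shows "mat n (h (JM_TL m i)) R P = (if R = P then of_int (set_content (folded p m P) i) else 0)"
 using assms
proof (induction i arbitrary: R P)
 case (Suc i)
 show ?case
 proof (cases "i = 0")
  case True
  have m1: "1 \<le> m" using Suc.prems(1) by simp
  have "mat n (h (JM_TL m 1)) R P = 0"
   unfolding JM_first[OF m1] h_smult[OF one_in_carrier] mat_smult by simp
  moreover have "set_content (folded p m P) 1 = 0"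
   by (rule set_content_one[OF folded_ballot[OF p lower upper Suc.prems(3)] m1])
  ultimately show ?thesis using True by simp
 next
  case False
  hence i: "i \<in> {1..<m}" "i \<in> {1..m}" using Suc.prems(1) by auto
  show ?thesis using JM_step[OF i(1) Suc.IH[OF i(2)] Suc.prems(2,3)] by simp
 qed
qed simp

lemma mat_h_minus:
 assumes x: "x \<in> carrier (TLQ m)" and y: "y \<in> carrier (TLQ m)"
 shows "mat n (h (x \<ominus>\<^bsub>TLQ m\<^esub> y)) R P = mat n (h x) R P - mat n (h y) R P"
proof -
 have "(x \<ominus>\<^bsub>TLQ m\<^esub> y) \<oplus>\<^bsub>TLQ m\<^esub> y = x" unfolding TL_minus[OF x y] by (simp add: TL_simps)
 hence "h x = h (x \<ominus>\<^bsub>TLQ m\<^esub> y) \<oplus>\<^bsub>TLQ n\<^esub> h y"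
  using h_add[OF TL.minus_closed[OF x y] y] by simp
 thus ?thesis by (simp add: mat_add)
qed

lemma mat_h_EE_factor:
 assumes R: "R \<in> class_sets p n" and P: "P \<in> class_sets p n" and i: "i \<in> {1..m}"
 shows "mat n (h (EE_factor m t (c, i))) R P =
  (if R = P then of_int (set_content (folded p m P) i - c) / of_int (content t i - c) else 0)"
proof -
 have L: "JM_TL m i \<in> carrier (TLQ m)" using i by (intro JM_TL_closed) simp
 have c1: "(of_int c :: rat) \<odot>\<^bsub>TLQ m\<^esub> \<one>\<^bsub>TLQ m\<^esub> \<in> carrier (TLQ m)" by (rule smult_closed[OF one_in_carrier])
 show ?thesis
  unfolding EE_factor_def prod.case h_smult[OF TL.minus_closed[OF L c1]] mat_smult mat_h_minus[OF L c1]
   mat_h_JM[OF i R P] h_smult[OF one_in_carrier] mat_h_one[OF R P] by simp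
qed

lemma mat_h_list_mult:
 assumes xs: "set xs \<subseteq> carrier (TLQ m)"
  and d: "\<And>x R P. x \<in> set xs \<Longrightarrow> R \<in> class_sets p n \<Longrightarrow> P \<in> class_sets p n \<Longrightarrow>
   mat n (h x) R P = (if R = P then d x P else 0)"
  and R: "R \<in> class_sets p n" and P: "P \<in> class_sets p n"
 shows "mat n (h (list_mult (TLQ m) xs)) R P = (if R = P then (\<Prod>x\<leftarrow>xs. d x P) else 0)"
 using xs d R
proof (induction xs arbitrary: R)
 case Nil
 thus ?case by (simp add: list_mult_Nil mat_h_one P)
next
 case (Cons x xs)
 have c: "x \<in> carrier (TLQ m)" "list_mult (TLQ m) xs \<in> carrier (TLQ m)"
  using Cons.prems(1) list_mult_closed by auto
 have IH: "mat n (h (list_mult (TLQ m) xs)) T P = (if T = P then (\<Prod>x\<leftarrow>xs. d x P) else 0)" if "T \<in> class_sets p n" for T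
  using Cons.prems(1,2) that by (intro Cons.IH) auto
 have "mat n (h (list_mult (TLQ m) (x # xs))) R P =
   (\<Sum>T\<in>class_sets p n. if T = P then mat n (h x) R P * (\<Prod>x\<leftarrow>xs. d x P) else 0)"
  unfolding list_mult_Cons mat_h_mult[OF c Cons.prems(3) P] by (intro sum.cong refl) (simp add: IH)
 also have "\<dots> = mat n (h x) R P * (\<Prod>x\<leftarrow>xs. d x P)" using P finite_class_sets by simp
 finally show ?case using Cons.prems(2)[OF _ Cons.prems(3) P, of x] by simp
qed

text \<open>The same interpolation as for \<open>EE\<close> itself, with the contents of the folded
  set as eigenvalues.\<close>

lemma mat_h_EE:
 assumes S: "S \<in> ballot m" and R: "R \<in> ballot n" and P: "P \<in> ballot n"
 shows "mat n (h (EE m (tab m S))) R P = (if R = P \<and> P \<in> {Q \<in> class_sets p n. folded p m Q = S} then 1 else 0)"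
proof (cases "R \<in> class_sets p n \<and> P \<in> class_sets p n")
 case True
 hence RC: "R \<in> class_sets p n" and PC: "P \<in> class_sets p n" by blast+
 let ?t = "tab m S"
 let ?xs = "map (EE_factor m ?t) (EE_list m ?t)"
 define d where "d = (\<lambda>x Q. mat n (h x) Q Q)"
 have cl: "set ?xs \<subseteq> carrier (TLQ m)"
  by (auto simp: set_EE_list intro: EE_factor_closed)
 have "mat n (h (EE m ?t)) R P = (if R = P then (\<Prod>x\<leftarrow>?xs. d x P) else 0)"
  unfolding EE_eq_list_mult
 proof (rule mat_h_list_mult[OF cl _ RC PC])
  fix x A B assume x: "x \<in> set ?xs" and AB: "A \<in> class_sets p n" "B \<in> class_sets p n"
  obtain c i where "x = EE_factor m ?t (c, i)" "i \<in> {1..m}" using x by (auto simp: set_EE_list)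
  thus "mat n (h x) A B = (if A = B then d x B else 0)"
   using mat_h_EE_factor[OF AB] mat_h_EE_factor[OF AB(2,2)] unfolding d_def by simp
 qed
 also have "(\<Prod>x\<leftarrow>?xs. d x P) =
   (\<Prod>(c, i)\<leftarrow>EE_list m ?t. of_int (set_content (folded p m P) i - c) / of_int (content ?t i - c))"
  unfolding map_map comp_def
  by (intro arg_cong[where f = prod_list] map_cong refl) (auto simp: set_EE_list d_def mat_h_EE_factor PC)
 finally show ?thesis unfolding EE_coefficient[OF folded_ballot[OF p lower upper PC] S] using PC by auto
next
 case False
 thus ?thesis using mat_h_outside[OF EE_closed R P] by auto
qed

lemma h_EE:
 assumes S: "S \<in> ballot m"
 shows "h (EE m (tab m S)) = (\<Oplus>\<^bsub>TLQ n\<^esub>t\<in>tab n ` {Q \<in> class_sets p n. folded p m Q = S}. EE n t)"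
proof (rule mat_faithful[OF h_closed[OF EE_closed]])
 have sub: "{Q \<in> class_sets p n. folded p m Q = S} \<subseteq> ballot n" using class_sets_ballot by blast
 show "(\<Oplus>\<^bsub>TLQ n\<^esub>t\<in>tab n ` {Q \<in> class_sets p n. folded p m Q = S}. EE n t) \<in> carrier (TLQ n)"
  by (rule mat_finsum_EE(1)[OF sub empty_ballot empty_ballot])
 fix R P assume "R \<in> ballot n" "P \<in> ballot n"
 thus "mat n (h (EE m (tab m S))) R P = mat n (\<Oplus>\<^bsub>TLQ n\<^esub>t\<in>tab n ` {Q \<in> class_sets p n. folded p m Q = S}. EE n t) R P"
  by (simp only: mat_h_EE[OF S] mat_finsum_EE(2)[OF sub])
qed

lemma h_EE_mult:
 assumes S: "S \<in> ballot m" and Q: "Q \<in> class_sets p n"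
 shows "h (EE m (tab m S)) \<otimes>\<^bsub>TLQ n\<^esub> EE n (tab n Q) = (if folded p m Q = S then EE n (tab n Q) else \<zero>\<^bsub>TLQ n\<^esub>)"
  and "EE n (tab n Q) \<otimes>\<^bsub>TLQ n\<^esub> h (EE m (tab m S)) = (if folded p m Q = S then EE n (tab n Q) else \<zero>\<^bsub>TLQ n\<^esub>)"
proof -
 have Qb: "Q \<in> ballot n" using Q class_sets_ballot by blast
 note c = h_closed[OF EE_closed, of "tab m S"] EE_closed[of n "tab n Q"]
 have z: "(if folded p m Q = S then EE n (tab n Q) else \<zero>\<^bsub>TLQ n\<^esub>) \<in> carrier (TLQ n)" using c(2) by simp
 have r: "mat n (if folded p m Q = S then EE n (tab n Q) else \<zero>\<^bsub>TLQ n\<^esub>) R P = of_bool (R = P \<and> P = Q \<and> folded p m Q = S)"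
  if "R \<in> ballot n" "P \<in> ballot n" for R P using mat_EE[OF that Qb] by (simp add: mat_zero)
 show "h (EE m (tab m S)) \<otimes>\<^bsub>TLQ n\<^esub> EE n (tab n Q) = (if folded p m Q = S then EE n (tab n Q) else \<zero>\<^bsub>TLQ n\<^esub>)"
 proof (rule mat_faithful[OF TL_mult_closed[OF c] z])
  fix R P assume RP: "R \<in> ballot n" "P \<in> ballot n"
  have "mat n (EE n (tab n Q)) T P = (if T = P then of_bool (P = Q) else 0)" if "T \<in> ballot n" for T
   using mat_EE[OF that RP(2) Qb] by auto
  from mat_mult_diag_right[OF RP this] show "mat n (h (EE m (tab m S)) \<otimes>\<^bsub>TLQ n\<^esub> EE n (tab n Q)) R P =
    mat n (if folded p m Q = S then EE n (tab n Q) else \<zero>\<^bsub>TLQ n\<^esub>) R P"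
   unfolding r[OF RP] using mat_h_EE[OF S RP] Q by auto
 qed
 show "EE n (tab n Q) \<otimes>\<^bsub>TLQ n\<^esub> h (EE m (tab m S)) = (if folded p m Q = S then EE n (tab n Q) else \<zero>\<^bsub>TLQ n\<^esub>)"
 proof (rule mat_faithful[OF TL_mult_closed[OF c(2,1)] z])
  fix R P assume RP: "R \<in> ballot n" "P \<in> ballot n"
  have "mat n (EE n (tab n Q)) R T = (if T = R then of_bool (R = Q) else 0)" if "T \<in> ballot n" for T
   using mat_EE[OF RP(1) that Qb] by auto
  from mat_mult_diag_left[OF RP(1) this] show "mat n (EE n (tab n Q) \<otimes>\<^bsub>TLQ n\<^esub> h (EE m (tab m S))) R P =
    mat n (if folded p m Q = S then EE n (tab n Q) else \<zero>\<^bsub>TLQ n\<^esub>) R P"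
   unfolding r[OF RP] using mat_h_EE[OF S RP] Q by auto
 qed
qed

end

text \<open>Diagrams have coefficients 0 and 1, so the unit and the generators lie in the integral
  form, on which \<open>\<iota>Q\<close> is given by \<open>\<iota>\<close>.\<close>

lemma delta_in_TL_Z_loc: "2 \<le> p \<Longrightarrow> D \<in> diagrams n \<Longrightarrow> delta D \<in> carrier (TL (Z_loc p) n)"
 by (auto simp: TL_carrier delta_def Z_loc_def quotient_of_int[of 1, simplified])

theorem corollary6p10:
  fixes p n n1 n2 r0 :: nat
    and \<iota> \<iota>Q :: "(diagram \<Rightarrow> rat) \<Rightarrow> (diagram \<Rightarrow> rat)"
  assumes "prime p" and "odd p" and "n \<ge> p"
    and "n = (p - 1) + n1" and "n1 = p * n2 + r0" and "r0 < p" and "n2 > 1"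
    and "iota_KLR p n n2 \<iota>" and "induced_over_Q p n n2 \<iota> \<iota>Q"
  shows "(\<forall>t\<in>one_column_class p n. \<forall>s\<in>Std2 n2.
            \<iota>Q (EE n2 s) \<otimes>\<^bsub>TLQ n\<^esub> EE n t = (if f_tableau p n2 t = s then EE n t else \<zero>\<^bsub>TLQ n\<^esub>) \<and>
            EE n t \<otimes>\<^bsub>TLQ n\<^esub> \<iota>Q (EE n2 s) = (if f_tableau p n2 t = s then EE n t else \<zero>\<^bsub>TLQ n\<^esub>)) \<and>
         (\<forall>s\<in>Std2 n2.
            \<iota>Q (EE n2 s) = (\<Oplus>\<^bsub>TLQ n\<^esub>t\<in>{t\<in>one_column_class p n. f_tableau p n2 t = s}. EE n t))"
proof -
  have p: "2 \<le> p" using \<open>prime p\<close> by (rule prime_ge_2_nat)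
  \<comment> \<open>The two bounds encode n + 1 = (n2 + 1) p + r0 with r0 < p.\<close>
  have lower: "(n2 + 1) * p \<le> n + 1" and upper: "n + 1 < (n2 + 2) * p"
    using assms(4-6) p by (simp_all add: algebra_simps)
  have ext: "\<iota>Q x = \<iota> x" if "x \<in> carrier (TL (Z_loc p) n2)" for x
    using assms(9) that unfolding induced_over_Q_def by blast
  have hom: "alg_hom UNIV (TLQ n2) (TLQ n) \<iota>Q" using assms(9) unfolding induced_over_Q_def by blast
  have one: "\<iota>Q \<one>\<^bsub>TLQ n2\<^esub> = e_class p n"
    using assms(8) ext[OF delta_in_TL_Z_loc[OF p identity_diagram_in_diagrams]] unfolding iota_KLR_def TL_simps by simp
  have gen: "\<iota>Q (u_gen n2 i) = UU p n i" if i: "i \<in> {1..<n2}" for i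
  proof -
    have "\<iota> (u_gen n2 i) = UU p n i" using assms(8) i unfolding iota_KLR_def by blast
    thus ?thesis using ext[OF delta_in_TL_Z_loc[OF p u_diagram_in_diagrams[OF i]]] unfolding u_gen_def by simp
  qed
  note facts = p lower upper hom one gen
  note f = f_tableau_tab[OF p lower upper]
  have eq: "f_tableau p n2 (tab n Q) = tab n2 S \<longleftrightarrow> folded p n2 Q = S" if "Q \<in> class_sets p n" "S \<in> ballot n2" for Q S
    unfolding f[OF that(1)]
    by (rule tab_eq_iff[OF ballot_subset[OF folded_ballot[OF p lower upper that(1)]] ballot_subset[OF that(2)]])
  show ?thesis
  proof (intro conjI ballI)
    fix t s assume "t \<in> one_column_class p n" "s \<in> Std2 n2"
    then obtain Q S where QS: "Q \<in> class_sets p n" "t = tab n Q" "S \<in> ballot n2" "s = tab n2 S"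
      unfolding one_column_class_eq Std2_eq by blast
    show "\<iota>Q (EE n2 s) \<otimes>\<^bsub>TLQ n\<^esub> EE n t = (if f_tableau p n2 t = s then EE n t else \<zero>\<^bsub>TLQ n\<^esub>)"
      unfolding QS(2,4) eq[OF QS(1,3)] by (rule h_EE_mult(1)[OF facts QS(3,1)])
    show "EE n t \<otimes>\<^bsub>TLQ n\<^esub> \<iota>Q (EE n2 s) = (if f_tableau p n2 t = s then EE n t else \<zero>\<^bsub>TLQ n\<^esub>)"
      unfolding QS(2,4) eq[OF QS(1,3)] by (rule h_EE_mult(2)[OF facts QS(3,1)])
  next
    fix s assume "s \<in> Std2 n2"
    then obtain S where S: "S \<in> ballot n2" "s = tab n2 S" unfolding Std2_eq by blast
    have "{t \<in> one_column_class p n. f_tableau p n2 t = s} = tab n ` {Q \<in> class_sets p n. folded p n2 Q = S}"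
      unfolding one_column_class_eq S(2) using eq[OF _ S(1)] by blast
    thus "\<iota>Q (EE n2 s) = (\<Oplus>\<^bsub>TLQ n\<^esub>t\<in>{t\<in>one_column_class p n. f_tableau p n2 t = s}. EE n t)"
      unfolding S(2) by (simp only: h_EE[OF facts S(1)])
  qed
qed

end
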